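(* The type theories $\mathbf{mTT}_{cind}$ and $\mathbf{MLtt}_{cind}$ can both be interpreted in the type theory $\mathbb{MLS}_{ind}$, by interpreting coinductive positivity relations by the types $W_{\max}$ defined in $\mathbb{MLS}_{ind}$ in the context. In particular, the consistency of $\mathbf{mTT}_{cind}+\mathbf{AC}+\mathbf{CT}$ is reduced to the consistency of $\mathbb{MLS}_{ind}+\mathbf{CT}$ (if $\mathbb{MLS}_{ind}+\mathbf{CT}$ is consistent, then so is $\mathbf{mTT}_{cind}+\mathbf{AC}+\mathbf{CT}$).
   Context: General conventions. All type theories are dependent type theories with judgements $A\ type\ [\Gamma]$, $A=B\ type\ [\Gamma]$, $a\in A\ [\Gamma]$, $a=b\in A\ [\Gamma]$. In place of the usual congruence rules for terms (in particular without the $\xi$-rule for $\lambda$-terms) only the replacement rule is postulated: from $c(x_1,\dots,x_n)\in C(x_1,\dots,x_n)\ [x_1\in A_1,\dots,x_n\in A_n]$ and $a_1=b_1\in A_1,\dots,a_n=b_n\in A_n(a_1,\dots,a_{n-1})$ infer $c(a_1,\dots,a_n)=c(b_1,\dots,b_n)\in C(a_1,\dots,a_n)$. Consistent means that the falsum $\bot$ (respectively the empty type $\mathsf N_0$) has no closed element. $\mathsf{Ap}$ is function application. The theory $\mathbf{mTT}_{cind}$. $\mathbf{mTT}$ is the intensional level of the Minimalist Foundation. It has four kinds of types: collections, sets, propositions, small propositions; small propositions are sets and propositions, sets and propositions are collections. Sets: $\mathsf N_0$, $\mathsf N_1$, $\mathsf{List}(A)$, $A+B$, $(\Sigma x\in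 A)B$, $(\Pi x\in A)B$ with the usual rules of intensional Martin-Löf type theory (eliminations towards collections); $\mathsf N$ is the set of natural numbers. Propositions: $\bot$, $\wedge$, $\vee$, $\to$, $\forall_{x\in A}$, $\exists_{x\in A}$, $\mathsf{Id}(A,a,b)$ for collections $A$, with proof-terms as in intensional Martin-Löf type theory, but with eliminations only towards propositions not depending on proof-terms. Small propositions: those propositions built with quantifiers and equalities restricted to sets. Collections: also the universe à la Russell $\mathsf{prop_s}$ of small propositions, function collections $A\to\mathsf{prop_s}$ ($A$ a set), and $\Sigma$-types of collections. For $V\in A\to\mathsf{prop_s}$, $a\,\epsilon\,V$ means $\mathsf{Ap}(V,a)$. An axiom set is: $A\ set$, $I(x)\ set\ [x\in A]$, $C(x,j)\in A\to\mathsf{prop_s}\ [x\in A,j\in I(x)]$. $\mathbf{mTT}_{ind}$ adds, for each axiom set, $V\in A\to\mathsf{prop_s}$ and $a\in A$, a small proposition $a\triangleleft_{I,C}V$ with: $\mathsf{rf}(a,r)\in a\triangleleft_{I,C}V$ for $r\in a\,\epsilon\,V$; $\mathsf{tr}(a,j,r)\in a\triangleleft_{I,C}V$ for $j\in I(a)$, $r\in\forall_{z\in A}(z\,\epsilon\,C(a,j)\to z\triangleleft_{I,C}V)$; and, for $P(x)\ prop\ [x\in A]$, $m\in a\triangleleft_{I,C}V$, $q_1(x,w)\in P(x)\ [x\in A,w\in x\,\epsilon\,V]$, $q_2(x,h,k,f)\in P(x)\ [x\in A,h\in I(x),k\in\forall_{z\in A}(z\,\epsilon\,C(x,h)\to z\triangleleft_{I,C}V),f\in\forall_{z\in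 A}(z\,\epsilon\,C(x,h)\to P(z))]$, an eliminator $\mathsf{ind}(m,q_1,q_2)\in P(a)$ with $\mathsf{ind}(\mathsf{rf}(a,r),q_1,q_2)=q_1(a,r)$ and $\mathsf{ind}(\mathsf{tr}(a,j,r),q_1,q_2)=q_2(a,j,r,\lambda z.\lambda u.\mathsf{ind}(\mathsf{Ap}(\mathsf{Ap}(r,z),u),q_1,q_2))$. $\mathbf{mTT}_{cind}$ adds, for each axiom set, $V\in A\to\mathsf{prop_s}$ and $a\in A$, a small proposition $a\ltimes_{I,C}V$ with (no equality rules): $\mathsf{ax_1}(a,q)\in a\,\epsilon\,V$ for $q\in a\ltimes_{I,C}V$; $\mathsf{ax_2}(a,i,q)\in\exists_{y\in A}(y\,\epsilon\,C(a,i)\wedge y\ltimes_{I,C}V)$ for $i\in I(a)$, $q\in a\ltimes_{I,C}V$; and, for $P(x)\ prop\ [x\in A]$, $m\in P(a)$, $q_1(x,z)\in V(x)\ [x\in A,z\in P(x)]$, $q_2(x,j,z)\in\exists_{y\in A}(P(y)\wedge y\,\epsilon\,C(x,j))\ [x\in A,j\in I(x),z\in P(x)]$, a term $\mathsf{ax_3}(a,m,q_1,q_2)\in a\ltimes_{I,C}V$. The axioms. $\mathbf{AC}$: $(\forall x\in A)(\exists y\in B)R(x,y)\to(\exists f\in(\Pi x\in A)B)(\forall x\in A)R(x,\mathsf{Ap}(f,x))$ for collections $A,B$ (for which the function type $(\Pi x\in A)B$ is available) and any relation $R$. $\mathbf{CT}$: $(\forall f\in\mathsf N\to\mathsf N)(\exists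 e\in\mathsf N)(\forall x\in\mathsf N)(\exists z\in\mathsf N)(T(e,x,z)\wedge\mathsf{Ap}(f,x)=_{\mathsf N}U(z))$, with $T$ Kleene's predicate and $U$ the result-extracting function; in Martin-Löf type theories it is read via propositions-as-types. The theory $\mathbf{MLtt}_{cind}$. It is intensional Martin-Löf type theory with types $\mathsf N_0,\mathsf N_1,\mathsf N,\mathsf{List}(A),A+B,(\Sigma x\in A)B,(\Pi x\in A)B,\mathsf{Id}(A,a,b)$ and one universe $\mathsf U_0$ à la Tarski with decoding $\mathsf T$, closed under codes for all these type constructors and under the following. Write $t\,\epsilon\,v$ for $\mathsf T(\mathsf{Ap}(v,t))$. An axiom-set is $s\in\mathsf U_0$, $i(x)\in\mathsf U_0\ [x\in\mathsf T(s)]$, $c(x,j)\in\mathsf T(s)\to\mathsf U_0\ [x\in\mathsf T(s),j\in\mathsf T(i(x))]$. For $v\in\mathsf T(s)\to\mathsf U_0$, $a\in\mathsf T(s)$ there are codes $a\,\widehat\triangleleft_{s,i,c}v\in\mathsf U_0$ and $a\,\widehat\ltimes_{s,i,c}v\in\mathsf U_0$, with decodings $a\triangleleft_{s,i,c}v$ and $a\ltimes_{s,i,c}v$. Covers: constructors $\mathsf{rf}(a,r)$ ($r\in a\,\epsilon\,v$) and $\mathsf{tr}(a,j,r)$ ($j\in\mathsf T(i(a))$, $r\in(\Pi z\in\mathsf T(s))(z\,\epsilon\,c(a,j)\to z\triangleleft_{s,i,c}v)$) of $a\triangleleft_{s,i,c}v$; for any $P(x,u)\ type\ [x\in\mathsf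 T(s),u\in x\triangleleft_{s,i,c}v]$, $m\in a\triangleleft_{s,i,c}v$, $q_1(x,w)\in P(x,\mathsf{rf}(x,w))\ [x\in \mathsf T(s),w\in x\,\epsilon\,v]$ and $q_2(x,h,k,f)\in P(x,\mathsf{tr}(x,h,k))\ [x\in\mathsf T(s),h\in\mathsf T(i(x)),k\in(\Pi z\in\mathsf T(s))(z\,\epsilon\,c(x,h)\to z\triangleleft_{s,i,c}v),f\in(\Pi z\in\mathsf T(s))(\Pi u\in z\,\epsilon\,c(x,h))P(z,\mathsf{Ap}(\mathsf{Ap}(k,z),u))]$, an eliminator $\mathsf{ind}(m,q_1,q_2)\in P(a,m)$, with the two computation rules $\mathsf{ind}(\mathsf{rf}(a,r),q_1,q_2)=q_1(a,r)$ and $\mathsf{ind}(\mathsf{tr}(a,j,r),q_1,q_2)=q_2(a,j,r,\lambda z.\lambda u.\mathsf{ind}(\mathsf{Ap}(\mathsf{Ap}(r,z),u),q_1,q_2))$. Positivity: $\mathsf{ax_1}(a,q)\in a\,\epsilon\,v$ for $q\in a\ltimes_{s,i,c}v$; $\mathsf{ax_2}(a,j,q)\in(\Sigma y\in\mathsf T(s))(y\,\epsilon\,c(a,j)\times y\ltimes_{s,i,c}v)$ for $j\in\mathsf T(i(a))$, $q\in a\ltimes_{s,i,c}v$; and, for $P(x)\ type\ [x\in\mathsf T(s)]$, $m\in P(a)$, $q_1(x,z)\in\mathsf T(v(x))\ [x\in\mathsf T(s),z\in P(x)]$, $q_2(x,j,z)\in(\Sigma y\in\mathsf T(s))(y\,\epsilon\,c(x,j)\times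 P(y))\ [x\in\mathsf T(s),j\in\mathsf T(i(x)),z\in P(x)]$, a term $\mathsf{ax_3}(m,q_1,q_2)\in a\ltimes_{s,i,c}v$. The theory $\mathbb{MLS}_{ind}$. It has the same first-order types $\mathsf N_0,\mathsf N_1,\mathsf N,\mathsf{List},+,\Sigma,\Pi,\mathsf{Id}$ and, instead of $\mathsf U_0$, a superuniverse $\mathcal S$ à la Tarski with decoding $\mathsf T$, closed under: (i) all these type constructors; (ii) the universe constructor: for $a\in\mathcal S$, $b(x)\in\mathcal S\ [x\in\mathsf T(a)]$ there is a universe $\mathsf U(\mathsf T(a),(x)\mathsf T(b))$ à la Tarski with code $\mathbf u(a,(x)b)\in\mathcal S$, containing codes for $\mathsf T(a)$ and all $\mathsf T(b(x))$ and closed under the first-order type constructors (not necessarily under covers), each of its codes being mapped to a code in $\mathcal S$ with the same decoding; (iii) inductive covers $a\,\widehat\triangleleft_{s,i,c}v\in\mathcal S$ with exactly the cover rules listed for $\mathbf{MLtt}_{cind}$, with $\mathsf U_0$ replaced by $\mathcal S$. It has no primitive positivity relations. The interpretations. $\mathsf U_0$ is interpreted as $\mathcal S$; $\mathbf{mTT}_{cind}$ is interpreted following propositions-as-types ($\bot\mapsto\mathsf N_0$, $\wedge\mapsto\times$, $\vee\mapsto+$, implication to function type, $\forall\mapsto\Pi$, $\exists\mapsto\Sigma$, $\mathsf{Id}\mapsto\mathsf{Id}$), with $\mathsf{prop_s}$ interpreted as $\mathcal S$, small propositions regarded as terms interpreted as codes in $\mathcal S$, sets and covers interpreted by the corresponding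 types. Positivity: for an axiom-set $s,i,c$ in $\mathcal S$, put $A\equiv\mathsf T(s)$, $I(x)\equiv\mathsf T(i(x))$, $C(x,j)\equiv c(x,j)$, let $U_{I,C}$ be a universe with code in $\mathcal S$ containing all components of the axiom-set, and, for $X$ a propositional function on $A$, put $\tau(X)\equiv\{x\in A\mid x\,\epsilon\,X\ \&\ \forall_{i\in I(x)}\exists_{y\in A}(y\,\epsilon\,C(x,i)\ \&\ y\,\epsilon\,X)\}$. For $V\in A\to\mathcal S$ the type $a\ltimes V$ is interpreted as $a\,\epsilon\,W_{\max}(V)$ where $W_{\max}(V)\in A\to\mathcal S$ is $W_{\max}(V)\equiv\{x\in A\mid\exists_{Z\in A\to U_{I,C}}(x\,\epsilon\,Z\ \&\ (Z\subseteq\tau(Z)\ \&\ Z\subseteq V))\}$, logical symbols being read via propositions-as-types and $\{x\in A\mid\phi(x)\}$ denoting the propositional function $\phi\in A\to\mathcal S$. *)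

theory Defs
  imports Main "HOL-Library.Nat_Bijection"
begin

text \<open>
  Raw expressions use de Bruijn indices.  A context is a list of types whose head is the type of
  the variable of index 0; each entry lives in the context formed by the rest of the list.
  In a constructor that binds several variables, the last variable bound has index 0, so
  in \<open>d(x,y)\<close> the variable \<open>x\<close> is \<open>Var 1\<close> and \<open>y\<close> is \<open>Var 0\<close>.  Terms carry no type annotations.
\<close>


section \<open>Primitive recursive functions and Kleene's predicate\<close>

datatype pr = PZero | PSucc | PProj nat | PComp pr "pr list" | PRec pr pr

primrec pr_eval :: "pr \<Rightarrow> nat list \<Rightarrow> nat" where
  "pr_eval PZero xs = 0"
| "pr_eval PSucc xs = Suc (hd xs)"
| "pr_eval (PProj i) xs = xs ! i"
| "pr_eval (PComp f gs) xs = pr_eval f (map (\<lambda>h. h xs) (map pr_eval gs))"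
| "pr_eval (PRec f g) xs =
     rec_nat (pr_eval f (tl xs)) (\<lambda>n r. pr_eval g (n # r # tl xs)) (hd xs)"

text \<open>
  Numbers are read as infinite lists with finitely many nonzero entries, by means of the pairing
  bijection of the library (\<open>0\<close> is the list of zeros).
\<close>

definition hdc :: "nat \<Rightarrow> nat" where "hdc l = fst (prod_decode l)"
definition tlc :: "nat \<Rightarrow> nat" where "tlc l = snd (prod_decode l)"
definition item :: "nat \<Rightarrow> nat \<Rightarrow> nat" where "item l k = hdc ((tlc ^^ k) l)"

primrec upd :: "nat \<Rightarrow> nat \<Rightarrow> nat \<Rightarrow> nat" where
  "upd 0 v l = prod_encode (v, tlc l)"
| "upd (Suc k) v l = prod_encode (hdc l, upd k v (tlc l))"

text \<open>
  Kleene's predicate, for register machines.  A program \<open>e\<close> is a list of instructions: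
  \<open>0\<close> stops; \<open>1 + \<langle>0,r,q,_\<rangle>\<close> increments register \<open>r\<close> and goes to \<open>q\<close>; \<open>1 + \<langle>k+1,r,q,q'\<rangle>\<close> goes to \<open>q'\<close>
  if register \<open>r\<close> is \<open>0\<close>, and otherwise decrements it and goes to \<open>q\<close>.  A configuration
  is a pair (program counter, list of registers); input and output are in register 0.
  \<open>kleene_T e x z\<close> says that \<open>z\<close> codes the complete terminating computation of \<open>e\<close> on \<open>x\<close>:
  a pair of its length and of the list of its configurations, the last one first.
\<close>

definition rm_step :: "nat \<Rightarrow> nat \<Rightarrow> nat" where
  "rm_step e c =
    (let l = hdc c; R = tlc c; w = item e l - 1;
         k = hdc w; r = hdc (tlc w); q = hdc (tlc (tlc w)); q' = tlc (tlc (tlc w))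
     in if item e l = 0 then c
        else if k = 0 then prod_encode (q, upd r (item R r + 1) R)
        else if item R r = 0 then prod_encode (q', R)
        else prod_encode (q, upd r (item R r - 1) R))"

primrec rm_history :: "nat \<Rightarrow> nat \<Rightarrow> nat \<Rightarrow> nat" where
  "rm_history e x 0 = prod_encode (prod_encode (0, prod_encode (x, 0)), 0)"
| "rm_history e x (Suc n) =
     prod_encode (rm_step e (hdc (rm_history e x n)), rm_history e x n)"

definition rm_halted :: "nat \<Rightarrow> nat \<Rightarrow> bool" where
  "rm_halted e c \<longleftrightarrow> item e (hdc c) = 0"

definition kleene_T :: "nat \<Rightarrow> nat \<Rightarrow> nat \<Rightarrow> bool" where
  "kleene_T e x z \<longleftrightarrow>
     tlc z = rm_history e x (hdc z) \<and> rm_halted e (hdc (tlc z)) \<and>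
     (\<forall>m<hdc z. \<not> rm_halted e (hdc (rm_history e x m)))"

definition kleene_U :: "nat \<Rightarrow> nat" where
  "kleene_U z = item (tlc (hdc (tlc z))) 0"

abbreviation (input) "pp \<equiv> PProj"
abbreviation (input) "pc1 f a \<equiv> PComp f [a]"
abbreviation (input) "pc2 f a b \<equiv> PComp f [a, b]"
abbreviation (input) "pc3 f a b c \<equiv> PComp f [a, b, c]"

definition "prOne = pc1 PSucc PZero"
definition "prAdd = PRec (pp 0) (pc1 PSucc (pp 1))"
definition "prPred = PRec PZero (pp 0)"
definition "prSub = pc2 (PRec (pp 0) (pc1 prPred (pp 1))) (pp 1) (pp 0)"
definition "prIf = PRec (pp 1) (pp 2)"   \<comment> \<open>\<open>(c,a,b) \<mapsto> if c \<noteq> 0 then a else b\<close>\<close>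
definition "prNot = PRec prOne PZero"
definition "prEq = pc1 prNot (pc2 prAdd prSub (pc2 prSub (pp 1) (pp 0)))"
definition "prTri = PRec PZero (pc2 prAdd (pp 1) (pc1 PSucc (pp 0)))"
definition "prPair = pc2 prAdd (pc1 prTri prAdd) (pp 0)"

text \<open>\<open>prDiag z\<close> is the largest \<open>s\<close> with \<open>triangle s \<le> z\<close>.\<close>

definition "prDiag = PRec PZero
  (pc3 prIf (pc2 prSub (pc1 prTri (pc1 PSucc (pp 1))) (pc1 PSucc (pp 0))) (pp 1) (pc1 PSucc (pp 1)))"
definition "prHd = pc2 prSub (pp 0) (pc1 prTri prDiag)"
definition "prTl = pc2 prSub prDiag prHd"
definition "prDrop = PRec (pp 0) (pc1 prTl (pp 1))"
definition "prItem = pc1 prHd (pc2 prDrop (pp 1) (pp 0))"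

text \<open>
  The update of entry \<open>k\<close> shifts \<open>k\<close> entries to an accumulator, changes the head, and shifts back.
\<close>

definition "prFwd = PRec (pc2 prPair PZero (pp 0))
  (pc2 prPair (pc2 prPair (pc1 prHd (pc1 prTl (pp 1))) (pc1 prHd (pp 1))) (pc1 prTl (pc1 prTl (pp 1))))"
definition "prBack = PRec (pp 0)
  (pc2 prPair (pc1 prTl (pc1 prHd (pp 1)))
     (pc2 prPair (pc1 prHd (pc1 prHd (pp 1))) (pc1 prTl (pp 1))))"
definition "prUpd =
  (let st = pc2 prFwd (pp 0) (pp 2) in
   pc1 prTl (pc2 prBack (pp 0)
     (pc2 prPair (pc1 prHd st) (pc2 prPair (pp 1) (pc1 prTl (pc1 prTl st))))))"

definition "prStep =
  (let c = pp 1; R = pc1 prTl c; ins = pc2 prItem (pp 0) (pc1 prHd c); w = pc1 prPred ins;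
       k = pc1 prHd w; r = pc1 prHd (pc1 prTl w); q = pc1 prHd (pc1 prTl (pc1 prTl w));
       q' = pc1 prTl (pc1 prTl (pc1 prTl w)); v = pc2 prItem R r
   in pc3 prIf ins
        (pc3 prIf k
          (pc3 prIf v (pc2 prPair q (pc3 prUpd r (pc1 prPred v) R)) (pc2 prPair q' R))
          (pc2 prPair q (pc3 prUpd r (pc1 PSucc v) R)))
        c)"
definition "prHistory = PRec
  (pc2 prPair (pc2 prPair PZero (pc2 prPair (pp 1) PZero)) PZero)
  (pc2 prPair (pc2 prStep (pp 2) (pc1 prHd (pp 1))) (pp 1))"
definition "prActive = pc2 prItem (pp 0) (pc1 prHd (pp 1))"
definition "prRunning = PRec prOne
  (pc3 prIf (pc2 prActive (pp 2) (pc1 prHd (pc3 prHistory (pp 0) (pp 2) (pp 3)))) (pp 1) PZero)"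

definition prT :: pr where
  "prT = (let n = pc1 prHd (pp 2); h = pc1 prTl (pp 2) in
     pc3 prIf (pc2 prEq h (pc3 prHistory n (pp 0) (pp 1)))
       (pc3 prIf (pc2 prActive (pp 0) (pc1 prHd h)) PZero
          (pc3 prRunning n (pp 0) (pp 1)))
       PZero)"

definition prU :: pr where
  "prU = pc2 prItem (pc1 prTl (pc1 prHd (pc1 prTl (pp 0)))) PZero"

lemma pr_basic [simp]:
  "pr_eval prOne xs = 1"
  "pr_eval prAdd [a, b] = a + b"
  "pr_eval prPred [a] = a - 1"
  "pr_eval prIf [c, a, b] = (if c \<noteq> 0 then a else b)"
  "pr_eval prNot [a] = of_bool (a = 0)"
proof -
  show "pr_eval prAdd [a, b] = a + b" by (induction a) (simp_all add: prAdd_def)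
  show "pr_eval prPred [a] = a - 1" by (cases a) (simp_all add: prPred_def)
  show "pr_eval prIf [c, a, b] = (if c \<noteq> 0 then a else b)" by (cases c) (simp_all add: prIf_def)
  show "pr_eval prNot [a] = of_bool (a = 0)" by (cases a) (simp_all add: prNot_def prOne_def)
qed (simp_all add: prOne_def)

lemma pr_sub [simp]: "pr_eval prSub [a, b] = a - b"
proof -
  have "pr_eval (PRec (pp 0) (pc1 prPred (pp 1))) [b, a] = a - b" by (induction b) simp_all
  then show ?thesis by (simp add: prSub_def)
qed

lemma pr_pair [simp]:
  "pr_eval prEq [a, b] = of_bool (a = b)"
  "pr_eval prTri [a] = triangle a"
  "pr_eval prPair [a, b] = prod_encode (a, b)"
proof -
  show "pr_eval prEq [a, b] = of_bool (a = b)" by (auto simp: prEq_def)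
  show *: "pr_eval prTri [a] = triangle a" for a by (induction a) (simp_all add: prTri_def)
  show "pr_eval prPair [a, b] = prod_encode (a, b)" by (simp add: prPair_def * prod_encode_def)
qed

lemma pr_diag: "triangle (pr_eval prDiag [z]) \<le> z \<and> z < triangle (Suc (pr_eval prDiag [z]))"
proof (induction z)
  case (Suc z)
  let ?d = "pr_eval prDiag [z]"
  have "pr_eval prDiag [Suc z] = (if triangle (Suc ?d) - Suc z \<noteq> 0 then ?d else Suc ?d)"
    by (simp add: prDiag_def del: triangle_Suc)
  then show ?case using Suc by auto
qed (simp add: prDiag_def)

lemma triangle_mono: "a \<le> b \<Longrightarrow> triangle a \<le> triangle b"
  by (induction b) (auto simp: le_Suc_eq)

lemma pr_hd_tl [simp]: "pr_eval prHd [z] = hdc z" "pr_eval prTl [z] = tlc z"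
proof -
  obtain a b where ab: "prod_decode z = (a, b)" by fastforce
  have z: "z = triangle (a + b) + a" proof -
    have "z = prod_encode (a, b)" using ab by (metis prod_decode_inverse)
    then show ?thesis by (simp add: prod_encode_def)
  qed
  let ?d = "pr_eval prDiag [z]"
  have "?d = a + b"
  proof (rule antisym; rule ccontr)
    assume "\<not> ?d \<le> a + b"
    then have "triangle (Suc (a + b)) \<le> triangle ?d" by (intro triangle_mono) simp
    then show False using pr_diag[of z] z by simp
  next
    assume "\<not> a + b \<le> ?d"
    then have "triangle (Suc ?d) \<le> triangle (a + b)" by (intro triangle_mono) simp
    then show False using pr_diag[of z] z by simp
  qed
  then show "pr_eval prHd [z] = hdc z" "pr_eval prTl [z] = tlc z"
    using z ab by (simp_all add: prHd_def prTl_def hdc_def tlc_def)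
qed

lemma code_simps [simp]: "hdc (prod_encode (a, b)) = a" "tlc (prod_encode (a, b)) = b"
  by (simp_all add: hdc_def tlc_def)

lemma pr_item [simp]: "pr_eval prItem [l, k] = item l k"
proof -
  have "pr_eval prDrop [k, l] = (tlc ^^ k) l" by (induction k) (simp_all add: prDrop_def)
  then show ?thesis by (simp add: prItem_def item_def)
qed

lemma pr_upd [simp]: "pr_eval prUpd [k, v, l] = upd k v l"
proof -
  define f where "f r = prod_encode (prod_encode (hdc (tlc r), hdc r), tlc (tlc r))" for r
  define b where "b r = prod_encode (tlc (hdc r), prod_encode (hdc (hdc r), tlc r))" for r
  have F: "pr_eval prFwd [k, l] = (f ^^ k) (prod_encode (0, l))"
    by (induction k) (simp_all add: prFwd_def f_def)
  have B: "pr_eval prBack [k, s] = (b ^^ k) s" for s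
    by (induction k) (simp_all add: prBack_def b_def)
  have "(b ^^ k) (prod_encode (hdc ((f ^^ k) (prod_encode (a, l))),
      prod_encode (v, tlc (tlc ((f ^^ k) (prod_encode (a, l))))))) = prod_encode (a, upd k v l)" for a
  proof (induction k arbitrary: a l)
    case (Suc k)
    have "(f ^^ Suc k) (prod_encode (a, l)) = (f ^^ k) (prod_encode (prod_encode (hdc l, a), tlc l))"
      by (simp add: funpow_swap1 f_def)
    moreover have "(b ^^ Suc k) s = b ((b ^^ k) s)" for s by simp
    moreover have "b (prod_encode (prod_encode (x, y), w)) = prod_encode (y, prod_encode (x, w))" for x y w
      by (simp add: b_def)
    ultimately show ?case by (simp only: Suc.IH upd.simps)
  qed simp
  then show ?thesis by (simp add: prUpd_def Let_def F B)
qed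

lemma pr_step [simp]: "pr_eval prStep [e, c] = rm_step e c"
  by (simp add: prStep_def rm_step_def Let_def)

lemma pr_history [simp]: "pr_eval prHistory [n, e, x] = rm_history e x n"
  by (induction n) (simp_all add: prHistory_def)

lemma pr_running [simp]: "pr_eval prRunning [n, e, x] =
    of_bool (\<forall>m<n. \<not> rm_halted e (hdc (rm_history e x m)))"
  by (induction n) (auto simp: prRunning_def prActive_def rm_halted_def less_Suc_eq)

lemma pr_eval_prT: "pr_eval prT [e, x, z] = of_bool (kleene_T e x z)"
  by (auto simp: prT_def kleene_T_def Let_def prActive_def rm_halted_def)

lemma pr_eval_prU: "pr_eval prU [z] = kleene_U z"
  by (simp add: prU_def kleene_U_def)


section \<open>Raw expressions\<close>

text \<open>
  One syntax serves all the theories, each of which uses a part of it.  Constructors of the same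
  arity and binding pattern are grouped; \<open>CB f a b\<close> binds a variable in \<open>b\<close>.  The other binders are
  \<open>Split(t,(x,y)c)\<close>, \<open>When(t,(x)c,(y)d)\<close>, \<open>RNat(t,c,(x,r)d)\<close>, \<open>RLst(t,c,(x,l,r)d)\<close>,
  \<open>SubDec(a,(x)b,t)\<close>, \<open>SubLift(a,(x)b,t)\<close>, \<open>Cov(s,(x)i,(x,j)c,v,a)\<close>, \<open>Pos(s,(x)i,(x,j)c,v,a)\<close>,
  \<open>Ind(m,(x,w)q\<^sub>1,(x,h,k,f)q\<^sub>2)\<close>, \<open>Ax3(a,m,(x,z)q\<^sub>1,(x,j,z)q\<^sub>2)\<close>.

  In the Martin-Loef type theories, \<open>Univ\<close> is the universe \<open>U\<^sub>0\<close> or the superuniverse \<open>S\<close>, and \<open>Dec\<close> its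
  decoding \<open>T\<close>; the codes in it are written with a \<open>c\<close> in front, and \<open>Cov s i c v a\<close>, \<open>Pos s i c v a\<close> are
  the codes of \<open>a \<triangleleft> v\<close> and \<open>a \<ltimes> v\<close>.  \<open>SubU a b\<close> is the universe \<open>U(T(a),(x)T(b))\<close> and \<open>SubDec a b\<close> its
  decoding; its codes are written with a \<open>u\<close> in front, \<open>uBase\<close> and \<open>uFam x\<close> being those of \<open>T(a)\<close>
  and \<open>T(b(x))\<close>.  \<open>SubLift a b\<close> maps codes of \<open>SubU a b\<close> to codes of \<open>S\<close>.

  In the Minimalist Foundation the universe \<open>Props\<close> is a la Russell, so small propositions, including
  \<open>Cov A I C V a\<close> and \<open>Pos A I C V a\<close>, are themselves terms.  Proof-terms are those of Martin-Loef type
  theory, e.g. \<open>Lam\<close>, \<open>App\<close> for \<open>\<Pi>\<close>, \<open>\<rightarrow>\<close>, \<open>\<forall>\<close> and \<open>Pr\<close>, \<open>Split\<close> for \<open>\<Sigma>\<close>, \<open>\<and>\<close>, \<open>\<exists>\<close>.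

  \<open>Post A\<close> is the element of \<open>A\<close> that is postulated if \<open>A\<close> is an axiom.
\<close>

datatype op0 = oN0 | oN1 | oNN | oStar | oZero | oNl | oUniv | ocN0 | ocN1 | ocNN | ouBase
  | ouN0 | ouN1 | ouNN | oBot | oProps
datatype op1 = oLst | oR0 | oSucc | oInL | oInR | oRfl | oDec | ocLst | ouFam | ouLst | oPost
datatype op2 = oCoprod | oR1 | oCns | oPr | oApp | ocCoprod | ouCoprod | oRf | oAx1 | oAnd
  | oOr | oImp
datatype op3 = oEq | ocEq | ouEq | oTr | oAx2
datatype opB = oSig | oPi | oIdRec | oSubU | ocSig | ocPi | ocSubU | ouSig | ouPi | oForall | oExis

datatype tm =
    Var nat | C0 op0 | C1 op1 tm | C2 op2 tm tm | C3 op3 tm tm tm | CB opB tm tm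
  | Lam tm | Split tm tm | When tm tm tm | RNat tm tm tm | RLst tm tm tm
  | SubDec tm tm tm | SubLift tm tm tm | Cov tm tm tm tm tm | Pos tm tm tm tm tm | Ind tm tm tm | Ax3 tm tm tm tm

abbreviation "N0 \<equiv> C0 oN0"
abbreviation "N1 \<equiv> C0 oN1"
abbreviation "NN \<equiv> C0 oNN"
abbreviation "Star \<equiv> C0 oStar"
abbreviation "Zero \<equiv> C0 oZero"
abbreviation "Nl \<equiv> C0 oNl"
abbreviation "Univ \<equiv> C0 oUniv"
abbreviation "cN0 \<equiv> C0 ocN0"
abbreviation "cN1 \<equiv> C0 ocN1"
abbreviation "cNN \<equiv> C0 ocNN"
abbreviation "uBase \<equiv> C0 ouBase"
abbreviation "uN0 \<equiv> C0 ouN0"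
abbreviation "uN1 \<equiv> C0 ouN1"
abbreviation "uNN \<equiv> C0 ouNN"
abbreviation "Bot \<equiv> C0 oBot"
abbreviation "Props \<equiv> C0 oProps"
abbreviation "Lst \<equiv> C1 oLst"
abbreviation "R0 \<equiv> C1 oR0"
abbreviation "Succ \<equiv> C1 oSucc"
abbreviation "InL \<equiv> C1 oInL"
abbreviation "InR \<equiv> C1 oInR"
abbreviation "Rfl \<equiv> C1 oRfl"
abbreviation "Dec \<equiv> C1 oDec"
abbreviation "cLst \<equiv> C1 ocLst"
abbreviation "uFam \<equiv> C1 ouFam"
abbreviation "uLst \<equiv> C1 ouLst"
abbreviation "Post \<equiv> C1 oPost"
abbreviation "Coprod \<equiv> C2 oCoprod"
abbreviation "R1 \<equiv> C2 oR1"
abbreviation "Cns \<equiv> C2 oCns"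
abbreviation "Pr \<equiv> C2 oPr"
abbreviation "App \<equiv> C2 oApp"
abbreviation "cCoprod \<equiv> C2 ocCoprod"
abbreviation "uCoprod \<equiv> C2 ouCoprod"
abbreviation "Rf \<equiv> C2 oRf"
abbreviation "Ax1 \<equiv> C2 oAx1"
abbreviation "And \<equiv> C2 oAnd"
abbreviation "Or \<equiv> C2 oOr"
abbreviation "Imp \<equiv> C2 oImp"
abbreviation "Eq \<equiv> C3 oEq"
abbreviation "cEq \<equiv> C3 ocEq"
abbreviation "uEq \<equiv> C3 ouEq"
abbreviation "Tr \<equiv> C3 oTr"
abbreviation "Ax2 \<equiv> C3 oAx2"
abbreviation "Sig \<equiv> CB oSig"
abbreviation "Pi \<equiv> CB oPi"
abbreviation "IdRec \<equiv> CB oIdRec"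
abbreviation "SubU \<equiv> CB oSubU"
abbreviation "cSig \<equiv> CB ocSig"
abbreviation "cPi \<equiv> CB ocPi"
abbreviation "cSubU \<equiv> CB ocSubU"
abbreviation "uSig \<equiv> CB ouSig"
abbreviation "uPi \<equiv> CB ouPi"
abbreviation "Forall \<equiv> CB oForall"
abbreviation "Exis \<equiv> CB oExis"

text \<open>\<open>trav g k e\<close> replaces each variable \<open>i\<close> that occurs in \<open>e\<close> below \<open>d\<close> binders by \<open>g (k+d) i\<close>.\<close>

primrec trav :: "(nat \<Rightarrow> nat \<Rightarrow> tm) \<Rightarrow> nat \<Rightarrow> tm \<Rightarrow> tm" where
  "trav g k (Var i) = g k i"
| "trav g k (C0 f) = C0 f"
| "trav g k (C1 f a) = C1 f (trav g k a)"
| "trav g k (C2 f a b) = C2 f (trav g k a) (trav g k b)"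
| "trav g k (C3 f a b c) = C3 f (trav g k a) (trav g k b) (trav g k c)"
| "trav g k (CB f a b) = CB f (trav g k a) (trav g (k+1) b)"
| "trav g k (Lam a) = Lam (trav g (k+1) a)"
| "trav g k (Split a b) = Split (trav g k a) (trav g (k+2) b)"
| "trav g k (When a b c) = When (trav g k a) (trav g (k+1) b) (trav g (k+1) c)"
| "trav g k (RNat a b c) = RNat (trav g k a) (trav g k b) (trav g (k+2) c)"
| "trav g k (RLst a b c) = RLst (trav g k a) (trav g k b) (trav g (k+3) c)"
| "trav g k (SubDec a b c) = SubDec (trav g k a) (trav g (k+1) b) (trav g k c)"
| "trav g k (SubLift a b c) = SubLift (trav g k a) (trav g (k+1) b) (trav g k c)"
| "trav g k (Cov a b c d e) = Cov (trav g k a) (trav g (k+1) b) (trav g (k+2) c) (trav g k d) (trav g k e)"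
| "trav g k (Pos a b c d e) = Pos (trav g k a) (trav g (k+1) b) (trav g (k+2) c) (trav g k d) (trav g k e)"
| "trav g k (Ind a b c) = Ind (trav g k a) (trav g (k+2) b) (trav g (k+4) c)"
| "trav g k (Ax3 a b c d) = Ax3 (trav g k a) (trav g k b) (trav g (k+2) c) (trav g (k+3) d)"

definition lift :: "nat \<Rightarrow> nat \<Rightarrow> tm \<Rightarrow> tm" where
  "lift n = trav (\<lambda>k i. Var (if i < k then i else i + n))"

abbreviation sh :: "nat \<Rightarrow> tm \<Rightarrow> tm" where "sh n \<equiv> lift n 0"

definition under :: "nat \<Rightarrow> (nat \<Rightarrow> tm) \<Rightarrow> nat \<Rightarrow> tm" where
  "under k \<sigma> i = (if i < k then Var i else sh k (\<sigma> (i - k)))"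

definition sub :: "(nat \<Rightarrow> tm) \<Rightarrow> tm \<Rightarrow> tm" where
  "sub \<sigma> = trav (\<lambda>k. under k \<sigma>) 0"

text \<open>
  \<open>ins n ts e\<close> takes \<open>e\<close>, over \<open>\<Gamma>\<close> and \<open>length ts\<close> further variables, and substitutes for the latter
  the expressions \<open>ts\<close> (\<open>ts ! 0\<close> for the last one), which live over \<open>\<Gamma>\<close> and \<open>n\<close> other variables.
\<close>

definition ins :: "nat \<Rightarrow> tm list \<Rightarrow> tm \<Rightarrow> tm" where
  "ins n ts = sub (\<lambda>i. if i < length ts then ts ! i else Var (i - length ts + n))"

abbreviation prod :: "tm \<Rightarrow> tm \<Rightarrow> tm" where "prod A B \<equiv> Sig A (sh 1 B)"
abbreviation arr :: "tm \<Rightarrow> tm \<Rightarrow> tm" where "arr A B \<equiv> Pi A (sh 1 B)"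
abbreviation cAnd :: "tm \<Rightarrow> tm \<Rightarrow> tm" where "cAnd a b \<equiv> cSig a (sh 1 b)"
abbreviation cImp :: "tm \<Rightarrow> tm \<Rightarrow> tm" where "cImp a b \<equiv> cPi a (sh 1 b)"
abbreviation (input) eps :: "tm \<Rightarrow> tm \<Rightarrow> tm" where "eps t v \<equiv> Dec (App v t)"

text \<open>\<open>Z \<triangleleft> V\<close> and \<open>Z \<ltimes> V\<close> for an expression \<open>Z\<close> over \<open>n\<close> variables more than \<open>s,i,c,v\<close>.\<close>

abbreviation CovT :: "nat \<Rightarrow> tm \<Rightarrow> tm \<Rightarrow> tm \<Rightarrow> tm \<Rightarrow> tm \<Rightarrow> tm" where
  "CovT n s i c v Z \<equiv> Dec (Cov (sh n s) (lift n 1 i) (lift n 2 c) (sh n v) Z)"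
abbreviation PosT :: "nat \<Rightarrow> tm \<Rightarrow> tm \<Rightarrow> tm \<Rightarrow> tm \<Rightarrow> tm \<Rightarrow> tm" where
  "PosT n s i c v Z \<equiv> Dec (Pos (sh n s) (lift n 1 i) (lift n 2 c) (sh n v) Z)"

text \<open>\<open>(\<Pi>z\<in>T(s)) (z \<epsilon> W \<rightarrow> z \<triangleleft> V)\<close>, for \<open>W\<close> over \<open>n\<close> variables more than \<open>s,i,c,v\<close>.\<close>

abbreviation CovAll :: "nat \<Rightarrow> tm \<Rightarrow> tm \<Rightarrow> tm \<Rightarrow> tm \<Rightarrow> tm \<Rightarrow> tm" where
  "CovAll n s i c v W \<equiv>
     Pi (Dec (sh n s)) (arr (eps (Var 0) (sh 1 W)) (CovT (n+1) s i c v (Var 0)))"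

text \<open>A primitive recursive function applied to terms; \<open>CT\<close> is read via propositions-as-types.\<close>

primrec pr_tm :: "pr \<Rightarrow> tm list \<Rightarrow> tm" where
  "pr_tm PZero ts = Zero"
| "pr_tm PSucc ts = Succ (hd ts)"
| "pr_tm (PProj i) ts = ts ! i"
| "pr_tm (PComp f gs) ts = pr_tm f (map (\<lambda>h. h ts) (map pr_tm gs))"
| "pr_tm (PRec f g) ts =
     RNat (hd ts) (pr_tm f (tl ts)) (pr_tm g (Var 1 # Var 0 # map (sh 2) (tl ts)))"

definition CT :: tm where
  "CT = Pi (arr NN NN) (Sig NN (Pi NN (Sig NN
     (prod (Eq NN (pr_tm prT [Var 2, Var 1, Var 0]) (Succ Zero))
           (Eq NN (App (Var 3) (Var 1)) (pr_tm prU [Var 0]))))))"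


section \<open>The theories \<open>MLtt_cind\<close>, \<open>MLS_ind\<close> and \<open>MLS_ind + CT\<close>\<close>

datatype jdg = Ok | Ty tm | TyEq tm tm | Tm tm tm | TmEq tm tm tm

primrec jsub :: "(nat \<Rightarrow> tm) \<Rightarrow> jdg \<Rightarrow> jdg" where
  "jsub \<sigma> Ok = Ok"
| "jsub \<sigma> (Ty A) = Ty (sub \<sigma> A)"
| "jsub \<sigma> (TyEq A B) = TyEq (sub \<sigma> A) (sub \<sigma> B)"
| "jsub \<sigma> (Tm a A) = Tm (sub \<sigma> a) (sub \<sigma> A)"
| "jsub \<sigma> (TmEq a b A) = TmEq (sub \<sigma> a) (sub \<sigma> b) (sub \<sigma> A)"

datatype ml_theory = MLtt_cind | MLS_ind | MLS_ind_CT

abbreviation (input) axset :: "(tm list \<Rightarrow> jdg \<Rightarrow> bool) \<Rightarrow> tm list \<Rightarrow> tm \<Rightarrow> tm \<Rightarrow> tm \<Rightarrow> tm \<Rightarrow> bool" where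
  "axset D \<Gamma> s i c v \<equiv>
     D \<Gamma> (Tm s Univ) \<and> D (Dec s # \<Gamma>) (Tm i Univ) \<and>
     D (Dec i # Dec s # \<Gamma>) (Tm c (arr (Dec (sh 2 s)) Univ)) \<and> D \<Gamma> (Tm v (arr (Dec s) Univ))"

abbreviation (input) ufam :: "(tm list \<Rightarrow> jdg \<Rightarrow> bool) \<Rightarrow> ml_theory \<Rightarrow> tm list \<Rightarrow> tm \<Rightarrow> tm \<Rightarrow> bool" where
  "ufam D T \<Gamma> a b \<equiv> T \<noteq> MLtt_cind \<and> D \<Gamma> (Tm a Univ) \<and> D (Dec a # \<Gamma>) (Tm b Univ)"

text \<open>
  Types have congruence rules; terms only the replacement rule.  Since codes are terms, there is
  no congruence rule for the binders in codes.
\<close>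

inductive ml :: "ml_theory \<Rightarrow> tm list \<Rightarrow> jdg \<Rightarrow> bool" ("_ \<rhd> _ \<turnstile> _" [51, 51, 51] 50) for T where
  ok_nil: "T \<rhd> [] \<turnstile> Ok"
| ok_ext: "T \<rhd> \<Gamma> \<turnstile> Ty A \<Longrightarrow> T \<rhd> A # \<Gamma> \<turnstile> Ok"
| var: "T \<rhd> \<Gamma> \<turnstile> Ok \<Longrightarrow> i < length \<Gamma> \<Longrightarrow> T \<rhd> \<Gamma> \<turnstile> Tm (Var i) (sh (Suc i) (\<Gamma> ! i))"
| ty_refl: "T \<rhd> \<Gamma> \<turnstile> Ty A \<Longrightarrow> T \<rhd> \<Gamma> \<turnstile> TyEq A A"
| ty_sym: "T \<rhd> \<Gamma> \<turnstile> TyEq A B \<Longrightarrow> T \<rhd> \<Gamma> \<turnstile> TyEq B A"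
| ty_trans: "T \<rhd> \<Gamma> \<turnstile> TyEq A B \<Longrightarrow> T \<rhd> \<Gamma> \<turnstile> TyEq B C \<Longrightarrow> T \<rhd> \<Gamma> \<turnstile> TyEq A C"
| tm_refl: "T \<rhd> \<Gamma> \<turnstile> Tm a A \<Longrightarrow> T \<rhd> \<Gamma> \<turnstile> TmEq a a A"
| tm_sym: "T \<rhd> \<Gamma> \<turnstile> TmEq a b A \<Longrightarrow> T \<rhd> \<Gamma> \<turnstile> TmEq b a A"
| tm_trans: "T \<rhd> \<Gamma> \<turnstile> TmEq a b A \<Longrightarrow> T \<rhd> \<Gamma> \<turnstile> TmEq b c A \<Longrightarrow> T \<rhd> \<Gamma> \<turnstile> TmEq a c A"
| conv: "T \<rhd> \<Gamma> \<turnstile> Tm a A \<Longrightarrow> T \<rhd> \<Gamma> \<turnstile> TyEq A B \<Longrightarrow> T \<rhd> \<Gamma> \<turnstile> Tm a B"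
| conv_eq: "T \<rhd> \<Gamma> \<turnstile> TmEq a b A \<Longrightarrow> T \<rhd> \<Gamma> \<turnstile> TyEq A B \<Longrightarrow> T \<rhd> \<Gamma> \<turnstile> TmEq a b B"
| subst:
    "T \<rhd> \<Delta> \<turnstile> J \<Longrightarrow> T \<rhd> \<Gamma> \<turnstile> Ok \<Longrightarrow>
     \<forall>i<length \<Delta>. T \<rhd> \<Gamma> \<turnstile> Tm (\<sigma> i) (sub \<sigma> (sh (Suc i) (\<Delta> ! i))) \<Longrightarrow>
     T \<rhd> \<Gamma> \<turnstile> jsub \<sigma> J"
| repl_ty:
    "T \<rhd> \<Delta> \<turnstile> Ty C \<Longrightarrow> T \<rhd> \<Gamma> \<turnstile> Ok \<Longrightarrow>
     \<forall>i<length \<Delta>. T \<rhd> \<Gamma> \<turnstile> TmEq (\<sigma> i) (\<tau> i) (sub \<sigma> (sh (Suc i) (\<Delta> ! i))) \<Longrightarrow>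
     T \<rhd> \<Gamma> \<turnstile> TyEq (sub \<sigma> C) (sub \<tau> C)"
| repl_tm:
    "T \<rhd> \<Delta> \<turnstile> Tm c C \<Longrightarrow> T \<rhd> \<Gamma> \<turnstile> Ok \<Longrightarrow>
     \<forall>i<length \<Delta>. T \<rhd> \<Gamma> \<turnstile> TmEq (\<sigma> i) (\<tau> i) (sub \<sigma> (sh (Suc i) (\<Delta> ! i))) \<Longrightarrow>
     T \<rhd> \<Gamma> \<turnstile> TmEq (sub \<sigma> c) (sub \<tau> c) (sub \<sigma> C)"

\<comment> \<open>first-order types\<close>
| N0_F: "T \<rhd> \<Gamma> \<turnstile> Ok \<Longrightarrow> T \<rhd> \<Gamma> \<turnstile> Ty N0"
| N0_E: "T \<rhd> N0 # \<Gamma> \<turnstile> Ty C \<Longrightarrow> T \<rhd> \<Gamma> \<turnstile> Tm t N0 \<Longrightarrow> T \<rhd> \<Gamma> \<turnstile> Tm (R0 t) (ins 0 [t] C)"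
| N1_F: "T \<rhd> \<Gamma> \<turnstile> Ok \<Longrightarrow> T \<rhd> \<Gamma> \<turnstile> Ty N1"
| N1_I: "T \<rhd> \<Gamma> \<turnstile> Ok \<Longrightarrow> T \<rhd> \<Gamma> \<turnstile> Tm Star N1"
| N1_E:
    "T \<rhd> N1 # \<Gamma> \<turnstile> Ty C \<Longrightarrow> T \<rhd> \<Gamma> \<turnstile> Tm t N1 \<Longrightarrow> T \<rhd> \<Gamma> \<turnstile> Tm c (ins 0 [Star] C) \<Longrightarrow>
     T \<rhd> \<Gamma> \<turnstile> Tm (R1 t c) (ins 0 [t] C)"
| N1_C:
    "T \<rhd> N1 # \<Gamma> \<turnstile> Ty C \<Longrightarrow> T \<rhd> \<Gamma> \<turnstile> Tm c (ins 0 [Star] C) \<Longrightarrow>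
     T \<rhd> \<Gamma> \<turnstile> TmEq (R1 Star c) c (ins 0 [Star] C)"
| Nat_F: "T \<rhd> \<Gamma> \<turnstile> Ok \<Longrightarrow> T \<rhd> \<Gamma> \<turnstile> Ty NN"
| Nat_I0: "T \<rhd> \<Gamma> \<turnstile> Ok \<Longrightarrow> T \<rhd> \<Gamma> \<turnstile> Tm Zero NN"
| Nat_IS: "T \<rhd> \<Gamma> \<turnstile> Tm t NN \<Longrightarrow> T \<rhd> \<Gamma> \<turnstile> Tm (Succ t) NN"
| Nat_E:
    "T \<rhd> NN # \<Gamma> \<turnstile> Ty C \<Longrightarrow> T \<rhd> \<Gamma> \<turnstile> Tm t NN \<Longrightarrow> T \<rhd> \<Gamma> \<turnstile> Tm c (ins 0 [Zero] C) \<Longrightarrow>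
     T \<rhd> C # NN # \<Gamma> \<turnstile> Tm d (ins 2 [Succ (Var 1)] C) \<Longrightarrow>
     T \<rhd> \<Gamma> \<turnstile> Tm (RNat t c d) (ins 0 [t] C)"
| Nat_C0:
    "T \<rhd> NN # \<Gamma> \<turnstile> Ty C \<Longrightarrow> T \<rhd> \<Gamma> \<turnstile> Tm c (ins 0 [Zero] C) \<Longrightarrow>
     T \<rhd> C # NN # \<Gamma> \<turnstile> Tm d (ins 2 [Succ (Var 1)] C) \<Longrightarrow>
     T \<rhd> \<Gamma> \<turnstile> TmEq (RNat Zero c d) c (ins 0 [Zero] C)"
| Nat_CS:
    "T \<rhd> NN # \<Gamma> \<turnstile> Ty C \<Longrightarrow> T \<rhd> \<Gamma> \<turnstile> Tm t NN \<Longrightarrow> T \<rhd> \<Gamma> \<turnstile> Tm c (ins 0 [Zero] C) \<Longrightarrow>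
     T \<rhd> C # NN # \<Gamma> \<turnstile> Tm d (ins 2 [Succ (Var 1)] C) \<Longrightarrow>
     T \<rhd> \<Gamma> \<turnstile> TmEq (RNat (Succ t) c d) (ins 0 [RNat t c d, t] d) (ins 0 [Succ t] C)"
| Lst_F: "T \<rhd> \<Gamma> \<turnstile> Ty A \<Longrightarrow> T \<rhd> \<Gamma> \<turnstile> Ty (Lst A)"
| Lst_cong: "T \<rhd> \<Gamma> \<turnstile> TyEq A A' \<Longrightarrow> T \<rhd> \<Gamma> \<turnstile> TyEq (Lst A) (Lst A')"
| Lst_I0: "T \<rhd> \<Gamma> \<turnstile> Ty A \<Longrightarrow> T \<rhd> \<Gamma> \<turnstile> Tm Nl (Lst A)"
| Lst_I1: "T \<rhd> \<Gamma> \<turnstile> Tm a A \<Longrightarrow> T \<rhd> \<Gamma> \<turnstile> Tm l (Lst A) \<Longrightarrow> T \<rhd> \<Gamma> \<turnstile> Tm (Cns a l) (Lst A)"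
| Lst_E:
    "T \<rhd> Lst A # \<Gamma> \<turnstile> Ty C \<Longrightarrow> T \<rhd> \<Gamma> \<turnstile> Tm t (Lst A) \<Longrightarrow> T \<rhd> \<Gamma> \<turnstile> Tm c (ins 0 [Nl] C) \<Longrightarrow>
     T \<rhd> lift 1 1 C # Lst (sh 1 A) # A # \<Gamma> \<turnstile> Tm d (ins 3 [Cns (Var 2) (Var 1)] C) \<Longrightarrow>
     T \<rhd> \<Gamma> \<turnstile> Tm (RLst t c d) (ins 0 [t] C)"
| Lst_C0:
    "T \<rhd> Lst A # \<Gamma> \<turnstile> Ty C \<Longrightarrow> T \<rhd> \<Gamma> \<turnstile> Tm c (ins 0 [Nl] C) \<Longrightarrow>
     T \<rhd> lift 1 1 C # Lst (sh 1 A) # A # \<Gamma> \<turnstile> Tm d (ins 3 [Cns (Var 2) (Var 1)] C) \<Longrightarrow>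
     T \<rhd> \<Gamma> \<turnstile> TmEq (RLst Nl c d) c (ins 0 [Nl] C)"
| Lst_C1:
    "T \<rhd> Lst A # \<Gamma> \<turnstile> Ty C \<Longrightarrow> T \<rhd> \<Gamma> \<turnstile> Tm a A \<Longrightarrow> T \<rhd> \<Gamma> \<turnstile> Tm l (Lst A) \<Longrightarrow>
     T \<rhd> \<Gamma> \<turnstile> Tm c (ins 0 [Nl] C) \<Longrightarrow>
     T \<rhd> lift 1 1 C # Lst (sh 1 A) # A # \<Gamma> \<turnstile> Tm d (ins 3 [Cns (Var 2) (Var 1)] C) \<Longrightarrow>
     T \<rhd> \<Gamma> \<turnstile> TmEq (RLst (Cns a l) c d) (ins 0 [RLst l c d, l, a] d) (ins 0 [Cns a l] C)"
| Sum_F: "T \<rhd> \<Gamma> \<turnstile> Ty A \<Longrightarrow> T \<rhd> \<Gamma> \<turnstile> Ty B \<Longrightarrow> T \<rhd> \<Gamma> \<turnstile> Ty (Coprod A B)"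
| Sum_cong: "T \<rhd> \<Gamma> \<turnstile> TyEq A A' \<Longrightarrow> T \<rhd> \<Gamma> \<turnstile> TyEq B B' \<Longrightarrow> T \<rhd> \<Gamma> \<turnstile> TyEq (Coprod A B) (Coprod A' B')"
| Sum_I1: "T \<rhd> \<Gamma> \<turnstile> Ty B \<Longrightarrow> T \<rhd> \<Gamma> \<turnstile> Tm a A \<Longrightarrow> T \<rhd> \<Gamma> \<turnstile> Tm (InL a) (Coprod A B)"
| Sum_I2: "T \<rhd> \<Gamma> \<turnstile> Ty A \<Longrightarrow> T \<rhd> \<Gamma> \<turnstile> Tm b B \<Longrightarrow> T \<rhd> \<Gamma> \<turnstile> Tm (InR b) (Coprod A B)"
| Sum_E:
    "T \<rhd> Coprod A B # \<Gamma> \<turnstile> Ty C \<Longrightarrow> T \<rhd> \<Gamma> \<turnstile> Tm t (Coprod A B) \<Longrightarrow>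
     T \<rhd> A # \<Gamma> \<turnstile> Tm c (ins 1 [InL (Var 0)] C) \<Longrightarrow> T \<rhd> B # \<Gamma> \<turnstile> Tm d (ins 1 [InR (Var 0)] C) \<Longrightarrow>
     T \<rhd> \<Gamma> \<turnstile> Tm (When t c d) (ins 0 [t] C)"
| Sum_C1:
    "T \<rhd> Coprod A B # \<Gamma> \<turnstile> Ty C \<Longrightarrow> T \<rhd> \<Gamma> \<turnstile> Tm a A \<Longrightarrow>
     T \<rhd> A # \<Gamma> \<turnstile> Tm c (ins 1 [InL (Var 0)] C) \<Longrightarrow> T \<rhd> B # \<Gamma> \<turnstile> Tm d (ins 1 [InR (Var 0)] C) \<Longrightarrow>
     T \<rhd> \<Gamma> \<turnstile> TmEq (When (InL a) c d) (ins 0 [a] c) (ins 0 [InL a] C)"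
| Sum_C2:
    "T \<rhd> Coprod A B # \<Gamma> \<turnstile> Ty C \<Longrightarrow> T \<rhd> \<Gamma> \<turnstile> Tm b B \<Longrightarrow>
     T \<rhd> A # \<Gamma> \<turnstile> Tm c (ins 1 [InL (Var 0)] C) \<Longrightarrow> T \<rhd> B # \<Gamma> \<turnstile> Tm d (ins 1 [InR (Var 0)] C) \<Longrightarrow>
     T \<rhd> \<Gamma> \<turnstile> TmEq (When (InR b) c d) (ins 0 [b] d) (ins 0 [InR b] C)"
| Sig_F: "T \<rhd> \<Gamma> \<turnstile> Ty A \<Longrightarrow> T \<rhd> A # \<Gamma> \<turnstile> Ty B \<Longrightarrow> T \<rhd> \<Gamma> \<turnstile> Ty (Sig A B)"
| Sig_cong: "T \<rhd> \<Gamma> \<turnstile> TyEq A A' \<Longrightarrow> T \<rhd> A # \<Gamma> \<turnstile> TyEq B B' \<Longrightarrow> T \<rhd> \<Gamma> \<turnstile> TyEq (Sig A B) (Sig A' B')"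
| Sig_I:
    "T \<rhd> A # \<Gamma> \<turnstile> Ty B \<Longrightarrow> T \<rhd> \<Gamma> \<turnstile> Tm a A \<Longrightarrow> T \<rhd> \<Gamma> \<turnstile> Tm b (ins 0 [a] B) \<Longrightarrow>
     T \<rhd> \<Gamma> \<turnstile> Tm (Pr a b) (Sig A B)"
| Sig_E:
    "T \<rhd> Sig A B # \<Gamma> \<turnstile> Ty C \<Longrightarrow> T \<rhd> \<Gamma> \<turnstile> Tm t (Sig A B) \<Longrightarrow>
     T \<rhd> B # A # \<Gamma> \<turnstile> Tm c (ins 2 [Pr (Var 1) (Var 0)] C) \<Longrightarrow>
     T \<rhd> \<Gamma> \<turnstile> Tm (Split t c) (ins 0 [t] C)"
| Sig_C:
    "T \<rhd> Sig A B # \<Gamma> \<turnstile> Ty C \<Longrightarrow> T \<rhd> \<Gamma> \<turnstile> Tm a A \<Longrightarrow> T \<rhd> \<Gamma> \<turnstile> Tm b (ins 0 [a] B) \<Longrightarrow>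
     T \<rhd> B # A # \<Gamma> \<turnstile> Tm c (ins 2 [Pr (Var 1) (Var 0)] C) \<Longrightarrow>
     T \<rhd> \<Gamma> \<turnstile> TmEq (Split (Pr a b) c) (ins 0 [b, a] c) (ins 0 [Pr a b] C)"
| Pi_F: "T \<rhd> \<Gamma> \<turnstile> Ty A \<Longrightarrow> T \<rhd> A # \<Gamma> \<turnstile> Ty B \<Longrightarrow> T \<rhd> \<Gamma> \<turnstile> Ty (Pi A B)"
| Pi_cong: "T \<rhd> \<Gamma> \<turnstile> TyEq A A' \<Longrightarrow> T \<rhd> A # \<Gamma> \<turnstile> TyEq B B' \<Longrightarrow> T \<rhd> \<Gamma> \<turnstile> TyEq (Pi A B) (Pi A' B')"
| Pi_I: "T \<rhd> A # \<Gamma> \<turnstile> Tm b B \<Longrightarrow> T \<rhd> \<Gamma> \<turnstile> Tm (Lam b) (Pi A B)"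
| Pi_E: "T \<rhd> \<Gamma> \<turnstile> Tm f (Pi A B) \<Longrightarrow> T \<rhd> \<Gamma> \<turnstile> Tm a A \<Longrightarrow> T \<rhd> \<Gamma> \<turnstile> Tm (App f a) (ins 0 [a] B)"
| Pi_C:
    "T \<rhd> A # \<Gamma> \<turnstile> Tm b B \<Longrightarrow> T \<rhd> \<Gamma> \<turnstile> Tm a A \<Longrightarrow>
     T \<rhd> \<Gamma> \<turnstile> TmEq (App (Lam b) a) (ins 0 [a] b) (ins 0 [a] B)"
| Eq_F: "T \<rhd> \<Gamma> \<turnstile> Ty A \<Longrightarrow> T \<rhd> \<Gamma> \<turnstile> Tm a A \<Longrightarrow> T \<rhd> \<Gamma> \<turnstile> Tm b A \<Longrightarrow> T \<rhd> \<Gamma> \<turnstile> Ty (Eq A a b)"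
| Eq_cong:
    "T \<rhd> \<Gamma> \<turnstile> TyEq A A' \<Longrightarrow> T \<rhd> \<Gamma> \<turnstile> TmEq a a' A \<Longrightarrow> T \<rhd> \<Gamma> \<turnstile> TmEq b b' A \<Longrightarrow>
     T \<rhd> \<Gamma> \<turnstile> TyEq (Eq A a b) (Eq A' a' b')"
| Eq_I: "T \<rhd> \<Gamma> \<turnstile> Tm a A \<Longrightarrow> T \<rhd> \<Gamma> \<turnstile> Tm (Rfl a) (Eq A a a)"
| Eq_E:
    "T \<rhd> Eq (sh 2 A) (Var 1) (Var 0) # sh 1 A # A # \<Gamma> \<turnstile> Ty C \<Longrightarrow>
     T \<rhd> \<Gamma> \<turnstile> Tm a A \<Longrightarrow> T \<rhd> \<Gamma> \<turnstile> Tm b A \<Longrightarrow> T \<rhd> \<Gamma> \<turnstile> Tm p (Eq A a b) \<Longrightarrow>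
     T \<rhd> A # \<Gamma> \<turnstile> Tm c (ins 1 [Rfl (Var 0), Var 0, Var 0] C) \<Longrightarrow>
     T \<rhd> \<Gamma> \<turnstile> Tm (IdRec p c) (ins 0 [p, b, a] C)"
| Eq_C:
    "T \<rhd> Eq (sh 2 A) (Var 1) (Var 0) # sh 1 A # A # \<Gamma> \<turnstile> Ty C \<Longrightarrow> T \<rhd> \<Gamma> \<turnstile> Tm a A \<Longrightarrow>
     T \<rhd> A # \<Gamma> \<turnstile> Tm c (ins 1 [Rfl (Var 0), Var 0, Var 0] C) \<Longrightarrow>
     T \<rhd> \<Gamma> \<turnstile> TmEq (IdRec (Rfl a) c) (ins 0 [a] c) (ins 0 [Rfl a, a, a] C)"

\<comment> \<open>the universe \<open>U\<^sub>0\<close> of \<open>MLtt_cind\<close>, the superuniverse \<open>S\<close> of \<open>MLS_ind\<close>\<close>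
| Univ_F: "T \<rhd> \<Gamma> \<turnstile> Ok \<Longrightarrow> T \<rhd> \<Gamma> \<turnstile> Ty Univ"
| Dec_F: "T \<rhd> \<Gamma> \<turnstile> Tm a Univ \<Longrightarrow> T \<rhd> \<Gamma> \<turnstile> Ty (Dec a)"
| cN0_I: "T \<rhd> \<Gamma> \<turnstile> Ok \<Longrightarrow> T \<rhd> \<Gamma> \<turnstile> Tm cN0 Univ"
| cN0_D: "T \<rhd> \<Gamma> \<turnstile> Ok \<Longrightarrow> T \<rhd> \<Gamma> \<turnstile> TyEq (Dec cN0) N0"
| cN1_I: "T \<rhd> \<Gamma> \<turnstile> Ok \<Longrightarrow> T \<rhd> \<Gamma> \<turnstile> Tm cN1 Univ"
| cN1_D: "T \<rhd> \<Gamma> \<turnstile> Ok \<Longrightarrow> T \<rhd> \<Gamma> \<turnstile> TyEq (Dec cN1) N1"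
| cNN_I: "T \<rhd> \<Gamma> \<turnstile> Ok \<Longrightarrow> T \<rhd> \<Gamma> \<turnstile> Tm cNN Univ"
| cNN_D: "T \<rhd> \<Gamma> \<turnstile> Ok \<Longrightarrow> T \<rhd> \<Gamma> \<turnstile> TyEq (Dec cNN) NN"
| cLst_I: "T \<rhd> \<Gamma> \<turnstile> Tm a Univ \<Longrightarrow> T \<rhd> \<Gamma> \<turnstile> Tm (cLst a) Univ"
| cLst_D: "T \<rhd> \<Gamma> \<turnstile> Tm a Univ \<Longrightarrow> T \<rhd> \<Gamma> \<turnstile> TyEq (Dec (cLst a)) (Lst (Dec a))"
| cSum_I: "T \<rhd> \<Gamma> \<turnstile> Tm a Univ \<Longrightarrow> T \<rhd> \<Gamma> \<turnstile> Tm b Univ \<Longrightarrow> T \<rhd> \<Gamma> \<turnstile> Tm (cCoprod a b) Univ"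
| cSum_D:
    "T \<rhd> \<Gamma> \<turnstile> Tm a Univ \<Longrightarrow> T \<rhd> \<Gamma> \<turnstile> Tm b Univ \<Longrightarrow>
     T \<rhd> \<Gamma> \<turnstile> TyEq (Dec (cCoprod a b)) (Coprod (Dec a) (Dec b))"
| cSig_I: "T \<rhd> \<Gamma> \<turnstile> Tm a Univ \<Longrightarrow> T \<rhd> Dec a # \<Gamma> \<turnstile> Tm b Univ \<Longrightarrow> T \<rhd> \<Gamma> \<turnstile> Tm (cSig a b) Univ"
| cSig_D:
    "T \<rhd> \<Gamma> \<turnstile> Tm a Univ \<Longrightarrow> T \<rhd> Dec a # \<Gamma> \<turnstile> Tm b Univ \<Longrightarrow>
     T \<rhd> \<Gamma> \<turnstile> TyEq (Dec (cSig a b)) (Sig (Dec a) (Dec b))"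
| cPi_I: "T \<rhd> \<Gamma> \<turnstile> Tm a Univ \<Longrightarrow> T \<rhd> Dec a # \<Gamma> \<turnstile> Tm b Univ \<Longrightarrow> T \<rhd> \<Gamma> \<turnstile> Tm (cPi a b) Univ"
| cPi_D:
    "T \<rhd> \<Gamma> \<turnstile> Tm a Univ \<Longrightarrow> T \<rhd> Dec a # \<Gamma> \<turnstile> Tm b Univ \<Longrightarrow>
     T \<rhd> \<Gamma> \<turnstile> TyEq (Dec (cPi a b)) (Pi (Dec a) (Dec b))"
| cEq_I:
    "T \<rhd> \<Gamma> \<turnstile> Tm a Univ \<Longrightarrow> T \<rhd> \<Gamma> \<turnstile> Tm t (Dec a) \<Longrightarrow> T \<rhd> \<Gamma> \<turnstile> Tm u (Dec a) \<Longrightarrow>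
     T \<rhd> \<Gamma> \<turnstile> Tm (cEq a t u) Univ"
| cEq_D:
    "T \<rhd> \<Gamma> \<turnstile> Tm a Univ \<Longrightarrow> T \<rhd> \<Gamma> \<turnstile> Tm t (Dec a) \<Longrightarrow> T \<rhd> \<Gamma> \<turnstile> Tm u (Dec a) \<Longrightarrow>
     T \<rhd> \<Gamma> \<turnstile> TyEq (Dec (cEq a t u)) (Eq (Dec a) t u)"

\<comment> \<open>inductive covers\<close>
| Cov_F: "axset (ml T) \<Gamma> s i c v \<Longrightarrow> T \<rhd> \<Gamma> \<turnstile> Tm a (Dec s) \<Longrightarrow> T \<rhd> \<Gamma> \<turnstile> Tm (Cov s i c v a) Univ"
| Cov_rf:
    "axset (ml T) \<Gamma> s i c v \<Longrightarrow> T \<rhd> \<Gamma> \<turnstile> Tm a (Dec s) \<Longrightarrow> T \<rhd> \<Gamma> \<turnstile> Tm r (eps a v) \<Longrightarrow>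
     T \<rhd> \<Gamma> \<turnstile> Tm (Rf a r) (Dec (Cov s i c v a))"
| Cov_tr:
    "axset (ml T) \<Gamma> s i c v \<Longrightarrow> T \<rhd> \<Gamma> \<turnstile> Tm a (Dec s) \<Longrightarrow> T \<rhd> \<Gamma> \<turnstile> Tm j (Dec (ins 0 [a] i)) \<Longrightarrow>
     T \<rhd> \<Gamma> \<turnstile> Tm r (CovAll 0 s i c v (ins 0 [j, a] c)) \<Longrightarrow>
     T \<rhd> \<Gamma> \<turnstile> Tm (Tr a j r) (Dec (Cov s i c v a))"
| Cov_E:
    "axset (ml T) \<Gamma> s i c v \<Longrightarrow> T \<rhd> \<Gamma> \<turnstile> Tm a (Dec s) \<Longrightarrow>
     T \<rhd> CovT 1 s i c v (Var 0) # Dec s # \<Gamma> \<turnstile> Ty P \<Longrightarrow>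
     T \<rhd> \<Gamma> \<turnstile> Tm m (Dec (Cov s i c v a)) \<Longrightarrow>
     T \<rhd> eps (Var 0) (sh 1 v) # Dec s # \<Gamma> \<turnstile> Tm q1 (ins 2 [Rf (Var 1) (Var 0), Var 1] P) \<Longrightarrow>
     T \<rhd> Pi (Dec (sh 3 s)) (Pi (eps (Var 0) (sh 2 c))
             (ins 5 [App (App (Var 2) (Var 1)) (Var 0), Var 1] P))
         # CovAll 2 s i c v c # Dec i # Dec s # \<Gamma>
       \<turnstile> Tm q2 (ins 4 [Tr (Var 3) (Var 2) (Var 1), Var 3] P) \<Longrightarrow>
     T \<rhd> \<Gamma> \<turnstile> Tm (Ind m q1 q2) (ins 0 [m, a] P)"
| Cov_C1:
    "axset (ml T) \<Gamma> s i c v \<Longrightarrow> T \<rhd> \<Gamma> \<turnstile> Tm a (Dec s) \<Longrightarrow>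
     T \<rhd> CovT 1 s i c v (Var 0) # Dec s # \<Gamma> \<turnstile> Ty P \<Longrightarrow>
     T \<rhd> \<Gamma> \<turnstile> Tm r (eps a v) \<Longrightarrow>
     T \<rhd> eps (Var 0) (sh 1 v) # Dec s # \<Gamma> \<turnstile> Tm q1 (ins 2 [Rf (Var 1) (Var 0), Var 1] P) \<Longrightarrow>
     T \<rhd> Pi (Dec (sh 3 s)) (Pi (eps (Var 0) (sh 2 c))
             (ins 5 [App (App (Var 2) (Var 1)) (Var 0), Var 1] P))
         # CovAll 2 s i c v c # Dec i # Dec s # \<Gamma>
       \<turnstile> Tm q2 (ins 4 [Tr (Var 3) (Var 2) (Var 1), Var 3] P) \<Longrightarrow>
     T \<rhd> \<Gamma> \<turnstile> TmEq (Ind (Rf a r) q1 q2) (ins 0 [r, a] q1) (ins 0 [Rf a r, a] P)"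
| Cov_C2:
    "axset (ml T) \<Gamma> s i c v \<Longrightarrow> T \<rhd> \<Gamma> \<turnstile> Tm a (Dec s) \<Longrightarrow>
     T \<rhd> CovT 1 s i c v (Var 0) # Dec s # \<Gamma> \<turnstile> Ty P \<Longrightarrow>
     T \<rhd> \<Gamma> \<turnstile> Tm j (Dec (ins 0 [a] i)) \<Longrightarrow> T \<rhd> \<Gamma> \<turnstile> Tm r (CovAll 0 s i c v (ins 0 [j, a] c)) \<Longrightarrow>
     T \<rhd> eps (Var 0) (sh 1 v) # Dec s # \<Gamma> \<turnstile> Tm q1 (ins 2 [Rf (Var 1) (Var 0), Var 1] P) \<Longrightarrow>
     T \<rhd> Pi (Dec (sh 3 s)) (Pi (eps (Var 0) (sh 2 c))
             (ins 5 [App (App (Var 2) (Var 1)) (Var 0), Var 1] P))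
         # CovAll 2 s i c v c # Dec i # Dec s # \<Gamma>
       \<turnstile> Tm q2 (ins 4 [Tr (Var 3) (Var 2) (Var 1), Var 3] P) \<Longrightarrow>
     T \<rhd> \<Gamma> \<turnstile> TmEq (Ind (Tr a j r) q1 q2)
       (ins 0 [Lam (Lam (Ind (App (App (sh 2 r) (Var 1)) (Var 0)) (lift 2 2 q1) (lift 2 4 q2))), r, j, a] q2)
       (ins 0 [Tr a j r, a] P)"

\<comment> \<open>positivity relations\<close>
| Pos_F:
    "T = MLtt_cind \<Longrightarrow> axset (ml T) \<Gamma> s i c v \<Longrightarrow> T \<rhd> \<Gamma> \<turnstile> Tm a (Dec s) \<Longrightarrow>
     T \<rhd> \<Gamma> \<turnstile> Tm (Pos s i c v a) Univ"
| Pos_ax1: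
    "T = MLtt_cind \<Longrightarrow> axset (ml T) \<Gamma> s i c v \<Longrightarrow> T \<rhd> \<Gamma> \<turnstile> Tm a (Dec s) \<Longrightarrow>
     T \<rhd> \<Gamma> \<turnstile> Tm q (Dec (Pos s i c v a)) \<Longrightarrow>
     T \<rhd> \<Gamma> \<turnstile> Tm (Ax1 a q) (eps a v)"
| Pos_ax2:
    "T = MLtt_cind \<Longrightarrow> axset (ml T) \<Gamma> s i c v \<Longrightarrow> T \<rhd> \<Gamma> \<turnstile> Tm a (Dec s) \<Longrightarrow>
     T \<rhd> \<Gamma> \<turnstile> Tm j (Dec (ins 0 [a] i)) \<Longrightarrow> T \<rhd> \<Gamma> \<turnstile> Tm q (Dec (Pos s i c v a)) \<Longrightarrow>
     T \<rhd> \<Gamma> \<turnstile> Tm (Ax2 a j q)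
       (Sig (Dec s) (prod (eps (Var 0) (sh 1 (ins 0 [j, a] c))) (PosT 1 s i c v (Var 0))))"
| Pos_ax3:
    "T = MLtt_cind \<Longrightarrow> axset (ml T) \<Gamma> s i c v \<Longrightarrow> T \<rhd> \<Gamma> \<turnstile> Tm a (Dec s) \<Longrightarrow>
     T \<rhd> Dec s # \<Gamma> \<turnstile> Ty P \<Longrightarrow> T \<rhd> \<Gamma> \<turnstile> Tm m (ins 0 [a] P) \<Longrightarrow>
     T \<rhd> P # Dec s # \<Gamma> \<turnstile> Tm q1 (eps (Var 1) (sh 2 v)) \<Longrightarrow>
     T \<rhd> sh 1 P # Dec i # Dec s # \<Gamma>
       \<turnstile> Tm q2 (Sig (Dec (sh 3 s)) (prod (eps (Var 0) (sh 2 c)) (ins 4 [Var 0] P))) \<Longrightarrow>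
     T \<rhd> \<Gamma> \<turnstile> Tm (Ax3 a m q1 q2) (Dec (Pos s i c v a))"

\<comment> \<open>the universe constructor\<close>
| SubU_F:
    "ufam (ml T) T \<Gamma> a b \<Longrightarrow> T \<rhd> \<Gamma> \<turnstile> Ty (SubU a b)"
| cSubU_I:
    "ufam (ml T) T \<Gamma> a b \<Longrightarrow> T \<rhd> \<Gamma> \<turnstile> Tm (cSubU a b) Univ"
| cSubU_D:
    "ufam (ml T) T \<Gamma> a b \<Longrightarrow> T \<rhd> \<Gamma> \<turnstile> TyEq (Dec (cSubU a b)) (SubU a b)"
| SubDec_F:
    "ufam (ml T) T \<Gamma> a b \<Longrightarrow> T \<rhd> \<Gamma> \<turnstile> Tm t (SubU a b) \<Longrightarrow> T \<rhd> \<Gamma> \<turnstile> Ty (SubDec a b t)"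
| SubLift_I:
    "ufam (ml T) T \<Gamma> a b \<Longrightarrow> T \<rhd> \<Gamma> \<turnstile> Tm t (SubU a b) \<Longrightarrow> T \<rhd> \<Gamma> \<turnstile> Tm (SubLift a b t) Univ"
| SubLift_D:
    "ufam (ml T) T \<Gamma> a b \<Longrightarrow> T \<rhd> \<Gamma> \<turnstile> Tm t (SubU a b) \<Longrightarrow>
     T \<rhd> \<Gamma> \<turnstile> TyEq (Dec (SubLift a b t)) (SubDec a b t)"
| uBase_I:
    "ufam (ml T) T \<Gamma> a b \<Longrightarrow> T \<rhd> \<Gamma> \<turnstile> Tm uBase (SubU a b)"
| uBase_D:
    "ufam (ml T) T \<Gamma> a b \<Longrightarrow> T \<rhd> \<Gamma> \<turnstile> TyEq (SubDec a b uBase) (Dec a)"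
| uFam_I:
    "ufam (ml T) T \<Gamma> a b \<Longrightarrow> T \<rhd> \<Gamma> \<turnstile> Tm t (Dec a) \<Longrightarrow> T \<rhd> \<Gamma> \<turnstile> Tm (uFam t) (SubU a b)"
| uFam_D:
    "ufam (ml T) T \<Gamma> a b \<Longrightarrow> T \<rhd> \<Gamma> \<turnstile> Tm t (Dec a) \<Longrightarrow>
     T \<rhd> \<Gamma> \<turnstile> TyEq (SubDec a b (uFam t)) (Dec (ins 0 [t] b))"
| uN0_I:
    "ufam (ml T) T \<Gamma> a b \<Longrightarrow> T \<rhd> \<Gamma> \<turnstile> Tm uN0 (SubU a b)"
| uN0_D:
    "ufam (ml T) T \<Gamma> a b \<Longrightarrow> T \<rhd> \<Gamma> \<turnstile> TyEq (SubDec a b uN0) N0"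
| uN1_I:
    "ufam (ml T) T \<Gamma> a b \<Longrightarrow> T \<rhd> \<Gamma> \<turnstile> Tm uN1 (SubU a b)"
| uN1_D:
    "ufam (ml T) T \<Gamma> a b \<Longrightarrow> T \<rhd> \<Gamma> \<turnstile> TyEq (SubDec a b uN1) N1"
| uNN_I:
    "ufam (ml T) T \<Gamma> a b \<Longrightarrow> T \<rhd> \<Gamma> \<turnstile> Tm uNN (SubU a b)"
| uNN_D:
    "ufam (ml T) T \<Gamma> a b \<Longrightarrow> T \<rhd> \<Gamma> \<turnstile> TyEq (SubDec a b uNN) NN"
| uLst_I:
    "ufam (ml T) T \<Gamma> a b \<Longrightarrow> T \<rhd> \<Gamma> \<turnstile> Tm t (SubU a b) \<Longrightarrow> T \<rhd> \<Gamma> \<turnstile> Tm (uLst t) (SubU a b)"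
| uLst_D:
    "ufam (ml T) T \<Gamma> a b \<Longrightarrow> T \<rhd> \<Gamma> \<turnstile> Tm t (SubU a b) \<Longrightarrow>
     T \<rhd> \<Gamma> \<turnstile> TyEq (SubDec a b (uLst t)) (Lst (SubDec a b t))"
| uCoprod_I:
    "ufam (ml T) T \<Gamma> a b \<Longrightarrow> T \<rhd> \<Gamma> \<turnstile> Tm t (SubU a b) \<Longrightarrow> T \<rhd> \<Gamma> \<turnstile> Tm u (SubU a b) \<Longrightarrow>
     T \<rhd> \<Gamma> \<turnstile> Tm (uCoprod t u) (SubU a b)"
| uCoprod_D:
    "ufam (ml T) T \<Gamma> a b \<Longrightarrow> T \<rhd> \<Gamma> \<turnstile> Tm t (SubU a b) \<Longrightarrow> T \<rhd> \<Gamma> \<turnstile> Tm u (SubU a b) \<Longrightarrow>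
     T \<rhd> \<Gamma> \<turnstile> TyEq (SubDec a b (uCoprod t u)) (Coprod (SubDec a b t) (SubDec a b u))"
| uSig_I:
    "ufam (ml T) T \<Gamma> a b \<Longrightarrow> T \<rhd> \<Gamma> \<turnstile> Tm t (SubU a b) \<Longrightarrow>
     T \<rhd> SubDec a b t # \<Gamma> \<turnstile> Tm u (SubU (sh 1 a) (lift 1 1 b)) \<Longrightarrow>
     T \<rhd> \<Gamma> \<turnstile> Tm (uSig t u) (SubU a b)"
| uSig_D:
    "ufam (ml T) T \<Gamma> a b \<Longrightarrow> T \<rhd> \<Gamma> \<turnstile> Tm t (SubU a b) \<Longrightarrow>
     T \<rhd> SubDec a b t # \<Gamma> \<turnstile> Tm u (SubU (sh 1 a) (lift 1 1 b)) \<Longrightarrow>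
     T \<rhd> \<Gamma> \<turnstile> TyEq (SubDec a b (uSig t u)) (Sig (SubDec a b t) (SubDec (sh 1 a) (lift 1 1 b) u))"
| uPi_I:
    "ufam (ml T) T \<Gamma> a b \<Longrightarrow> T \<rhd> \<Gamma> \<turnstile> Tm t (SubU a b) \<Longrightarrow>
     T \<rhd> SubDec a b t # \<Gamma> \<turnstile> Tm u (SubU (sh 1 a) (lift 1 1 b)) \<Longrightarrow>
     T \<rhd> \<Gamma> \<turnstile> Tm (uPi t u) (SubU a b)"
| uPi_D:
    "ufam (ml T) T \<Gamma> a b \<Longrightarrow> T \<rhd> \<Gamma> \<turnstile> Tm t (SubU a b) \<Longrightarrow>
     T \<rhd> SubDec a b t # \<Gamma> \<turnstile> Tm u (SubU (sh 1 a) (lift 1 1 b)) \<Longrightarrow>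
     T \<rhd> \<Gamma> \<turnstile> TyEq (SubDec a b (uPi t u)) (Pi (SubDec a b t) (SubDec (sh 1 a) (lift 1 1 b) u))"
| uEq_I:
    "ufam (ml T) T \<Gamma> a b \<Longrightarrow> T \<rhd> \<Gamma> \<turnstile> Tm t (SubU a b) \<Longrightarrow> T \<rhd> \<Gamma> \<turnstile> Tm c (SubDec a b t) \<Longrightarrow>
     T \<rhd> \<Gamma> \<turnstile> Tm d (SubDec a b t) \<Longrightarrow> T \<rhd> \<Gamma> \<turnstile> Tm (uEq t c d) (SubU a b)"
| uEq_D:
    "ufam (ml T) T \<Gamma> a b \<Longrightarrow> T \<rhd> \<Gamma> \<turnstile> Tm t (SubU a b) \<Longrightarrow> T \<rhd> \<Gamma> \<turnstile> Tm c (SubDec a b t) \<Longrightarrow>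
     T \<rhd> \<Gamma> \<turnstile> Tm d (SubDec a b t) \<Longrightarrow>
     T \<rhd> \<Gamma> \<turnstile> TyEq (SubDec a b (uEq t c d)) (Eq (SubDec a b t) c d)"

\<comment> \<open>the axiom\<close>
| CT_ax: "T = MLS_ind_CT \<Longrightarrow> T \<rhd> \<Gamma> \<turnstile> Ok \<Longrightarrow> T \<rhd> \<Gamma> \<turnstile> Tm (Post CT) CT"

definition ml_consistent :: "ml_theory \<Rightarrow> bool" where
  "ml_consistent T \<longleftrightarrow> \<not> (\<exists>t. T \<rhd> [] \<turnstile> Tm t N0)"


section \<open>The theories \<open>mTT_cind\<close> and \<open>mTT_cind + AC + CT\<close>\<close>

abbreviation (input) elt :: "tm \<Rightarrow> tm \<Rightarrow> tm" where "elt t V \<equiv> App V t"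
abbreviation Pws :: "tm \<Rightarrow> tm" where "Pws A \<equiv> Pi A Props"

abbreviation mCovT :: "nat \<Rightarrow> tm \<Rightarrow> tm \<Rightarrow> tm \<Rightarrow> tm \<Rightarrow> tm \<Rightarrow> tm" where
  "mCovT n A I C V z \<equiv> Cov (sh n A) (lift n 1 I) (lift n 2 C) (sh n V) z"
abbreviation mPosT :: "nat \<Rightarrow> tm \<Rightarrow> tm \<Rightarrow> tm \<Rightarrow> tm \<Rightarrow> tm \<Rightarrow> tm" where
  "mPosT n A I C V z \<equiv> Pos (sh n A) (lift n 1 I) (lift n 2 C) (sh n V) z"
abbreviation mCovAll :: "nat \<Rightarrow> tm \<Rightarrow> tm \<Rightarrow> tm \<Rightarrow> tm \<Rightarrow> tm \<Rightarrow> tm" where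
  "mCovAll n A I C V W \<equiv>
     Forall (sh n A) (Imp (elt (Var 0) (sh 1 W)) (mCovT (n+1) A I C V (Var 0)))"

definition mCT :: tm where
  "mCT = Forall (Pi NN NN) (Exis NN (Forall NN (Exis NN
     (And (Eq NN (pr_tm prT [Var 2, Var 1, Var 0]) (Succ Zero))
           (Eq NN (App (Var 3) (Var 1)) (pr_tm prU [Var 0]))))))"

text \<open>\<open>R\<close> lives over \<open>x \<in> A, y \<in> B\<close>.\<close>

definition mAC :: "tm \<Rightarrow> tm \<Rightarrow> tm \<Rightarrow> tm" where
  "mAC A B R = Imp (Forall A (Exis B R))
     (Exis (Pi A B) (Forall (sh 1 A) (ins 2 [App (Var 1) (Var 0), Var 0] R)))"

text \<open>Collections, sets, propositions, small propositions.\<close>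

datatype kind = Col | SetK | Prop | PropS

datatype mjdg = mOk | mTy kind tm | mTyEq kind tm tm | mTm tm tm | mTmEq tm tm tm

primrec mjsub :: "(nat \<Rightarrow> tm) \<Rightarrow> mjdg \<Rightarrow> mjdg" where
  "mjsub \<sigma> mOk = mOk"
| "mjsub \<sigma> (mTy k A) = mTy k (sub \<sigma> A)"
| "mjsub \<sigma> (mTyEq k A B) = mTyEq k (sub \<sigma> A) (sub \<sigma> B)"
| "mjsub \<sigma> (mTm a A) = mTm (sub \<sigma> a) (sub \<sigma> A)"
| "mjsub \<sigma> (mTmEq a b A) = mTmEq (sub \<sigma> a) (sub \<sigma> b) (sub \<sigma> A)"

datatype mtt_theory = mTT_cind | mTT_cind_AC_CT

inductive subkind :: "kind \<Rightarrow> kind \<Rightarrow> bool" where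
  "subkind PropS SetK"
| "subkind PropS Prop"
| "subkind SetK Col"
| "subkind Prop Col"

abbreviation (input) maxset :: "(tm list \<Rightarrow> mjdg \<Rightarrow> bool) \<Rightarrow> tm list \<Rightarrow> tm \<Rightarrow> tm \<Rightarrow> tm \<Rightarrow> tm \<Rightarrow> bool" where
  "maxset D \<Gamma> A I C V \<equiv>
     D \<Gamma> (mTy SetK A) \<and> D (A # \<Gamma>) (mTy SetK I) \<and>
     D (I # A # \<Gamma>) (mTm C (Pws (sh 2 A))) \<and> D \<Gamma> (mTm V (Pws A))"

text \<open>
  An element of \<open>Props\<close> is the same as a small proposition, and equal elements of \<open>Props\<close> are equal
  small propositions; the converse for equality is not a rule, as it would turn the congruence
  rules for types into congruence rules for terms.
\<close>

inductive mtt :: "mtt_theory \<Rightarrow> tm list \<Rightarrow> mjdg \<Rightarrow> bool" ("_ \<rhd> _ \<Turnstile> _" [51, 51, 51] 50) for T where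
  ok_nil: "T \<rhd> [] \<Turnstile> mOk"
| ok_ext: "T \<rhd> \<Gamma> \<Turnstile> mTy Col A \<Longrightarrow> T \<rhd> A # \<Gamma> \<Turnstile> mOk"
| var: "T \<rhd> \<Gamma> \<Turnstile> mOk \<Longrightarrow> i < length \<Gamma> \<Longrightarrow> T \<rhd> \<Gamma> \<Turnstile> mTm (Var i) (sh (Suc i) (\<Gamma> ! i))"
| ty_sub: "T \<rhd> \<Gamma> \<Turnstile> mTy k A \<Longrightarrow> subkind k l \<Longrightarrow> T \<rhd> \<Gamma> \<Turnstile> mTy l A"
| tyeq_sub: "T \<rhd> \<Gamma> \<Turnstile> mTyEq k A B \<Longrightarrow> subkind k l \<Longrightarrow> T \<rhd> \<Gamma> \<Turnstile> mTyEq l A B"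
| ty_refl: "T \<rhd> \<Gamma> \<Turnstile> mTy k A \<Longrightarrow> T \<rhd> \<Gamma> \<Turnstile> mTyEq k A A"
| ty_sym: "T \<rhd> \<Gamma> \<Turnstile> mTyEq k A B \<Longrightarrow> T \<rhd> \<Gamma> \<Turnstile> mTyEq k B A"
| ty_trans: "T \<rhd> \<Gamma> \<Turnstile> mTyEq k A B \<Longrightarrow> T \<rhd> \<Gamma> \<Turnstile> mTyEq k B C \<Longrightarrow> T \<rhd> \<Gamma> \<Turnstile> mTyEq k A C"
| tm_refl: "T \<rhd> \<Gamma> \<Turnstile> mTm a A \<Longrightarrow> T \<rhd> \<Gamma> \<Turnstile> mTmEq a a A"
| tm_sym: "T \<rhd> \<Gamma> \<Turnstile> mTmEq a b A \<Longrightarrow> T \<rhd> \<Gamma> \<Turnstile> mTmEq b a A"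
| tm_trans: "T \<rhd> \<Gamma> \<Turnstile> mTmEq a b A \<Longrightarrow> T \<rhd> \<Gamma> \<Turnstile> mTmEq b c A \<Longrightarrow> T \<rhd> \<Gamma> \<Turnstile> mTmEq a c A"
| conv: "T \<rhd> \<Gamma> \<Turnstile> mTm a A \<Longrightarrow> T \<rhd> \<Gamma> \<Turnstile> mTyEq Col A B \<Longrightarrow> T \<rhd> \<Gamma> \<Turnstile> mTm a B"
| conv_eq: "T \<rhd> \<Gamma> \<Turnstile> mTmEq a b A \<Longrightarrow> T \<rhd> \<Gamma> \<Turnstile> mTyEq Col A B \<Longrightarrow> T \<rhd> \<Gamma> \<Turnstile> mTmEq a b B"
| subst:
    "T \<rhd> \<Delta> \<Turnstile> J \<Longrightarrow> T \<rhd> \<Gamma> \<Turnstile> mOk \<Longrightarrow>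
     \<forall>i<length \<Delta>. T \<rhd> \<Gamma> \<Turnstile> mTm (\<sigma> i) (sub \<sigma> (sh (Suc i) (\<Delta> ! i))) \<Longrightarrow>
     T \<rhd> \<Gamma> \<Turnstile> mjsub \<sigma> J"
| repl_ty:
    "T \<rhd> \<Delta> \<Turnstile> mTy k C \<Longrightarrow> T \<rhd> \<Gamma> \<Turnstile> mOk \<Longrightarrow>
     \<forall>i<length \<Delta>. T \<rhd> \<Gamma> \<Turnstile> mTmEq (\<sigma> i) (\<tau> i) (sub \<sigma> (sh (Suc i) (\<Delta> ! i))) \<Longrightarrow>
     T \<rhd> \<Gamma> \<Turnstile> mTyEq k (sub \<sigma> C) (sub \<tau> C)"
| repl_tm:
    "T \<rhd> \<Delta> \<Turnstile> mTm c C \<Longrightarrow> T \<rhd> \<Gamma> \<Turnstile> mOk \<Longrightarrow>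
     \<forall>i<length \<Delta>. T \<rhd> \<Gamma> \<Turnstile> mTmEq (\<sigma> i) (\<tau> i) (sub \<sigma> (sh (Suc i) (\<Delta> ! i))) \<Longrightarrow>
     T \<rhd> \<Gamma> \<Turnstile> mTmEq (sub \<sigma> c) (sub \<tau> c) (sub \<sigma> C)"

\<comment> \<open>sets and collections\<close>
| N0_F: "T \<rhd> \<Gamma> \<Turnstile> mOk \<Longrightarrow> T \<rhd> \<Gamma> \<Turnstile> mTy SetK N0"
| N0_E: "T \<rhd> N0 # \<Gamma> \<Turnstile> mTy Col C \<Longrightarrow> T \<rhd> \<Gamma> \<Turnstile> mTm t N0 \<Longrightarrow> T \<rhd> \<Gamma> \<Turnstile> mTm (R0 t) (ins 0 [t] C)"
| N1_F: "T \<rhd> \<Gamma> \<Turnstile> mOk \<Longrightarrow> T \<rhd> \<Gamma> \<Turnstile> mTy SetK N1"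
| N1_I: "T \<rhd> \<Gamma> \<Turnstile> mOk \<Longrightarrow> T \<rhd> \<Gamma> \<Turnstile> mTm Star N1"
| N1_E:
    "T \<rhd> N1 # \<Gamma> \<Turnstile> mTy Col C \<Longrightarrow> T \<rhd> \<Gamma> \<Turnstile> mTm t N1 \<Longrightarrow> T \<rhd> \<Gamma> \<Turnstile> mTm c (ins 0 [Star] C) \<Longrightarrow>
     T \<rhd> \<Gamma> \<Turnstile> mTm (R1 t c) (ins 0 [t] C)"
| N1_C:
    "T \<rhd> N1 # \<Gamma> \<Turnstile> mTy Col C \<Longrightarrow> T \<rhd> \<Gamma> \<Turnstile> mTm c (ins 0 [Star] C) \<Longrightarrow>
     T \<rhd> \<Gamma> \<Turnstile> mTmEq (R1 Star c) c (ins 0 [Star] C)"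
| Nat_F: "T \<rhd> \<Gamma> \<Turnstile> mOk \<Longrightarrow> T \<rhd> \<Gamma> \<Turnstile> mTy SetK NN"
| Nat_I0: "T \<rhd> \<Gamma> \<Turnstile> mOk \<Longrightarrow> T \<rhd> \<Gamma> \<Turnstile> mTm Zero NN"
| Nat_IS: "T \<rhd> \<Gamma> \<Turnstile> mTm t NN \<Longrightarrow> T \<rhd> \<Gamma> \<Turnstile> mTm (Succ t) NN"
| Nat_E:
    "T \<rhd> NN # \<Gamma> \<Turnstile> mTy Col C \<Longrightarrow> T \<rhd> \<Gamma> \<Turnstile> mTm t NN \<Longrightarrow> T \<rhd> \<Gamma> \<Turnstile> mTm c (ins 0 [Zero] C) \<Longrightarrow>
     T \<rhd> C # NN # \<Gamma> \<Turnstile> mTm d (ins 2 [Succ (Var 1)] C) \<Longrightarrow>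
     T \<rhd> \<Gamma> \<Turnstile> mTm (RNat t c d) (ins 0 [t] C)"
| Nat_C0:
    "T \<rhd> NN # \<Gamma> \<Turnstile> mTy Col C \<Longrightarrow> T \<rhd> \<Gamma> \<Turnstile> mTm c (ins 0 [Zero] C) \<Longrightarrow>
     T \<rhd> C # NN # \<Gamma> \<Turnstile> mTm d (ins 2 [Succ (Var 1)] C) \<Longrightarrow>
     T \<rhd> \<Gamma> \<Turnstile> mTmEq (RNat Zero c d) c (ins 0 [Zero] C)"
| Nat_CS:
    "T \<rhd> NN # \<Gamma> \<Turnstile> mTy Col C \<Longrightarrow> T \<rhd> \<Gamma> \<Turnstile> mTm t NN \<Longrightarrow> T \<rhd> \<Gamma> \<Turnstile> mTm c (ins 0 [Zero] C) \<Longrightarrow>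
     T \<rhd> C # NN # \<Gamma> \<Turnstile> mTm d (ins 2 [Succ (Var 1)] C) \<Longrightarrow>
     T \<rhd> \<Gamma> \<Turnstile> mTmEq (RNat (Succ t) c d) (ins 0 [RNat t c d, t] d) (ins 0 [Succ t] C)"
| Lst_F: "T \<rhd> \<Gamma> \<Turnstile> mTy SetK A \<Longrightarrow> T \<rhd> \<Gamma> \<Turnstile> mTy SetK (Lst A)"
| Lst_cong: "T \<rhd> \<Gamma> \<Turnstile> mTyEq SetK A A' \<Longrightarrow> T \<rhd> \<Gamma> \<Turnstile> mTyEq SetK (Lst A) (Lst A')"
| Lst_I0: "T \<rhd> \<Gamma> \<Turnstile> mTy SetK A \<Longrightarrow> T \<rhd> \<Gamma> \<Turnstile> mTm Nl (Lst A)"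
| Lst_I1:
    "T \<rhd> \<Gamma> \<Turnstile> mTy SetK A \<Longrightarrow> T \<rhd> \<Gamma> \<Turnstile> mTm a A \<Longrightarrow> T \<rhd> \<Gamma> \<Turnstile> mTm l (Lst A) \<Longrightarrow>
     T \<rhd> \<Gamma> \<Turnstile> mTm (Cns a l) (Lst A)"
| Lst_E:
    "T \<rhd> Lst A # \<Gamma> \<Turnstile> mTy Col C \<Longrightarrow> T \<rhd> \<Gamma> \<Turnstile> mTm t (Lst A) \<Longrightarrow> T \<rhd> \<Gamma> \<Turnstile> mTm c (ins 0 [Nl] C) \<Longrightarrow>
     T \<rhd> lift 1 1 C # Lst (sh 1 A) # A # \<Gamma> \<Turnstile> mTm d (ins 3 [Cns (Var 2) (Var 1)] C) \<Longrightarrow>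
     T \<rhd> \<Gamma> \<Turnstile> mTm (RLst t c d) (ins 0 [t] C)"
| Lst_C0:
    "T \<rhd> Lst A # \<Gamma> \<Turnstile> mTy Col C \<Longrightarrow> T \<rhd> \<Gamma> \<Turnstile> mTm c (ins 0 [Nl] C) \<Longrightarrow>
     T \<rhd> lift 1 1 C # Lst (sh 1 A) # A # \<Gamma> \<Turnstile> mTm d (ins 3 [Cns (Var 2) (Var 1)] C) \<Longrightarrow>
     T \<rhd> \<Gamma> \<Turnstile> mTmEq (RLst Nl c d) c (ins 0 [Nl] C)"
| Lst_C1:
    "T \<rhd> Lst A # \<Gamma> \<Turnstile> mTy Col C \<Longrightarrow> T \<rhd> \<Gamma> \<Turnstile> mTm a A \<Longrightarrow> T \<rhd> \<Gamma> \<Turnstile> mTm l (Lst A) \<Longrightarrow>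
     T \<rhd> \<Gamma> \<Turnstile> mTm c (ins 0 [Nl] C) \<Longrightarrow>
     T \<rhd> lift 1 1 C # Lst (sh 1 A) # A # \<Gamma> \<Turnstile> mTm d (ins 3 [Cns (Var 2) (Var 1)] C) \<Longrightarrow>
     T \<rhd> \<Gamma> \<Turnstile> mTmEq (RLst (Cns a l) c d) (ins 0 [RLst l c d, l, a] d) (ins 0 [Cns a l] C)"
| Sum_F: "T \<rhd> \<Gamma> \<Turnstile> mTy SetK A \<Longrightarrow> T \<rhd> \<Gamma> \<Turnstile> mTy SetK B \<Longrightarrow> T \<rhd> \<Gamma> \<Turnstile> mTy SetK (Coprod A B)"
| Sum_cong:
    "T \<rhd> \<Gamma> \<Turnstile> mTyEq SetK A A' \<Longrightarrow> T \<rhd> \<Gamma> \<Turnstile> mTyEq SetK B B' \<Longrightarrow>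
     T \<rhd> \<Gamma> \<Turnstile> mTyEq SetK (Coprod A B) (Coprod A' B')"
| Sum_I1:
    "T \<rhd> \<Gamma> \<Turnstile> mTy SetK A \<Longrightarrow> T \<rhd> \<Gamma> \<Turnstile> mTy SetK B \<Longrightarrow> T \<rhd> \<Gamma> \<Turnstile> mTm a A \<Longrightarrow>
     T \<rhd> \<Gamma> \<Turnstile> mTm (InL a) (Coprod A B)"
| Sum_I2:
    "T \<rhd> \<Gamma> \<Turnstile> mTy SetK A \<Longrightarrow> T \<rhd> \<Gamma> \<Turnstile> mTy SetK B \<Longrightarrow> T \<rhd> \<Gamma> \<Turnstile> mTm b B \<Longrightarrow>
     T \<rhd> \<Gamma> \<Turnstile> mTm (InR b) (Coprod A B)"
| Sum_E:
    "T \<rhd> Coprod A B # \<Gamma> \<Turnstile> mTy Col C \<Longrightarrow> T \<rhd> \<Gamma> \<Turnstile> mTm t (Coprod A B) \<Longrightarrow>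
     T \<rhd> A # \<Gamma> \<Turnstile> mTm c (ins 1 [InL (Var 0)] C) \<Longrightarrow>
     T \<rhd> B # \<Gamma> \<Turnstile> mTm d (ins 1 [InR (Var 0)] C) \<Longrightarrow>
     T \<rhd> \<Gamma> \<Turnstile> mTm (When t c d) (ins 0 [t] C)"
| Sum_C1:
    "T \<rhd> Coprod A B # \<Gamma> \<Turnstile> mTy Col C \<Longrightarrow> T \<rhd> \<Gamma> \<Turnstile> mTm a A \<Longrightarrow>
     T \<rhd> A # \<Gamma> \<Turnstile> mTm c (ins 1 [InL (Var 0)] C) \<Longrightarrow>
     T \<rhd> B # \<Gamma> \<Turnstile> mTm d (ins 1 [InR (Var 0)] C) \<Longrightarrow>
     T \<rhd> \<Gamma> \<Turnstile> mTmEq (When (InL a) c d) (ins 0 [a] c) (ins 0 [InL a] C)"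
| Sum_C2:
    "T \<rhd> Coprod A B # \<Gamma> \<Turnstile> mTy Col C \<Longrightarrow> T \<rhd> \<Gamma> \<Turnstile> mTm b B \<Longrightarrow>
     T \<rhd> A # \<Gamma> \<Turnstile> mTm c (ins 1 [InL (Var 0)] C) \<Longrightarrow>
     T \<rhd> B # \<Gamma> \<Turnstile> mTm d (ins 1 [InR (Var 0)] C) \<Longrightarrow>
     T \<rhd> \<Gamma> \<Turnstile> mTmEq (When (InR b) c d) (ins 0 [b] d) (ins 0 [InR b] C)"
| Sig_F:
    "k \<in> {Col, SetK} \<Longrightarrow> T \<rhd> \<Gamma> \<Turnstile> mTy k A \<Longrightarrow> T \<rhd> A # \<Gamma> \<Turnstile> mTy k B \<Longrightarrow> T \<rhd> \<Gamma> \<Turnstile> mTy k (Sig A B)"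
| Sig_cong:
    "k \<in> {Col, SetK} \<Longrightarrow> T \<rhd> \<Gamma> \<Turnstile> mTyEq k A A' \<Longrightarrow> T \<rhd> A # \<Gamma> \<Turnstile> mTyEq k B B' \<Longrightarrow>
     T \<rhd> \<Gamma> \<Turnstile> mTyEq k (Sig A B) (Sig A' B')"
| Sig_I:
    "T \<rhd> A # \<Gamma> \<Turnstile> mTy Col B \<Longrightarrow> T \<rhd> \<Gamma> \<Turnstile> mTm a A \<Longrightarrow> T \<rhd> \<Gamma> \<Turnstile> mTm b (ins 0 [a] B) \<Longrightarrow>
     T \<rhd> \<Gamma> \<Turnstile> mTm (Pr a b) (Sig A B)"
| Sig_E:
    "T \<rhd> Sig A B # \<Gamma> \<Turnstile> mTy Col C \<Longrightarrow> T \<rhd> \<Gamma> \<Turnstile> mTm t (Sig A B) \<Longrightarrow>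
     T \<rhd> B # A # \<Gamma> \<Turnstile> mTm c (ins 2 [Pr (Var 1) (Var 0)] C) \<Longrightarrow>
     T \<rhd> \<Gamma> \<Turnstile> mTm (Split t c) (ins 0 [t] C)"
| Sig_C:
    "T \<rhd> Sig A B # \<Gamma> \<Turnstile> mTy Col C \<Longrightarrow> T \<rhd> \<Gamma> \<Turnstile> mTm a A \<Longrightarrow> T \<rhd> \<Gamma> \<Turnstile> mTm b (ins 0 [a] B) \<Longrightarrow>
     T \<rhd> B # A # \<Gamma> \<Turnstile> mTm c (ins 2 [Pr (Var 1) (Var 0)] C) \<Longrightarrow>
     T \<rhd> \<Gamma> \<Turnstile> mTmEq (Split (Pr a b) c) (ins 0 [b, a] c) (ins 0 [Pr a b] C)"
| Pi_F: "T \<rhd> \<Gamma> \<Turnstile> mTy SetK A \<Longrightarrow> T \<rhd> A # \<Gamma> \<Turnstile> mTy SetK B \<Longrightarrow> T \<rhd> \<Gamma> \<Turnstile> mTy SetK (Pi A B)"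
| Pi_cong:
    "T \<rhd> \<Gamma> \<Turnstile> mTyEq SetK A A' \<Longrightarrow> T \<rhd> A # \<Gamma> \<Turnstile> mTyEq SetK B B' \<Longrightarrow>
     T \<rhd> \<Gamma> \<Turnstile> mTyEq SetK (Pi A B) (Pi A' B')"
| Props_F: "T \<rhd> \<Gamma> \<Turnstile> mOk \<Longrightarrow> T \<rhd> \<Gamma> \<Turnstile> mTy Col Props"
| Props_I: "T \<rhd> \<Gamma> \<Turnstile> mTy PropS A \<Longrightarrow> T \<rhd> \<Gamma> \<Turnstile> mTm A Props"
| Props_E: "T \<rhd> \<Gamma> \<Turnstile> mTm A Props \<Longrightarrow> T \<rhd> \<Gamma> \<Turnstile> mTy PropS A"
| Props_Eq: "T \<rhd> \<Gamma> \<Turnstile> mTmEq A B Props \<Longrightarrow> T \<rhd> \<Gamma> \<Turnstile> mTyEq PropS A B"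
| Pow_F: "T \<rhd> \<Gamma> \<Turnstile> mTy SetK A \<Longrightarrow> T \<rhd> \<Gamma> \<Turnstile> mTy Col (Pws A)"
| Pow_cong: "T \<rhd> \<Gamma> \<Turnstile> mTyEq SetK A A' \<Longrightarrow> T \<rhd> \<Gamma> \<Turnstile> mTyEq Col (Pws A) (Pws A')"
| Pi_I: "T \<rhd> \<Gamma> \<Turnstile> mTy Col (Pi A B) \<Longrightarrow> T \<rhd> A # \<Gamma> \<Turnstile> mTm b B \<Longrightarrow> T \<rhd> \<Gamma> \<Turnstile> mTm (Lam b) (Pi A B)"
| Pi_E: "T \<rhd> \<Gamma> \<Turnstile> mTm f (Pi A B) \<Longrightarrow> T \<rhd> \<Gamma> \<Turnstile> mTm a A \<Longrightarrow> T \<rhd> \<Gamma> \<Turnstile> mTm (App f a) (ins 0 [a] B)"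
| Pi_C:
    "T \<rhd> \<Gamma> \<Turnstile> mTy Col (Pi A B) \<Longrightarrow> T \<rhd> A # \<Gamma> \<Turnstile> mTm b B \<Longrightarrow> T \<rhd> \<Gamma> \<Turnstile> mTm a A \<Longrightarrow>
     T \<rhd> \<Gamma> \<Turnstile> mTmEq (App (Lam b) a) (ins 0 [a] b) (ins 0 [a] B)"

\<comment> \<open>propositions, with eliminations towards propositions that do not depend on proof-terms\<close>
| Bot_F: "T \<rhd> \<Gamma> \<Turnstile> mOk \<Longrightarrow> T \<rhd> \<Gamma> \<Turnstile> mTy PropS Bot"
| Bot_E: "T \<rhd> \<Gamma> \<Turnstile> mTy Prop C \<Longrightarrow> T \<rhd> \<Gamma> \<Turnstile> mTm t Bot \<Longrightarrow> T \<rhd> \<Gamma> \<Turnstile> mTm (R0 t) C"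
| And_F:
    "k \<in> {Prop, PropS} \<Longrightarrow> T \<rhd> \<Gamma> \<Turnstile> mTy k A \<Longrightarrow> T \<rhd> \<Gamma> \<Turnstile> mTy k B \<Longrightarrow> T \<rhd> \<Gamma> \<Turnstile> mTy k (And A B)"
| And_cong:
    "k \<in> {Prop, PropS} \<Longrightarrow> T \<rhd> \<Gamma> \<Turnstile> mTyEq k A A' \<Longrightarrow> T \<rhd> \<Gamma> \<Turnstile> mTyEq k B B' \<Longrightarrow>
     T \<rhd> \<Gamma> \<Turnstile> mTyEq k (And A B) (And A' B')"
| And_I:
    "T \<rhd> \<Gamma> \<Turnstile> mTy Prop (And A B) \<Longrightarrow> T \<rhd> \<Gamma> \<Turnstile> mTm a A \<Longrightarrow> T \<rhd> \<Gamma> \<Turnstile> mTm b B \<Longrightarrow>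
     T \<rhd> \<Gamma> \<Turnstile> mTm (Pr a b) (And A B)"
| And_E:
    "T \<rhd> \<Gamma> \<Turnstile> mTy Prop C \<Longrightarrow> T \<rhd> \<Gamma> \<Turnstile> mTm t (And A B) \<Longrightarrow> T \<rhd> sh 1 B # A # \<Gamma> \<Turnstile> mTm c (sh 2 C) \<Longrightarrow>
     T \<rhd> \<Gamma> \<Turnstile> mTm (Split t c) C"
| And_C:
    "T \<rhd> \<Gamma> \<Turnstile> mTy Prop C \<Longrightarrow> T \<rhd> \<Gamma> \<Turnstile> mTy Prop (And A B) \<Longrightarrow> T \<rhd> \<Gamma> \<Turnstile> mTm a A \<Longrightarrow>
     T \<rhd> \<Gamma> \<Turnstile> mTm b B \<Longrightarrow> T \<rhd> sh 1 B # A # \<Gamma> \<Turnstile> mTm c (sh 2 C) \<Longrightarrow>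
     T \<rhd> \<Gamma> \<Turnstile> mTmEq (Split (Pr a b) c) (ins 0 [b, a] c) C"
| Or_F:
    "k \<in> {Prop, PropS} \<Longrightarrow> T \<rhd> \<Gamma> \<Turnstile> mTy k A \<Longrightarrow> T \<rhd> \<Gamma> \<Turnstile> mTy k B \<Longrightarrow> T \<rhd> \<Gamma> \<Turnstile> mTy k (Or A B)"
| Or_cong:
    "k \<in> {Prop, PropS} \<Longrightarrow> T \<rhd> \<Gamma> \<Turnstile> mTyEq k A A' \<Longrightarrow> T \<rhd> \<Gamma> \<Turnstile> mTyEq k B B' \<Longrightarrow>
     T \<rhd> \<Gamma> \<Turnstile> mTyEq k (Or A B) (Or A' B')"
| Or_I1:
    "T \<rhd> \<Gamma> \<Turnstile> mTy Prop (Or A B) \<Longrightarrow> T \<rhd> \<Gamma> \<Turnstile> mTm a A \<Longrightarrow> T \<rhd> \<Gamma> \<Turnstile> mTm (InL a) (Or A B)"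
| Or_I2:
    "T \<rhd> \<Gamma> \<Turnstile> mTy Prop (Or A B) \<Longrightarrow> T \<rhd> \<Gamma> \<Turnstile> mTm b B \<Longrightarrow> T \<rhd> \<Gamma> \<Turnstile> mTm (InR b) (Or A B)"
| Or_E:
    "T \<rhd> \<Gamma> \<Turnstile> mTy Prop C \<Longrightarrow> T \<rhd> \<Gamma> \<Turnstile> mTm t (Or A B) \<Longrightarrow>
     T \<rhd> A # \<Gamma> \<Turnstile> mTm c (sh 1 C) \<Longrightarrow> T \<rhd> B # \<Gamma> \<Turnstile> mTm d (sh 1 C) \<Longrightarrow>
     T \<rhd> \<Gamma> \<Turnstile> mTm (When t c d) C"
| Or_C1:
    "T \<rhd> \<Gamma> \<Turnstile> mTy Prop C \<Longrightarrow> T \<rhd> \<Gamma> \<Turnstile> mTy Prop (Or A B) \<Longrightarrow> T \<rhd> \<Gamma> \<Turnstile> mTm a A \<Longrightarrow>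
     T \<rhd> A # \<Gamma> \<Turnstile> mTm c (sh 1 C) \<Longrightarrow> T \<rhd> B # \<Gamma> \<Turnstile> mTm d (sh 1 C) \<Longrightarrow>
     T \<rhd> \<Gamma> \<Turnstile> mTmEq (When (InL a) c d) (ins 0 [a] c) C"
| Or_C2:
    "T \<rhd> \<Gamma> \<Turnstile> mTy Prop C \<Longrightarrow> T \<rhd> \<Gamma> \<Turnstile> mTy Prop (Or A B) \<Longrightarrow> T \<rhd> \<Gamma> \<Turnstile> mTm b B \<Longrightarrow>
     T \<rhd> A # \<Gamma> \<Turnstile> mTm c (sh 1 C) \<Longrightarrow> T \<rhd> B # \<Gamma> \<Turnstile> mTm d (sh 1 C) \<Longrightarrow>
     T \<rhd> \<Gamma> \<Turnstile> mTmEq (When (InR b) c d) (ins 0 [b] d) C"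
| Imp_F:
    "k \<in> {Prop, PropS} \<Longrightarrow> T \<rhd> \<Gamma> \<Turnstile> mTy k A \<Longrightarrow> T \<rhd> \<Gamma> \<Turnstile> mTy k B \<Longrightarrow> T \<rhd> \<Gamma> \<Turnstile> mTy k (Imp A B)"
| Imp_cong:
    "k \<in> {Prop, PropS} \<Longrightarrow> T \<rhd> \<Gamma> \<Turnstile> mTyEq k A A' \<Longrightarrow> T \<rhd> \<Gamma> \<Turnstile> mTyEq k B B' \<Longrightarrow>
     T \<rhd> \<Gamma> \<Turnstile> mTyEq k (Imp A B) (Imp A' B')"
| Imp_I:
    "T \<rhd> \<Gamma> \<Turnstile> mTy Prop (Imp A B) \<Longrightarrow> T \<rhd> A # \<Gamma> \<Turnstile> mTm b (sh 1 B) \<Longrightarrow>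
     T \<rhd> \<Gamma> \<Turnstile> mTm (Lam b) (Imp A B)"
| Imp_E: "T \<rhd> \<Gamma> \<Turnstile> mTm f (Imp A B) \<Longrightarrow> T \<rhd> \<Gamma> \<Turnstile> mTm a A \<Longrightarrow> T \<rhd> \<Gamma> \<Turnstile> mTm (App f a) B"
| Imp_C:
    "T \<rhd> \<Gamma> \<Turnstile> mTy Prop (Imp A B) \<Longrightarrow> T \<rhd> A # \<Gamma> \<Turnstile> mTm b (sh 1 B) \<Longrightarrow> T \<rhd> \<Gamma> \<Turnstile> mTm a A \<Longrightarrow>
     T \<rhd> \<Gamma> \<Turnstile> mTmEq (App (Lam b) a) (ins 0 [a] b) B"
| All_F: "T \<rhd> \<Gamma> \<Turnstile> mTy Col A \<Longrightarrow> T \<rhd> A # \<Gamma> \<Turnstile> mTy Prop B \<Longrightarrow> T \<rhd> \<Gamma> \<Turnstile> mTy Prop (Forall A B)"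
| All_FS: "T \<rhd> \<Gamma> \<Turnstile> mTy SetK A \<Longrightarrow> T \<rhd> A # \<Gamma> \<Turnstile> mTy PropS B \<Longrightarrow> T \<rhd> \<Gamma> \<Turnstile> mTy PropS (Forall A B)"
| All_cong:
    "(k, l) \<in> {(Col, Prop), (SetK, PropS)} \<Longrightarrow> T \<rhd> \<Gamma> \<Turnstile> mTyEq k A A' \<Longrightarrow> T \<rhd> A # \<Gamma> \<Turnstile> mTyEq l B B' \<Longrightarrow>
     T \<rhd> \<Gamma> \<Turnstile> mTyEq l (Forall A B) (Forall A' B')"
| All_I: "T \<rhd> A # \<Gamma> \<Turnstile> mTy Prop B \<Longrightarrow> T \<rhd> A # \<Gamma> \<Turnstile> mTm b B \<Longrightarrow> T \<rhd> \<Gamma> \<Turnstile> mTm (Lam b) (Forall A B)"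
| All_E: "T \<rhd> \<Gamma> \<Turnstile> mTm f (Forall A B) \<Longrightarrow> T \<rhd> \<Gamma> \<Turnstile> mTm a A \<Longrightarrow> T \<rhd> \<Gamma> \<Turnstile> mTm (App f a) (ins 0 [a] B)"
| All_C:
    "T \<rhd> A # \<Gamma> \<Turnstile> mTy Prop B \<Longrightarrow> T \<rhd> A # \<Gamma> \<Turnstile> mTm b B \<Longrightarrow> T \<rhd> \<Gamma> \<Turnstile> mTm a A \<Longrightarrow>
     T \<rhd> \<Gamma> \<Turnstile> mTmEq (App (Lam b) a) (ins 0 [a] b) (ins 0 [a] B)"
| Ex_F: "T \<rhd> \<Gamma> \<Turnstile> mTy Col A \<Longrightarrow> T \<rhd> A # \<Gamma> \<Turnstile> mTy Prop B \<Longrightarrow> T \<rhd> \<Gamma> \<Turnstile> mTy Prop (Exis A B)"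
| Ex_FS: "T \<rhd> \<Gamma> \<Turnstile> mTy SetK A \<Longrightarrow> T \<rhd> A # \<Gamma> \<Turnstile> mTy PropS B \<Longrightarrow> T \<rhd> \<Gamma> \<Turnstile> mTy PropS (Exis A B)"
| Ex_cong:
    "(k, l) \<in> {(Col, Prop), (SetK, PropS)} \<Longrightarrow> T \<rhd> \<Gamma> \<Turnstile> mTyEq k A A' \<Longrightarrow> T \<rhd> A # \<Gamma> \<Turnstile> mTyEq l B B' \<Longrightarrow>
     T \<rhd> \<Gamma> \<Turnstile> mTyEq l (Exis A B) (Exis A' B')"
| Ex_I:
    "T \<rhd> A # \<Gamma> \<Turnstile> mTy Prop B \<Longrightarrow> T \<rhd> \<Gamma> \<Turnstile> mTm a A \<Longrightarrow> T \<rhd> \<Gamma> \<Turnstile> mTm b (ins 0 [a] B) \<Longrightarrow>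
     T \<rhd> \<Gamma> \<Turnstile> mTm (Pr a b) (Exis A B)"
| Ex_E:
    "T \<rhd> \<Gamma> \<Turnstile> mTy Prop C \<Longrightarrow> T \<rhd> \<Gamma> \<Turnstile> mTm t (Exis A B) \<Longrightarrow> T \<rhd> B # A # \<Gamma> \<Turnstile> mTm c (sh 2 C) \<Longrightarrow>
     T \<rhd> \<Gamma> \<Turnstile> mTm (Split t c) C"
| Ex_C:
    "T \<rhd> \<Gamma> \<Turnstile> mTy Prop C \<Longrightarrow> T \<rhd> A # \<Gamma> \<Turnstile> mTy Prop B \<Longrightarrow> T \<rhd> \<Gamma> \<Turnstile> mTm a A \<Longrightarrow>
     T \<rhd> \<Gamma> \<Turnstile> mTm b (ins 0 [a] B) \<Longrightarrow> T \<rhd> B # A # \<Gamma> \<Turnstile> mTm c (sh 2 C) \<Longrightarrow>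
     T \<rhd> \<Gamma> \<Turnstile> mTmEq (Split (Pr a b) c) (ins 0 [b, a] c) C"
| Eq_F:
    "(k, l) \<in> {(Col, Prop), (SetK, PropS)} \<Longrightarrow> T \<rhd> \<Gamma> \<Turnstile> mTy k A \<Longrightarrow>
     T \<rhd> \<Gamma> \<Turnstile> mTm a A \<Longrightarrow> T \<rhd> \<Gamma> \<Turnstile> mTm b A \<Longrightarrow> T \<rhd> \<Gamma> \<Turnstile> mTy l (Eq A a b)"
| Eq_cong:
    "(k, l) \<in> {(Col, Prop), (SetK, PropS)} \<Longrightarrow> T \<rhd> \<Gamma> \<Turnstile> mTyEq k A A' \<Longrightarrow>
     T \<rhd> \<Gamma> \<Turnstile> mTmEq a a' A \<Longrightarrow> T \<rhd> \<Gamma> \<Turnstile> mTmEq b b' A \<Longrightarrow> T \<rhd> \<Gamma> \<Turnstile> mTyEq l (Eq A a b) (Eq A' a' b')"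
| Eq_I: "T \<rhd> \<Gamma> \<Turnstile> mTm a A \<Longrightarrow> T \<rhd> \<Gamma> \<Turnstile> mTm (Rfl a) (Eq A a a)"
| Eq_E:
    "T \<rhd> sh 1 A # A # \<Gamma> \<Turnstile> mTy Prop C \<Longrightarrow>
     T \<rhd> \<Gamma> \<Turnstile> mTm a A \<Longrightarrow> T \<rhd> \<Gamma> \<Turnstile> mTm b A \<Longrightarrow> T \<rhd> \<Gamma> \<Turnstile> mTm p (Eq A a b) \<Longrightarrow>
     T \<rhd> A # \<Gamma> \<Turnstile> mTm c (ins 1 [Var 0, Var 0] C) \<Longrightarrow>
     T \<rhd> \<Gamma> \<Turnstile> mTm (IdRec p c) (ins 0 [b, a] C)"
| Eq_C:
    "T \<rhd> sh 1 A # A # \<Gamma> \<Turnstile> mTy Prop C \<Longrightarrow> T \<rhd> \<Gamma> \<Turnstile> mTm a A \<Longrightarrow>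
     T \<rhd> A # \<Gamma> \<Turnstile> mTm c (ins 1 [Var 0, Var 0] C) \<Longrightarrow>
     T \<rhd> \<Gamma> \<Turnstile> mTmEq (IdRec (Rfl a) c) (ins 0 [a] c) (ins 0 [a, a] C)"

\<comment> \<open>inductive covers\<close>
| Cov_F: "maxset (mtt T) \<Gamma> A I C V \<Longrightarrow> T \<rhd> \<Gamma> \<Turnstile> mTm a A \<Longrightarrow> T \<rhd> \<Gamma> \<Turnstile> mTy PropS (Cov A I C V a)"
| Cov_rf:
    "maxset (mtt T) \<Gamma> A I C V \<Longrightarrow> T \<rhd> \<Gamma> \<Turnstile> mTm a A \<Longrightarrow> T \<rhd> \<Gamma> \<Turnstile> mTm r (elt a V) \<Longrightarrow>
     T \<rhd> \<Gamma> \<Turnstile> mTm (Rf a r) (Cov A I C V a)"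
| Cov_tr:
    "maxset (mtt T) \<Gamma> A I C V \<Longrightarrow> T \<rhd> \<Gamma> \<Turnstile> mTm a A \<Longrightarrow> T \<rhd> \<Gamma> \<Turnstile> mTm j (ins 0 [a] I) \<Longrightarrow>
     T \<rhd> \<Gamma> \<Turnstile> mTm r (mCovAll 0 A I C V (ins 0 [j, a] C)) \<Longrightarrow>
     T \<rhd> \<Gamma> \<Turnstile> mTm (Tr a j r) (Cov A I C V a)"
| Cov_E:
    "maxset (mtt T) \<Gamma> A I C V \<Longrightarrow> T \<rhd> \<Gamma> \<Turnstile> mTm a A \<Longrightarrow> T \<rhd> A # \<Gamma> \<Turnstile> mTy Prop P \<Longrightarrow>
     T \<rhd> \<Gamma> \<Turnstile> mTm m (Cov A I C V a) \<Longrightarrow>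
     T \<rhd> elt (Var 0) (sh 1 V) # A # \<Gamma> \<Turnstile> mTm q1 (sh 1 P) \<Longrightarrow>
     T \<rhd> Forall (sh 3 A) (Imp (elt (Var 0) (sh 2 C)) (ins 4 [Var 0] P))
         # mCovAll 2 A I C V C # I # A # \<Gamma> \<Turnstile> mTm q2 (sh 3 P) \<Longrightarrow>
     T \<rhd> \<Gamma> \<Turnstile> mTm (Ind m q1 q2) (ins 0 [a] P)"
| Cov_C1:
    "maxset (mtt T) \<Gamma> A I C V \<Longrightarrow> T \<rhd> \<Gamma> \<Turnstile> mTm a A \<Longrightarrow> T \<rhd> A # \<Gamma> \<Turnstile> mTy Prop P \<Longrightarrow>
     T \<rhd> \<Gamma> \<Turnstile> mTm r (elt a V) \<Longrightarrow>
     T \<rhd> elt (Var 0) (sh 1 V) # A # \<Gamma> \<Turnstile> mTm q1 (sh 1 P) \<Longrightarrow>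
     T \<rhd> Forall (sh 3 A) (Imp (elt (Var 0) (sh 2 C)) (ins 4 [Var 0] P))
         # mCovAll 2 A I C V C # I # A # \<Gamma> \<Turnstile> mTm q2 (sh 3 P) \<Longrightarrow>
     T \<rhd> \<Gamma> \<Turnstile> mTmEq (Ind (Rf a r) q1 q2) (ins 0 [r, a] q1) (ins 0 [a] P)"
| Cov_C2:
    "maxset (mtt T) \<Gamma> A I C V \<Longrightarrow> T \<rhd> \<Gamma> \<Turnstile> mTm a A \<Longrightarrow> T \<rhd> A # \<Gamma> \<Turnstile> mTy Prop P \<Longrightarrow>
     T \<rhd> \<Gamma> \<Turnstile> mTm j (ins 0 [a] I) \<Longrightarrow> T \<rhd> \<Gamma> \<Turnstile> mTm r (mCovAll 0 A I C V (ins 0 [j, a] C)) \<Longrightarrow>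
     T \<rhd> elt (Var 0) (sh 1 V) # A # \<Gamma> \<Turnstile> mTm q1 (sh 1 P) \<Longrightarrow>
     T \<rhd> Forall (sh 3 A) (Imp (elt (Var 0) (sh 2 C)) (ins 4 [Var 0] P))
         # mCovAll 2 A I C V C # I # A # \<Gamma> \<Turnstile> mTm q2 (sh 3 P) \<Longrightarrow>
     T \<rhd> \<Gamma> \<Turnstile> mTmEq (Ind (Tr a j r) q1 q2)
       (ins 0 [Lam (Lam (Ind (App (App (sh 2 r) (Var 1)) (Var 0)) (lift 2 2 q1) (lift 2 4 q2))), r, j, a] q2)
       (ins 0 [a] P)"

\<comment> \<open>positivity relations\<close>
| Pos_F: "maxset (mtt T) \<Gamma> A I C V \<Longrightarrow> T \<rhd> \<Gamma> \<Turnstile> mTm a A \<Longrightarrow> T \<rhd> \<Gamma> \<Turnstile> mTy PropS (Pos A I C V a)"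
| Pos_ax1:
    "maxset (mtt T) \<Gamma> A I C V \<Longrightarrow> T \<rhd> \<Gamma> \<Turnstile> mTm a A \<Longrightarrow> T \<rhd> \<Gamma> \<Turnstile> mTm q (Pos A I C V a) \<Longrightarrow>
     T \<rhd> \<Gamma> \<Turnstile> mTm (Ax1 a q) (elt a V)"
| Pos_ax2:
    "maxset (mtt T) \<Gamma> A I C V \<Longrightarrow> T \<rhd> \<Gamma> \<Turnstile> mTm a A \<Longrightarrow> T \<rhd> \<Gamma> \<Turnstile> mTm j (ins 0 [a] I) \<Longrightarrow>
     T \<rhd> \<Gamma> \<Turnstile> mTm q (Pos A I C V a) \<Longrightarrow>
     T \<rhd> \<Gamma> \<Turnstile> mTm (Ax2 a j q)
       (Exis A (And (elt (Var 0) (sh 1 (ins 0 [j, a] C))) (mPosT 1 A I C V (Var 0))))"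
| Pos_ax3:
    "maxset (mtt T) \<Gamma> A I C V \<Longrightarrow> T \<rhd> \<Gamma> \<Turnstile> mTm a A \<Longrightarrow> T \<rhd> A # \<Gamma> \<Turnstile> mTy Prop P \<Longrightarrow>
     T \<rhd> \<Gamma> \<Turnstile> mTm m (ins 0 [a] P) \<Longrightarrow>
     T \<rhd> P # A # \<Gamma> \<Turnstile> mTm q1 (elt (Var 1) (sh 2 V)) \<Longrightarrow>
     T \<rhd> sh 1 P # I # A # \<Gamma>
       \<Turnstile> mTm q2 (Exis (sh 3 A) (And (ins 4 [Var 0] P) (elt (Var 0) (sh 2 C)))) \<Longrightarrow>
     T \<rhd> \<Gamma> \<Turnstile> mTm (Ax3 a m q1 q2) (Pos A I C V a)"

\<comment> \<open>the axioms; the third premise of \<open>AC_ax\<close> says that the function type is available\<close>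
| AC_ax:
    "T = mTT_cind_AC_CT \<Longrightarrow> T \<rhd> \<Gamma> \<Turnstile> mTy Col A \<Longrightarrow> T \<rhd> A # \<Gamma> \<Turnstile> mTy Col B \<Longrightarrow>
     T \<rhd> \<Gamma> \<Turnstile> mTy Col (Pi A B) \<Longrightarrow> T \<rhd> B # A # \<Gamma> \<Turnstile> mTy Prop R \<Longrightarrow>
     T \<rhd> \<Gamma> \<Turnstile> mTm (Post (mAC A B R)) (mAC A B R)"
| CT_ax: "T = mTT_cind_AC_CT \<Longrightarrow> T \<rhd> \<Gamma> \<Turnstile> mOk \<Longrightarrow> T \<rhd> \<Gamma> \<Turnstile> mTm (Post mCT) mCT"

definition mtt_consistent :: "mtt_theory \<Rightarrow> bool" where
  "mtt_consistent T \<longleftrightarrow> \<not> (\<exists>t. T \<rhd> [] \<Turnstile> mTm t Bot)"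


section \<open>The propositional function \<open>W_max(V)\<close>\<close>

text \<open>
  As \<open>U_{I,C}\<close> we take \<open>U(T(a),(x)T(b))\<close> for the family of all components of the axiom-set, indexed
  by \<open>N\<^sub>1 + (A + (\<Sigma>x\<in>A)(\<Sigma>j\<in>I(x))A)\<close>: the index \<open>inl *\<close> gives \<open>A\<close>, \<open>inr (inl x)\<close> gives \<open>I(x)\<close>, and
  \<open>inr (inr (x,j,y))\<close> gives \<open>y \<epsilon> C(x,j)\<close>.
\<close>

definition UIC_index :: "tm \<Rightarrow> tm \<Rightarrow> tm" where
  "UIC_index s i = cCoprod cN1 (cCoprod s (cSig s (cSig i (sh 2 s))))"

definition UIC_family :: "tm \<Rightarrow> tm \<Rightarrow> tm \<Rightarrow> tm" where
  "UIC_family s i c =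
     When (Var 0) (sh 2 s)
       (When (Var 0) (lift 2 1 i)
         (Split (Var 0) (Split (Var 0) (App (ins 7 [Var 1, Var 3] c) (Var 0)))))"

definition tau :: "tm \<Rightarrow> tm \<Rightarrow> tm \<Rightarrow> tm \<Rightarrow> tm" where
  "tau s i c X = Lam
     (cAnd (App (sh 1 X) (Var 0))
        (cPi i (cSig (sh 2 s) (cAnd (App (sh 1 c) (Var 0)) (App (sh 3 X) (Var 0))))))"

definition incl :: "tm \<Rightarrow> tm \<Rightarrow> tm \<Rightarrow> tm" where
  "incl s X Y = cPi s (cImp (App (sh 1 X) (Var 0)) (App (sh 1 Y) (Var 0)))"

text \<open>\<open>W_max(V)\<close> over \<open>s,i,c,v\<close>; the variable \<open>Z \<in> A \<rightarrow> U_{I,C}\<close> is read as the function \<open>Z' \<in> A \<rightarrow> S\<close>.\<close>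

definition Wmax :: "tm \<Rightarrow> tm \<Rightarrow> tm \<Rightarrow> tm \<Rightarrow> tm" where
  "Wmax s i c v =
     (let a = UIC_index s i; b = UIC_family s i c;
          s' = sh 2 s; i' = lift 2 1 i; c' = lift 2 2 c; v' = sh 2 v;
          Z' = Lam (SubLift (sh 3 a) (lift 3 1 b) (App (Var 1) (Var 0)))
      in Lam (cSig (cImp (sh 1 s) (sh 1 (cSubU a b)))
           (cAnd (App Z' (Var 1)) (cAnd (incl s' Z' (tau s' i' c' Z')) (incl s' Z' v')))))"


section \<open>The interpretations in \<open>MLS_ind\<close>\<close>

text \<open>
  The functions \<open>x1, x2, x3\<close> interpret the terms \<open>ax\<^sub>1, ax\<^sub>2, ax\<^sub>3\<close>.  They operate on raw
  expressions, and are required to commute with substitution as the other term constructors do.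
\<close>

definition stable :: "(tm \<Rightarrow> tm \<Rightarrow> tm) \<Rightarrow> (tm \<Rightarrow> tm \<Rightarrow> tm \<Rightarrow> tm) \<Rightarrow> (tm \<Rightarrow> tm \<Rightarrow> tm \<Rightarrow> tm \<Rightarrow> tm) \<Rightarrow> bool" where
  "stable x1 x2 x3 \<longleftrightarrow>
     (\<forall>\<sigma> a q. sub \<sigma> (x1 a q) = x1 (sub \<sigma> a) (sub \<sigma> q)) \<and>
     (\<forall>\<sigma> a j q. sub \<sigma> (x2 a j q) = x2 (sub \<sigma> a) (sub \<sigma> j) (sub \<sigma> q)) \<and>
     (\<forall>\<sigma> a m q1 q2. sub \<sigma> (x3 a m q1 q2) =
        x3 (sub \<sigma> a) (sub \<sigma> m) (sub (under 2 \<sigma>) q1) (sub (under 3 \<sigma>) q2))"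

text \<open>\<open>MLtt_cind\<close>: \<open>U\<^sub>0\<close> becomes \<open>S\<close>, \<open>a \<ltimes> v\<close> becomes \<open>a \<epsilon> W_max(v)\<close>, all else is unchanged.\<close>

primrec cind_tm ::
  "(tm \<Rightarrow> tm \<Rightarrow> tm) \<Rightarrow> (tm \<Rightarrow> tm \<Rightarrow> tm \<Rightarrow> tm) \<Rightarrow> (tm \<Rightarrow> tm \<Rightarrow> tm \<Rightarrow> tm \<Rightarrow> tm) \<Rightarrow> tm \<Rightarrow> tm" where
  "cind_tm x1 x2 x3 (Var i) = Var i"
| "cind_tm x1 x2 x3 (C0 f) = C0 f"
| "cind_tm x1 x2 x3 (C1 f a) = C1 f (cind_tm x1 x2 x3 a)"
| "cind_tm x1 x2 x3 (C2 f a b) = (if f = oAx1 then x1 (cind_tm x1 x2 x3 a) (cind_tm x1 x2 x3 b) else C2 f (cind_tm x1 x2 x3 a) (cind_tm x1 x2 x3 b))"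
| "cind_tm x1 x2 x3 (C3 f a b c) = (if f = oAx2 then x2 (cind_tm x1 x2 x3 a) (cind_tm x1 x2 x3 b) (cind_tm x1 x2 x3 c) else C3 f (cind_tm x1 x2 x3 a) (cind_tm x1 x2 x3 b) (cind_tm x1 x2 x3 c))"
| "cind_tm x1 x2 x3 (CB f a b) = CB f (cind_tm x1 x2 x3 a) (cind_tm x1 x2 x3 b)"
| "cind_tm x1 x2 x3 (Lam a) = Lam (cind_tm x1 x2 x3 a)"
| "cind_tm x1 x2 x3 (Split a b) = Split (cind_tm x1 x2 x3 a) (cind_tm x1 x2 x3 b)"
| "cind_tm x1 x2 x3 (When a b c) = When (cind_tm x1 x2 x3 a) (cind_tm x1 x2 x3 b) (cind_tm x1 x2 x3 c)"
| "cind_tm x1 x2 x3 (RNat a b c) = RNat (cind_tm x1 x2 x3 a) (cind_tm x1 x2 x3 b) (cind_tm x1 x2 x3 c)"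
| "cind_tm x1 x2 x3 (RLst a b c) = RLst (cind_tm x1 x2 x3 a) (cind_tm x1 x2 x3 b) (cind_tm x1 x2 x3 c)"
| "cind_tm x1 x2 x3 (SubDec a b c) = SubDec (cind_tm x1 x2 x3 a) (cind_tm x1 x2 x3 b) (cind_tm x1 x2 x3 c)"
| "cind_tm x1 x2 x3 (SubLift a b c) = SubLift (cind_tm x1 x2 x3 a) (cind_tm x1 x2 x3 b) (cind_tm x1 x2 x3 c)"
| "cind_tm x1 x2 x3 (Cov a b c d e) = Cov (cind_tm x1 x2 x3 a) (cind_tm x1 x2 x3 b) (cind_tm x1 x2 x3 c) (cind_tm x1 x2 x3 d) (cind_tm x1 x2 x3 e)"
| "cind_tm x1 x2 x3 (Pos a b c d e) = App (Wmax (cind_tm x1 x2 x3 a) (cind_tm x1 x2 x3 b) (cind_tm x1 x2 x3 c) (cind_tm x1 x2 x3 d)) (cind_tm x1 x2 x3 e)"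
| "cind_tm x1 x2 x3 (Ind a b c) = Ind (cind_tm x1 x2 x3 a) (cind_tm x1 x2 x3 b) (cind_tm x1 x2 x3 c)"
| "cind_tm x1 x2 x3 (Ax3 a b c d) = x3 (cind_tm x1 x2 x3 a) (cind_tm x1 x2 x3 b) (cind_tm x1 x2 x3 c) (cind_tm x1 x2 x3 d)"

primrec cind_jdg ::
  "(tm \<Rightarrow> tm \<Rightarrow> tm) \<Rightarrow> (tm \<Rightarrow> tm \<Rightarrow> tm \<Rightarrow> tm) \<Rightarrow> (tm \<Rightarrow> tm \<Rightarrow> tm \<Rightarrow> tm \<Rightarrow> tm) \<Rightarrow> jdg \<Rightarrow> jdg" where
  "cind_jdg x1 x2 x3 Ok = Ok"
| "cind_jdg x1 x2 x3 (Ty A) = Ty (cind_tm x1 x2 x3 A)"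
| "cind_jdg x1 x2 x3 (TyEq A B) = TyEq (cind_tm x1 x2 x3 A) (cind_tm x1 x2 x3 B)"
| "cind_jdg x1 x2 x3 (Tm a A) = Tm (cind_tm x1 x2 x3 a) (cind_tm x1 x2 x3 A)"
| "cind_jdg x1 x2 x3 (TmEq a b A) = TmEq (cind_tm x1 x2 x3 a) (cind_tm x1 x2 x3 b) (cind_tm x1 x2 x3 A)"

text \<open>
  \<open>mTT_cind\<close>: \<open>mtt_tm\<close> interprets terms, sending small propositions (and sets) to their codes in \<open>S\<close>,
  and \<open>mtt_ty\<close> interprets types.  A term regarded as a small proposition is interpreted
  by decoding.  The value of \<open>mtt_tm\<close> at the collection \<open>Props\<close>, which has no code, is irrelevant.
\<close>

primrec mtt_tm ::
  "(tm \<Rightarrow> tm \<Rightarrow> tm) \<Rightarrow> (tm \<Rightarrow> tm \<Rightarrow> tm \<Rightarrow> tm) \<Rightarrow> (tm \<Rightarrow> tm \<Rightarrow> tm \<Rightarrow> tm \<Rightarrow> tm) \<Rightarrow> tm \<Rightarrow> tm" where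
  "mtt_tm x1 x2 x3 (Var i) = Var i"
| "mtt_tm x1 x2 x3 (C0 f) = (case f of
      oN0 \<Rightarrow> cN0
    | oN1 \<Rightarrow> cN1
    | oNN \<Rightarrow> cNN
    | oBot \<Rightarrow> cN0
    | _ \<Rightarrow> C0 f)"
| "mtt_tm x1 x2 x3 (C1 f a) = (case f of
      oLst \<Rightarrow> cLst (mtt_tm x1 x2 x3 a)
    | _ \<Rightarrow> C1 f (mtt_tm x1 x2 x3 a))"
| "mtt_tm x1 x2 x3 (C2 f a b) = (case f of
      oCoprod \<Rightarrow> cCoprod (mtt_tm x1 x2 x3 a) (mtt_tm x1 x2 x3 b)
    | oAnd \<Rightarrow> cAnd (mtt_tm x1 x2 x3 a) (mtt_tm x1 x2 x3 b)
    | oOr \<Rightarrow> cCoprod (mtt_tm x1 x2 x3 a) (mtt_tm x1 x2 x3 b)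
    | oImp \<Rightarrow> cImp (mtt_tm x1 x2 x3 a) (mtt_tm x1 x2 x3 b)
    | oAx1 \<Rightarrow> x1 (mtt_tm x1 x2 x3 a) (mtt_tm x1 x2 x3 b)
    | _ \<Rightarrow> C2 f (mtt_tm x1 x2 x3 a) (mtt_tm x1 x2 x3 b))"
| "mtt_tm x1 x2 x3 (C3 f a b c) = (case f of
      oEq \<Rightarrow> cEq (mtt_tm x1 x2 x3 a) (mtt_tm x1 x2 x3 b) (mtt_tm x1 x2 x3 c)
    | oAx2 \<Rightarrow> x2 (mtt_tm x1 x2 x3 a) (mtt_tm x1 x2 x3 b) (mtt_tm x1 x2 x3 c)
    | _ \<Rightarrow> C3 f (mtt_tm x1 x2 x3 a) (mtt_tm x1 x2 x3 b) (mtt_tm x1 x2 x3 c))"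
| "mtt_tm x1 x2 x3 (CB f a b) = (case f of
      oSig \<Rightarrow> cSig (mtt_tm x1 x2 x3 a) (mtt_tm x1 x2 x3 b)
    | oPi \<Rightarrow> cPi (mtt_tm x1 x2 x3 a) (mtt_tm x1 x2 x3 b)
    | oForall \<Rightarrow> cPi (mtt_tm x1 x2 x3 a) (mtt_tm x1 x2 x3 b)
    | oExis \<Rightarrow> cSig (mtt_tm x1 x2 x3 a) (mtt_tm x1 x2 x3 b)
    | _ \<Rightarrow> CB f (mtt_tm x1 x2 x3 a) (mtt_tm x1 x2 x3 b))"
| "mtt_tm x1 x2 x3 (Lam a) = Lam (mtt_tm x1 x2 x3 a)"
| "mtt_tm x1 x2 x3 (Split a b) = Split (mtt_tm x1 x2 x3 a) (mtt_tm x1 x2 x3 b)"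
| "mtt_tm x1 x2 x3 (When a b c) = When (mtt_tm x1 x2 x3 a) (mtt_tm x1 x2 x3 b) (mtt_tm x1 x2 x3 c)"
| "mtt_tm x1 x2 x3 (RNat a b c) = RNat (mtt_tm x1 x2 x3 a) (mtt_tm x1 x2 x3 b) (mtt_tm x1 x2 x3 c)"
| "mtt_tm x1 x2 x3 (RLst a b c) = RLst (mtt_tm x1 x2 x3 a) (mtt_tm x1 x2 x3 b) (mtt_tm x1 x2 x3 c)"
| "mtt_tm x1 x2 x3 (SubDec a b c) = SubDec (mtt_tm x1 x2 x3 a) (mtt_tm x1 x2 x3 b) (mtt_tm x1 x2 x3 c)"
| "mtt_tm x1 x2 x3 (SubLift a b c) = SubLift (mtt_tm x1 x2 x3 a) (mtt_tm x1 x2 x3 b) (mtt_tm x1 x2 x3 c)"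
| "mtt_tm x1 x2 x3 (Cov a b c d e) = Cov (mtt_tm x1 x2 x3 a) (mtt_tm x1 x2 x3 b) (mtt_tm x1 x2 x3 c) (mtt_tm x1 x2 x3 d) (mtt_tm x1 x2 x3 e)"
| "mtt_tm x1 x2 x3 (Pos a b c d e) = App (Wmax (mtt_tm x1 x2 x3 a) (mtt_tm x1 x2 x3 b) (mtt_tm x1 x2 x3 c) (mtt_tm x1 x2 x3 d)) (mtt_tm x1 x2 x3 e)"
| "mtt_tm x1 x2 x3 (Ind a b c) = Ind (mtt_tm x1 x2 x3 a) (mtt_tm x1 x2 x3 b) (mtt_tm x1 x2 x3 c)"
| "mtt_tm x1 x2 x3 (Ax3 a b c d) = x3 (mtt_tm x1 x2 x3 a) (mtt_tm x1 x2 x3 b) (mtt_tm x1 x2 x3 c) (mtt_tm x1 x2 x3 d)"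

primrec mtt_ty ::
  "(tm \<Rightarrow> tm \<Rightarrow> tm) \<Rightarrow> (tm \<Rightarrow> tm \<Rightarrow> tm \<Rightarrow> tm) \<Rightarrow> (tm \<Rightarrow> tm \<Rightarrow> tm \<Rightarrow> tm \<Rightarrow> tm) \<Rightarrow> tm \<Rightarrow> tm" where
  "mtt_ty x1 x2 x3 (Var i) = Dec (Var i)"
| "mtt_ty x1 x2 x3 (C0 f) = (case f of
      oN0 \<Rightarrow> N0
    | oN1 \<Rightarrow> N1
    | oNN \<Rightarrow> NN
    | oBot \<Rightarrow> N0
    | oProps \<Rightarrow> Univ
    | _ \<Rightarrow> Dec (mtt_tm x1 x2 x3 (C0 f)))"
| "mtt_ty x1 x2 x3 (C1 f a) = (case f of
      oLst \<Rightarrow> Lst (mtt_ty x1 x2 x3 a)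
    | _ \<Rightarrow> Dec (mtt_tm x1 x2 x3 (C1 f a)))"
| "mtt_ty x1 x2 x3 (C2 f a b) = (case f of
      oCoprod \<Rightarrow> Coprod (mtt_ty x1 x2 x3 a) (mtt_ty x1 x2 x3 b)
    | oAnd \<Rightarrow> prod (mtt_ty x1 x2 x3 a) (mtt_ty x1 x2 x3 b)
    | oOr \<Rightarrow> Coprod (mtt_ty x1 x2 x3 a) (mtt_ty x1 x2 x3 b)
    | oImp \<Rightarrow> arr (mtt_ty x1 x2 x3 a) (mtt_ty x1 x2 x3 b)
    | _ \<Rightarrow> Dec (mtt_tm x1 x2 x3 (C2 f a b)))"
| "mtt_ty x1 x2 x3 (C3 f a b c) = (case f of
      oEq \<Rightarrow> Eq (mtt_ty x1 x2 x3 a) (mtt_tm x1 x2 x3 b) (mtt_tm x1 x2 x3 c)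
    | _ \<Rightarrow> Dec (mtt_tm x1 x2 x3 (C3 f a b c)))"
| "mtt_ty x1 x2 x3 (CB f a b) = (case f of
      oSig \<Rightarrow> Sig (mtt_ty x1 x2 x3 a) (mtt_ty x1 x2 x3 b)
    | oPi \<Rightarrow> Pi (mtt_ty x1 x2 x3 a) (mtt_ty x1 x2 x3 b)
    | oForall \<Rightarrow> Pi (mtt_ty x1 x2 x3 a) (mtt_ty x1 x2 x3 b)
    | oExis \<Rightarrow> Sig (mtt_ty x1 x2 x3 a) (mtt_ty x1 x2 x3 b)
    | _ \<Rightarrow> Dec (mtt_tm x1 x2 x3 (CB f a b)))"
| "mtt_ty x1 x2 x3 (Lam a) = Dec (mtt_tm x1 x2 x3 (Lam a))"
| "mtt_ty x1 x2 x3 (Split a b) = Dec (mtt_tm x1 x2 x3 (Split a b))"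
| "mtt_ty x1 x2 x3 (When a b c) = Dec (mtt_tm x1 x2 x3 (When a b c))"
| "mtt_ty x1 x2 x3 (RNat a b c) = Dec (mtt_tm x1 x2 x3 (RNat a b c))"
| "mtt_ty x1 x2 x3 (RLst a b c) = Dec (mtt_tm x1 x2 x3 (RLst a b c))"
| "mtt_ty x1 x2 x3 (SubDec a b c) = Dec (mtt_tm x1 x2 x3 (SubDec a b c))"
| "mtt_ty x1 x2 x3 (SubLift a b c) = Dec (mtt_tm x1 x2 x3 (SubLift a b c))"
| "mtt_ty x1 x2 x3 (Cov a b c d e) = Dec (mtt_tm x1 x2 x3 (Cov a b c d e))"
| "mtt_ty x1 x2 x3 (Pos a b c d e) = Dec (mtt_tm x1 x2 x3 (Pos a b c d e))"
| "mtt_ty x1 x2 x3 (Ind a b c) = Dec (mtt_tm x1 x2 x3 (Ind a b c))"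
| "mtt_ty x1 x2 x3 (Ax3 a b c d) = Dec (mtt_tm x1 x2 x3 (Ax3 a b c d))"

primrec mtt_jdg ::
  "(tm \<Rightarrow> tm \<Rightarrow> tm) \<Rightarrow> (tm \<Rightarrow> tm \<Rightarrow> tm \<Rightarrow> tm) \<Rightarrow> (tm \<Rightarrow> tm \<Rightarrow> tm \<Rightarrow> tm \<Rightarrow> tm) \<Rightarrow> mjdg \<Rightarrow> jdg set" where
  "mtt_jdg x1 x2 x3 mOk = {Ok}"
| "mtt_jdg x1 x2 x3 (mTy k A) = {Ty (mtt_ty x1 x2 x3 A)} \<union>
     (if k \<in> {SetK, PropS}
      then {Tm (mtt_tm x1 x2 x3 A) Univ, TyEq (Dec (mtt_tm x1 x2 x3 A)) (mtt_ty x1 x2 x3 A)} else {})"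
| "mtt_jdg x1 x2 x3 (mTyEq k A B) = {TyEq (mtt_ty x1 x2 x3 A) (mtt_ty x1 x2 x3 B)}"
| "mtt_jdg x1 x2 x3 (mTm a A) = {Tm (mtt_tm x1 x2 x3 a) (mtt_ty x1 x2 x3 A)}"
| "mtt_jdg x1 x2 x3 (mTmEq a b A) = {TmEq (mtt_tm x1 x2 x3 a) (mtt_tm x1 x2 x3 b) (mtt_ty x1 x2 x3 A)}"

definition interprets_MLtt_cind ::
  "(tm \<Rightarrow> tm \<Rightarrow> tm) \<Rightarrow> (tm \<Rightarrow> tm \<Rightarrow> tm \<Rightarrow> tm) \<Rightarrow> (tm \<Rightarrow> tm \<Rightarrow> tm \<Rightarrow> tm \<Rightarrow> tm) \<Rightarrow> bool" where
  "interprets_MLtt_cind x1 x2 x3 \<longleftrightarrow> stable x1 x2 x3 \<and>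
     (\<forall>\<Gamma> J. MLtt_cind \<rhd> \<Gamma> \<turnstile> J \<longrightarrow> MLS_ind \<rhd> map (cind_tm x1 x2 x3) \<Gamma> \<turnstile> cind_jdg x1 x2 x3 J)"

definition interprets_mTT_cind ::
  "(tm \<Rightarrow> tm \<Rightarrow> tm) \<Rightarrow> (tm \<Rightarrow> tm \<Rightarrow> tm \<Rightarrow> tm) \<Rightarrow> (tm \<Rightarrow> tm \<Rightarrow> tm \<Rightarrow> tm \<Rightarrow> tm) \<Rightarrow> bool" where
  "interprets_mTT_cind x1 x2 x3 \<longleftrightarrow> stable x1 x2 x3 \<and>
     (\<forall>\<Gamma> J. mTT_cind \<rhd> \<Gamma> \<Turnstile> J \<longrightarrow>
        (\<forall>K\<in>mtt_jdg x1 x2 x3 J. MLS_ind \<rhd> map (mtt_ty x1 x2 x3) \<Gamma> \<turnstile> K))"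

end

theory Submission
  imports Defs
begin

text \<open>
  In both interpretations, every rule of the source theory becomes a derivable rule of the target.

  For \<open>MLtt_cind\<close>, the translation commutes with substitution, and only \<open>ax3\<close> needs an idea: \<open>P\<close> may be
  large, but \<open>W_max\<close> quantifies over functions into \<open>U_{I,C}\<close> only.  As \<open>q2\<close> chooses the next state
  after each move, every state reached from the first one is determined by a finite sequence of moves.
  Such sequences form a type with code in \<open>U_{I,C}\<close>, so the set of the points reached can serve as \<open>Z\<close>.

  For \<open>mTT_cind\<close>, small propositions are both types and terms.  A set and the decoding of its code
  are interpreted by judgmentally equal, but in general different, types; hence the interpretation of
  types commutes with substitution only up to judgmental equality.  Under propositions-as-types, \<open>AC\<close>
  is derivable, \<open>CT\<close> becomes \<open>CT\<close> and \<open>\<bottom>\<close> becomes \<open>N\<^sub>0\<close>, which gives relative consistency.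
\<close>

section \<open>Substitution\<close>

text \<open>The data for ax3 depend on each other: a move after a sequence is an element of
  \<open>I(x)\<close> for the point \<open>x\<close> that the sequence reaches. This looks like
  induction-recursion. It is replaced by recursion on the length, with values that are pairs of a
  code and a function from its decoding to states. These values are large, because states mention
  \<open>P\<close>; but in the code of \<open>Z\<close> the states occur only inside the terms of an
  identity type over \<open>A\<close>, and a subterm may come from a large type. So
  \<open>U_{I,C}\<close> has to provide only \<open>A\<close>, the sets \<open>I(x)\<close> and
  first-order constructors.

  The second obstacle is the lack of congruence under binders in terms. A code cannot be rewritten
  under a binder, so codes are compared through their decodings, where types do have congruence. In
  \<open>mTT_cind\<close> this matters for substitution: a variable for a small proposition is
  interpreted by its decoding, and when a conjunction is put for it, the decoding of a code meets a
  product. To identify the two, one must know that the components of a derivable code are codes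
  again; the generation lemmas serve this purpose.\<close>

lemma trav_trav: "trav h k (trav g k t) = trav (\<lambda>k i. trav h k (g k i)) k t"
  by (induction t arbitrary: k) simp_all

text \<open>Both \<open>lift\<close> and \<open>sub\<close> are traversals, so the fusion of
  traversals and this congruence reduce their laws to computations on variables. The starting depths
  may differ because \<open>trav_under\<close> compares a traversal that starts below
  \<open>n\<close> binders with one that starts at 0 with \<open>under n \<sigma>\<close>.\<close>

lemma trav_cong: "(\<And>k i. g (k + a) i = h (k + b) i) \<Longrightarrow> trav g a t = trav h b t"
proof (induction t arbitrary: a b)
  case (Var x)
  then show ?case using Var[of 0 x] by simp
next
  case C: (CB x1 t1 t2)
  have "g (k + (a + 1)) i = h (k + (b + 1)) i" for k i using C(3)[of "k+1" i] by simp
  then show ?case using C by simp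
next
  case C: (Lam t)
  have "g (k + (a + 1)) i = h (k + (b + 1)) i" for k i using C(2)[of "k+1" i] by simp
  then show ?case using C by simp
next
  case C: (Split t1 t2)
  have "g (k + (a + 2)) i = h (k + (b + 2)) i" for k i using C(3)[of "k+2" i] by simp
  then show ?case using C by simp
next
  case C: (When t1 t2 t3)
  have "g (k + (a + 1)) i = h (k + (b + 1)) i" for k i using C(4)[of "k+1" i] by simp
  then show ?case using C by simp
next
  case C: (RNat t1 t2 t3)
  have "g (k + (a + 2)) i = h (k + (b + 2)) i" for k i using C(4)[of "k+2" i] by simp
  then show ?case using C by simp
next
  case C: (RLst t1 t2 t3)
  have "g (k + (a + 3)) i = h (k + (b + 3)) i" for k i using C(4)[of "k+3" i] by (simp add: ac_simps)
  then show ?case using C by simp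
next
  case C: (SubDec t1 t2 t3)
  have "g (k + (a + 1)) i = h (k + (b + 1)) i" for k i using C(4)[of "k+1" i] by simp
  then show ?case using C by simp
next
  case C: (SubLift t1 t2 t3)
  have "g (k + (a + 1)) i = h (k + (b + 1)) i" for k i using C(4)[of "k+1" i] by simp
  then show ?case using C by simp
next
  case C: (Cov t1 t2 t3 t4 t5)
  have "g (k + (a + 1)) i = h (k + (b + 1)) i" "g (k + (a + 2)) i = h (k + (b + 2)) i" for k i
    using C(6)[of "k+1" i] C(6)[of "k+2" i] by simp_all
  then show ?case using C by simp
next
  case C: (Pos t1 t2 t3 t4 t5)
  have "g (k + (a + 1)) i = h (k + (b + 1)) i" "g (k + (a + 2)) i = h (k + (b + 2)) i" for k i
    using C(6)[of "k+1" i] C(6)[of "k+2" i] by simp_all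
  then show ?case using C by simp
next
  case C: (Ind t1 t2 t3)
  have "g (k + (a + 2)) i = h (k + (b + 2)) i" "g (k + (a + 4)) i = h (k + (b + 4)) i" for k i
    using C(4)[of "k+2" i] C(4)[of "k+4" i] by (simp_all add: ac_simps)
  then show ?case using C by simp
next
  case C: (Ax3 t1 t2 t3 t4)
  have "g (k + (a + 2)) i = h (k + (b + 2)) i" "g (k + (a + 3)) i = h (k + (b + 3)) i" for k i
    using C(5)[of "k+2" i] C(5)[of "k+3" i] by (simp_all add: ac_simps)
  then show ?case using C by simp
qed simp_all

lemma trav_Var [simp]: "trav (\<lambda>k. Var) k t = t"
  by (induction t arbitrary: k) simp_all

lemma sh_0 [simp]: "sh 0 t = t"
proof -
  have "(\<lambda>k i. Var (if i < k then i else i + 0)) = (\<lambda>k. Var)" by (simp add: fun_eq_iff)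
  then show ?thesis unfolding lift_def by (simp only: trav_Var)
qed

lemma lift_Var: "lift n k (Var i) = Var (if i < k then i else i + n)"
  by (simp add: lift_def)

lemma lift_lift: "lift m k (lift n k t) = lift (m + n) k t"
  unfolding lift_def trav_trav by (rule trav_cong) simp

lemma lift_sh: "lift n k (sh k t) = sh (k + n) t"
proof -
  have "lift n k (sh k t) = trav (\<lambda>j i. Var (if i < j + k then i else i + n)) 0 (sh k t)"
    unfolding lift_def[of n] by (rule trav_cong) simp
  also have "\<dots> = sh (k + n) t"
    unfolding lift_def trav_trav by (rule trav_cong) auto
  finally show ?thesis .
qed

lemma under_under: "under k (under n \<sigma>) = under (k + n) \<sigma>"
  by (auto simp: under_def lift_Var lift_lift fun_eq_iff)

lemma under_0 [simp]: "under 0 \<sigma> = \<sigma>"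
  by (simp add: under_def fun_eq_iff)

lemma trav_under: "trav (\<lambda>k. under k \<sigma>) n t = sub (under n \<sigma>) t"
  unfolding sub_def by (rule trav_cong) (simp add: under_under)

lemma sub_simps [simp]:
  "sub \<sigma> (Var i) = \<sigma> i"
  "sub \<sigma> (C0 f) = C0 f"
  "sub \<sigma> (C1 f1 a) = C1 f1 (sub \<sigma> a)"
  "sub \<sigma> (C2 g a b) = C2 g (sub \<sigma> a) (sub \<sigma> b)"
  "sub \<sigma> (C3 h a b c) = C3 h (sub \<sigma> a) (sub \<sigma> b) (sub \<sigma> c)"
  "sub \<sigma> (CB k a b) = CB k (sub \<sigma> a) (sub (under 1 \<sigma>) b)"
  "sub \<sigma> (Lam a) = Lam (sub (under 1 \<sigma>) a)"
  "sub \<sigma> (Split a b) = Split (sub \<sigma> a) (sub (under 2 \<sigma>) b)"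
  "sub \<sigma> (When a b c) = When (sub \<sigma> a) (sub (under 1 \<sigma>) b) (sub (under 1 \<sigma>) c)"
  "sub \<sigma> (RNat a b c) = RNat (sub \<sigma> a) (sub \<sigma> b) (sub (under 2 \<sigma>) c)"
  "sub \<sigma> (RLst a b c) = RLst (sub \<sigma> a) (sub \<sigma> b) (sub (under 3 \<sigma>) c)"
  "sub \<sigma> (SubDec a b c) = SubDec (sub \<sigma> a) (sub (under 1 \<sigma>) b) (sub \<sigma> c)"
  "sub \<sigma> (SubLift a b c) = SubLift (sub \<sigma> a) (sub (under 1 \<sigma>) b) (sub \<sigma> c)"
  "sub \<sigma> (Cov a b c d e) =
     Cov (sub \<sigma> a) (sub (under 1 \<sigma>) b) (sub (under 2 \<sigma>) c) (sub \<sigma> d) (sub \<sigma> e)"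
  "sub \<sigma> (Pos a b c d e) =
     Pos (sub \<sigma> a) (sub (under 1 \<sigma>) b) (sub (under 2 \<sigma>) c) (sub \<sigma> d) (sub \<sigma> e)"
  "sub \<sigma> (Ind a b c) = Ind (sub \<sigma> a) (sub (under 2 \<sigma>) b) (sub (under 4 \<sigma>) c)"
  "sub \<sigma> (Ax3 a b c d) = Ax3 (sub \<sigma> a) (sub \<sigma> b) (sub (under 2 \<sigma>) c) (sub (under 3 \<sigma>) d)"
  unfolding sub_def[of \<sigma>]
  by (simp_all add: trav_under[of \<sigma> "Suc n" for n] trav_under[of \<sigma> "numeral n" for n] numeral_2_eq_2)

lemma lift_sub: "lift n k = sub (\<lambda>i. Var (if i < k then i else i + n))"
  unfolding lift_def sub_def by (intro ext trav_cong) (auto simp: under_def lift_Var)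

lemma sub_sh: "sub (under n \<sigma>) (sh n t) = sh n (sub \<sigma> t)"
  unfolding lift_def[of n] sub_def trav_trav
  by (rule trav_cong) (auto simp: under_under, auto simp: under_def lift_def[symmetric] lift_sh lift_Var add.commute)

lemma under_comp: "sub (under k \<sigma>) (under k \<tau> i) = under k (\<lambda>i. sub \<sigma> (\<tau> i)) i"
  by (cases "i < k") (simp_all add: under_def[of k \<tau>] under_def[of k "\<lambda>i. sub \<sigma> (\<tau> i)"] sub_sh, simp add: under_def)

lemma sub_sub: "sub \<sigma> (sub \<tau> t) = sub (\<lambda>i. sub \<sigma> (\<tau> i)) t"
  unfolding sub_def trav_trav
  by (rule trav_cong) (simp add: trav_under under_comp sub_def[symmetric])

lemma sub_Var [simp]: "sub Var t = t"
proof -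
  have "(\<lambda>k. under k Var) = (\<lambda>k. Var)" by (simp add: under_def fun_eq_iff lift_Var)
  then show ?thesis by (simp add: sub_def)
qed

text \<open>
  Substitutions are brought to a normal form built from \<open>scons\<close> (extension of a substitution by
  an expression for the variable 0), \<open>up\<close> and \<open>\<odot>\<close>; numerals are expanded into successors.
\<close>

definition scons :: "tm \<Rightarrow> (nat \<Rightarrow> tm) \<Rightarrow> nat \<Rightarrow> tm" (infixr ";;" 61) where
  "(t ;; \<sigma>) i = (case i of 0 \<Rightarrow> t | Suc j \<Rightarrow> \<sigma> j)"

definition up :: "nat \<Rightarrow> nat \<Rightarrow> tm" where
  "up n i = Var (i + n)"

definition scomp :: "(nat \<Rightarrow> tm) \<Rightarrow> (nat \<Rightarrow> tm) \<Rightarrow> nat \<Rightarrow> tm" (infixr "\<odot>" 65) where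
  "(\<sigma> \<odot> \<tau>) i = sub \<sigma> (\<tau> i)"

lemma up_0: "up 0 = Var"
  by (simp add: up_def fun_eq_iff)

lemma scomp_up_0: "\<sigma> \<odot> Var = \<sigma>" "Var \<odot> \<sigma> = \<sigma>"
  by (simp_all add: scomp_def fun_eq_iff)

lemma scons_app: "(t ;; \<sigma>) 0 = t" "(t ;; \<sigma>) (Suc i) = \<sigma> i"
  by (simp_all add: scons_def)

lemma scomp_scons: "\<sigma> \<odot> (t ;; \<tau>) = sub \<sigma> t ;; (\<sigma> \<odot> \<tau>)"
  by (simp add: scomp_def scons_def fun_eq_iff split: nat.split)

lemma sub_scomp: "sub \<sigma> (sub \<tau> t) = sub (\<sigma> \<odot> \<tau>) t"
  unfolding sub_sub by (simp add: scomp_def[abs_def])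

lemma scomp_assoc: "(\<sigma> \<odot> \<tau>) \<odot> \<rho> = \<sigma> \<odot> \<tau> \<odot> \<rho>"
  by (simp add: scomp_def[of _ _] fun_eq_iff sub_sub scomp_def[abs_def])

lemma scons_up: "(t ;; \<sigma>) \<odot> up (Suc n) = \<sigma> \<odot> up n"
  by (simp add: fun_eq_iff scomp_def scons_def up_def)

lemma up_up: "up m \<odot> up n = up (n + m)"
  by (simp add: fun_eq_iff scomp_def up_def)

lemma scons_eta: "Var n ;; up (Suc n) = up n" "\<sigma> 0 ;; (\<sigma> \<odot> up (Suc 0)) = \<sigma>"
  "\<sigma> n ;; (\<sigma> \<odot> up (Suc n)) = \<sigma> \<odot> up n"
  by (auto simp: fun_eq_iff scons_def up_def scomp_def split: nat.split)

lemma scons_up': "(t ;; \<sigma>) \<odot> up (Suc n) \<odot> \<tau> = \<sigma> \<odot> up n \<odot> \<tau>"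
  by (simp add: scomp_assoc[symmetric] scons_up)

lemma up_up': "up m \<odot> up n \<odot> \<tau> = up (n + m) \<odot> \<tau>"
  by (simp add: scomp_assoc[symmetric] up_up)

lemma under_Suc: "under (Suc k) \<sigma> = Var 0 ;; (up (Suc 0) \<odot> under k \<sigma>)"
  by (auto simp: fun_eq_iff under_def scons_def scomp_def up_def lift_sub sub_sub split: nat.split)

lemma lift_nf: "lift n k = sub (under k (up n))"
  by (auto simp: lift_sub under_def up_def fun_eq_iff intro!: arg_cong2[where f=sub])

text \<open>Names the substitution inside \<open>ins\<close>, so that it unfolds along the list into
  \<open>;;\<close> ending in \<open>up n\<close>.\<close>

definition insf :: "nat \<Rightarrow> tm list \<Rightarrow> nat \<Rightarrow> tm" where
  "insf n ts i = (if i < length ts then ts ! i else Var (i - length ts + n))"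

lemma ins_nf: "ins n ts = sub (insf n ts)"
  by (simp add: ins_def insf_def[abs_def])

lemma insf_simps: "insf n [] = up n" "insf n (t # ts) = t ;; insf n ts"
  by (auto simp: up_def scons_def insf_def fun_eq_iff split: nat.split)

lemma up_app: "up n i = Var (i + n)"
  by (simp add: up_def)

lemma scomp_app: "(\<sigma> \<odot> \<tau>) i = sub \<sigma> (\<tau> i)"
  by (simp add: scomp_def)

text \<open>These are rewrite rules of the sigma-calculus of explicit substitutions; simplification
  with them settles the index shifts in the typing rules.\<close>

lemmas nf = lift_nf ins_nf insf_simps under_Suc under_0 sub_scomp scomp_scons scomp_assoc
  scons_up scons_up' up_up up_up' scomp_up_0 up_0 scons_app scons_eta(1) up_app scomp_app numeral_eq_Suc

section \<open>Derivability in the Martin-Loef type theories\<close>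

text \<open>Stated for all tails of the context at once, since a premise over an extended context
  has to yield the facts about the context itself.\<close>

lemma ml_ctx: "T \<rhd> \<Gamma> \<turnstile> J \<Longrightarrow> T \<rhd> \<Gamma> \<turnstile> Ok \<and>
    (\<forall>n A \<Delta>. drop n \<Gamma> = A # \<Delta> \<longrightarrow> T \<rhd> \<Delta> \<turnstile> Ty A \<and> T \<rhd> \<Delta> \<turnstile> Ok)"
proof (induction rule: ml.induct)
  case (ok_ext \<Gamma> A)
  then show ?case by (auto simp: drop_Cons' intro: ml.ok_ext split: if_splits)
qed (force dest: spec[where x=0] spec[where x="Suc _"] intro: ml.ok_nil)+

lemma ml_Ok: "T \<rhd> \<Gamma> \<turnstile> J \<Longrightarrow> T \<rhd> \<Gamma> \<turnstile> Ok"
  using ml_ctx by blast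

lemma ml_hd: "T \<rhd> A # \<Gamma> \<turnstile> J \<Longrightarrow> T \<rhd> \<Gamma> \<turnstile> Ty A"
  using ml_ctx[of T "A # \<Gamma>" J] by (metis drop0)

lemma ml_tl: "T \<rhd> A # \<Gamma> \<turnstile> J \<Longrightarrow> T \<rhd> \<Gamma> \<turnstile> Ok"
  using ml_hd ml_Ok by blast

text \<open>The premises of the rule \<open>subst\<close>, with the shifted types written by
  composition so that \<open>nf\<close> applies; \<open>teq\<close> does the same for the
  replacement rules.\<close>

definition tsub :: "ml_theory \<Rightarrow> tm list \<Rightarrow> (nat \<Rightarrow> tm) \<Rightarrow> tm list \<Rightarrow> bool" where
  "tsub T \<Gamma> \<sigma> \<Delta> \<longleftrightarrow> T \<rhd> \<Gamma> \<turnstile> Ok \<and>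
     (\<forall>i<length \<Delta>. T \<rhd> \<Gamma> \<turnstile> Tm (\<sigma> i) (sub (\<sigma> \<odot> up (Suc i)) (\<Delta> ! i)))"

definition teq :: "ml_theory \<Rightarrow> tm list \<Rightarrow> (nat \<Rightarrow> tm) \<Rightarrow> (nat \<Rightarrow> tm) \<Rightarrow> tm list \<Rightarrow> bool" where
  "teq T \<Gamma> \<sigma> \<tau> \<Delta> \<longleftrightarrow> T \<rhd> \<Gamma> \<turnstile> Ok \<and>
     (\<forall>i<length \<Delta>. T \<rhd> \<Gamma> \<turnstile> TmEq (\<sigma> i) (\<tau> i) (sub (\<sigma> \<odot> up (Suc i)) (\<Delta> ! i)))"

lemma sub_sh_nf: "sub \<sigma> (sh n A) = sub (\<sigma> \<odot> up n) A"
  by (simp add: nf)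

lemma tsub_J: "tsub T \<Gamma> \<sigma> \<Delta> \<Longrightarrow> T \<rhd> \<Delta> \<turnstile> J \<Longrightarrow> T \<rhd> \<Gamma> \<turnstile> jsub \<sigma> J"
  unfolding tsub_def by (intro ml.subst) (auto simp: sub_sh_nf)

lemmas tsub_Ty = tsub_J[where J="Ty A" for A, unfolded jsub.simps]
  and tsub_TyEq = tsub_J[where J="TyEq A B" for A B, unfolded jsub.simps]
  and tsub_Tm = tsub_J[where J="Tm a A" for a A, unfolded jsub.simps]
  and tsub_TmEq = tsub_J[where J="TmEq a b A" for a b A, unfolded jsub.simps]

lemma teq_Ty: "teq T \<Gamma> \<sigma> \<tau> \<Delta> \<Longrightarrow> T \<rhd> \<Delta> \<turnstile> Ty C \<Longrightarrow> T \<rhd> \<Gamma> \<turnstile> TyEq (sub \<sigma> C) (sub \<tau> C)"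
  unfolding teq_def by (rule ml.repl_ty) (auto simp: sub_sh_nf)

lemma teq_Tm: "teq T \<Gamma> \<sigma> \<tau> \<Delta> \<Longrightarrow> T \<rhd> \<Delta> \<turnstile> Tm c C \<Longrightarrow> T \<rhd> \<Gamma> \<turnstile> TmEq (sub \<sigma> c) (sub \<tau> c) (sub \<sigma> C)"
  unfolding teq_def by (rule ml.repl_tm) (auto simp: sub_sh_nf)

lemma tsub_Cons: "tsub T \<Gamma> \<sigma> \<Delta> \<Longrightarrow> T \<rhd> \<Gamma> \<turnstile> Tm t (sub \<sigma> A) \<Longrightarrow> tsub T \<Gamma> (t ;; \<sigma>) (A # \<Delta>)"
  by (auto simp: tsub_def nth_Cons nf split: nat.splits)

lemma tsub_Var: "T \<rhd> \<Gamma> \<turnstile> Ok \<Longrightarrow> tsub T \<Gamma> Var \<Gamma>"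
  using ml.var[of T \<Gamma>] by (auto simp: tsub_def nf)

text \<open>Weakening is not a primitive rule: it is the rule \<open>subst\<close> for the
  shift.\<close>

lemma tsub_up: "tsub T \<Gamma> \<sigma> \<Delta> \<Longrightarrow> T \<rhd> \<Gamma> \<turnstile> Ty B \<Longrightarrow> tsub T (B # \<Gamma>) (up (Suc 0) \<odot> \<sigma>) \<Delta>"
proof -
  assume *: "tsub T \<Gamma> \<sigma> \<Delta>" and B: "T \<rhd> \<Gamma> \<turnstile> Ty B"
  have ok: "T \<rhd> B # \<Gamma> \<turnstile> Ok" using B by (rule ml.ok_ext)
  have "T \<rhd> B # \<Gamma> \<turnstile> jsub (up (Suc 0)) J" if "T \<rhd> \<Gamma> \<turnstile> J" for J
  proof (rule ml.subst[OF that ok], intro allI impI)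
    fix i assume "i < length \<Gamma>"
    then show "T \<rhd> B # \<Gamma> \<turnstile> Tm (up (Suc 0) i) (sub (up (Suc 0)) (sh (Suc i) (\<Gamma> ! i)))"
      using ml.var[OF ok, of "Suc i"] by (simp add: nf)
  qed
  from this[of "Tm a A" for a A] show ?thesis
    using * ok unfolding tsub_def by (metis jsub.simps(4) scomp_app scomp_assoc sub_scomp)
qed

lemma tsub_upS: "T \<rhd> \<Gamma> \<turnstile> Ty B \<Longrightarrow> tsub T \<Gamma> (up n) \<Delta> \<Longrightarrow> tsub T (B # \<Gamma>) (up (Suc n)) \<Delta>"
  using tsub_up[of T \<Gamma> "up n" \<Delta> B] by (simp add: nf)

lemma tsub_up1: "T \<rhd> \<Gamma> \<turnstile> Ty B \<Longrightarrow> tsub T (B # \<Gamma>) (up (Suc 0)) \<Gamma>"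
  using tsub_up[OF tsub_Var[OF ml_Ok]] by (simp add: nf)

lemma ml_var0: "T \<rhd> \<Gamma> \<turnstile> Ty A \<Longrightarrow> T \<rhd> A # \<Gamma> \<turnstile> Tm (Var 0) (sub (up (Suc 0)) A)"
  using ml.var[OF ml.ok_ext, of T \<Gamma> A 0] by (simp add: nf)

lemma tsub_under: "tsub T \<Gamma> \<sigma> \<Delta> \<Longrightarrow> T \<rhd> \<Delta> \<turnstile> Ty A \<Longrightarrow>
    tsub T (sub \<sigma> A # \<Gamma>) (Var 0 ;; (up (Suc 0) \<odot> \<sigma>)) (A # \<Delta>)"
  using ml_var0[OF tsub_Ty, of T \<Gamma> \<sigma> \<Delta> A] by (intro tsub_Cons tsub_up) (auto simp: nf dest: tsub_Ty)

text \<open>Generation by the head symbol; formers that are not listed carry no information.\<close>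

definition ty_inv :: "ml_theory \<Rightarrow> tm list \<Rightarrow> tm \<Rightarrow> bool" where
  "ty_inv T \<Gamma> X = (case X of
      Var i \<Rightarrow> False
    | C1 f a \<Rightarrow> (f = oLst \<longrightarrow> T \<rhd> \<Gamma> \<turnstile> Ty a) \<and> (f = oDec \<longrightarrow> T \<rhd> \<Gamma> \<turnstile> Tm a Univ)
    | C2 f a b \<Rightarrow> f = oCoprod \<longrightarrow> T \<rhd> \<Gamma> \<turnstile> Ty a \<and> T \<rhd> \<Gamma> \<turnstile> Ty b
    | C3 f a b c \<Rightarrow> f = oEq \<longrightarrow> T \<rhd> \<Gamma> \<turnstile> Ty a \<and> T \<rhd> \<Gamma> \<turnstile> Tm b a \<and> T \<rhd> \<Gamma> \<turnstile> Tm c a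
    | CB f a b \<Rightarrow> f \<in> {oSig, oPi} \<longrightarrow> T \<rhd> \<Gamma> \<turnstile> Ty a \<and> T \<rhd> a # \<Gamma> \<turnstile> Ty b
    | _ \<Rightarrow> True)"

definition tm_inv :: "ml_theory \<Rightarrow> tm list \<Rightarrow> tm \<Rightarrow> bool" where
  "tm_inv T \<Gamma> t = (case t of
      Var i \<Rightarrow> i < length \<Gamma>
    | C0 f \<Rightarrow> f \<noteq> oProps
    | C1 f a \<Rightarrow> f = ocLst \<longrightarrow> T \<rhd> \<Gamma> \<turnstile> Tm a Univ
    | C2 f a b \<Rightarrow> f = ocCoprod \<longrightarrow> T \<rhd> \<Gamma> \<turnstile> Tm a Univ \<and> T \<rhd> \<Gamma> \<turnstile> Tm b Univ
    | C3 f a b c \<Rightarrow> f = ocEq \<longrightarrow> T \<rhd> \<Gamma> \<turnstile> Tm a Univ \<and> T \<rhd> \<Gamma> \<turnstile> Tm b (Dec a) \<and> T \<rhd> \<Gamma> \<turnstile> Tm c (Dec a)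
    | CB f a b \<Rightarrow> f \<in> {ocSig, ocPi} \<longrightarrow> T \<rhd> \<Gamma> \<turnstile> Tm a Univ \<and> T \<rhd> Dec a # \<Gamma> \<turnstile> Tm b Univ
    | _ \<Rightarrow> True)"

lemma ty_inv_sub:
  assumes "tsub T \<Gamma> \<sigma> \<Delta>" "ty_inv T \<Delta> X"
  shows "ty_inv T \<Gamma> (sub \<sigma> X)"
proof (cases X)
  case (CB f a b)
  then show ?thesis
    using assms tsub_Ty[OF tsub_under[OF assms(1)], of a b]
    by (auto simp: ty_inv_def nf dest: tsub_Ty)
qed (use assms in \<open>auto simp: ty_inv_def dest: tsub_Ty tsub_Tm\<close>)

text \<open>If \<open>t\<close> is a variable, its instance is an entry of \<open>\<sigma>\<close>,
  whose head can be anything; hence inversion is assumed for the entries. In \<open>ml_inv\<close>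
  the induction hypotheses of the rule \<open>subst\<close> provide it.\<close>

lemma tm_inv_sub:
  assumes "tsub T \<Gamma> \<sigma> \<Delta>" "tm_inv T \<Delta> t" "\<forall>i<length \<Delta>. tm_inv T \<Gamma> (\<sigma> i)"
  shows "tm_inv T \<Gamma> (sub \<sigma> t)"
proof (cases t)
  case (CB f a b)
  then show ?thesis
    using assms tsub_Tm[OF tsub_under[OF assms(1) ml.Dec_F], of a b Univ] tsub_Tm[OF assms(1), of a Univ]
    by (auto simp: tm_inv_def nf)
qed (use assms in \<open>auto simp: tm_inv_def dest: tsub_Tm\<close>)

text \<open>Conversion changes the type of a term and never the term, and no rule concludes
  \<open>Ty\<close> from an equality of types. So inversion is an induction on derivations, without
  confluence or normalisation.\<close>

lemma ml_inv: "T \<rhd> \<Gamma> \<turnstile> J \<Longrightarrow> (\<forall>X. J = Ty X \<longrightarrow> ty_inv T \<Gamma> X) \<and> (\<forall>t A. J = Tm t A \<longrightarrow> tm_inv T \<Gamma> t)"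
proof (induction rule: ml.induct)
  case (subst \<Delta> J \<Gamma> \<sigma>)
  then have \<sigma>: "tsub T \<Gamma> \<sigma> \<Delta>" "\<forall>i<length \<Delta>. tm_inv T \<Gamma> (\<sigma> i)"
    by (auto simp: tsub_def sub_sh_nf)
  show ?case
    using subst ty_inv_sub[OF \<sigma>(1)] tm_inv_sub[OF \<sigma>(1) _ \<sigma>(2)] by (cases J) auto
qed (auto simp: tm_inv_def ty_inv_def)

lemma ml_inv_Ty: "T \<rhd> \<Gamma> \<turnstile> Ty X \<Longrightarrow> ty_inv T \<Gamma> X"
  using ml_inv by blast

lemma ml_inv_Tm: "T \<rhd> \<Gamma> \<turnstile> Tm t A \<Longrightarrow> tm_inv T \<Gamma> t"
  using ml_inv by blast

section \<open>Typing of primitive recursive terms and of \<open>CT\<close>\<close>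

primrec pr_ok :: "pr \<Rightarrow> nat \<Rightarrow> bool" where
  "pr_ok PZero n \<longleftrightarrow> True"
| "pr_ok PSucc n \<longleftrightarrow> n > 0"
| "pr_ok (PProj i) n \<longleftrightarrow> i < n"
| "pr_ok (PComp f gs) n \<longleftrightarrow> pr_ok f (length gs) \<and> list_all (\<lambda>g. g n) (map pr_ok gs)"
| "pr_ok (PRec f g) n \<longleftrightarrow> n > 0 \<and> pr_ok f (n - 1) \<and> pr_ok g (n + 1)"

lemma pr_ok_prT: "pr_ok prT 3" and pr_ok_prU: "pr_ok prU 1"
  by (simp_all add: prT_def prU_def prEq_def prNot_def prOne_def prAdd_def prSub_def prPred_def
      prIf_def prHistory_def prStep_def prPair_def prTri_def prHd_def prTl_def prDiag_def prUpd_def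
      prFwd_def prBack_def prItem_def prDrop_def prActive_def prRunning_def Let_def)

text \<open>\<open>pr_ok\<close> checks arities: \<open>pr_tm\<close> takes heads and entries of the
  argument list, which are unspecified for lists that are too short.\<close>

lemma Tm_pr_tm:
  "pr_ok f (length ts) \<Longrightarrow> T \<rhd> \<Gamma> \<turnstile> Ok \<Longrightarrow> \<forall>t\<in>set ts. T \<rhd> \<Gamma> \<turnstile> Tm t NN \<Longrightarrow> T \<rhd> \<Gamma> \<turnstile> Tm (pr_tm f ts) NN"
proof (induction f arbitrary: ts \<Gamma>)
  case (PRec f g)
  then obtain t us where ts: "ts = t # us" by (cases ts) auto
  have N: "tsub T (NN # NN # \<Gamma>) (up 2) \<Gamma>" "T \<rhd> NN # \<Gamma> \<turnstile> Ty NN" "T \<rhd> NN # NN # \<Gamma> \<turnstile> Ok"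
    using PRec.prems(2) by (auto simp: numeral_2_eq_2 intro!: tsub_upS tsub_up1 ml.Nat_F ml.ok_ext)
  have "T \<rhd> NN # NN # \<Gamma> \<turnstile> Tm (sh 2 u) NN" if "u \<in> set us" for u
    using tsub_Tm[OF N(1), of u NN] PRec.prems that ts by (simp add: lift_nf)
  then have "T \<rhd> NN # NN # \<Gamma> \<turnstile> Tm (pr_tm g (Var 1 # Var 0 # map (sh 2) us)) NN"
    using PRec.prems ts N ml.var[OF N(3), of 0] ml.var[OF N(3), of 1]
    by (intro PRec.IH(2)) (auto simp: nf)
  moreover have "T \<rhd> \<Gamma> \<turnstile> Tm (pr_tm f us) NN" using PRec ts by auto
  ultimately show ?case
    using PRec.prems ts ml.Nat_E[of T \<Gamma> NN t "pr_tm f us" "pr_tm g (Var 1 # Var 0 # map (sh 2) us)"] N(2)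
    by (simp add: nf)
next
  case (PComp f gs)
  have "\<forall>u\<in>set (map (\<lambda>h. h ts) (map pr_tm gs)). T \<rhd> \<Gamma> \<turnstile> Tm u NN"
    using PComp.prems by (auto simp: list_all_iff intro!: PComp.IH(2))
  then show ?case using PComp.prems PComp.IH(1)[of "map (\<lambda>h. h ts) (map pr_tm gs)" \<Gamma>] by simp
next
  case (PSucc)
  then show ?case by (cases ts) (auto intro: ml.Nat_IS)
qed (auto intro: ml.Nat_I0)

lemma Ty_arr: "T \<rhd> \<Gamma> \<turnstile> Ty A \<Longrightarrow> T \<rhd> \<Gamma> \<turnstile> Ty B \<Longrightarrow> T \<rhd> \<Gamma> \<turnstile> Ty (arr A B)"
  using tsub_Ty[OF tsub_up1] by (auto simp: nf intro!: ml.Pi_F)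

lemma Ty_prod: "T \<rhd> \<Gamma> \<turnstile> Ty A \<Longrightarrow> T \<rhd> \<Gamma> \<turnstile> Ty B \<Longrightarrow> T \<rhd> \<Gamma> \<turnstile> Ty (prod A B)"
  using tsub_Ty[OF tsub_up1] by (auto simp: nf intro!: ml.Sig_F)

lemma Ty_CT: assumes "T \<rhd> \<Gamma> \<turnstile> Ok" shows "T \<rhd> \<Gamma> \<turnstile> Ty CT"
proof -
  let ?F = "arr NN NN"
  let ?\<Delta> = "NN # NN # NN # ?F # \<Gamma>"
  have F: "T \<rhd> \<Gamma> \<turnstile> Ty ?F" using assms by (intro Ty_arr ml.Nat_F)
  have ok: "T \<rhd> ?\<Delta> \<turnstile> Ok" by (intro ml.ok_ext ml.Nat_F F)
  have v: "T \<rhd> ?\<Delta> \<turnstile> Tm (Var 0) NN" "T \<rhd> ?\<Delta> \<turnstile> Tm (Var 1) NN" "T \<rhd> ?\<Delta> \<turnstile> Tm (Var 2) NN"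
     "T \<rhd> ?\<Delta> \<turnstile> Tm (Var 3) ?F"
    using ml.var[OF ok, of 0] ml.var[OF ok, of 1] ml.var[OF ok, of 2] ml.var[OF ok, of 3] by (simp_all add: nf)
  have t: "T \<rhd> ?\<Delta> \<turnstile> Tm (pr_tm prT [Var 2, Var 1, Var 0]) NN"
    "T \<rhd> ?\<Delta> \<turnstile> Tm (pr_tm prU [Var 0]) NN"
    using v ok Tm_pr_tm[of prT "[Var 2, Var 1, Var 0]" T ?\<Delta>] Tm_pr_tm[of prU "[Var 0]" T ?\<Delta>]
      pr_ok_prT pr_ok_prU by (simp_all add: numeral_3_eq_3)
  have a: "T \<rhd> ?\<Delta> \<turnstile> Tm (App (Var 3) (Var 1)) NN"
    using ml.Pi_E[OF v(4) v(2)] by (simp add: nf)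
  show ?thesis unfolding CT_def
    by (intro ml.Pi_F ml.Sig_F ml.Nat_F F Ty_prod ml.Eq_F t a ml.Nat_IS ml.Nat_I0 ml.ok_ext ok)
qed

section \<open>Instantiation, weakening and change of context\<close>

lemma jsub_Var [simp]: "jsub Var J = J"
  by (cases J) simp_all

lemma ml_ins1: "T \<rhd> A # \<Gamma> \<turnstile> J \<Longrightarrow> T \<rhd> \<Gamma> \<turnstile> Tm a A \<Longrightarrow> T \<rhd> \<Gamma> \<turnstile> jsub (a ;; Var) J"
  by (rule tsub_J[OF tsub_Cons[OF tsub_Var]]) (auto dest: ml_Ok)

lemma ml_ins2: "T \<rhd> B # A # \<Gamma> \<turnstile> J \<Longrightarrow> T \<rhd> \<Gamma> \<turnstile> Tm a A \<Longrightarrow> T \<rhd> \<Gamma> \<turnstile> Tm b (sub (a ;; Var) B) \<Longrightarrow>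
    T \<rhd> \<Gamma> \<turnstile> jsub (b ;; a ;; Var) J"
  by (rule tsub_J[OF tsub_Cons[OF tsub_Cons[OF tsub_Var]]]) (auto dest: ml_Ok)

lemma ml_ins3: "T \<rhd> C # B # A # \<Gamma> \<turnstile> J \<Longrightarrow> T \<rhd> \<Gamma> \<turnstile> Tm a A \<Longrightarrow> T \<rhd> \<Gamma> \<turnstile> Tm b (sub (a ;; Var) B) \<Longrightarrow>
    T \<rhd> \<Gamma> \<turnstile> Tm c (sub (b ;; a ;; Var) C) \<Longrightarrow> T \<rhd> \<Gamma> \<turnstile> jsub (c ;; b ;; a ;; Var) J"
  by (rule tsub_J[OF tsub_Cons[OF tsub_Cons[OF tsub_Cons[OF tsub_Var]]]]) (auto dest: ml_Ok)

lemma ml_ins4: "T \<rhd> D # C # B # A # \<Gamma> \<turnstile> J \<Longrightarrow> T \<rhd> \<Gamma> \<turnstile> Tm a A \<Longrightarrow> T \<rhd> \<Gamma> \<turnstile> Tm b (sub (a ;; Var) B) \<Longrightarrow>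
    T \<rhd> \<Gamma> \<turnstile> Tm c (sub (b ;; a ;; Var) C) \<Longrightarrow> T \<rhd> \<Gamma> \<turnstile> Tm d (sub (c ;; b ;; a ;; Var) D) \<Longrightarrow>
    T \<rhd> \<Gamma> \<turnstile> jsub (d ;; c ;; b ;; a ;; Var) J"
  by (rule tsub_J[OF tsub_Cons[OF tsub_Cons[OF tsub_Cons[OF tsub_Cons[OF tsub_Var]]]]]) (auto dest: ml_Ok)

lemma ml_wk1: "T \<rhd> \<Gamma> \<turnstile> J \<Longrightarrow> T \<rhd> \<Gamma> \<turnstile> Ty A \<Longrightarrow> T \<rhd> A # \<Gamma> \<turnstile> jsub (up (Suc 0)) J"
  by (rule tsub_J[OF tsub_up1])

lemma tsub_conv: "tsub T \<Gamma> \<sigma> \<Delta> \<Longrightarrow> T \<rhd> \<Gamma> \<turnstile> TyEq B (sub \<sigma> A) \<Longrightarrow> T \<rhd> \<Gamma> \<turnstile> Ty B \<Longrightarrow>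
    tsub T (B # \<Gamma>) (Var 0 ;; (up (Suc 0) \<odot> \<sigma>)) (A # \<Delta>)"
  using ml_wk1[of T \<Gamma> "TyEq B (sub \<sigma> A)" B]
  by (auto intro!: tsub_Cons tsub_up intro: ml.conv[OF ml_var0] simp: nf)

lemma tsub_conv_Var: "tsub T \<Gamma> Var \<Delta> \<Longrightarrow> T \<rhd> \<Gamma> \<turnstile> TyEq B A \<Longrightarrow> T \<rhd> \<Gamma> \<turnstile> Ty B \<Longrightarrow> tsub T (B # \<Gamma>) Var (A # \<Delta>)"
  using tsub_conv[of T \<Gamma> Var \<Delta> B A] by (simp add: nf)

text \<open>A context is exchanged for a judgmentally equal one by substituting \<open>Var\<close>;
  \<open>tsub_conv_Var\<close> builds such a substitution entry by entry.\<close>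

lemma ml_ctx_conv: "tsub T \<Gamma> Var \<Delta> \<Longrightarrow> T \<rhd> \<Delta> \<turnstile> J \<Longrightarrow> T \<rhd> \<Gamma> \<turnstile> J"
  using tsub_J by fastforce

section \<open>Presuppositions of judgements\<close>

fun presup :: "ml_theory \<Rightarrow> tm list \<Rightarrow> jdg \<Rightarrow> bool" where
  "presup T \<Gamma> (TyEq A B) \<longleftrightarrow> T \<rhd> \<Gamma> \<turnstile> Ty A \<and> T \<rhd> \<Gamma> \<turnstile> Ty B"
| "presup T \<Gamma> (Tm a A) \<longleftrightarrow> T \<rhd> \<Gamma> \<turnstile> Ty A"
| "presup T \<Gamma> (TmEq a b A) \<longleftrightarrow> T \<rhd> \<Gamma> \<turnstile> Ty A \<and> T \<rhd> \<Gamma> \<turnstile> Tm a A \<and> T \<rhd> \<Gamma> \<turnstile> Tm b A"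
| "presup T \<Gamma> J \<longleftrightarrow> True"

lemmas ml_Ty_intros = ml.N0_F ml.N1_F ml.Nat_F ml.Lst_F ml.Sum_F ml.Sig_F ml.Pi_F ml.Eq_F ml.Univ_F
  ml.Dec_F ml.SubU_F ml.SubDec_F

lemma ty_inv_simps [simp]:
  "ty_inv T \<Gamma> (Lst A) \<longleftrightarrow> T \<rhd> \<Gamma> \<turnstile> Ty A"
  "ty_inv T \<Gamma> (Dec a) \<longleftrightarrow> T \<rhd> \<Gamma> \<turnstile> Tm a Univ"
  "ty_inv T \<Gamma> (Coprod A B) \<longleftrightarrow> T \<rhd> \<Gamma> \<turnstile> Ty A \<and> T \<rhd> \<Gamma> \<turnstile> Ty B"
  "ty_inv T \<Gamma> (Sig A B) \<longleftrightarrow> T \<rhd> \<Gamma> \<turnstile> Ty A \<and> T \<rhd> A # \<Gamma> \<turnstile> Ty B"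
  "ty_inv T \<Gamma> (Pi A B) \<longleftrightarrow> T \<rhd> \<Gamma> \<turnstile> Ty A \<and> T \<rhd> A # \<Gamma> \<turnstile> Ty B"
  "ty_inv T \<Gamma> (Eq A a b) \<longleftrightarrow> T \<rhd> \<Gamma> \<turnstile> Ty A \<and> T \<rhd> \<Gamma> \<turnstile> Tm a A \<and> T \<rhd> \<Gamma> \<turnstile> Tm b A"
  by (simp_all add: ty_inv_def)

lemmas ml_ins1' = ml_ins1[where J="Ty A" for A, unfolded jsub.simps] ml_ins1[where J="Tm a A" for a A, unfolded jsub.simps]
lemmas ml_ins3' = ml_ins3[where J="Ty A" for A, unfolded jsub.simps] ml_ins3[where J="Tm a A" for a A, unfolded jsub.simps]

lemma ufam_sub: "tsub T \<Gamma> \<sigma> \<Delta> \<Longrightarrow> ufam (ml T) T \<Delta> a b \<Longrightarrow> ufam (ml T) T \<Gamma> (sub \<sigma> a) (sub (under 1 \<sigma>) b)"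
  using tsub_Tm[OF tsub_under[OF _ ml.Dec_F], of T \<Gamma> \<sigma> \<Delta> a b Univ] tsub_Tm[of T \<Gamma> \<sigma> \<Delta> a Univ]
  by (simp add: nf)

lemma axset_sub: "tsub T \<Gamma> \<sigma> \<Delta> \<Longrightarrow> axset (ml T) \<Delta> s i c v \<Longrightarrow>
    axset (ml T) \<Gamma> (sub \<sigma> s) (sub (under 1 \<sigma>) i) (sub (under 2 \<sigma>) c) (sub \<sigma> v)"
  using tsub_Tm[of T \<Gamma> \<sigma> \<Delta> s Univ] tsub_Tm[of T \<Gamma> \<sigma> \<Delta> v "arr (Dec s) Univ"]
    tsub_Tm[OF tsub_under[OF _ ml.Dec_F], of T \<Gamma> \<sigma> \<Delta> s i Univ]
    tsub_Tm[OF tsub_under[OF tsub_under[OF _ ml.Dec_F] ml.Dec_F], of T \<Gamma> \<sigma> \<Delta> s i c "arr (Dec (sh 2 s)) Univ"]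
  by (simp add: nf)

text \<open>The entries of \<open>\<tau>\<close> are given at types instantiated by
  \<open>\<sigma>\<close> and must be moved to those instantiated by \<open>\<tau>\<close>. The type
  equality for this is replacement over the shorter context, whence the induction on
  \<open>\<Delta>\<close>.\<close>

lemma tsub_teq:
  assumes "\<forall>i<length \<Delta>. T \<rhd> \<Gamma> \<turnstile> TmEq (\<sigma> i) (\<tau> i) (sub (\<sigma> \<odot> up (Suc i)) (\<Delta> ! i)) \<and>
      T \<rhd> \<Gamma> \<turnstile> Tm (\<sigma> i) (sub (\<sigma> \<odot> up (Suc i)) (\<Delta> ! i)) \<and> T \<rhd> \<Gamma> \<turnstile> Tm (\<tau> i) (sub (\<sigma> \<odot> up (Suc i)) (\<Delta> ! i))"
    and "T \<rhd> \<Gamma> \<turnstile> Ok" "T \<rhd> \<Delta> \<turnstile> Ok"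
  shows "tsub T \<Gamma> \<sigma> \<Delta> \<and> tsub T \<Gamma> \<tau> \<Delta>"
  using assms
proof (induction \<Delta> arbitrary: \<sigma> \<tau>)
  case (Cons A \<Delta>)
  let ?\<sigma> = "\<sigma> \<odot> up (Suc 0)" and ?\<tau> = "\<tau> \<odot> up (Suc 0)"
  have h: "T \<rhd> \<Gamma> \<turnstile> TmEq (?\<sigma> i) (?\<tau> i) (sub (?\<sigma> \<odot> up (Suc i)) (\<Delta> ! i)) \<and>
      T \<rhd> \<Gamma> \<turnstile> Tm (?\<sigma> i) (sub (?\<sigma> \<odot> up (Suc i)) (\<Delta> ! i)) \<and> T \<rhd> \<Gamma> \<turnstile> Tm (?\<tau> i) (sub (?\<sigma> \<odot> up (Suc i)) (\<Delta> ! i))"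
    if "i < length \<Delta>" for i
    using Cons.prems(1)[rule_format, of "Suc i"] that by (simp add: nf)
  have t: "tsub T \<Gamma> ?\<sigma> \<Delta>" "tsub T \<Gamma> ?\<tau> \<Delta>"
    using Cons.IH[of ?\<sigma> ?\<tau>] h Cons.prems(2,3) ml_tl by blast+
  moreover have "T \<rhd> \<Gamma> \<turnstile> TyEq (sub ?\<sigma> A) (sub ?\<tau> A)"
    using h Cons.prems(2,3) by (intro teq_Ty[of _ _ _ _ \<Delta>]) (auto simp: teq_def dest: ml_hd)
  moreover have "T \<rhd> \<Gamma> \<turnstile> Tm (\<sigma> 0) (sub ?\<sigma> A)" "T \<rhd> \<Gamma> \<turnstile> Tm (\<tau> 0) (sub ?\<sigma> A)"
    using Cons.prems(1) by force+
  ultimately have "tsub T \<Gamma> (\<sigma> 0 ;; ?\<sigma>) (A # \<Delta>)" "tsub T \<Gamma> (\<tau> 0 ;; ?\<tau>) (A # \<Delta>)"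
    by (auto intro: tsub_Cons ml.conv)
  then show ?case using scons_eta(2)[of \<sigma>] scons_eta(2)[of \<tau>] by simp
qed (simp add: tsub_def)

lemmas ml_code_intros = ml.cN0_I ml.cN1_I ml.cNN_I ml.cLst_I ml.cSum_I ml.cSig_I ml.cPi_I ml.cEq_I
  ml.Cov_F ml.cSubU_I ml.SubLift_I ml.uBase_I ml.uFam_I ml.uN0_I ml.uN1_I ml.uNN_I ml.uLst_I
  ml.uCoprod_I ml.uSig_I ml.uPi_I ml.uEq_I

lemma presup_E_sub:
  assumes "axset (ml T) \<Gamma> s i c v" "T \<rhd> CovT 1 s i c v (Var 0) # Dec s # \<Gamma> \<turnstile> Ty P" 
  "T \<rhd> \<Gamma> \<turnstile> Tm a (Dec s)" "T \<rhd> \<Gamma> \<turnstile> Tm m (Dec (Cov s i c v a))"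
  shows "T \<rhd> \<Gamma> \<turnstile> Ty (ins 0 [m, a] P)"
  using ml_ins2[OF assms(2,3), of m] assms(4) by (simp add: nf)

text \<open>Equality rules do not carry the typings of everything that they equate, while the
  conversions below need both sides typed. The theories treated are the targets of the two
  interpretations.\<close>

lemma presup: "T \<rhd> \<Gamma> \<turnstile> J \<Longrightarrow> T \<noteq> MLtt_cind \<Longrightarrow> presup T \<Gamma> J"
proof (induction rule: ml.induct)
  case (conv_eq \<Gamma> a b A B)
  then show ?case by (auto intro: ml.conv)
next
  case (var \<Gamma> i)
  have "drop i \<Gamma> = \<Gamma> ! i # drop (Suc i) \<Gamma>" using var by (simp add: Cons_nth_drop_Suc)
  then have "T \<rhd> drop (Suc i) \<Gamma> \<turnstile> Ty (\<Gamma> ! i)" using ml_ctx[OF var(1)] by blast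
  moreover have "tsub T \<Gamma> (up (Suc i)) (drop (Suc i) \<Gamma>)"
    using ml.var[OF var(1)] var(1) by (auto simp: tsub_def nf ac_simps)
  ultimately show ?case using tsub_Ty[of T \<Gamma> "up (Suc i)" "drop (Suc i) \<Gamma>" "\<Gamma> ! i"] by (simp add: nf)
next
  case (subst \<Delta> J \<Gamma> \<sigma>)
  then have "tsub T \<Gamma> \<sigma> \<Delta>" by (auto simp: tsub_def sub_sh_nf)
  with subst show ?case by (cases J) (auto dest: tsub_Ty tsub_Tm)
next
  case (repl_ty \<Delta> C \<Gamma> \<sigma> \<tau>)
  then have "tsub T \<Gamma> \<sigma> \<Delta>" "tsub T \<Gamma> \<tau> \<Delta>"
    using tsub_teq[of \<Delta> T \<Gamma> \<sigma> \<tau>] by (auto simp: sub_sh_nf dest: ml_Ok)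
  with repl_ty show ?case by (auto dest: tsub_Ty)
next
  case (repl_tm \<Delta> c C \<Gamma> \<sigma> \<tau>)
  then have t: "tsub T \<Gamma> \<sigma> \<Delta>" "tsub T \<Gamma> \<tau> \<Delta>"
    using tsub_teq[of \<Delta> T \<Gamma> \<sigma> \<tau>] by (auto simp: sub_sh_nf dest: ml_Ok)
  have "T \<rhd> \<Gamma> \<turnstile> TyEq (sub \<sigma> C) (sub \<tau> C)"
    using repl_tm by (intro teq_Ty[of _ _ _ _ \<Delta>]) (auto simp: teq_def sub_sh_nf)
  moreover have "T \<rhd> \<Gamma> \<turnstile> Tm (sub \<sigma> c) (sub \<sigma> C)" "T \<rhd> \<Gamma> \<turnstile> Tm (sub \<tau> c) (sub \<tau> C)"
    using t repl_tm by (auto dest: tsub_Tm)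
  ultimately show ?case using t repl_tm by (auto dest: tsub_Ty intro: ml.conv ml.ty_sym)
next
  case C: (Sig_cong \<Gamma> A A' B B')
  \<comment> \<open>The premise types \<open>B'\<close> over \<open>A\<close>, whereas forming
    \<open>Sig A' B'\<close> requires it over \<open>A'\<close>.\<close>
  have "tsub T (A' # \<Gamma>) Var (A # \<Gamma>)"
    using C by (intro tsub_conv_Var tsub_Var ml.ty_sym[OF C.hyps(1)] ml_Ok[OF C.hyps(1)]) auto
  then have "T \<rhd> A' # \<Gamma> \<turnstile> Ty B'" using C by (auto intro: ml_ctx_conv)
  with C show ?case by (auto intro: ml.Sig_F)
next
  case C: (Pi_cong \<Gamma> A A' B B')
  have "tsub T (A' # \<Gamma>) Var (A # \<Gamma>)"
    using C by (intro tsub_conv_Var tsub_Var ml.ty_sym[OF C.hyps(1)] ml_Ok[OF C.hyps(1)]) auto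
  then have "T \<rhd> A' # \<Gamma> \<turnstile> Ty B'" using C by (auto intro: ml_ctx_conv)
  with C show ?case by (auto intro: ml.Pi_F)
next
  case (Eq_cong \<Gamma> A A' a a' b b')
  then show ?case by (auto intro: ml.Eq_F ml.conv)
next
  case (N1_C \<Gamma> C c)
  then show ?case using ml.N1_E[OF N1_C.hyps(1) ml.N1_I N1_C.hyps(2)] ml_Ok[OF N1_C.hyps(2)] by simp
next
  case (Nat_C0 \<Gamma> C c d)
  then show ?case using ml.Nat_E[OF Nat_C0.hyps(1) ml.Nat_I0 Nat_C0.hyps(2,3)] ml_Ok[OF Nat_C0.hyps(2)] by simp
next
  case C: (Nat_CS \<Gamma> C t c d)
  have "T \<rhd> \<Gamma> \<turnstile> Tm (ins 0 [RNat t c d, t] d) (ins 0 [Succ t] C)"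
    using ml_ins2[OF C.hyps(4) C.hyps(2), of "RNat t c d"] ml.Nat_E[OF C.hyps(1,2,3,4)] by (simp add: nf)
  with C ml.Nat_E[OF C.hyps(1) ml.Nat_IS[OF C.hyps(2)] C.hyps(3,4)] ml_ins1[OF C.hyps(1) ml.Nat_IS[OF C.hyps(2)]]
  show ?case by (simp add: nf)
next
  case C: (Lst_C0 A \<Gamma> C c d)
  have "T \<rhd> \<Gamma> \<turnstile> Tm Nl (Lst A)" using ml_inv_Ty[OF ml_hd[OF C.hyps(1)]] by (simp add: ml.Lst_I0)
  with C show ?case by (auto intro!: ml.Lst_E)
next
  case C: (Lst_C1 A \<Gamma> C a l c d)
  have l: "T \<rhd> \<Gamma> \<turnstile> Tm (Cns a l) (Lst A)" using C by (auto intro: ml.Lst_I1)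
  have "T \<rhd> \<Gamma> \<turnstile> Tm (ins 0 [RLst l c d, l, a] d) (ins 0 [Cns a l] C)"
    using ml_ins3[OF C.hyps(5) C.hyps(2), of l "RLst l c d"] C.hyps(3) ml.Lst_E[OF C.hyps(1,3,4,5)] by (simp add: nf)
  with C ml.Lst_E[OF C.hyps(1) l C.hyps(4,5)] ml_ins1[OF C.hyps(1) l] show ?case by (simp add: nf)
next
  case C: (Sum_C1 A B \<Gamma> C a c d)
  have l: "T \<rhd> \<Gamma> \<turnstile> Tm (InL a) (Coprod A B)"
    using C.hyps(2) ml_inv_Ty[OF ml_hd[OF C.hyps(1)]] by (auto intro: ml.Sum_I1)
  have "T \<rhd> \<Gamma> \<turnstile> Tm (ins 0 [a] c) (ins 0 [InL a] C)"
    using ml_ins1[OF C.hyps(3) C.hyps(2)] by (simp add: nf)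
  with C ml.Sum_E[OF C.hyps(1) l C.hyps(3,4)] ml_ins1[OF C.hyps(1) l] show ?case by (simp add: nf)
next
  case C: (Sum_C2 A B \<Gamma> C b c d)
  have l: "T \<rhd> \<Gamma> \<turnstile> Tm (InR b) (Coprod A B)"
    using C.hyps(2) ml_inv_Ty[OF ml_hd[OF C.hyps(1)]] by (auto intro: ml.Sum_I2)
  have "T \<rhd> \<Gamma> \<turnstile> Tm (ins 0 [b] d) (ins 0 [InR b] C)"
    using ml_ins1[OF C.hyps(4) C.hyps(2)] by (simp add: nf)
  with C ml.Sum_E[OF C.hyps(1) l C.hyps(3,4)] ml_ins1[OF C.hyps(1) l] show ?case by (simp add: nf)
next
  case C: (Sig_C A B \<Gamma> C a b c)
  have l: "T \<rhd> \<Gamma> \<turnstile> Tm (Pr a b) (Sig A B)"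
    using C.hyps(2,3) ml_inv_Ty[OF ml_hd[OF C.hyps(1)]] by (auto intro: ml.Sig_I)
  have "T \<rhd> \<Gamma> \<turnstile> Tm (ins 0 [b, a] c) (ins 0 [Pr a b] C)"
    using ml_ins2[OF C.hyps(4) C.hyps(2), of b] C.hyps(3) by (simp add: nf)
  with C ml.Sig_E[OF C.hyps(1) l C.hyps(4)] ml_ins1[OF C.hyps(1) l] show ?case by (simp add: nf)
next
  case C: (Pi_E \<Gamma> f A B a)
  then show ?case using ml_inv_Ty[of T \<Gamma> "Pi A B"] ml_ins1[of T A \<Gamma> "Ty B" a] by (simp add: nf)
next
  case C: (Pi_C A \<Gamma> b B a)
  then show ?case using ml_ins1[of T A \<Gamma> "Ty B" a] ml_ins1[of T A \<Gamma> "Tm b B" a]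
      ml.Pi_E[OF ml.Pi_I[OF C.hyps(1)] C.hyps(2)] by (simp add: nf)
next
  case C: (Eq_E A \<Gamma> C a b p c)
  then show ?case using ml_ins3[OF C.hyps(1) C.hyps(2), of b p] by (simp add: nf)
next
  case C: (Eq_C A \<Gamma> C a c)
  have r: "T \<rhd> \<Gamma> \<turnstile> Tm (Rfl a) (Eq A a a)" using C.hyps(2) by (rule ml.Eq_I)
  then show ?case using C ml_ins3[OF C.hyps(1) C.hyps(2), of a "Rfl a"] ml.Eq_E[OF C.hyps(1) C.hyps(2,2) r C.hyps(3)]
      ml_ins1[OF C.hyps(3,2)] by (simp add: nf)
next
  case (Cov_rf \<Gamma> s i c v a r)
  then show ?case by (auto intro!: ml.Dec_F ml.Cov_F)
next
  case (Cov_tr \<Gamma> s i c v a j r)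
  then show ?case by (auto intro!: ml.Dec_F ml.Cov_F)
next
  case C: (Cov_E \<Gamma> s i c v a P m q1 q2)
  then show ?case using presup_E_sub[of T \<Gamma> s i c v P a m] by auto
next
  case C: (Cov_C1 \<Gamma> s i c v a P r q1 q2)
  have ax: "axset (ml T) \<Gamma> s i c v" using C.IH(1) by auto
  have m: "T \<rhd> \<Gamma> \<turnstile> Tm (Rf a r) (Dec (Cov s i c v a))" using ax C.hyps(1,3) by (rule ml.Cov_rf)
  show ?case
    using ml.Cov_E[OF ax C.hyps(1,2) m C.hyps(4,5)] presup_E_sub[OF ax C.hyps(2) C.hyps(1) m]
      ml_ins2[OF C.hyps(4,1), of r] C.hyps(3)
    by (simp add: nf)
next
  case C: (Cov_C2 \<Gamma> s i c v a P j r q1 q2)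
  have ax: "axset (ml T) \<Gamma> s i c v" using C.IH(1) by auto
  have m: "T \<rhd> \<Gamma> \<turnstile> Tm (Tr a j r) (Dec (Cov s i c v a))" using ax C.hyps(1,3,4) by (rule ml.Cov_tr)
  \<comment> \<open>The recursive calls in the contractum live over two more variables
    \<open>z\<close> and \<open>u\<close>. The premises of the eliminator are weakened by these,
    each below its own binders, and \<open>Cov_E\<close> is applied there.\<close>
  let ?W = "ins 0 [j, a] c" and ?\<sigma> = "up (Suc (Suc 0))"
  let ?\<Gamma> = "eps (Var 0) (sh 1 ?W) # Dec s # \<Gamma>"
  have "T \<rhd> \<Gamma> \<turnstile> Ty (CovAll 0 s i c v ?W)" using C by auto
  then have G: "T \<rhd> \<Gamma> \<turnstile> Ty (Dec s)" "T \<rhd> Dec s # \<Gamma> \<turnstile> Ty (eps (Var 0) (sh 1 ?W))"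
    by (auto dest!: ml_inv_Ty)
  then have t: "tsub T ?\<Gamma> ?\<sigma> \<Gamma>" by (intro tsub_upS tsub_up1)
  note t' = tsub_under[OF tsub_under[OF t ml_hd[OF ml_Ok[OF ml_hd[OF C.hyps(2)]]]] ml_hd[OF C.hyps(2)]]
  note v = ml.var[OF ml.ok_ext[OF G(2)], of 0, simplified] ml.var[OF ml.ok_ext[OF G(2)], of 1, simplified]
  note r = tsub_Tm[OF t C.hyps(4)]
  have "T \<rhd> ?\<Gamma> \<turnstile> Tm (App (sh 2 r) (Var 1)) (Pi (eps (Var 1) (sh 2 ?W)) (CovT 3 s i c v (Var 2)))"
    using ml.Pi_E[OF r[unfolded sub_simps], of "Var 1"] v by (simp add: nf)
  from ml.Pi_E[OF this, of "Var 0"]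
  have m2: "T \<rhd> ?\<Gamma> \<turnstile> Tm (App (App (sh 2 r) (Var 1)) (Var 0))
      (Dec (Cov (sub ?\<sigma> s) (sub (under 1 ?\<sigma>) i) (sub (under 2 ?\<sigma>) c) (sub ?\<sigma> v) (Var 1)))"
    using v by (simp add: nf)
  have a2: "T \<rhd> ?\<Gamma> \<turnstile> Tm (Var 1) (Dec (sub ?\<sigma> s))"
    using v by (simp add: nf)
  note q1 = tsub_Tm[OF tsub_under[OF tsub_under[OF t G(1)] ml_hd[OF C.hyps(5)]] C.hyps(5)]
  note H = ml_hd[OF C.hyps(6)]
  note q2 = tsub_Tm[OF tsub_under[OF tsub_under[OF tsub_under[OF tsub_under[OF t G(1)]
      ml_hd[OF ml_Ok[OF ml_hd[OF H]]]] ml_hd[OF H]] H] C.hyps(6)]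
  have I: "T \<rhd> ?\<Gamma> \<turnstile> Tm (Ind (App (App (sh 2 r) (Var 1)) (Var 0)) (lift 2 2 q1) (lift 2 4 q2))
     (ins 0 [App (App (sh 2 r) (Var 1)) (Var 0), Var 1] (lift 2 2 P))"
    using ml.Cov_E[OF axset_sub[OF t ax] a2 _ m2, of "lift 2 2 P" "lift 2 2 q1" "lift 2 4 q2"]
      tsub_Ty[OF t' C.hyps(2)] q1 q2
    by (simp add: nf)
  have "T \<rhd> \<Gamma> \<turnstile> Tm (Lam (Lam (Ind (App (App (sh 2 r) (Var 1)) (Var 0)) (lift 2 2 q1) (lift 2 4 q2))))
     (Pi (Dec s) (Pi (eps (Var 0) (sh 1 ?W)) (ins 0 [App (App (sh 2 r) (Var 1)) (Var 0), Var 1] (lift 2 2 P))))"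
    by (intro ml.Pi_I I)
  then have "T \<rhd> \<Gamma> \<turnstile> Tm (ins 0 [Lam (Lam (Ind (App (App (sh 2 r) (Var 1)) (Var 0)) (lift 2 2 q1) (lift 2 4 q2))), r, j, a] q2)
       (ins 0 [Tr a j r, a] P)"
    using ml_ins4[OF C.hyps(6,1), of j r] C.hyps(3,4) by (simp add: nf)
  then show ?case
    using ml.Cov_E[OF ax C.hyps(1,2) m C.hyps(5,6)] presup_E_sub[OF ax C.hyps(2,1) m] by simp
next
  case (uSig_D \<Gamma> a b t u)
  then have "T \<rhd> SubDec a b t # \<Gamma> \<turnstile> Ty (SubDec (sh 1 a) (lift 1 1 b) u)"
    using ufam_sub[OF tsub_up1[OF ml_hd], of T "SubDec a b t" \<Gamma> _ a b]
    by (intro ml.SubDec_F) (auto simp: nf)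
  then show ?case using uSig_D by (auto intro!: ml_Ty_intros ml_code_intros)
next
  case (uPi_D \<Gamma> a b t u)
  then have "T \<rhd> SubDec a b t # \<Gamma> \<turnstile> Ty (SubDec (sh 1 a) (lift 1 1 b) u)"
    using ufam_sub[OF tsub_up1[OF ml_hd], of T "SubDec a b t" \<Gamma> _ a b]
    by (intro ml.SubDec_F) (auto simp: nf)
  then show ?case using uPi_D by (auto intro!: ml_Ty_intros ml_code_intros)
next
  case (uFam_D \<Gamma> a b t)
  then show ?case using ml_ins1[of T "Dec a" \<Gamma> "Tm b Univ" t]
    by (auto intro!: ml_Ty_intros ml_code_intros simp: nf)
next
  case cN0_D
  then show ?case by (auto intro!: ml_Ty_intros ml_code_intros intro: ml_Ok)
next
  case cN1_D
  then show ?case by (auto intro!: ml_Ty_intros ml_code_intros intro: ml_Ok)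
next
  case cNN_D
  then show ?case by (auto intro!: ml_Ty_intros ml_code_intros intro: ml_Ok)
next
  case cLst_D
  then show ?case by (auto intro!: ml_Ty_intros ml_code_intros intro: ml_Ok)
next
  case cSum_D
  then show ?case by (auto intro!: ml_Ty_intros ml_code_intros intro: ml_Ok)
next
  case cSig_D
  then show ?case by (auto intro!: ml_Ty_intros ml_code_intros intro: ml_Ok)
next
  case cPi_D
  then show ?case by (auto intro!: ml_Ty_intros ml_code_intros intro: ml_Ok)
next
  case cEq_D
  then show ?case by (auto intro!: ml_Ty_intros ml_code_intros intro: ml_Ok)
next
  case cSubU_D
  then show ?case by (auto intro!: ml_Ty_intros ml_code_intros intro: ml_Ok)
next
  case SubLift_D
  then show ?case by (auto intro!: ml_Ty_intros ml_code_intros intro: ml_Ok)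
next
  case uBase_D
  then show ?case by (auto intro!: ml_Ty_intros ml_code_intros intro: ml_Ok)
next
  case uN0_D
  then show ?case by (auto intro!: ml_Ty_intros ml_code_intros intro: ml_Ok)
next
  case uN1_D
  then show ?case by (auto intro!: ml_Ty_intros ml_code_intros intro: ml_Ok)
next
  case uNN_D
  then show ?case by (auto intro!: ml_Ty_intros ml_code_intros intro: ml_Ok)
next
  case uLst_D
  then show ?case by (auto intro!: ml_Ty_intros ml_code_intros intro: ml_Ok)
next
  case uCoprod_D
  then show ?case by (auto intro!: ml_Ty_intros ml_code_intros intro: ml_Ok)
next
  case uEq_D
  then show ?case by (auto intro!: ml_Ty_intros ml_code_intros intro: ml_Ok)
qed (auto simp: Ty_CT nf intro!: ml_Ty_intros intro: ml_ins1' ml_Ok ml_tl dest: ml_inv_Ty ml_hd)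

section \<open>Derived rules\<close>

abbreviation Fst :: "tm \<Rightarrow> tm" where "Fst t \<equiv> Split t (Var 1)"
abbreviation Snd :: "tm \<Rightarrow> tm" where "Snd t \<equiv> Split t (Var 0)"

lemma teq_Var: "T \<rhd> \<Gamma> \<turnstile> Ok \<Longrightarrow> teq T \<Gamma> Var Var \<Gamma>"
  using tsub_Var[of T \<Gamma>] by (auto simp: teq_def tsub_def intro: ml.tm_refl)

lemma teq_Cons: "teq T \<Gamma> \<sigma> \<tau> \<Delta> \<Longrightarrow> T \<rhd> \<Gamma> \<turnstile> TmEq t u (sub \<sigma> A) \<Longrightarrow> teq T \<Gamma> (t ;; \<sigma>) (u ;; \<tau>) (A # \<Delta>)"
  by (auto simp: teq_def nth_Cons nf split: nat.splits)

lemma TyEq_repl1: "T \<rhd> A # \<Gamma> \<turnstile> Ty C \<Longrightarrow> T \<rhd> \<Gamma> \<turnstile> TmEq a b A \<Longrightarrow> T \<rhd> \<Gamma> \<turnstile> TyEq (sub (a ;; Var) C) (sub (b ;; Var) C)"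
  by (rule teq_Ty[OF teq_Cons[OF teq_Var]]) (auto dest: ml_Ok)

lemma TmEq_repl1: "T \<rhd> A # \<Gamma> \<turnstile> Tm c C \<Longrightarrow> T \<rhd> \<Gamma> \<turnstile> TmEq a b A \<Longrightarrow>
    T \<rhd> \<Gamma> \<turnstile> TmEq (sub (a ;; Var) c) (sub (b ;; Var) c) (sub (a ;; Var) C)"
  by (rule teq_Tm[OF teq_Cons[OF teq_Var]]) (auto dest: ml_Ok)

lemmas wk1_Ty = ml_wk1[where J="Ty A" for A, unfolded jsub.simps]
  and wk1_Tm = ml_wk1[where J="Tm a A" for a A, unfolded jsub.simps]
  and wk1_TyEq = ml_wk1[where J="TyEq A B" for A B, unfolded jsub.simps]
  and wk1_TmEq = ml_wk1[where J="TmEq a b A" for a b A, unfolded jsub.simps]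
  and ins1_Ty = ml_ins1[where J="Ty A" for A, unfolded jsub.simps]
  and ins1_Tm = ml_ins1[where J="Tm a A" for a A, unfolded jsub.simps]
  and ins1_TyEq = ml_ins1[where J="TyEq A B" for A B, unfolded jsub.simps]
  and ins2_Ty = ml_ins2[where J="Ty A" for A, unfolded jsub.simps]
  and ins2_Tm = ml_ins2[where J="Tm a A" for a A, unfolded jsub.simps]

locale mls =
  fixes T :: ml_theory
  assumes T: "T \<noteq> MLtt_cind"
begin

lemma presup_Tm: "T \<rhd> \<Gamma> \<turnstile> Tm a A \<Longrightarrow> T \<rhd> \<Gamma> \<turnstile> Ty A"
  and presup_TyEq: "T \<rhd> \<Gamma> \<turnstile> TyEq A B \<Longrightarrow> T \<rhd> \<Gamma> \<turnstile> Ty A" "T \<rhd> \<Gamma> \<turnstile> TyEq A B \<Longrightarrow> T \<rhd> \<Gamma> \<turnstile> Ty B"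
  and presup_TmEq: "T \<rhd> \<Gamma> \<turnstile> TmEq a b A \<Longrightarrow> T \<rhd> \<Gamma> \<turnstile> Tm a A" "T \<rhd> \<Gamma> \<turnstile> TmEq a b A \<Longrightarrow> T \<rhd> \<Gamma> \<turnstile> Tm b A"
  using presup[OF _ T] by force+

lemma Ty_SigD: "T \<rhd> \<Gamma> \<turnstile> Ty (Sig A B) \<Longrightarrow> T \<rhd> \<Gamma> \<turnstile> Ty A \<and> T \<rhd> A # \<Gamma> \<turnstile> Ty B"
  and Ty_PiD: "T \<rhd> \<Gamma> \<turnstile> Ty (Pi A B) \<Longrightarrow> T \<rhd> \<Gamma> \<turnstile> Ty A \<and> T \<rhd> A # \<Gamma> \<turnstile> Ty B"
  and Ty_DecD: "T \<rhd> \<Gamma> \<turnstile> Ty (Dec a) \<Longrightarrow> T \<rhd> \<Gamma> \<turnstile> Tm a Univ"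
  by (auto dest: ml_inv_Ty)

lemma Fst_I: assumes t: "T \<rhd> \<Gamma> \<turnstile> Tm t (Sig A B)" shows "T \<rhd> \<Gamma> \<turnstile> Tm (Fst t) A"
proof -
  have S: "T \<rhd> \<Gamma> \<turnstile> Ty (Sig A B)" and AB: "T \<rhd> \<Gamma> \<turnstile> Ty A" "T \<rhd> A # \<Gamma> \<turnstile> Ty B"
    using presup_Tm[OF t] Ty_SigD by auto
  show ?thesis
    using ml.Sig_E[OF wk1_Ty[OF AB(1) S] t, of "Var 1"] ml.var[OF ml.ok_ext[OF AB(2)], of 1]
    by (simp add: nf)
qed

lemma Fst_C:
  assumes "T \<rhd> A # \<Gamma> \<turnstile> Ty B" "T \<rhd> \<Gamma> \<turnstile> Tm a A" "T \<rhd> \<Gamma> \<turnstile> Tm b (ins 0 [a] B)"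
  shows "T \<rhd> \<Gamma> \<turnstile> TmEq (Fst (Pr a b)) a A"
  using ml.Sig_C[OF wk1_Ty[OF ml_hd[OF assms(1)] ml.Sig_F[OF ml_hd[OF assms(1)] assms(1)]] assms(2,3), of "Var 1"]
    ml.var[OF ml.ok_ext[OF assms(1)], of 1]
  by (simp add: nf)

text \<open>The motive \<open>B(fst z)\<close> becomes \<open>B(fst (x,y))\<close> at a pair;
  replacement along the computation rule for \<open>fst\<close> converts it to the type
  \<open>B(x)\<close> of the second component.\<close>

lemma Snd_aux:
  assumes S: "T \<rhd> A # \<Gamma> \<turnstile> Ty B"
  shows "T \<rhd> Sig A B # \<Gamma> \<turnstile> Ty (sub (Fst (Var 0) ;; up (Suc 0)) B)" (is ?C)
    and "T \<rhd> B # A # \<Gamma> \<turnstile> Tm (Var 0) (ins 2 [Pr (Var 1) (Var 0)] (sub (Fst (Var 0) ;; up (Suc 0)) B))" (is ?D)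
proof -
  note A = ml_hd[OF S]
  note G = ml.Sig_F[OF A S]
  have f: "T \<rhd> Sig A B # \<Gamma> \<turnstile> Tm (Fst (Var 0)) (sub (up (Suc 0)) A)"
    using Fst_I[of _ "Var 0" "sub (up (Suc 0)) A"] ml_var0[OF G] by simp
  show ?C
    using tsub_Ty[OF tsub_Cons[OF tsub_up1[OF G] f] S] by simp
  let ?G = "B # A # \<Gamma>"
  note ok = ml.ok_ext[OF S]
  have t: "tsub T ?G (up (Suc (Suc 0))) \<Gamma>" by (intro tsub_upS S tsub_up1 A)
  have v: "T \<rhd> ?G \<turnstile> Tm (Var 1) (sub (up (Suc (Suc 0))) A)" "T \<rhd> ?G \<turnstile> Tm (Var 0) (sub (up (Suc 0)) B)"
    using ml.var[OF ok, of 1] ml.var[OF ok, of 0] by (simp_all add: nf)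
  have "T \<rhd> ?G \<turnstile> TmEq (Fst (Pr (Var 1) (Var 0))) (Var 1) (sub (up (Suc (Suc 0))) A)"
    by (rule Fst_C[OF tsub_Ty[OF tsub_under[OF t A] S]]) (use v in \<open>simp_all add: nf\<close>)
  then have "T \<rhd> ?G \<turnstile> TyEq (sub (Fst (Pr (Var 1) (Var 0)) ;; up (Suc (Suc 0))) B) (sub (Var 1 ;; up (Suc (Suc 0))) B)"
    using S t by (intro teq_Ty[OF teq_Cons S]) (auto simp: teq_def tsub_def intro: ml.tm_refl)
  then show ?D using v(2) by (auto simp: nf intro: ml.conv ml.ty_sym)
qed

lemma Snd_I:
  assumes t: "T \<rhd> \<Gamma> \<turnstile> Tm t (Sig A B)" shows "T \<rhd> \<Gamma> \<turnstile> Tm (Snd t) (ins 0 [Fst t] B)"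
proof -
  have S: "T \<rhd> A # \<Gamma> \<turnstile> Ty B" using presup_Tm[OF t] Ty_SigD by auto
  show ?thesis using ml.Sig_E[OF Snd_aux(1)[OF S] t Snd_aux(2)[OF S]] by (simp add: nf)
qed

lemma Snd_C:
  assumes "T \<rhd> A # \<Gamma> \<turnstile> Ty B" "T \<rhd> \<Gamma> \<turnstile> Tm a A" "T \<rhd> \<Gamma> \<turnstile> Tm b (ins 0 [a] B)"
  shows "T \<rhd> \<Gamma> \<turnstile> TmEq (Snd (Pr a b)) b (ins 0 [a] B)"
proof -
  have "T \<rhd> \<Gamma> \<turnstile> TyEq (ins 0 [Fst (Pr a b)] B) (ins 0 [a] B)"
    using TyEq_repl1[OF assms(1) Fst_C[OF assms]] by (simp add: nf)
  then show ?thesis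
    using ml.Sig_C[OF Snd_aux(1)[OF assms(1)] assms(2,3) Snd_aux(2)[OF assms(1)]]
    by (auto simp: nf intro: ml.conv_eq)
qed

lemma Fst_prod: "T \<rhd> \<Gamma> \<turnstile> Tm t (prod A B) \<Longrightarrow> T \<rhd> \<Gamma> \<turnstile> Tm (Fst t) A"
  by (rule Fst_I)

lemma Snd_prod: "T \<rhd> \<Gamma> \<turnstile> Tm t (prod A B) \<Longrightarrow> T \<rhd> \<Gamma> \<turnstile> Tm (Snd t) B"
  using Snd_I[of \<Gamma> t A "sh 1 B"] by (simp add: nf)

lemma Pr_prod: "T \<rhd> \<Gamma> \<turnstile> Tm a A \<Longrightarrow> T \<rhd> \<Gamma> \<turnstile> Tm b B \<Longrightarrow> T \<rhd> \<Gamma> \<turnstile> Tm (Pr a b) (prod A B)"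
  using ml.Sig_I[of T A \<Gamma> "sh 1 B" a b] wk1_Ty[OF presup_Tm presup_Tm, of \<Gamma> b B a A] by (simp add: nf)

lemma App_arr: "T \<rhd> \<Gamma> \<turnstile> Tm f (arr A B) \<Longrightarrow> T \<rhd> \<Gamma> \<turnstile> Tm a A \<Longrightarrow> T \<rhd> \<Gamma> \<turnstile> Tm (App f a) B"
  using ml.Pi_E[of T \<Gamma> f A "sh 1 B" a] by (simp add: nf)

lemma TyEq_prod: "T \<rhd> \<Gamma> \<turnstile> TyEq A A' \<Longrightarrow> T \<rhd> \<Gamma> \<turnstile> TyEq B B' \<Longrightarrow> T \<rhd> \<Gamma> \<turnstile> TyEq (prod A B) (prod A' B')"
  using wk1_TyEq[of T \<Gamma> B B' A] presup_TyEq by (auto simp: nf intro!: ml.Sig_cong)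

lemma TyEq_arr: "T \<rhd> \<Gamma> \<turnstile> TyEq A A' \<Longrightarrow> T \<rhd> \<Gamma> \<turnstile> TyEq B B' \<Longrightarrow> T \<rhd> \<Gamma> \<turnstile> TyEq (arr A B) (arr A' B')"
  using wk1_TyEq[of T \<Gamma> B B' A] presup_TyEq by (auto simp: nf intro!: ml.Pi_cong)

text \<open>Congruence is replacement in the open term \<open>App (Var 1) (Var 0)\<close>.
  \<open>TmEq_Fst\<close>, \<open>TmEq_Snd\<close>, \<open>TyEq_Dec\<close> and
  \<open>TyEq_SubDec\<close> are obtained in the same way; it reaches positions outside binders
  only.\<close>

lemma TmEq_App:
  assumes f: "T \<rhd> \<Gamma> \<turnstile> TmEq f g (Pi A B)" and a: "T \<rhd> \<Gamma> \<turnstile> TmEq a b A"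
  shows "T \<rhd> \<Gamma> \<turnstile> TmEq (App f a) (App g b) (ins 0 [a] B)"
proof -
  have P: "T \<rhd> \<Gamma> \<turnstile> Ty (Pi A B)" "T \<rhd> \<Gamma> \<turnstile> Ty A" using f presup_TmEq presup_Tm Ty_PiD by blast+
  have t: "teq T \<Gamma> (a ;; f ;; Var) (b ;; g ;; Var) (sub (up 1) A # Pi A B # \<Gamma>)"
    using f a by (intro teq_Cons teq_Var) (auto simp: nf dest: ml_Ok)
  have ok: "T \<rhd> sub (up 1) A # Pi A B # \<Gamma> \<turnstile> Ok"
    using ml.ok_ext[OF wk1_Ty[OF P(2,1)]] by simp
  have "T \<rhd> sub (up 1) A # Pi A B # \<Gamma> \<turnstile> Tm (Var 1) (Pi (sub (up 2) A) (sub (Var 0 ;; up 3) B))"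
    "T \<rhd> sub (up 1) A # Pi A B # \<Gamma> \<turnstile> Tm (Var 0) (sub (up 2) A)"
    using ml.var[OF ok, of 1] ml.var[OF ok, of 0] by (simp_all add: nf)
  from ml.Pi_E[OF this]
  have "T \<rhd> sub (up 1) A # Pi A B # \<Gamma> \<turnstile> Tm (App (Var 1) (Var 0)) (sub (Var 0 ;; up 2) B)"
    by (simp add: nf)
  from teq_Tm[OF t this] show ?thesis by (simp add: nf)
qed

lemma TmEq_Fst:
  assumes "T \<rhd> \<Gamma> \<turnstile> TmEq t u (Sig A B)" shows "T \<rhd> \<Gamma> \<turnstile> TmEq (Fst t) (Fst u) A"
proof -
  have S: "T \<rhd> \<Gamma> \<turnstile> Ty (Sig A B)" using assms presup_TmEq presup_Tm by blast
  have "T \<rhd> Sig A B # \<Gamma> \<turnstile> Tm (Fst (Var 0)) (sub (up (Suc 0)) A)"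
    using Fst_I[of _ "Var 0" "sub (up (Suc 0)) A"] ml_var0[OF S] by simp
  from TmEq_repl1[OF this assms] show ?thesis by (simp add: nf)
qed

lemma TmEq_Snd:
  assumes "T \<rhd> \<Gamma> \<turnstile> TmEq t u (Sig A B)" shows "T \<rhd> \<Gamma> \<turnstile> TmEq (Snd t) (Snd u) (ins 0 [Fst t] B)"
proof -
  have S: "T \<rhd> \<Gamma> \<turnstile> Ty (Sig A B)" using assms presup_TmEq presup_Tm by blast
  have "T \<rhd> Sig A B # \<Gamma> \<turnstile> Tm (Snd (Var 0)) (sub (Fst (Var 0) ;; up (Suc 0)) B)"
    using Snd_I[of _ "Var 0" "sub (up (Suc 0)) A" "sub (Var 0 ;; up (Suc (Suc 0))) B"] ml_var0[OF S] by (simp add: nf)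
  from TmEq_repl1[OF this assms] show ?thesis by (simp add: nf)
qed

text \<open>The motive consists of the functions from \<open>Q(y)\<close> to \<open>Q(x)\<close>,
  with the identity at reflexivity. The direction is from right to left because the identity proofs
  in \<open>ZsetT\<close> have the given point on the left and the reached point, where the data are
  available, on the right.\<close>

lemma transport:
  assumes e: "T \<rhd> \<Gamma> \<turnstile> Tm e (Eq A x y)" and Q: "T \<rhd> A # \<Gamma> \<turnstile> Ty Q" and u: "T \<rhd> \<Gamma> \<turnstile> Tm u (ins 0 [y] Q)"
  shows "T \<rhd> \<Gamma> \<turnstile> Tm (App (IdRec e (Lam (Var 0))) u) (ins 0 [x] Q)"
proof -
  have A: "T \<rhd> \<Gamma> \<turnstile> Ty A" and x: "T \<rhd> \<Gamma> \<turnstile> Tm x A" "T \<rhd> \<Gamma> \<turnstile> Tm y A"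
    using presup_Tm[OF e] by (auto dest: ml_inv_Ty)
  let ?Q = "\<lambda>t n. sub (t ;; up n) Q"
  let ?G2 = "sh 1 A # A # \<Gamma>" let ?G = "Eq (sh 2 A) (Var 1) (Var 0) # ?G2"
  have G2: "T \<rhd> ?G2 \<turnstile> Ok" using ml.ok_ext[OF wk1_Ty[OF A A]] by (simp add: nf)
  have t: "tsub T ?G2 (up 2) \<Gamma>" using tsub_upS[OF wk1_Ty[OF A A] tsub_up1[OF A]] by (simp add: nf)
  have "T \<rhd> ?G2 \<turnstile> Tm (Var 1) (sh 2 A)" "T \<rhd> ?G2 \<turnstile> Tm (Var 0) (sh 2 A)" "T \<rhd> ?G2 \<turnstile> Ty (sh 2 A)"
    using ml.var[OF G2, of 1] ml.var[OF G2, of 0] tsub_Ty[OF t A] by (simp_all add: nf)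
  then have E: "T \<rhd> ?G2 \<turnstile> Ty (Eq (sh 2 A) (Var 1) (Var 0))" by (intro ml.Eq_F)
  have G: "T \<rhd> ?G \<turnstile> Ok" by (rule ml.ok_ext[OF E])
  have t': "tsub T ?G (up 3) \<Gamma>" using tsub_upS[OF E, of "2"] t by (simp add: numeral_eq_Suc)
  have q: "T \<rhd> ?G \<turnstile> Ty (?Q (Var 1) 3)" "T \<rhd> ?G \<turnstile> Ty (?Q (Var 2) 3)"
    using ml.var[OF G, of 1] ml.var[OF G, of 2] tsub_Ty[OF tsub_Cons[OF t'] Q, of "Var 1"]
      tsub_Ty[OF tsub_Cons[OF t'] Q, of "Var 2"] by (simp_all add: nf)
  have C: "T \<rhd> ?G \<turnstile> Ty (arr (?Q (Var 1) 3) (?Q (Var 2) 3))" by (rule Ty_arr[OF q])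
  have "T \<rhd> A # \<Gamma> \<turnstile> Tm (Lam (Var 0)) (ins 1 [Rfl (Var 0), Var 0, Var 0] (arr (?Q (Var 1) 3) (?Q (Var 2) 3)))"
    using ml.Pi_I[OF ml_var0[OF Q]] Q by (simp add: nf)
  from ml.Eq_E[OF C x e this] have "T \<rhd> \<Gamma> \<turnstile> Tm (IdRec e (Lam (Var 0))) (arr (ins 0 [y] Q) (ins 0 [x] Q))"
    by (simp add: nf)
  from App_arr[OF this u] show ?thesis .
qed

end

section \<open>The propositional function \<open>W_max(V)\<close>\<close>

lemma sub_UIC_index [simp]: "sub \<sigma> (UIC_index s i) = UIC_index (sub \<sigma> s) (sub (under 1 \<sigma>) i)"
  by (simp add: UIC_index_def nf)

lemma sub_UIC_family [simp]: "sub (Var 0 ;; (up (Suc 0) \<odot> \<sigma>)) (UIC_family s i c) =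
    UIC_family (sub \<sigma> s) (sub (under 1 \<sigma>) i) (sub (under 2 \<sigma>) c)"
  by (simp add: UIC_family_def nf)

lemma sub_UIC_family' [simp]:
  "sub (Var 0 ;; up (Suc n)) (UIC_family s i c) =
    UIC_family (sub (up n) s) (sub (under 1 (up n)) i) (sub (under 2 (up n)) c)"
  using sub_UIC_family[of "up n" s i c] by (simp add: nf)

lemma sub_tau [simp]: "sub \<sigma> (tau s i c X) = tau (sub \<sigma> s) (sub (under 1 \<sigma>) i) (sub (under 2 \<sigma>) c) (sub \<sigma> X)"
  by (simp add: tau_def nf)

lemma sub_incl [simp]: "sub \<sigma> (incl s X Y) = incl (sub \<sigma> s) (sub \<sigma> X) (sub \<sigma> Y)"
  by (simp add: incl_def nf)

lemma sub_Wmax: "sub \<sigma> (Wmax s i c v) = Wmax (sub \<sigma> s) (sub (under 1 \<sigma>) i) (sub (under 2 \<sigma>) c) (sub \<sigma> v)"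
  by (simp add: Wmax_def UIC_family_def Let_def nf)

text \<open>The function \<open>Z'\<close> of \<open>Wmax\<close>, and the types decoding \<open>x \<epsilon> \<tau>(X)\<close>, \<open>X \<subseteq> Y\<close> and \<open>a \<epsilon> W_max(V)\<close>.\<close>

definition Zfun :: "tm \<Rightarrow> tm \<Rightarrow> tm \<Rightarrow> tm" where
  "Zfun a b Z = Lam (SubLift (sh 1 a) (lift 1 1 b) (App (sh 1 Z) (Var 0)))"

definition tauT :: "tm \<Rightarrow> tm \<Rightarrow> tm \<Rightarrow> tm \<Rightarrow> tm \<Rightarrow> tm" where
  "tauT s i c X x = prod (eps x X) (Pi (Dec (ins 0 [x] i)) (Sig (Dec (sh 1 s))
     (prod (eps (Var 0) (ins 2 [Var 1, sh 2 x] c)) (eps (Var 0) (sh 2 X)))))"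

definition inclT :: "tm \<Rightarrow> tm \<Rightarrow> tm \<Rightarrow> tm" where
  "inclT s X Y = Pi (Dec s) (arr (eps (Var 0) (sh 1 X)) (eps (Var 0) (sh 1 Y)))"

definition posT :: "tm \<Rightarrow> tm \<Rightarrow> tm \<Rightarrow> tm \<Rightarrow> tm \<Rightarrow> tm \<Rightarrow> tm" where
  "posT s i c v Z' x = prod (eps x Z') (prod
     (Pi (Dec s) (arr (eps (Var 0) (sh 1 Z'))
        (tauT (sh 1 s) (lift 1 1 i) (lift 1 2 c) (sh 1 Z') (Var 0))))
     (inclT s Z' v))"

lemma sub_Zfun [simp]: "sub \<sigma> (Zfun a b Z) = Zfun (sub \<sigma> a) (sub (under 1 \<sigma>) b) (sub \<sigma> Z)"
  by (simp add: Zfun_def nf)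

lemma sub_tauT [simp]: "sub \<sigma> (tauT s i c X x) =
    tauT (sub \<sigma> s) (sub (under 1 \<sigma>) i) (sub (under 2 \<sigma>) c) (sub \<sigma> X) (sub \<sigma> x)"
  by (simp add: tauT_def nf)

lemma sub_posT [simp]: "sub \<sigma> (posT s i c v X x) =
    posT (sub \<sigma> s) (sub (under 1 \<sigma>) i) (sub (under 2 \<sigma>) c) (sub \<sigma> v) (sub \<sigma> X) (sub \<sigma> x)"
  by (simp add: posT_def inclT_def nf)

section \<open>Codes in the superuniverse and their decodings\<close>

context mls
begin

text \<open>There is no congruence rule for codes under binders. Codes are therefore described by
  their decodings, up to the judgmental equality of types, which is a congruence.\<close>

definition code :: "tm list \<Rightarrow> tm \<Rightarrow> tm \<Rightarrow> bool" where
  "code \<Gamma> t X \<longleftrightarrow> T \<rhd> \<Gamma> \<turnstile> Tm t Univ \<and> T \<rhd> \<Gamma> \<turnstile> TyEq (Dec t) X"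

lemma codeD: "code \<Gamma> t X \<Longrightarrow> T \<rhd> \<Gamma> \<turnstile> Tm t Univ" "code \<Gamma> t X \<Longrightarrow> T \<rhd> \<Gamma> \<turnstile> TyEq (Dec t) X"
  by (auto simp: code_def)

lemma code_self: "T \<rhd> \<Gamma> \<turnstile> Tm t Univ \<Longrightarrow> code \<Gamma> t (Dec t)"
  by (auto simp: code_def intro: ml.ty_refl ml.Dec_F)

lemma TyEq_Dec: "T \<rhd> \<Gamma> \<turnstile> TmEq t u Univ \<Longrightarrow> T \<rhd> \<Gamma> \<turnstile> TyEq (Dec t) (Dec u)"
  using TyEq_repl1[of T Univ \<Gamma> "Dec (Var 0)" t u] ml_var0[OF ml.Univ_F, of T \<Gamma>]
  by (auto simp: nf dest: ml_Ok intro: ml.Dec_F)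

lemma code_eq: "T \<rhd> \<Gamma> \<turnstile> TmEq t u Univ \<Longrightarrow> code \<Gamma> u X \<Longrightarrow> code \<Gamma> t X"
  by (auto simp: code_def intro: ml.ty_trans TyEq_Dec presup_TmEq)

lemma code_Sig: "code \<Gamma> a A \<Longrightarrow> code (Dec a # \<Gamma>) b B \<Longrightarrow> code \<Gamma> (cSig a b) (Sig A B)"
  by (auto simp: code_def intro: ml.cSig_I ml.ty_trans[OF ml.cSig_D] ml.Sig_cong)

lemma code_Pi: "code \<Gamma> a A \<Longrightarrow> code (Dec a # \<Gamma>) b B \<Longrightarrow> code \<Gamma> (cPi a b) (Pi A B)"
  by (auto simp: code_def intro: ml.cPi_I ml.ty_trans[OF ml.cPi_D] ml.Pi_cong)

lemma code_sub: "tsub T \<Gamma> \<sigma> \<Delta> \<Longrightarrow> code \<Delta> a A \<Longrightarrow> code \<Gamma> (sub \<sigma> a) (sub \<sigma> A)"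
  using tsub_Tm[of T \<Gamma> \<sigma> \<Delta> a Univ] tsub_TyEq[of T \<Gamma> \<sigma> \<Delta> "Dec a" A] by (simp add: code_def)

lemma code_And: "code \<Gamma> a A \<Longrightarrow> code \<Gamma> b B \<Longrightarrow> code \<Gamma> (cAnd a b) (prod A B)"
proof -
  assume a: "code \<Gamma> a A" and b: "code \<Gamma> b B"
  have "code (Dec a # \<Gamma>) (sh 1 b) (sh 1 B)"
    using code_sub[OF tsub_up1[OF ml.Dec_F[OF codeD(1)[OF a]]] b] by (simp add: nf)
  with a show ?thesis by (rule code_Sig)
qed

lemma code_Imp: "code \<Gamma> a A \<Longrightarrow> code \<Gamma> b B \<Longrightarrow> code \<Gamma> (cImp a b) (arr A B)"
proof -
  assume a: "code \<Gamma> a A" and b: "code \<Gamma> b B"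
  have "code (Dec a # \<Gamma>) (sh 1 b) (sh 1 B)"
    using code_sub[OF tsub_up1[OF ml.Dec_F[OF codeD(1)[OF a]]] b] by (simp add: nf)
  with a show ?thesis by (rule code_Pi)
qed

lemma code_App: "T \<rhd> \<Gamma> \<turnstile> Tm v (arr A Univ) \<Longrightarrow> T \<rhd> \<Gamma> \<turnstile> Tm x A \<Longrightarrow> code \<Gamma> (App v x) (eps x v)"
  by (rule code_self[OF App_arr])

lemma code_SubLift: "ufam (ml T) T \<Gamma> a b \<Longrightarrow> T \<rhd> \<Gamma> \<turnstile> Tm t (SubU a b) \<Longrightarrow> code \<Gamma> (SubLift a b t) (SubDec a b t)"
  by (auto simp: code_def intro: ml.SubLift_I ml.SubLift_D)

lemma TmEq_beta: "T \<rhd> A # \<Gamma> \<turnstile> Tm b (sh 1 B) \<Longrightarrow> T \<rhd> \<Gamma> \<turnstile> Tm a A \<Longrightarrow> T \<rhd> \<Gamma> \<turnstile> TmEq (App (Lam b) a) (ins 0 [a] b) B"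
  using ml.Pi_C[of T A \<Gamma> b "sh 1 B" a] by (simp add: nf)

lemma code_Coprod: "code \<Gamma> a A \<Longrightarrow> code \<Gamma> b B \<Longrightarrow> code \<Gamma> (cCoprod a b) (Coprod A B)"
  by (auto simp: code_def intro: ml.cSum_I ml.ty_trans[OF ml.cSum_D] ml.Sum_cong)

lemma Ty_Univ: "T \<rhd> \<Gamma> \<turnstile> J \<Longrightarrow> T \<rhd> \<Gamma> \<turnstile> Ty Univ"
  by (rule ml.Univ_F[OF ml_Ok])

lemma When_var:
  assumes c: "T \<rhd> A # \<Gamma> \<turnstile> Tm c Univ" and d: "T \<rhd> B # \<Gamma> \<turnstile> Tm d Univ"
  shows "T \<rhd> Coprod A B # \<Gamma> \<turnstile> Tm (When (Var 0) (lift 1 1 c) (lift 1 1 d)) Univ"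
proof -
  have AB: "T \<rhd> \<Gamma> \<turnstile> Ty (Coprod A B)" using ml.Sum_F[OF ml_hd[OF c] ml_hd[OF d]] .
  note up = tsub_up1[OF AB]
  note v = ml_var0[OF AB]
  show ?thesis
    using ml.Sum_E[of T "sh 1 A" "sh 1 B" "Coprod A B # \<Gamma>" Univ "Var 0" "lift 1 1 c" "lift 1 1 d"] v
      Ty_Univ[OF ml.ok_ext[OF tsub_Ty[OF up AB]]]
      tsub_Tm[OF tsub_under[OF up ml_hd[OF c]] c] tsub_Tm[OF tsub_under[OF up ml_hd[OF d]] d]
    by (simp add: nf)
qed

lemma When_InL:
  assumes c: "T \<rhd> A # \<Gamma> \<turnstile> Tm c Univ" and d: "T \<rhd> B # \<Gamma> \<turnstile> Tm d Univ" and a: "T \<rhd> \<Gamma> \<turnstile> Tm a A"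
  shows "T \<rhd> \<Gamma> \<turnstile> TmEq (When (InL a) c d) (ins 0 [a] c) Univ"
  using ml.Sum_C1[OF Ty_Univ[OF ml.ok_ext[OF ml.Sum_F[OF ml_hd[OF c] ml_hd[OF d]]]] a, of c d] c d
  by (simp add: nf)

lemma When_InR:
  assumes c: "T \<rhd> A # \<Gamma> \<turnstile> Tm c Univ" and d: "T \<rhd> B # \<Gamma> \<turnstile> Tm d Univ" and b: "T \<rhd> \<Gamma> \<turnstile> Tm b B"
  shows "T \<rhd> \<Gamma> \<turnstile> TmEq (When (InR b) c d) (ins 0 [b] d) Univ"
  using ml.Sum_C2[OF Ty_Univ[OF ml.ok_ext[OF ml.Sum_F[OF ml_hd[OF c] ml_hd[OF d]]]] b, of c d] c d
  by (simp add: nf)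

lemma Split_nd:
  assumes "T \<rhd> \<Gamma> \<turnstile> Tm t (Sig A B)" "T \<rhd> B # A # \<Gamma> \<turnstile> Tm c Univ"
  shows "T \<rhd> \<Gamma> \<turnstile> Tm (Split t c) Univ"
  using ml.Sig_E[OF Ty_Univ[OF ml.ok_ext[OF presup_Tm[OF assms(1)]]] assms(1), of c] assms(2)
  by (simp add: nf)

section \<open>The universe of the components of an axiom-set\<close>

definition UIC_type :: "tm \<Rightarrow> tm \<Rightarrow> tm" where
  "UIC_type s i = Coprod N1 (Coprod (Dec s) (Sig (Dec s) (Sig (Dec i) (Dec (sh 2 s)))))"

lemma UIC_ufam:
  assumes ax: "axset (ml T) \<Gamma> s i c v"
  shows "ufam (ml T) T \<Gamma> (UIC_index s i) (UIC_family s i c)" (is ?ufam)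
    and "T \<rhd> \<Gamma> \<turnstile> TyEq (Dec (UIC_index s i)) (UIC_type s i)" (is ?B)
    and "T \<rhd> \<Gamma> \<turnstile> TmEq (ins 0 [InL Star] (UIC_family s i c)) s Univ" (is ?C)
    and "T \<rhd> \<Gamma> \<turnstile> Tm x (Dec s) \<Longrightarrow> T \<rhd> \<Gamma> \<turnstile> TmEq (ins 0 [InR (InL x)] (UIC_family s i c)) (ins 0 [x] i) Univ" (is "_ \<Longrightarrow> ?D")
proof -
  let ?A = "Dec s" and ?I = "Dec i" and ?S = "Sig (Dec s) (Sig (Dec i) (Dec (sh 2 s)))"
  \<comment> \<open>The family is assembled from its innermost branch outwards. Each
    \<open>When_var\<close> weakens its branches by one variable, so two of them turn the
    \<open>ins 5\<close> here into the \<open>ins 7\<close> of \<open>UIC_family\<close>.\<close>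
  let ?G = "Split (Var 0) (Split (Var 0) (App (ins 5 [Var 1, Var 3] c) (Var 0)))"
  have A: "T \<rhd> \<Gamma> \<turnstile> Ty ?A" and I: "T \<rhd> ?A # \<Gamma> \<turnstile> Ty ?I" using ax by (auto intro: ml.Dec_F)
  have t2: "tsub T (?I # ?A # \<Gamma>) (up 2) \<Gamma>"
    using tsub_upS[OF I tsub_up1[OF A]] by (simp add: numeral_2_eq_2)
  have s2: "T \<rhd> ?I # ?A # \<Gamma> \<turnstile> Tm (sh 2 s) Univ" using tsub_Tm[OF t2, of s Univ] ax by (simp add: nf)
  have "code \<Gamma> (UIC_index s i) (UIC_type s i)"
    unfolding UIC_index_def UIC_type_def using ax s2
    by (intro code_Coprod code_Sig code_self) (auto simp: code_def intro: ml.cN1_I ml.cN1_D ml_Ok)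
  then have idx: "T \<rhd> \<Gamma> \<turnstile> Tm (UIC_index s i) Univ" and B: ?B by (simp_all add: code_def)
  show ?B by (rule B)
  have I1: "T \<rhd> \<Gamma> \<turnstile> Ty (Sig ?A (Sig ?I (Dec (sh 2 s))))" and I2: "T \<rhd> ?A # \<Gamma> \<turnstile> Ty (Sig ?I (Dec (sh 2 s)))"
    using A I s2 by (auto intro: ml.Sig_F ml.Dec_F)
  let ?u1 = "up (Suc 0)" let ?\<Gamma>1 = "?S # \<Gamma>"
  let ?B1 = "sub (Var 0 ;; up 2) (Sig ?I (Dec (sh 2 s)))" let ?\<Gamma>3 = "?B1 # sub ?u1 ?A # ?\<Gamma>1"
  note u1 = tsub_up1[OF I1]
  note u1' = tsub_under[OF u1 A]
  have B1: "T \<rhd> sub ?u1 ?A # ?\<Gamma>1 \<turnstile> Ty ?B1" using tsub_Ty[OF u1' I2] by (simp add: nf)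
  note ok3 = ml.ok_ext[OF B1]
  have u3: "tsub T ?\<Gamma>3 (up 3) \<Gamma>"
    using tsub_upS[OF B1 tsub_upS[OF tsub_Ty[OF u1 A] u1]] by (simp add: numeral_3_eq_3)
  have "T \<rhd> ?\<Gamma>3 \<turnstile> Tm (Var 1) (sub (up 3) ?A)" using ml.var[OF ok3, of 1] by (simp add: nf)
  then have u3': "tsub T ?\<Gamma>3 (Var 1 ;; up 3) (?A # \<Gamma>)" by (rule tsub_Cons[OF u3])
  note I3 = tsub_Ty[OF u3' I]
  note u4 = tsub_under[OF u3' I]
  note S4 = tsub_Ty[OF u4 ml.Dec_F[OF s2]]
  let ?\<Gamma>5 = "sub (Var 0 ;; (up (Suc 0) \<odot> (Var 1 ;; up 3))) (Dec (sh 2 s)) # sub (Var 1 ;; up 3) ?I # ?\<Gamma>3"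
  note ok5 = ml.ok_ext[OF S4]
  have u5: "tsub T ?\<Gamma>5 (Var 1 ;; Var 3 ;; up 5) (?I # ?A # \<Gamma>)"
    using tsub_up[OF u4 S4] by (simp add: nf)
  have "T \<rhd> ?\<Gamma>5 \<turnstile> Tm (App (ins 5 [Var 1, Var 3] c) (Var 0)) Univ"
    using tsub_Tm[OF u5, of c "arr (Dec (sh 2 s)) Univ"] ax ml.var[OF ok5, of 0]
    by (intro App_arr[of _ _ "Dec (sub (up 5) s)"]) (simp_all add: nf)
  moreover have "T \<rhd> ?\<Gamma>3 \<turnstile> Tm (Var 0) (Sig (sub (Var 1 ;; up 3) ?I) (sub (Var 0 ;; (up (Suc 0) \<odot> (Var 1 ;; up 3))) (Dec (sh 2 s))))"
    using ml.var[OF ok3, of 0] by (simp add: nf)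
  ultimately have "T \<rhd> ?\<Gamma>3 \<turnstile> Tm (Split (Var 0) (App (ins 5 [Var 1, Var 3] c) (Var 0))) Univ"
    by (rule Split_nd[rotated])
  moreover have "T \<rhd> ?\<Gamma>1 \<turnstile> Tm (Var 0) (Sig (sub ?u1 ?A) ?B1)"
    using ml_var0[OF I1] by (simp add: nf)
  ultimately have G: "T \<rhd> ?\<Gamma>1 \<turnstile> Tm ?G Univ" by (rule Split_nd[rotated])
  have i: "T \<rhd> ?A # \<Gamma> \<turnstile> Tm i Univ" using ax by simp
  let ?F = "When (Var 0) (lift 1 1 i) (lift 1 1 ?G)"
  have F: "T \<rhd> Coprod ?A ?S # \<Gamma> \<turnstile> Tm ?F Univ" by (rule When_var[OF i G])
  have s1: "T \<rhd> N1 # \<Gamma> \<turnstile> Tm (sh 1 s) Univ"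
    using wk1_Tm[OF _ ml.N1_F[OF ml_Ok[OF A]], of s Univ] ax by (simp add: nf)
  have fam: "UIC_family s i c = When (Var 0) (lift 1 1 (sh 1 s)) (lift 1 1 ?F)"
    by (simp add: UIC_family_def nf)
  have "T \<rhd> UIC_type s i # \<Gamma> \<turnstile> Tm (UIC_family s i c) Univ"
    unfolding fam UIC_type_def by (rule When_var[OF s1 F])
  \<comment> \<open>The family has been typed over the sum type itself and is moved to the decoding
    of its code.\<close>
  then show ?ufam
    using idx T ml_ctx_conv[OF tsub_conv_Var[OF tsub_Var[OF ml_Ok[OF A]] B ml.Dec_F[OF idx]]] by blast
  have star: "T \<rhd> \<Gamma> \<turnstile> Tm Star N1" using ml_Ok[OF A] by (rule ml.N1_I)
  show ?C using When_InL[OF s1 F star] by (simp add: fam nf)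
  assume x: "T \<rhd> \<Gamma> \<turnstile> Tm x (Dec s)"
  then have "T \<rhd> \<Gamma> \<turnstile> Tm (InL x) (Coprod ?A ?S)" using I1 by (intro ml.Sum_I1)
  from When_InR[OF s1 F this] When_InL[OF i G x] show ?D
    by (auto simp: fam nf intro: ml.tm_trans)
qed

section \<open>Decoding the propositional function \<open>Wmax\<close>\<close>

lemma code_Zfun:
  assumes u: "ufam (ml T) T \<Gamma> a b" and Z: "T \<rhd> \<Gamma> \<turnstile> Tm Z (arr A (SubU a b))"
  shows "T \<rhd> \<Gamma> \<turnstile> Tm (Zfun a b Z) (arr A Univ)"
    and "T \<rhd> \<Gamma> \<turnstile> Tm x A \<Longrightarrow> code \<Gamma> (App (Zfun a b Z) x) (SubDec a b (App Z x))"
proof -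
  have A: "T \<rhd> \<Gamma> \<turnstile> Ty A" using presup_Tm[OF Z] Ty_PiD by blast
  note up = tsub_up1[OF A]
  have "T \<rhd> A # \<Gamma> \<turnstile> Tm (App (sh 1 Z) (Var 0)) (SubU (sh 1 a) (lift 1 1 b))"
    using App_arr[of "A # \<Gamma>" "sh 1 Z" "sh 1 A" "sh 1 (SubU a b)" "Var 0"] tsub_Tm[OF up Z] ml_var0[OF A]
    by (simp add: nf)
  then have 1: "T \<rhd> A # \<Gamma> \<turnstile> Tm (SubLift (sh 1 a) (lift 1 1 b) (App (sh 1 Z) (Var 0))) Univ"
    using ml.SubLift_I ufam_sub[OF up u] by (simp add: nf)
  then show "T \<rhd> \<Gamma> \<turnstile> Tm (Zfun a b Z) (arr A Univ)"
    unfolding Zfun_def by (intro ml.Pi_I) (simp add: nf)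
  assume x: "T \<rhd> \<Gamma> \<turnstile> Tm x A"
  have "T \<rhd> \<Gamma> \<turnstile> TmEq (App (Zfun a b Z) x) (SubLift a b (App Z x)) Univ"
    using TmEq_beta[OF _ x, of "SubLift (sh 1 a) (lift 1 1 b) (App (sh 1 Z) (Var 0))" Univ] 1
    by (simp add: nf Zfun_def)
  then show "code \<Gamma> (App (Zfun a b Z) x) (SubDec a b (App Z x))"
    by (rule code_eq[OF _ code_SubLift[OF u App_arr[OF Z x]]])
qed

lemma code_tau_aux:
  assumes ax: "axset (ml T) \<Gamma> s i c v" and X: "T \<rhd> \<Gamma> \<turnstile> Tm X (arr (Dec s) Univ)"
  shows "code (Dec i # Dec s # \<Gamma>) (cSig (sh 2 s) (cAnd (App (sh 1 c) (Var 0)) (App (sh 3 X) (Var 0))))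
      (Sig (Dec (sh 2 s)) (prod (eps (Var 0) (sh 1 c)) (eps (Var 0) (sh 3 X))))"
proof -
  let ?A = "Dec s" and ?I = "Dec i"
  have A: "T \<rhd> \<Gamma> \<turnstile> Ty ?A" and I: "T \<rhd> ?A # \<Gamma> \<turnstile> Ty ?I" using ax by (auto intro: ml.Dec_F)
  note u1 = tsub_up1[OF A] note u2 = tsub_upS[OF I u1] note A2 = tsub_Ty[OF u2 A]
  note u3 = tsub_upS[OF A2 u2]
  let ?G3 = "sub (up (Suc (Suc 0))) ?A # ?I # ?A # \<Gamma>"
  note ok3 = ml.ok_ext[OF A2]
  have s2: "code (?I # ?A # \<Gamma>) (sh 2 s) (Dec (sh 2 s))"
    using tsub_Tm[OF u2, of s Univ] ax by (intro code_self) (simp add: nf)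
  have "code ?G3 (App (sh 1 c) (Var 0)) (eps (Var 0) (sh 1 c))"
    using tsub_Tm[OF tsub_up1[OF A2], of c "arr (Dec (sh 2 s)) Univ"] ax ml.var[OF ok3, of 0]
    by (intro code_App[of _ _ "Dec (sh 3 s)"]) (simp_all add: nf)
  moreover have "code ?G3 (App (sh 3 X) (Var 0)) (eps (Var 0) (sh 3 X))"
    using tsub_Tm[OF u3 X] ml.var[OF ok3, of 0]
    by (intro code_App[of _ _ "Dec (sh 3 s)"]) (simp_all add: nf)
  ultimately have "code ?G3 (cAnd (App (sh 1 c) (Var 0)) (App (sh 3 X) (Var 0))) (prod (eps (Var 0) (sh 1 c)) (eps (Var 0) (sh 3 X)))"
    by (rule code_And)
  then show ?thesis
    using code_Sig[OF s2, of "cAnd (App (sh 1 c) (Var 0)) (App (sh 3 X) (Var 0))"] by (simp add: nf)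
qed

lemma code_tau:
  assumes ax: "axset (ml T) \<Gamma> s i c v" and X: "T \<rhd> \<Gamma> \<turnstile> Tm X (arr (Dec s) Univ)" and x: "T \<rhd> \<Gamma> \<turnstile> Tm x (Dec s)"
  shows "code \<Gamma> (App (tau s i c X) x) (tauT s i c X x)"
proof -
  let ?A = "Dec s" and ?I = "Dec i"
  let ?B = "cAnd (App (sh 1 X) (Var 0)) (cPi i (cSig (sh 2 s) (cAnd (App (sh 1 c) (Var 0)) (App (sh 3 X) (Var 0)))))"
  have A: "T \<rhd> \<Gamma> \<turnstile> Ty ?A" using ax by (auto intro: ml.Dec_F)
  note u1 = tsub_up1[OF A]
  note S = code_tau_aux[OF ax X]
  have X1: "code (?A # \<Gamma>) (App (sh 1 X) (Var 0)) (eps (Var 0) (sh 1 X))"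
    using tsub_Tm[OF u1 X] ml_var0[OF A]
    by (intro code_App[of _ _ "Dec (sh 1 s)"]) (simp_all add: nf)
  have "code (?A # \<Gamma>) i ?I" using ax by (intro code_self) simp
  from code_And[OF X1 code_Pi[OF this S]] have 1: "code (?A # \<Gamma>) ?B
     (tauT (sh 1 s) (lift 1 1 i) (lift 1 2 c) (sh 1 X) (Var 0))"
    unfolding tauT_def by (simp add: nf)
  have "T \<rhd> \<Gamma> \<turnstile> TmEq (App (tau s i c X) x)
    (sub (x ;; Var) ?B) Univ"
    using TmEq_beta[OF _ x, of ?B Univ] codeD(1)[OF 1] by (simp add: nf tau_def)
  moreover have "tsub T \<Gamma> (x ;; Var) (?A # \<Gamma>)" using x ml_Ok[OF A] by (intro tsub_Cons tsub_Var) simp_all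
  from code_sub[OF this 1] have "code \<Gamma>
    (sub (x ;; Var) ?B)
    (tauT s i c X x)"
    by (simp add: nf)
  ultimately show ?thesis by (rule code_eq)
qed

lemma code_incl:
  assumes s: "T \<rhd> \<Gamma> \<turnstile> Tm s Univ" and X: "T \<rhd> \<Gamma> \<turnstile> Tm X (arr (Dec s) Univ)"
    and Y: "code (Dec s # \<Gamma>) (App (sh 1 Y) (Var 0)) Q"
  shows "code \<Gamma> (incl s X Y) (Pi (Dec s) (arr (eps (Var 0) (sh 1 X)) Q))"
proof -
  have A: "T \<rhd> \<Gamma> \<turnstile> Ty (Dec s)" using s by (rule ml.Dec_F)
  have "code (Dec s # \<Gamma>) (App (sh 1 X) (Var 0)) (eps (Var 0) (sh 1 X))"
    using tsub_Tm[OF tsub_up1[OF A] X] ml_var0[OF A]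
    by (intro code_App[of _ _ "Dec (sh 1 s)"]) (simp_all add: nf)
  from code_Pi[OF code_self[OF s] code_Imp[OF this Y]] show ?thesis unfolding incl_def .
qed

lemma code_pos:
  assumes ax: "axset (ml T) \<Gamma> s i c v" and X: "T \<rhd> \<Gamma> \<turnstile> Tm X (arr (Dec s) Univ)" and x: "T \<rhd> \<Gamma> \<turnstile> Tm x (Dec s)"
  shows "code \<Gamma> (cAnd (App X x) (cAnd (incl s X (tau s i c X)) (incl s X v))) (posT s i c v X x)"
proof -
  have A: "T \<rhd> \<Gamma> \<turnstile> Ty (Dec s)" using ax by (auto intro: ml.Dec_F)
  note u1 = tsub_up1[OF A]
  have 1: "code (Dec s # \<Gamma>) (App (sh 1 (tau s i c X)) (Var 0))
     (tauT (sh 1 s) (lift 1 1 i) (lift 1 2 c) (sh 1 X) (Var 0))"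
    using code_tau[OF axset_sub[OF u1 ax], of "sh 1 X" "Var 0"] tsub_Tm[OF u1 X] ml_var0[OF A]
    by (simp add: nf)
  have 2: "code (Dec s # \<Gamma>) (App (sh 1 v) (Var 0)) (eps (Var 0) (sh 1 v))"
    using tsub_Tm[OF u1, of v "arr (Dec s) Univ"] ax ml_var0[OF A]
    by (intro code_App[of _ _ "Dec (sh 1 s)"]) (simp_all add: nf)
  show ?thesis
    unfolding posT_def inclT_def
    using code_And[OF code_App[OF X x] code_And[OF code_incl[OF _ X 1] code_incl[OF _ X 2]]] ax by simp
qed

definition WmaxT :: "tm \<Rightarrow> tm \<Rightarrow> tm \<Rightarrow> tm \<Rightarrow> tm \<Rightarrow> tm" where
  "WmaxT s i c v x = (let a = UIC_index s i; b = UIC_family s i c in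
     Sig (arr (Dec s) (SubU a b)) (posT (sh 1 s) (lift 1 1 i) (lift 1 2 c) (sh 1 v)
       (Zfun (sh 1 a) (lift 1 1 b) (Var 0)) (sh 1 x)))"

text \<open>Beta exposes the code in the body of \<open>Wmax\<close>. Its decoding is computed over
  the bound variable and instantiated afterwards; elements of the decoding are then handled through
  \<open>WmaxT\<close>.\<close>

lemma Wmax:
  assumes ax: "axset (ml T) \<Gamma> s i c v"
  shows "T \<rhd> \<Gamma> \<turnstile> Tm (Wmax s i c v) (arr (Dec s) Univ)"
    and "T \<rhd> \<Gamma> \<turnstile> Tm x (Dec s) \<Longrightarrow> code \<Gamma> (App (Wmax s i c v) x) (WmaxT s i c v x)"
proof -
  let ?a = "UIC_index s i" and ?b = "UIC_family s i c"
  note u = UIC_ufam(1)[OF ax]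
  have A: "T \<rhd> \<Gamma> \<turnstile> Ty (Dec s)" using ax by (auto intro: ml.Dec_F)
  note u1 = tsub_up1[OF A]
  have cc: "code \<Gamma> (cSubU ?a ?b) (SubU ?a ?b)"
    using u by (auto simp: code_def intro: ml.cSubU_I ml.cSubU_D)
  have F: "code (Dec s # \<Gamma>) (cImp (sh 1 s) (sh 1 (cSubU ?a ?b))) (arr (Dec (sh 1 s)) (sh 1 (SubU ?a ?b)))"
    using tsub_Tm[OF u1, of s Univ] ax code_Imp[OF code_self code_sub[OF u1 cc], of "sh 1 s"] by (simp add: nf)
  let ?F = "Dec (cImp (sh 1 s) (sh 1 (cSubU ?a ?b)))"
  let ?G = "?F # Dec s # \<Gamma>"
  have F': "T \<rhd> Dec s # \<Gamma> \<turnstile> Ty ?F" using codeD(1)[OF F] by (rule ml.Dec_F)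
  note u2 = tsub_upS[OF F' u1]
  \<comment> \<open>The type of the bound variable is the decoding of a code, so it becomes a
    function only by conversion.\<close>
  have v0: "T \<rhd> ?G \<turnstile> Tm (Var 0) (arr (Dec (sh 2 s)) (SubU (sh 2 ?a) (lift 2 1 ?b)))"
    using ml.conv[OF ml_var0[OF F'] tsub_TyEq[OF tsub_up1[OF F'] codeD(2)[OF F]]]
    by (simp add: nf UIC_family_def)
  have v1: "T \<rhd> ?G \<turnstile> Tm (Var 1) (Dec (sh 2 s))"
    using ml.var[OF ml.ok_ext[OF F'], of 1] by (simp add: nf)
  let ?Z = "Zfun (sh 2 ?a) (lift 2 1 ?b) (Var 0)"
  have Z: "T \<rhd> ?G \<turnstile> Tm ?Z (arr (Dec (sh 2 s)) Univ)"
    using code_Zfun(1)[OF _ v0] ufam_sub[OF u2 u] by (simp add: nf)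
  have "code ?G (cAnd (App ?Z (Var 1)) (cAnd (incl (sh 2 s) ?Z (tau (sh 2 s) (lift 2 1 i) (lift 2 2 c) ?Z))
        (incl (sh 2 s) ?Z (sh 2 v)))) (posT (sh 2 s) (lift 2 1 i) (lift 2 2 c) (sh 2 v) ?Z (Var 1))"
    using code_pos[OF axset_sub[OF u2 ax], of ?Z "Var 1"] Z v1 by (simp add: nf)
  from code_Sig[OF F this]
  have 1: "code (Dec s # \<Gamma>) (cSig (cImp (sh 1 s) (sh 1 (cSubU ?a ?b))) (cAnd (App ?Z (Var 1)) (cAnd (incl (sh 2 s) ?Z (tau (sh 2 s) (lift 2 1 i) (lift 2 2 c) ?Z))
        (incl (sh 2 s) ?Z (sh 2 v))))) (WmaxT (sh 1 s) (lift 1 1 i) (lift 1 2 c) (sh 1 v) (Var 0))" (is "code _ ?B _")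
    by (simp add: nf WmaxT_def Let_def)
  have W: "Wmax s i c v = Lam ?B" by (simp add: nf Wmax_def Let_def Zfun_def UIC_family_def)
  show "T \<rhd> \<Gamma> \<turnstile> Tm (Wmax s i c v) (arr (Dec s) Univ)"
    unfolding W using codeD(1)[OF 1] by (intro ml.Pi_I) (simp add: nf)
  assume x: "T \<rhd> \<Gamma> \<turnstile> Tm x (Dec s)"
  have "T \<rhd> \<Gamma> \<turnstile> TmEq (App (Wmax s i c v) x) (sub (x ;; Var) ?B) Univ"
    unfolding W using TmEq_beta[OF _ x, of ?B Univ] codeD(1)[OF 1] by (simp add: nf)
  moreover have "tsub T \<Gamma> (x ;; Var) (Dec s # \<Gamma>)" using x ml_Ok[OF A] by (intro tsub_Cons tsub_Var) simp_all
  from code_sub[OF this 1] have "code \<Gamma> (sub (x ;; Var) ?B) (WmaxT s i c v x)"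
    by (simp add: nf WmaxT_def Let_def UIC_family_def)
  ultimately show "code \<Gamma> (App (Wmax s i c v) x) (WmaxT s i c v x)" by (rule code_eq)
qed

end

section \<open>The rules of positivity relations\<close>

text \<open>This is \<open>UIC_family\<close> with arguments already weakened by the index variable.
  In this form every substitution that keeps variable 0 passes through, also one that does not have
  the form \<open>under 1 \<sigma>\<close>.\<close>

definition ufm :: "tm \<Rightarrow> tm \<Rightarrow> tm \<Rightarrow> tm" where
  "ufm s i c =
     When (Var 0) (sh 1 s)
       (When (Var 0) (lift 1 1 i)
         (Split (Var 0) (Split (Var 0) (App (ins 6 [Var 1, Var 3] c) (Var 0)))))"

lemma UIC_family_ufm: "UIC_family s i c = ufm (sh 1 s) (lift 1 1 i) (lift 1 2 c)"
  by (simp add: UIC_family_def ufm_def nf)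

lemma sub_ufm: "sub (Var 0 ;; \<sigma>) (ufm s i c) =
    ufm (sub (Var 0 ;; \<sigma>) s) (sub (under 1 (Var 0 ;; \<sigma>)) i) (sub (under 2 (Var 0 ;; \<sigma>)) c)"
  by (simp add: ufm_def nf)

lemmas nfu = nf UIC_family_ufm sub_ufm

text \<open>An element of \<open>W_max(V)\<close> at \<open>a\<close> has the form
  \<open>(Z, (p, (t, u)))\<close>, where \<open>p\<close> proves \<open>a \<epsilon> Z\<close>,
  \<open>t\<close> that \<open>Z\<close> is contained in \<open>\<tau>(Z)\<close>, and
  \<open>u\<close> that \<open>Z\<close> is contained in \<open>V\<close>. \<open>pos1\<close>
  applies \<open>u\<close>.\<close>

definition pos1 :: "tm \<Rightarrow> tm \<Rightarrow> tm" where
  "pos1 a q = App (App (Snd (Snd (Snd q))) a) (Fst (Snd q))"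

text \<open>\<open>w\<close> consists of the successor of \<open>a\<close> that \<open>t\<close>
  yields for \<open>j\<close> and its two proofs. The successor lies in the same \<open>Z\<close>,
  so \<open>Z\<close>, \<open>t\<close> and \<open>u\<close> are reused as evidence for it.\<close>

definition pos2 :: "tm \<Rightarrow> tm \<Rightarrow> tm \<Rightarrow> tm" where
  "pos2 a j q = (let w = App (Snd (App (App (Fst (Snd (Snd q))) a) (Fst (Snd q)))) j
     in Pr (Fst w) (Pr (Fst (Snd w)) (Pr (Fst q) (Pr (Snd (Snd w)) (Snd (Snd q))))))"

context mls
begin

lemma Wmax_elim:
  assumes ax: "axset (ml T) \<Gamma> s i c v" and a: "T \<rhd> \<Gamma> \<turnstile> Tm a (Dec s)"
    and q: "T \<rhd> \<Gamma> \<turnstile> Tm q (eps a (Wmax s i c v))"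
  shows "T \<rhd> \<Gamma> \<turnstile> Tm (Fst q) (arr (Dec s) (SubU (UIC_index s i) (UIC_family s i c)))"
    and "T \<rhd> \<Gamma> \<turnstile> Tm (Snd q) (posT s i c v (Zfun (UIC_index s i) (UIC_family s i c) (Fst q)) a)"
proof -
  have q: "T \<rhd> \<Gamma> \<turnstile> Tm q (WmaxT s i c v a)"
    using q codeD(2)[OF Wmax(2)[OF ax a]] by (rule ml.conv)
  show "T \<rhd> \<Gamma> \<turnstile> Tm (Fst q) (arr (Dec s) (SubU (UIC_index s i) (UIC_family s i c)))"
    using Fst_I[OF q[unfolded WmaxT_def Let_def]] .
  show "T \<rhd> \<Gamma> \<turnstile> Tm (Snd q) (posT s i c v (Zfun (UIC_index s i) (UIC_family s i c) (Fst q)) a)"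
    using Snd_I[OF q[unfolded WmaxT_def Let_def]] by (simp add: nfu)
qed

lemma Wmax_intro:
  assumes ax: "axset (ml T) \<Gamma> s i c v" and a: "T \<rhd> \<Gamma> \<turnstile> Tm a (Dec s)"
    and Z: "T \<rhd> \<Gamma> \<turnstile> Tm Z (arr (Dec s) (SubU (UIC_index s i) (UIC_family s i c)))"
    and p: "T \<rhd> \<Gamma> \<turnstile> Tm p (posT s i c v (Zfun (UIC_index s i) (UIC_family s i c) Z) a)"
  shows "T \<rhd> \<Gamma> \<turnstile> Tm (Pr Z p) (eps a (Wmax s i c v))"
proof -
  note W = codeD(2)[OF Wmax(2)[OF ax a]]
  have "T \<rhd> \<Gamma> \<turnstile> Tm (Pr Z p) (WmaxT s i c v a)"
    using ml.Sig_I[OF _ Z, of _ p] Ty_SigD[OF presup_TyEq(2)[OF W, unfolded WmaxT_def Let_def]] p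
    unfolding WmaxT_def Let_def by (simp add: nfu)
  then show ?thesis using ml.ty_sym[OF W] by (rule ml.conv)
qed

lemma pos1_I:
  assumes ax: "axset (ml T) \<Gamma> s i c v" and a: "T \<rhd> \<Gamma> \<turnstile> Tm a (Dec s)"
    and q: "T \<rhd> \<Gamma> \<turnstile> Tm q (eps a (Wmax s i c v))"
  shows "T \<rhd> \<Gamma> \<turnstile> Tm (pos1 a q) (eps a v)"
proof -
  note p = Wmax_elim(2)[OF ax a q, unfolded posT_def]
  note h = ml.Pi_E[OF Snd_prod[OF Snd_prod[OF p], unfolded inclT_def] a]
  have "T \<rhd> \<Gamma> \<turnstile> Tm (App (Snd (Snd (Snd q))) a)
     (arr (eps a (Zfun (UIC_index s i) (UIC_family s i c) (Fst q))) (eps a v))"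
    using h by (simp add: nfu)
  from App_arr[OF this Fst_prod[OF p]] show ?thesis unfolding pos1_def .
qed

lemma pos2_I:
  assumes ax: "axset (ml T) \<Gamma> s i c v" and a: "T \<rhd> \<Gamma> \<turnstile> Tm a (Dec s)"
    and j: "T \<rhd> \<Gamma> \<turnstile> Tm j (Dec (ins 0 [a] i))" and q: "T \<rhd> \<Gamma> \<turnstile> Tm q (eps a (Wmax s i c v))"
  shows "T \<rhd> \<Gamma> \<turnstile> Tm (pos2 a j q) (Sig (Dec s) (prod (eps (Var 0) (sh 1 (ins 0 [j, a] c)))
      (eps (Var 0) (sh 1 (Wmax s i c v)))))"
proof -
  let ?Z = "Zfun (UIC_index s i) (UIC_family s i c) (Fst q)"
  note p = Wmax_elim(2)[OF ax a q, unfolded posT_def]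
  note H = Snd_prod[OF p]
  have "T \<rhd> \<Gamma> \<turnstile> Tm (App (Fst (Snd (Snd q))) a) (arr (eps a ?Z) (tauT s i c ?Z a))"
    using ml.Pi_E[OF Fst_prod[OF H] a] by (simp add: nfu)
  note h = App_arr[OF this Fst_prod[OF p], unfolded tauT_def]
  define w where "w = App (Snd (App (App (Fst (Snd (Snd q))) a) (Fst (Snd q)))) j"
  have w: "T \<rhd> \<Gamma> \<turnstile> Tm w (Sig (Dec s) (prod (eps (Var 0) (sh 1 (ins 0 [j, a] c))) (eps (Var 0) (sh 1 ?Z))))"
    using ml.Pi_E[OF Snd_prod[OF h] j] by (simp add: nfu w_def)
  note y = Fst_I[OF w]
  have w2: "T \<rhd> \<Gamma> \<turnstile> Tm (Snd w) (prod (eps (Fst w) (ins 0 [j, a] c)) (eps (Fst w) ?Z))"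
    using Snd_I[OF w] by (simp add: nfu)
  have "T \<rhd> \<Gamma> \<turnstile> Tm (Pr (Snd (Snd w)) (Snd (Snd q))) (posT s i c v ?Z (Fst w))"
    unfolding posT_def by (rule Pr_prod[OF Snd_prod[OF w2] H])
  from Pr_prod[OF Fst_prod[OF w2] Wmax_intro[OF ax y Wmax_elim(1)[OF ax a q] this]]
  have e: "T \<rhd> \<Gamma> \<turnstile> Tm (Pr (Fst (Snd w)) (Pr (Fst q) (Pr (Snd (Snd w)) (Snd (Snd q)))))
     (prod (eps (Fst w) (ins 0 [j, a] c)) (eps (Fst w) (Wmax s i c v)))" .
  have A: "T \<rhd> \<Gamma> \<turnstile> Ty (Dec s)" using ax by (auto intro: ml.Dec_F)
  have v0: "T \<rhd> Dec s # \<Gamma> \<turnstile> Tm (Var 0) (Dec (sh 1 s))" using ml_var0[OF A] by (simp add: nf)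
  have "T \<rhd> Dec s # \<Gamma> \<turnstile> Ty (eps (Var 0) (sh 1 (Wmax s i c v)))"
    using App_arr[OF _ v0, of "sh 1 (Wmax s i c v)" Univ] wk1_Tm[OF Wmax(1)[OF ax] A]
    by (intro ml.Dec_F) (simp add: nf)
  moreover have "T \<rhd> Dec s # \<Gamma> \<turnstile> Ty (eps (Var 0) (sh 1 (ins 0 [j, a] c)))"
    using presup_Tm[OF w] Ty_SigD by blast
  ultimately have "T \<rhd> Dec s # \<Gamma> \<turnstile> Ty (prod (eps (Var 0) (sh 1 (ins 0 [j, a] c))) (eps (Var 0) (sh 1 (Wmax s i c v))))"
    by (intro Ty_prod)
  from ml.Sig_I[OF this y] e show ?thesis
    unfolding pos2_def w_def[symmetric] Let_def by (simp add: nf)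
qed

lemma UIC_A:
  assumes ax: "axset (ml T) \<Gamma> s i c v"
  shows "T \<rhd> \<Gamma> \<turnstile> Tm (uFam (InL Star)) (SubU (UIC_index s i) (UIC_family s i c))"
    and "T \<rhd> \<Gamma> \<turnstile> TyEq (SubDec (UIC_index s i) (UIC_family s i c) (uFam (InL Star))) (Dec s)"
proof -
  note u = UIC_ufam(1,2)[OF ax]
  have "T \<rhd> \<Gamma> \<turnstile> Tm (InL Star) (UIC_type s i)"
    using presup_TyEq(2)[OF u(2)] unfolding UIC_type_def
    by (intro ml.Sum_I1 ml.N1_I) (auto dest: ml_inv_Ty ml_Ok)
  then have *: "T \<rhd> \<Gamma> \<turnstile> Tm (InL Star) (Dec (UIC_index s i))" by (rule ml.conv[OF _ ml.ty_sym[OF u(2)]])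
  then show "T \<rhd> \<Gamma> \<turnstile> Tm (uFam (InL Star)) (SubU (UIC_index s i) (UIC_family s i c))" using u(1) by (intro ml.uFam_I)
  show "T \<rhd> \<Gamma> \<turnstile> TyEq (SubDec (UIC_index s i) (UIC_family s i c) (uFam (InL Star))) (Dec s)"
    by (rule ml.ty_trans[OF ml.uFam_D[OF u(1) *] TyEq_Dec[OF UIC_ufam(3)[OF ax]]])
qed

lemma UIC_I:
  assumes ax: "axset (ml T) \<Gamma> s i c v" and x: "T \<rhd> \<Gamma> \<turnstile> Tm x (Dec s)"
  shows "T \<rhd> \<Gamma> \<turnstile> Tm (uFam (InR (InL x))) (SubU (UIC_index s i) (UIC_family s i c))"
    and "T \<rhd> \<Gamma> \<turnstile> TyEq (SubDec (UIC_index s i) (UIC_family s i c) (uFam (InR (InL x)))) (Dec (ins 0 [x] i))"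
proof -
  note u = UIC_ufam(1,2)[OF ax]
  have 1: "T \<rhd> \<Gamma> \<turnstile> Ty N1" "T \<rhd> \<Gamma> \<turnstile> Ty (Coprod (Dec s) (Sig (Dec s) (Sig (Dec i) (Dec (sh 2 s)))))"
    using ml_inv_Ty[OF presup_TyEq(2)[OF u(2), unfolded UIC_type_def]] by simp_all
  have "T \<rhd> \<Gamma> \<turnstile> Ty (Sig (Dec s) (Sig (Dec i) (Dec (sh 2 s))))" using ml_inv_Ty[OF 1(2)] by simp
  then have "T \<rhd> \<Gamma> \<turnstile> Tm (InR (InL x)) (UIC_type s i)"
    unfolding UIC_type_def by (rule ml.Sum_I2[OF 1(1) ml.Sum_I1[OF _ x]])
  then have *: "T \<rhd> \<Gamma> \<turnstile> Tm (InR (InL x)) (Dec (UIC_index s i))" by (rule ml.conv[OF _ ml.ty_sym[OF u(2)]])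
  then show "T \<rhd> \<Gamma> \<turnstile> Tm (uFam (InR (InL x))) (SubU (UIC_index s i) (UIC_family s i c))" using u(1) by (intro ml.uFam_I)
  show "T \<rhd> \<Gamma> \<turnstile> TyEq (SubDec (UIC_index s i) (UIC_family s i c) (uFam (InR (InL x)))) (Dec (ins 0 [x] i))"
    by (rule ml.ty_trans[OF ml.uFam_D[OF u(1) *] TyEq_Dec[OF UIC_ufam(4)[OF ax x]]])
qed

text \<open>Used because the codes of sequences are first projections of \<open>recN\<close>, which
  equal the expected codes only judgmentally.\<close>

lemma TyEq_SubDec:
  assumes u: "ufam (ml T) T \<Gamma> a b" and t: "T \<rhd> \<Gamma> \<turnstile> TmEq t t' (SubU a b)"
  shows "T \<rhd> \<Gamma> \<turnstile> TyEq (SubDec a b t) (SubDec a b t')"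
proof -
  have U: "T \<rhd> \<Gamma> \<turnstile> Ty (SubU a b)" using u by (rule ml.SubU_F)
  have "T \<rhd> SubU a b # \<Gamma> \<turnstile> Ty (SubDec (sh 1 a) (lift 1 1 b) (Var 0))"
    using ml.SubDec_F ufam_sub[OF tsub_up1[OF U] u] ml_var0[OF U] by (simp add: nf)
  from TyEq_repl1[OF this t] show ?thesis by (simp add: nf)
qed

end

section \<open>The coinduction rule: finite sequences of moves\<close>

text \<open>
  The witness of \<open>ax3\<close>.  Since \<open>P\<close> need not be small, \<open>P\<close> itself is not a value of \<open>Z\<close>.
  Instead, the sequences of moves from \<open>(a,m)\<close> of length \<open>n\<close> form a type with code in \<open>U_{I,C}\<close>,
  given together with the state in \<open>(\<Sigma>x\<in>A)P(x)\<close> reached by each of them by recursion on \<open>n\<close>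
  (\<open>recN\<close>); a move is an element of \<open>I(x)\<close>, and \<open>q2\<close> gives the next state.
  The elements of \<open>Z\<close> are the points reached.
\<close>

definition stepW :: "tm \<Rightarrow> tm \<Rightarrow> tm \<Rightarrow> tm" where
  "stepW q2 st j = ins 0 [Snd st, j, Fst st] q2"

definition step :: "tm \<Rightarrow> tm \<Rightarrow> tm \<Rightarrow> tm" where
  "step q2 st j = Pr (Fst (stepW q2 st j)) (Snd (Snd (stepW q2 st j)))"

text \<open>A sequence of length n+1 is one of length n together with a move at the point that the
  shorter one reaches; \<open>uFam (InR (InL x))\<close> is the code of \<open>I(x)\<close>.\<close>

definition recC :: "tm \<Rightarrow> tm" where
  "recC r = uSig (Fst r) (uFam (InR (InL (Fst (App (Snd (sh 1 r)) (Var 0))))))"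

definition recS :: "tm \<Rightarrow> tm \<Rightarrow> tm" where
  "recS q2 r = Pr (recC r) (Lam (step (lift 1 3 q2) (App (Snd (sh 1 r)) (Fst (Var 0))) (Snd (Var 0))))"

definition recN :: "tm \<Rightarrow> tm \<Rightarrow> tm \<Rightarrow> tm \<Rightarrow> tm" where
  "recN a m q2 n = RNat n (Pr uN1 (Lam (Pr (sh 1 a) (sh 1 m)))) (recS (lift 2 3 q2) (Var 0))"

text \<open>\<open>uFam (InL Star)\<close> is the code of \<open>A\<close>. The states occur only
  inside a term of the identity type, which is why \<open>Z\<close> is small although
  \<open>P\<close> need not be.\<close>

definition Zcode :: "tm \<Rightarrow> tm \<Rightarrow> tm \<Rightarrow> tm \<Rightarrow> tm" where
  "Zcode a m q2 x = uSig uNN (uSig (Fst (recN (sh 1 a) (sh 1 m) (lift 1 3 q2) (Var 0)))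
     (uEq (uFam (InL Star)) (sh 2 x) (Fst (App (Snd (recN (sh 2 a) (sh 2 m) (lift 2 3 q2) (Var 1))) (Var 0)))))"

definition Zset :: "tm \<Rightarrow> tm \<Rightarrow> tm \<Rightarrow> tm" where
  "Zset a m q2 = Lam (Zcode (sh 1 a) (sh 1 m) (lift 1 3 q2) (Var 0))"

lemma sub_stepW: "sub \<sigma> (stepW q2 st j) = stepW (sub (under 3 \<sigma>) q2) (sub \<sigma> st) (sub \<sigma> j)"
  by (simp add: stepW_def nf)

lemma sub_step: "sub \<sigma> (step q2 st j) = step (sub (under 3 \<sigma>) q2) (sub \<sigma> st) (sub \<sigma> j)"
  by (simp add: step_def sub_stepW nf)

lemma sub_recC: "sub \<sigma> (recC r) = recC (sub \<sigma> r)"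
  by (simp add: recC_def nf)

lemma sub_recS: "sub \<sigma> (recS q2 r) = recS (sub (under 3 \<sigma>) q2) (sub \<sigma> r)"
  by (simp add: recS_def sub_recC sub_step nf)

lemma sub_recN: "sub \<sigma> (recN a m q2 n) = recN (sub \<sigma> a) (sub \<sigma> m) (sub (under 3 \<sigma>) q2) (sub \<sigma> n)"
  by (simp add: recN_def sub_recS nf)

lemma sub_Zcode: "sub \<sigma> (Zcode a m q2 x) = Zcode (sub \<sigma> a) (sub \<sigma> m) (sub (under 3 \<sigma>) q2) (sub \<sigma> x)"
  by (simp add: Zcode_def sub_recN nf)

lemma sub_Zset: "sub \<sigma> (Zset a m q2) = Zset (sub \<sigma> a) (sub \<sigma> m) (sub (under 3 \<sigma>) q2)"
  by (simp add: Zset_def sub_Zcode nf)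

text \<open>A large type, which contains the universe and mentions \<open>P\<close>. The elimination
  rule for natural numbers admits it as a motive, so recursion into it is possible.\<close>

definition recT :: "tm \<Rightarrow> tm \<Rightarrow> tm \<Rightarrow> tm \<Rightarrow> tm" where
  "recT s i c P = (let a = UIC_index s i; b = UIC_family s i c in
     Sig (SubU a b) (arr (SubDec (sh 1 a) (lift 1 1 b) (Var 0)) (sh 1 (Sig (Dec s) P))))"

definition nextT :: "tm \<Rightarrow> tm \<Rightarrow> tm \<Rightarrow> tm \<Rightarrow> tm" where
  "nextT s i c r = Sig (SubDec (UIC_index s i) (UIC_family s i c) (Fst r))
     (Dec (ins 0 [Fst (App (Snd (sh 1 r)) (Var 0))] (lift 1 1 i)))"

definition ZsetT :: "tm \<Rightarrow> tm \<Rightarrow> tm \<Rightarrow> tm \<Rightarrow> tm \<Rightarrow> tm \<Rightarrow> tm \<Rightarrow> tm" where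
  "ZsetT s i c a m q2 x = Sig NN (Sig (SubDec (UIC_index (sh 1 s) (lift 1 1 i))
     (UIC_family (sh 1 s) (lift 1 1 i) (lift 1 2 c)) (Fst (recN (sh 1 a) (sh 1 m) (lift 1 3 q2) (Var 0))))
     (Eq (Dec (sh 2 s)) (sh 2 x) (Fst (App (Snd (recN (sh 2 a) (sh 2 m) (lift 2 3 q2) (Var 1))) (Var 0)))))"

lemma sub_recT: "sub \<sigma> (recT s i c P) = recT (sub \<sigma> s) (sub (under 1 \<sigma>) i) (sub (under 2 \<sigma>) c) (sub (under 1 \<sigma>) P)"
  by (simp add: recT_def Let_def nfu)

lemmas nfr = nfu sub_stepW sub_step sub_recC sub_recS sub_recN sub_Zcode sub_Zset sub_recT

context mls
begin

text \<open>A transition system on the states \<open>(\<Sigma>x\<in>A)P(x)\<close>: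
  \<open>q2\<close> gives each state a successor for each move. The starting state and
  \<open>q1\<close> are kept apart.\<close>

definition coalg :: "tm list \<Rightarrow> tm \<Rightarrow> tm \<Rightarrow> tm \<Rightarrow> tm \<Rightarrow> tm \<Rightarrow> tm \<Rightarrow> bool" where
  "coalg \<Gamma> s i c v P q2 \<longleftrightarrow> axset (ml T) \<Gamma> s i c v \<and> T \<rhd> Dec s # \<Gamma> \<turnstile> Ty P \<and>
     T \<rhd> sh 1 P # Dec i # Dec s # \<Gamma>
       \<turnstile> Tm q2 (Sig (Dec (sh 3 s)) (prod (eps (Var 0) (sh 2 c)) (ins 4 [Var 0] P)))"

lemma coalg_sub:
  assumes t: "tsub T \<Gamma> \<sigma> \<Delta>" and g: "coalg \<Delta> s i c v P q2"
  shows "coalg \<Gamma> (sub \<sigma> s) (sub (under 1 \<sigma>) i) (sub (under 2 \<sigma>) c) (sub \<sigma> v) (sub (under 1 \<sigma>) P) (sub (under 3 \<sigma>) q2)"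
proof -
  have ax: "axset (ml T) \<Delta> s i c v" and P: "T \<rhd> Dec s # \<Delta> \<turnstile> Ty P"
    and q2: "T \<rhd> sh 1 P # Dec i # Dec s # \<Delta>
       \<turnstile> Tm q2 (Sig (Dec (sh 3 s)) (prod (eps (Var 0) (sh 2 c)) (ins 4 [Var 0] P)))"
    using g by (auto simp: coalg_def)
  note t1 = tsub_under[OF t ml_hd[OF P]]
  note t2 = tsub_under[OF t1 ml_hd[OF ml_Ok[OF ml_hd[OF q2]]]]
  note t3 = tsub_under[OF t2 ml_hd[OF q2]]
  show ?thesis
    using axset_sub[OF t ax] tsub_Ty[OF t1 P] tsub_Tm[OF t3 q2] unfolding coalg_def by (simp add: nf)
qed

lemma stepW_I:
  assumes g: "coalg \<Gamma> s i c v P q2" and st: "T \<rhd> \<Gamma> \<turnstile> Tm st (Sig (Dec s) P)"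
    and j: "T \<rhd> \<Gamma> \<turnstile> Tm j (Dec (ins 0 [Fst st] i))"
  shows "T \<rhd> \<Gamma> \<turnstile> Tm (stepW q2 st j) (Sig (Dec s) (prod (eps (Var 0) (sh 1 (ins 0 [j, Fst st] c))) P))"
proof -
  have "T \<rhd> sh 1 P # Dec i # Dec s # \<Gamma>
       \<turnstile> Tm q2 (Sig (Dec (sh 3 s)) (prod (eps (Var 0) (sh 2 c)) (ins 4 [Var 0] P)))"
    using g by (auto simp: coalg_def)
  from ml_ins3'(2)[OF this Fst_I[OF st], of j "Snd st"] j Snd_I[OF st]
  show ?thesis by (simp add: nf stepW_def)
qed

lemma step_I:
  assumes g: "coalg \<Gamma> s i c v P q2" and st: "T \<rhd> \<Gamma> \<turnstile> Tm st (Sig (Dec s) P)"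
    and j: "T \<rhd> \<Gamma> \<turnstile> Tm j (Dec (ins 0 [Fst st] i))"
  shows "T \<rhd> \<Gamma> \<turnstile> Tm (step q2 st j) (Sig (Dec s) P)"
proof -
  note W = stepW_I[OF assms]
  have "T \<rhd> \<Gamma> \<turnstile> Tm (Snd (stepW q2 st j))
      (prod (eps (Fst (stepW q2 st j)) (ins 0 [j, Fst st] c)) (ins 0 [Fst (stepW q2 st j)] P))"
    using Snd_I[OF W] by (simp add: nf)
  from ml.Sig_I[OF _ Fst_I[OF W] Snd_prod[OF this]] show ?thesis
    using g unfolding step_def coalg_def by blast
qed

lemma recT_D:
  assumes r: "T \<rhd> \<Gamma> \<turnstile> Tm r (recT s i c P)"
  shows "T \<rhd> \<Gamma> \<turnstile> Tm (Fst r) (SubU (UIC_index s i) (UIC_family s i c))"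
    and "T \<rhd> \<Gamma> \<turnstile> Tm (Snd r) (arr (SubDec (UIC_index s i) (UIC_family s i c) (Fst r)) (Sig (Dec s) P))"
  using Fst_I[OF r[unfolded recT_def Let_def]] Snd_I[OF r[unfolded recT_def Let_def]] by (simp_all add: nfu)

lemma recT_I:
  assumes P: "T \<rhd> Dec s # \<Gamma> \<turnstile> Ty P" and ax: "axset (ml T) \<Gamma> s i c v"
    and p: "T \<rhd> \<Gamma> \<turnstile> Tm p (SubU (UIC_index s i) (UIC_family s i c))"
    and f: "T \<rhd> \<Gamma> \<turnstile> Tm f (arr (SubDec (UIC_index s i) (UIC_family s i c) p) (Sig (Dec s) P))"
  shows "T \<rhd> \<Gamma> \<turnstile> Tm (Pr p f) (recT s i c P)"
    and "T \<rhd> \<Gamma> \<turnstile> TmEq (Fst (Pr p f)) p (SubU (UIC_index s i) (UIC_family s i c))"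
    and "T \<rhd> \<Gamma> \<turnstile> TmEq (Snd (Pr p f)) f (arr (SubDec (UIC_index s i) (UIC_family s i c) p) (Sig (Dec s) P))"
proof -
  let ?a = "UIC_index s i" and ?b = "UIC_family s i c"
  let ?U = "SubU ?a ?b" and ?B = "arr (SubDec (sh 1 ?a) (lift 1 1 ?b) (Var 0)) (sh 1 (Sig (Dec s) P))"
  note u = UIC_ufam(1)[OF ax]
  have U: "T \<rhd> \<Gamma> \<turnstile> Ty ?U" using u by (rule ml.SubU_F)
  have "T \<rhd> ?U # \<Gamma> \<turnstile> Ty (SubDec (sh 1 ?a) (lift 1 1 ?b) (Var 0))"
    using ml.SubDec_F ufam_sub[OF tsub_up1[OF U] u] ml_var0[OF U] by (simp add: nf)
  moreover have "T \<rhd> ?U # \<Gamma> \<turnstile> Ty (sh 1 (Sig (Dec s) P))"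
    using wk1_Ty[OF ml.Sig_F[OF ml_hd[OF P] P] U] by (simp add: nf)
  ultimately have B: "T \<rhd> ?U # \<Gamma> \<turnstile> Ty ?B" by (rule Ty_arr)
  have f': "T \<rhd> \<Gamma> \<turnstile> Tm f (ins 0 [p] ?B)" using f by (simp add: nfu)
  show "T \<rhd> \<Gamma> \<turnstile> Tm (Pr p f) (recT s i c P)"
    unfolding recT_def Let_def by (rule ml.Sig_I[OF B p f'])
  show "T \<rhd> \<Gamma> \<turnstile> TmEq (Fst (Pr p f)) p ?U" by (rule Fst_C[OF B p f'])
  show "T \<rhd> \<Gamma> \<turnstile> TmEq (Snd (Pr p f)) f (arr (SubDec ?a ?b p) (Sig (Dec s) P))"
    using Snd_C[OF B p f'] by (simp add: nfu)
qed

lemma recC_I: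
  assumes ax: "axset (ml T) \<Gamma> s i c v" and r: "T \<rhd> \<Gamma> \<turnstile> Tm r (recT s i c P)"
  shows "T \<rhd> \<Gamma> \<turnstile> Tm (recC r) (SubU (UIC_index s i) (UIC_family s i c))"
    and "T \<rhd> \<Gamma> \<turnstile> TyEq (SubDec (UIC_index s i) (UIC_family s i c) (recC r)) (nextT s i c r)"
proof -
  let ?a = "UIC_index s i" and ?b = "UIC_family s i c"
  note u = UIC_ufam(1)[OF ax] note p = recT_D[OF r]
  let ?X = "SubDec ?a ?b (Fst r)"
  have X: "T \<rhd> \<Gamma> \<turnstile> Ty ?X" using u p(1) by (rule ml.SubDec_F)
  note t = tsub_up1[OF X]
  have "T \<rhd> ?X # \<Gamma> \<turnstile> Tm (App (Snd (sh 1 r)) (Var 0)) (sub (up (Suc 0)) (Sig (Dec s) P))"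
    using App_arr[of "?X # \<Gamma>" "sh 1 (Snd r)" "sh 1 ?X" "sh 1 (Sig (Dec s) P)" "Var 0"]
      tsub_Tm[OF t p(2)] ml_var0[OF X] by (simp add: nf)
  from Fst_I[OF this[unfolded sub_simps]]
  have x: "T \<rhd> ?X # \<Gamma> \<turnstile> Tm (Fst (App (Snd (sh 1 r)) (Var 0))) (Dec (sub (up (Suc 0)) s))" .
  note UI = UIC_I[OF axset_sub[OF t ax] x]
  have 1: "T \<rhd> ?X # \<Gamma> \<turnstile> Tm (uFam (InR (InL (Fst (App (Snd (sh 1 r)) (Var 0)))))) (SubU (sh 1 ?a) (lift 1 1 ?b))"
    using UI(1) by (simp add: nfu)
  show "T \<rhd> \<Gamma> \<turnstile> Tm (recC r) (SubU ?a ?b)"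
    unfolding recC_def by (rule ml.uSig_I[OF u p(1) 1])
  have 2: "T \<rhd> ?X # \<Gamma> \<turnstile> TyEq (SubDec (sh 1 ?a) (lift 1 1 ?b) (uFam (InR (InL (Fst (App (Snd (sh 1 r)) (Var 0)))))))
      (Dec (ins 0 [Fst (App (Snd (sh 1 r)) (Var 0))] (lift 1 1 i)))"
    using UI(2) by (simp add: nfu)
  show "T \<rhd> \<Gamma> \<turnstile> TyEq (SubDec ?a ?b (recC r)) (nextT s i c r)"
    unfolding recC_def nextT_def
    by (rule ml.ty_trans[OF ml.uSig_D[OF u p(1) 1] ml.Sig_cong[OF ml.ty_refl[OF X] 2]])
qed

lemma recS_aux:
  assumes g: "coalg \<Gamma> s i c v P q2" and r: "T \<rhd> \<Gamma> \<turnstile> Tm r (recT s i c P)"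
  shows "T \<rhd> SubDec (UIC_index s i) (UIC_family s i c) (recC r) # \<Gamma> \<turnstile>
     Tm (step (lift 1 3 q2) (App (Snd (sh 1 r)) (Fst (Var 0))) (Snd (Var 0))) (sh 1 (Sig (Dec s) P))"
proof -
  have ax: "axset (ml T) \<Gamma> s i c v" using g by (auto simp: coalg_def)
  note C = recC_I[OF ax r]
  let ?X = "SubDec (UIC_index s i) (UIC_family s i c) (recC r)"
  have X: "T \<rhd> \<Gamma> \<turnstile> Ty ?X" using UIC_ufam(1)[OF ax] C(1) by (rule ml.SubDec_F)
  note t = tsub_up1[OF X]
  have w: "T \<rhd> ?X # \<Gamma> \<turnstile> Tm (Var 0) (Sig (sub (up (Suc 0)) (SubDec (UIC_index s i) (UIC_family s i c) (Fst r)))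
      (sub (under 1 (up (Suc 0))) (Dec (ins 0 [Fst (App (Snd (sh 1 r)) (Var 0))] (lift 1 1 i)))))"
    using ml.conv[OF ml_var0[OF X] tsub_TyEq[OF t C(2)]] by (simp add: nextT_def)
  note w1 = Fst_I[OF w]
  note f = tsub_Tm[OF t recT_D(2)[OF r]]
  have st: "T \<rhd> ?X # \<Gamma> \<turnstile> Tm (App (Snd (sh 1 r)) (Fst (Var 0))) (sub (up (Suc 0)) (Sig (Dec s) P))"
    using App_arr[of "?X # \<Gamma>" "sh 1 (Snd r)" "sh 1 (SubDec (UIC_index s i) (UIC_family s i c) (Fst r))"
       "sh 1 (Sig (Dec s) P)" "Fst (Var 0)"] f w1 by (simp add: nf)
  show ?thesis
    using step_I[OF coalg_sub[OF t g] st[unfolded sub_simps], of "Snd (Var 0)"] Snd_I[OF w] by (simp add: nf)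
qed

lemma recS_I:
  assumes g: "coalg \<Gamma> s i c v P q2" and r: "T \<rhd> \<Gamma> \<turnstile> Tm r (recT s i c P)"
  shows "T \<rhd> \<Gamma> \<turnstile> Tm (recS q2 r) (recT s i c P)"
    and "T \<rhd> \<Gamma> \<turnstile> TmEq (Fst (recS q2 r)) (recC r) (SubU (UIC_index s i) (UIC_family s i c))"
    and "T \<rhd> \<Gamma> \<turnstile> TmEq (Snd (recS q2 r)) (Lam (step (lift 1 3 q2) (App (Snd (sh 1 r)) (Fst (Var 0))) (Snd (Var 0))))
       (arr (SubDec (UIC_index s i) (UIC_family s i c) (recC r)) (Sig (Dec s) P))"
  using recT_I[OF _ _ recC_I(1)[OF _ r] ml.Pi_I[OF recS_aux[OF g r]], of v v] g
  unfolding recS_def coalg_def by blast+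

text \<open>Stated for any \<open>r'\<close> judgmentally equal to \<open>recS q2 r\<close>, since
  it is applied to \<open>recN\<close> at a successor. The equation for the states is judgmental as
  well, so that reflexivity will prove that the extended sequence reaches the chosen point.\<close>

lemma recS_next:
  assumes g: "coalg \<Gamma> s i c v P q2" and r: "T \<rhd> \<Gamma> \<turnstile> Tm r (recT s i c P)"
    and e: "T \<rhd> \<Gamma> \<turnstile> TmEq r' (recS q2 r) (recT s i c P)"
    and t: "T \<rhd> \<Gamma> \<turnstile> Tm t (SubDec (UIC_index s i) (UIC_family s i c) (Fst r))"
    and j: "T \<rhd> \<Gamma> \<turnstile> Tm j (Dec (ins 0 [Fst (App (Snd r) t)] i))"
  shows "T \<rhd> \<Gamma> \<turnstile> Tm (Pr t j) (SubDec (UIC_index s i) (UIC_family s i c) (Fst r'))"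
    and "T \<rhd> \<Gamma> \<turnstile> TmEq (App (Snd r') (Pr t j)) (step q2 (App (Snd r) t) j) (Sig (Dec s) P)"
proof -
  have ax: "axset (ml T) \<Gamma> s i c v" using g by (auto simp: coalg_def)
  let ?a = "UIC_index s i" and ?b = "UIC_family s i c"
  let ?X = "SubDec ?a ?b (Fst r)" and ?J = "Dec (ins 0 [Fst (App (Snd (sh 1 r)) (Var 0))] (lift 1 1 i))"
  note C = recC_I[OF ax r] note S = recS_I[OF g r]
  have "T \<rhd> \<Gamma> \<turnstile> TmEq (Fst r') (recC r) (SubU ?a ?b)"
    using TmEq_Fst[OF e[unfolded recT_def Let_def]] S(2) by (rule ml.tm_trans)
  then have E: "T \<rhd> \<Gamma> \<turnstile> TyEq (SubDec ?a ?b (Fst r')) (SubDec ?a ?b (recC r))"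
    by (rule TyEq_SubDec[OF UIC_ufam(1)[OF ax]])
  have J: "T \<rhd> ?X # \<Gamma> \<turnstile> Ty ?J"
    using presup_TyEq(2)[OF C(2)] Ty_SigD unfolding nextT_def by blast
  have j': "T \<rhd> \<Gamma> \<turnstile> Tm j (ins 0 [t] ?J)" using j by (simp add: nf)
  have "T \<rhd> \<Gamma> \<turnstile> Tm (Pr t j) (nextT s i c r)"
    unfolding nextT_def by (rule ml.Sig_I[OF J t j'])
  then have p: "T \<rhd> \<Gamma> \<turnstile> Tm (Pr t j) (SubDec ?a ?b (recC r))" by (rule ml.conv[OF _ ml.ty_sym[OF C(2)]])
  then show p': "T \<rhd> \<Gamma> \<turnstile> Tm (Pr t j) (SubDec ?a ?b (Fst r'))" by (rule ml.conv[OF _ ml.ty_sym[OF E]])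
  have "T \<rhd> \<Gamma> \<turnstile> TmEq (Snd r') (Snd (recS q2 r)) (arr (SubDec ?a ?b (Fst r')) (Sig (Dec s) P))"
    using TmEq_Snd[OF e[unfolded recT_def Let_def]] by (simp add: nfu)
  moreover have "T \<rhd> \<Gamma> \<turnstile> TyEq (arr (SubDec ?a ?b (Fst r')) (Sig (Dec s) P)) (arr (SubDec ?a ?b (recC r)) (Sig (Dec s) P))"
    using E g unfolding coalg_def by (intro TyEq_arr ml.ty_refl ml.Sig_F) (auto intro: ml.Dec_F)
  ultimately have "T \<rhd> \<Gamma> \<turnstile> TmEq (Snd r') (Lam (step (lift 1 3 q2) (App (Snd (sh 1 r)) (Fst (Var 0))) (Snd (Var 0))))
     (arr (SubDec ?a ?b (recC r)) (Sig (Dec s) P))"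
    using S(3) by (blast intro: ml.tm_trans ml.conv_eq)
  from TmEq_App[OF this ml.tm_refl[OF p]]
  have "T \<rhd> \<Gamma> \<turnstile> TmEq (App (Snd r') (Pr t j)) (App (Lam (step (lift 1 3 q2) (App (Snd (sh 1 r)) (Fst (Var 0))) (Snd (Var 0)))) (Pr t j)) (Sig (Dec s) P)"
    by (simp add: nf)
  moreover have "T \<rhd> \<Gamma> \<turnstile> TmEq (App (Lam (step (lift 1 3 q2) (App (Snd (sh 1 r)) (Fst (Var 0))) (Snd (Var 0)))) (Pr t j))
      (step q2 (App (Snd r) (Fst (Pr t j))) (Snd (Pr t j))) (Sig (Dec s) P)"
    using TmEq_beta[OF recS_aux[OF g r, unfolded One_nat_def[symmetric]] p] by (simp add: nf sub_step)
  moreover have "T \<rhd> \<Gamma> \<turnstile> TmEq (step q2 (App (Snd r) (Fst (Pr t j))) (Snd (Pr t j))) (step q2 (App (Snd r) t) j) (Sig (Dec s) P)"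
  proof -
    \<comment> \<open>Beta leaves the projections of \<open>Pr t j\<close> inside
      \<open>step\<close>, where \<open>q2\<close> may use them anywhere. They are replaced in the
      open term over a sequence and a move; as the type of the move depends on the sequence, the
      equation for the second projection is converted first.\<close>
    let ?G = "?J # ?X # \<Gamma>"
    have ok: "T \<rhd> ?G \<turnstile> Ok" by (rule ml.ok_ext[OF J])
    have t2: "tsub T ?G (up 2) \<Gamma>" using tsub_upS[OF J tsub_up1[OF ml_hd[OF J]]] by (simp add: nf)
    have v: "T \<rhd> ?G \<turnstile> Tm (Var 1) (sh 2 ?X)" "T \<rhd> ?G \<turnstile> Tm (Var 0) (sh 1 ?J)"
      using ml.var[OF ok, of 1] ml.var[OF ok, of 0] by (simp_all add: nf)
    have "T \<rhd> ?G \<turnstile> Tm (App (Snd (sh 2 r)) (Var 1)) (sub (up 2) (Sig (Dec s) P))"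
      using App_arr[of ?G "sh 2 (Snd r)" "sh 2 ?X" "sh 2 (Sig (Dec s) P)" "Var 1"]
        tsub_Tm[OF t2 recT_D(2)[OF r]] v(1) by (simp add: nf)
    from step_I[OF coalg_sub[OF t2 g] this[unfolded sub_simps], of "Var 0"] v(2)
    have c: "T \<rhd> ?G \<turnstile> Tm (step (lift 2 3 q2) (App (Snd (sh 2 r)) (Var 1)) (Var 0)) (sh 2 (Sig (Dec s) P))"
      by (simp add: nf)
    note F = Fst_C[OF J t j']
    have "T \<rhd> \<Gamma> \<turnstile> TmEq (Snd (Pr t j)) j (sub (Fst (Pr t j) ;; Var) ?J)"
      using ml.conv_eq[OF Snd_C[OF J t j']] TyEq_repl1[OF J ml.tm_sym[OF F]] by (simp add: nf)
    then have "teq T \<Gamma> (Snd (Pr t j) ;; Fst (Pr t j) ;; Var) (j ;; t ;; Var) ?G"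
      using F by (intro teq_Cons teq_Var ml_Ok[OF t]) (simp_all only: sub_Var)
    from teq_Tm[OF this c] show ?thesis by (simp add: nf sub_step)
  qed
  ultimately show "T \<rhd> \<Gamma> \<turnstile> TmEq (App (Snd r') (Pr t j)) (step q2 (App (Snd r) t) j) (Sig (Dec s) P)"
    by (blast intro: ml.tm_trans)
qed

end

section \<open>The set of reached points as a post-fixed point contained in \<open>V\<close>\<close>

abbreviation tr :: "tm \<Rightarrow> tm \<Rightarrow> tm" where "tr e u \<equiv> App (IdRec e (Lam (Var 0))) u"

text \<open>Elements of \<open>Z\<close> at \<open>x\<close> are \<open>(n, (t, e))\<close> with a
  sequence \<open>t\<close> of length \<open>n\<close> and a proof \<open>e\<close> that
  \<open>x\<close> equals the point reached; \<open>zst\<close> is the state reached.\<close>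

definition zst :: "tm \<Rightarrow> tm \<Rightarrow> tm \<Rightarrow> tm \<Rightarrow> tm" where
  "zst a m q2 z = App (Snd (recN a m q2 (Fst z))) (Fst (Snd z))"

definition zincl :: "tm \<Rightarrow> tm \<Rightarrow> tm \<Rightarrow> tm \<Rightarrow> tm \<Rightarrow> tm" where
  "zincl a m q1 q2 z = tr (Snd (Snd z)) (ins 0 [Snd (zst a m q2 z), Fst (zst a m q2 z)] q1)"

text \<open>The sequence is prolonged by the move \<open>j\<close>. The point then reached computes
  to \<open>Fst W\<close>, hence the reflexivity proof.\<close>

definition znext :: "tm \<Rightarrow> tm \<Rightarrow> tm \<Rightarrow> tm \<Rightarrow> tm \<Rightarrow> tm" where
  "znext a m q2 z j = (let W = stepW q2 (zst a m q2 z) j in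
     Pr (Fst W) (Pr (Fst (Snd W)) (Pr (Succ (Fst z)) (Pr (Pr (Fst (Snd z)) j) (Rfl (Fst W))))))"

text \<open>\<open>\<tau>\<close> asks for an answer to every move at \<open>x\<close>, while
  \<open>znext\<close> expects moves at the reached point. The whole universally quantified
  statement is transported, so that single moves need not be.\<close>

definition ztau :: "tm \<Rightarrow> tm \<Rightarrow> tm \<Rightarrow> tm \<Rightarrow> tm" where
  "ztau a m q2 z = Pr z (tr (Snd (Snd z)) (Lam (znext (sh 1 a) (sh 1 m) (lift 1 3 q2) (sh 1 z) (Var 0))))"

definition pos3 :: "tm \<Rightarrow> tm \<Rightarrow> tm \<Rightarrow> tm \<Rightarrow> tm" where
  "pos3 a m q1 q2 = Pr (Zset a m q2) (Pr (Pr Zero (Pr Star (Rfl a)))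
     (Pr (Lam (Lam (ztau (sh 2 a) (sh 2 m) (lift 2 3 q2) (Var 0))))
         (Lam (Lam (zincl (sh 2 a) (sh 2 m) (lift 2 2 q1) (lift 2 3 q2) (Var 0))))))"

lemma sub_zst: "sub \<sigma> (zst a m q2 z) = zst (sub \<sigma> a) (sub \<sigma> m) (sub (under 3 \<sigma>) q2) (sub \<sigma> z)"
  by (simp add: zst_def nfr)

lemma sub_zincl: "sub \<sigma> (zincl a m q1 q2 z) =
    zincl (sub \<sigma> a) (sub \<sigma> m) (sub (under 2 \<sigma>) q1) (sub (under 3 \<sigma>) q2) (sub \<sigma> z)"
  by (simp add: zincl_def sub_zst nf)

lemma sub_znext: "sub \<sigma> (znext a m q2 z j) =
    znext (sub \<sigma> a) (sub \<sigma> m) (sub (under 3 \<sigma>) q2) (sub \<sigma> z) (sub \<sigma> j)"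
  by (simp add: znext_def Let_def sub_zst sub_stepW nf)

lemma sub_ztau: "sub \<sigma> (ztau a m q2 z) = ztau (sub \<sigma> a) (sub \<sigma> m) (sub (under 3 \<sigma>) q2) (sub \<sigma> z)"
  by (simp add: ztau_def sub_znext nf)

lemma sub_pos3: "sub \<sigma> (pos3 a m q1 q2) =
    pos3 (sub \<sigma> a) (sub \<sigma> m) (sub (under 2 \<sigma>) q1) (sub (under 3 \<sigma>) q2)"
  by (simp add: pos3_def sub_zincl sub_ztau sub_Zset nf)

context mls
begin

lemma Sig_Ty: "T \<rhd> A # \<Gamma> \<turnstile> Ty B \<Longrightarrow> T \<rhd> \<Gamma> \<turnstile> Ty (Sig A B)"
  by (rule ml.Sig_F[OF ml_hd])

lemma recN_base:
  assumes g: "coalg \<Gamma> s i c v P q2" and a: "T \<rhd> \<Gamma> \<turnstile> Tm a (Dec s)" and m: "T \<rhd> \<Gamma> \<turnstile> Tm m (ins 0 [a] P)"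
  defines "f \<equiv> Lam (Pr (sh 1 a) (sh 1 m))"
  defines "U \<equiv> SubU (UIC_index s i) (UIC_family s i c)"
    and "A \<equiv> arr (SubDec (UIC_index s i) (UIC_family s i c) uN1) (Sig (Dec s) P)"
  shows "T \<rhd> \<Gamma> \<turnstile> Tm (Pr uN1 f) (recT s i c P)"
    and "T \<rhd> \<Gamma> \<turnstile> TmEq (Fst (Pr uN1 f)) uN1 U" and "T \<rhd> \<Gamma> \<turnstile> TmEq (Snd (Pr uN1 f)) f A"
    and "T \<rhd> \<Gamma> \<turnstile> Tm t (SubDec (UIC_index s i) (UIC_family s i c) uN1) \<Longrightarrow> T \<rhd> \<Gamma> \<turnstile> TmEq (App f t) (Pr a m) (Sig (Dec s) P)"
proof -
  have ax: "axset (ml T) \<Gamma> s i c v" and P: "T \<rhd> Dec s # \<Gamma> \<turnstile> Ty P" using g by (auto simp: coalg_def)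
  note u = UIC_ufam(1)[OF ax]
  let ?X = "SubDec (UIC_index s i) (UIC_family s i c) uN1"
  have X: "T \<rhd> \<Gamma> \<turnstile> Ty ?X" by (rule ml.SubDec_F[OF u ml.uN1_I[OF u]])
  have p: "T \<rhd> \<Gamma> \<turnstile> Tm (Pr a m) (Sig (Dec s) P)" by (rule ml.Sig_I[OF P a m])
  have b: "T \<rhd> ?X # \<Gamma> \<turnstile> Tm (Pr (sh 1 a) (sh 1 m)) (sh 1 (Sig (Dec s) P))"
    using wk1_Tm[OF p X] by (simp add: nf)
  have f: "T \<rhd> \<Gamma> \<turnstile> Tm f A" unfolding f_def A_def by (rule ml.Pi_I[OF b])
  note R = recT_I[OF P ax ml.uN1_I[OF u] f[unfolded A_def]]
  show "T \<rhd> \<Gamma> \<turnstile> Tm (Pr uN1 f) (recT s i c P)" "T \<rhd> \<Gamma> \<turnstile> TmEq (Fst (Pr uN1 f)) uN1 U"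
    "T \<rhd> \<Gamma> \<turnstile> TmEq (Snd (Pr uN1 f)) f A" using R unfolding U_def A_def by blast+
  assume t: "T \<rhd> \<Gamma> \<turnstile> Tm t ?X"
  show "T \<rhd> \<Gamma> \<turnstile> TmEq (App f t) (Pr a m) (Sig (Dec s) P)"
    using TmEq_beta[OF b t] by (simp add: f_def nf)
qed

lemma recN:
  assumes g: "coalg \<Gamma> s i c v P q2" and a: "T \<rhd> \<Gamma> \<turnstile> Tm a (Dec s)" and m: "T \<rhd> \<Gamma> \<turnstile> Tm m (ins 0 [a] P)"
  shows "T \<rhd> \<Gamma> \<turnstile> TmEq (recN a m q2 Zero) (Pr uN1 (Lam (Pr (sh 1 a) (sh 1 m)))) (recT s i c P)"
    and "T \<rhd> \<Gamma> \<turnstile> Tm n NN \<Longrightarrow> T \<rhd> \<Gamma> \<turnstile> Tm (recN a m q2 n) (recT s i c P)"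
    and "T \<rhd> \<Gamma> \<turnstile> Tm n NN \<Longrightarrow> T \<rhd> \<Gamma> \<turnstile> TmEq (recN a m q2 (Succ n)) (recS q2 (recN a m q2 n)) (recT s i c P)"
proof -
  let ?R = "recT s i c P" let ?C = "sh 1 ?R"
  note b = recN_base(1)[OF g a m]
  have N: "T \<rhd> \<Gamma> \<turnstile> Ty NN" by (rule ml.Nat_F[OF ml_Ok[OF a]])
  have C: "T \<rhd> NN # \<Gamma> \<turnstile> Ty ?C" using wk1_Ty[OF presup_Tm[OF b] N] by (simp add: nf)
  have t: "tsub T (?C # NN # \<Gamma>) (up 2) \<Gamma>" using tsub_upS[OF C tsub_up1[OF N]] by (simp add: nf)
  have r: "T \<rhd> ?C # NN # \<Gamma> \<turnstile> Tm (Var 0) (sub (up 2) ?R)" using ml_var0[OF C] by (simp add: nf)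
  have d: "T \<rhd> ?C # NN # \<Gamma> \<turnstile> Tm (recS (lift 2 3 q2) (Var 0)) (ins 2 [Succ (Var 1)] ?C)"
    using recS_I(1)[OF coalg_sub[OF t g] r[unfolded sub_recT]] by (simp add: nfr)
  have b': "T \<rhd> \<Gamma> \<turnstile> Tm (Pr uN1 (Lam (Pr (sh 1 a) (sh 1 m)))) (ins 0 [Zero] ?C)"
    using b by (simp add: nfr)
  show "T \<rhd> \<Gamma> \<turnstile> TmEq (recN a m q2 Zero) (Pr uN1 (Lam (Pr (sh 1 a) (sh 1 m)))) ?R"
    using ml.Nat_C0[OF C b' d] by (simp add: recN_def nfr)
  assume n: "T \<rhd> \<Gamma> \<turnstile> Tm n NN"
  show "T \<rhd> \<Gamma> \<turnstile> Tm (recN a m q2 n) ?R"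
    using ml.Nat_E[OF C n b' d] by (simp add: recN_def nfr)
  show "T \<rhd> \<Gamma> \<turnstile> TmEq (recN a m q2 (Succ n)) (recS q2 (recN a m q2 n)) ?R"
    using ml.Nat_CS[OF C n b' d] by (simp add: recN_def nfr)
qed

lemma Zcode:
  assumes g: "coalg \<Gamma> s i c v P q2" and a: "T \<rhd> \<Gamma> \<turnstile> Tm a (Dec s)" and m: "T \<rhd> \<Gamma> \<turnstile> Tm m (ins 0 [a] P)"
    and x: "T \<rhd> \<Gamma> \<turnstile> Tm x (Dec s)"
  shows "T \<rhd> \<Gamma> \<turnstile> Tm (Zcode a m q2 x) (SubU (UIC_index s i) (UIC_family s i c))"
    and "T \<rhd> \<Gamma> \<turnstile> TyEq (SubDec (UIC_index s i) (UIC_family s i c) (Zcode a m q2 x)) (ZsetT s i c a m q2 x)"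
proof -
  have ax: "axset (ml T) \<Gamma> s i c v" using g by (auto simp: coalg_def)
  let ?a = "UIC_index s i" and ?b = "UIC_family s i c"
  note u = UIC_ufam(1)[OF ax]
  let ?X = "SubDec ?a ?b uNN"
  have X: "T \<rhd> \<Gamma> \<turnstile> Ty ?X" by (rule ml.SubDec_F[OF u ml.uNN_I[OF u]])
  note t1 = tsub_up1[OF X]
  let ?r = "recN (sh 1 a) (sh 1 m) (lift 1 3 q2) (Var 0)"
  \<comment> \<open>The variable bound by \<open>uSig uNN\<close> lies in the decoding of
    \<open>uNN\<close>, which is only judgmentally \<open>NN\<close>.\<close>
  have n: "T \<rhd> ?X # \<Gamma> \<turnstile> Tm (Var 0) NN"
    using ml.conv[OF ml_var0[OF X] tsub_TyEq[OF t1 ml.uNN_D[OF u]]] by simp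
  have r: "T \<rhd> ?X # \<Gamma> \<turnstile> Tm ?r (sub (up (Suc 0)) (recT s i c P))"
    using recN(2)[OF coalg_sub[OF t1 g] _ _ n, of "sh 1 a" "sh 1 m"] tsub_Tm[OF t1 a] tsub_Tm[OF t1 m]
    by (simp add: nfr)
  note p = recT_D[OF r[unfolded sub_recT]]
  note u1 = UIC_ufam(1)[OF axset_sub[OF t1 ax]]
  let ?a1 = "sh 1 ?a" and ?b1 = "lift 1 1 ?b"
  let ?Y = "SubDec ?a1 ?b1 (Fst ?r)"
  have Y: "T \<rhd> ?X # \<Gamma> \<turnstile> Ty ?Y" using ml.SubDec_F[OF u1 p(1)] by (simp add: nfu)
  let ?G = "?Y # ?X # \<Gamma>"
  have ok: "T \<rhd> ?G \<turnstile> Ok" by (rule ml.ok_ext[OF Y])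
  note t2' = tsub_up1[OF Y]
  have t2: "tsub T ?G (up 2) \<Gamma>" using tsub_upS[OF Y t1] by (simp add: nf)
  note ax2 = axset_sub[OF t2 ax]
  let ?y = "Fst (App (Snd (recN (sh 2 a) (sh 2 m) (lift 2 3 q2) (Var 1))) (Var 0))"
  have "T \<rhd> ?G \<turnstile> Tm (App (Snd (recN (sh 2 a) (sh 2 m) (lift 2 3 q2) (Var 1))) (Var 0)) (sub (up 2) (Sig (Dec s) P))"
    using App_arr[of ?G "sh 1 (Snd ?r)" "sh 1 ?Y" "sub (up 2) (Sig (Dec s) P)" "Var 0"]
      tsub_Tm[OF t2' p(2)] ml_var0[OF Y] by (simp add: nfr)
  from Fst_I[OF this[unfolded sub_simps]] have y: "T \<rhd> ?G \<turnstile> Tm ?y (Dec (sh 2 s))" by (simp add: nf)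
  have x2: "T \<rhd> ?G \<turnstile> Tm (sh 2 x) (Dec (sh 2 s))" using tsub_Tm[OF t2 x] by (simp add: nf)
  let ?a2 = "sh 1 ?a1" and ?b2 = "lift 1 1 ?b1"
  have A: "T \<rhd> ?G \<turnstile> Tm (uFam (InL Star)) (SubU ?a2 ?b2)" "T \<rhd> ?G \<turnstile> TyEq (SubDec ?a2 ?b2 (uFam (InL Star))) (Dec (sh 2 s))"
    using UIC_A[OF ax2] by (simp_all add: nfu)
  have u2: "ufam (ml T) T ?G ?a2 ?b2" using UIC_ufam(1)[OF ax2] by (simp add: nfu)
  have u1': "ufam (ml T) T (?X # \<Gamma>) ?a1 ?b1" using u1 by (simp add: nfu)
  have p1: "T \<rhd> ?X # \<Gamma> \<turnstile> Tm (Fst ?r) (SubU ?a1 ?b1)" using p(1) by (simp add: nfu)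
  let ?E = "uEq (uFam (InL Star)) (sh 2 x) ?y"
  note xy = ml.conv[OF x2 ml.ty_sym[OF A(2)]] ml.conv[OF y ml.ty_sym[OF A(2)]]
  have E: "T \<rhd> ?G \<turnstile> Tm ?E (SubU ?a2 ?b2)" by (rule ml.uEq_I[OF u2 A(1) xy])
  have ED: "T \<rhd> ?G \<turnstile> TyEq (SubDec ?a2 ?b2 ?E) (Eq (Dec (sh 2 s)) (sh 2 x) ?y)"
    by (rule ml.ty_trans[OF ml.uEq_D[OF u2 A(1) xy] ml.Eq_cong[OF A(2) ml.tm_refl[OF xy(1)] ml.tm_refl[OF xy(2)]]])
  have K: "T \<rhd> ?X # \<Gamma> \<turnstile> Tm (uSig (Fst ?r) ?E) (SubU ?a1 ?b1)" by (rule ml.uSig_I[OF u1' p1 E])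
  have KD: "T \<rhd> ?X # \<Gamma> \<turnstile> TyEq (SubDec ?a1 ?b1 (uSig (Fst ?r) ?E)) (Sig ?Y (Eq (Dec (sh 2 s)) (sh 2 x) ?y))"
    by (rule ml.ty_trans[OF ml.uSig_D[OF u1' p1 E] ml.Sig_cong[OF ml.ty_refl[OF Y] ED]])
  show "T \<rhd> \<Gamma> \<turnstile> Tm (Zcode a m q2 x) (SubU ?a ?b)"
    unfolding Zcode_def by (rule ml.uSig_I[OF u ml.uNN_I[OF u] K])
  have "T \<rhd> \<Gamma> \<turnstile> TyEq (SubDec ?a ?b (Zcode a m q2 x)) (Sig NN (Sig ?Y (Eq (Dec (sh 2 s)) (sh 2 x) ?y)))"
    unfolding Zcode_def by (rule ml.ty_trans[OF ml.uSig_D[OF u ml.uNN_I[OF u] K] ml.Sig_cong[OF ml.uNN_D[OF u] KD]])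
  then show "T \<rhd> \<Gamma> \<turnstile> TyEq (SubDec ?a ?b (Zcode a m q2 x)) (ZsetT s i c a m q2 x)"
    unfolding ZsetT_def by (simp add: nfr)
qed

lemma Zset:
  assumes g: "coalg \<Gamma> s i c v P q2" and a: "T \<rhd> \<Gamma> \<turnstile> Tm a (Dec s)" and m: "T \<rhd> \<Gamma> \<turnstile> Tm m (ins 0 [a] P)"
  defines "Z \<equiv> Zfun (UIC_index s i) (UIC_family s i c) (Zset a m q2)"
  shows "T \<rhd> \<Gamma> \<turnstile> Tm (Zset a m q2) (arr (Dec s) (SubU (UIC_index s i) (UIC_family s i c)))"
    and "T \<rhd> \<Gamma> \<turnstile> Tm Z (arr (Dec s) Univ)"
    and "T \<rhd> \<Gamma> \<turnstile> Tm x (Dec s) \<Longrightarrow> T \<rhd> \<Gamma> \<turnstile> TyEq (eps x Z) (ZsetT s i c a m q2 x)"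
proof -
  have ax: "axset (ml T) \<Gamma> s i c v" using g by (auto simp: coalg_def)
  let ?a = "UIC_index s i" and ?b = "UIC_family s i c"
  note u = UIC_ufam(1)[OF ax]
  have A: "T \<rhd> \<Gamma> \<turnstile> Ty (Dec s)" using ax by (auto intro: ml.Dec_F)
  note t = tsub_up1[OF A]
  let ?B = "Zcode (sh 1 a) (sh 1 m) (lift 1 3 q2) (Var 0)"
  have B: "T \<rhd> Dec s # \<Gamma> \<turnstile> Tm ?B (sh 1 (SubU ?a ?b))"
    using Zcode(1)[OF coalg_sub[OF t g], of "sh 1 a" "sh 1 m" "Var 0"] tsub_Tm[OF t a] tsub_Tm[OF t m] ml_var0[OF A]
    by (simp add: nfr)
  show Z: "T \<rhd> \<Gamma> \<turnstile> Tm (Zset a m q2) (arr (Dec s) (SubU ?a ?b))"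
    unfolding Zset_def by (rule ml.Pi_I[OF B])
  show "T \<rhd> \<Gamma> \<turnstile> Tm Z (arr (Dec s) Univ)" unfolding Z_def by (rule code_Zfun(1)[OF u Z])
  assume x: "T \<rhd> \<Gamma> \<turnstile> Tm x (Dec s)"
  have "T \<rhd> \<Gamma> \<turnstile> TmEq (App (Zset a m q2) x) (Zcode a m q2 x) (SubU ?a ?b)"
    using TmEq_beta[OF B x] by (simp add: nfr Zset_def)
  from ml.ty_trans[OF codeD(2)[OF code_Zfun(2)[OF u Z x]] ml.ty_trans[OF TyEq_SubDec[OF u this] Zcode(2)[OF g a m x]]]
  show "T \<rhd> \<Gamma> \<turnstile> TyEq (eps x Z) (ZsetT s i c a m q2 x)" unfolding Z_def .
qed

lemma Zset_intro:
  assumes g: "coalg \<Gamma> s i c v P q2" and a: "T \<rhd> \<Gamma> \<turnstile> Tm a (Dec s)" and m: "T \<rhd> \<Gamma> \<turnstile> Tm m (ins 0 [a] P)"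
    and x: "T \<rhd> \<Gamma> \<turnstile> Tm x (Dec s)" and n: "T \<rhd> \<Gamma> \<turnstile> Tm n NN"
    and t: "T \<rhd> \<Gamma> \<turnstile> Tm t (SubDec (UIC_index s i) (UIC_family s i c) (Fst (recN a m q2 n)))"
    and e: "T \<rhd> \<Gamma> \<turnstile> Tm e (Eq (Dec s) x (Fst (App (Snd (recN a m q2 n)) t)))"
  shows "T \<rhd> \<Gamma> \<turnstile> Tm (Pr n (Pr t e)) (eps x (Zfun (UIC_index s i) (UIC_family s i c) (Zset a m q2)))"
proof -
  note D = Zset(3)[OF g a m x]
  note S = conjunct2[OF Ty_SigD[OF presup_TyEq(2)[OF D, unfolded ZsetT_def]]]
  have S': "T \<rhd> SubDec (UIC_index s i) (UIC_family s i c) (Fst (recN a m q2 n)) # \<Gamma> \<turnstile>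
     Ty (Eq (Dec (sh 1 s)) (sh 1 x) (Fst (App (Snd (sh 1 (recN a m q2 n))) (Var 0))))"
    using conjunct2[OF Ty_SigD[OF ins1_Ty[OF S n, unfolded sub_simps]]] by (simp add: nfr)
  have "T \<rhd> \<Gamma> \<turnstile> Tm (Pr t e) (Sig (SubDec (UIC_index s i) (UIC_family s i c) (Fst (recN a m q2 n)))
      (Eq (Dec (sh 1 s)) (sh 1 x) (Fst (App (Snd (sh 1 (recN a m q2 n))) (Var 0)))))"
    using ml.Sig_I[OF S' t] e by (simp add: nf)
  then have "T \<rhd> \<Gamma> \<turnstile> Tm (Pr n (Pr t e)) (ZsetT s i c a m q2 x)"
    unfolding ZsetT_def by (intro ml.Sig_I[OF S n]) (simp add: nfr)
  then show ?thesis using ml.ty_sym[OF D] by (rule ml.conv)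
qed

lemma Zset_elim:
  assumes g: "coalg \<Gamma> s i c v P q2" and a: "T \<rhd> \<Gamma> \<turnstile> Tm a (Dec s)" and m: "T \<rhd> \<Gamma> \<turnstile> Tm m (ins 0 [a] P)"
    and x: "T \<rhd> \<Gamma> \<turnstile> Tm x (Dec s)"
    and z: "T \<rhd> \<Gamma> \<turnstile> Tm z (eps x (Zfun (UIC_index s i) (UIC_family s i c) (Zset a m q2)))"
  shows "T \<rhd> \<Gamma> \<turnstile> Tm (Fst z) NN"
    and "T \<rhd> \<Gamma> \<turnstile> Tm (Fst (Snd z)) (SubDec (UIC_index s i) (UIC_family s i c) (Fst (recN a m q2 (Fst z))))"
    and "T \<rhd> \<Gamma> \<turnstile> Tm (Snd (Snd z)) (Eq (Dec s) x (Fst (zst a m q2 z)))"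
    and "T \<rhd> \<Gamma> \<turnstile> Tm (zst a m q2 z) (Sig (Dec s) P)"
proof -
  note z' = ml.conv[OF z Zset(3)[OF g a m x], unfolded ZsetT_def]
  show n: "T \<rhd> \<Gamma> \<turnstile> Tm (Fst z) NN" by (rule Fst_I[OF z'])
  have s: "T \<rhd> \<Gamma> \<turnstile> Tm (Snd z) (Sig (SubDec (UIC_index s i) (UIC_family s i c) (Fst (recN a m q2 (Fst z))))
      (Eq (Dec (sh 1 s)) (sh 1 x) (Fst (App (Snd (sh 1 (recN a m q2 (Fst z)))) (Var 0)))))"
    using Snd_I[OF z'] by (simp add: nfr)
  show t: "T \<rhd> \<Gamma> \<turnstile> Tm (Fst (Snd z)) (SubDec (UIC_index s i) (UIC_family s i c) (Fst (recN a m q2 (Fst z))))"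
    by (rule Fst_I[OF s])
  show "T \<rhd> \<Gamma> \<turnstile> Tm (Snd (Snd z)) (Eq (Dec s) x (Fst (zst a m q2 z)))"
    using Snd_I[OF s] by (simp add: nfr zst_def)
  show "T \<rhd> \<Gamma> \<turnstile> Tm (zst a m q2 z) (Sig (Dec s) P)"
    unfolding zst_def by (rule App_arr[OF recT_D(2)[OF recN(2)[OF g a m n]] t])
qed

text \<open>The empty sequence reaches \<open>a\<close> by computation: \<open>recN\<close> at 0 is
  the pair of \<open>uN1\<close> and the constant function with value \<open>(a,m)\<close>.
  Therefore \<open>Star\<close> and reflexivity suffice.\<close>

lemma Zset_start:
  assumes g: "coalg \<Gamma> s i c v P q2" and a: "T \<rhd> \<Gamma> \<turnstile> Tm a (Dec s)" and m: "T \<rhd> \<Gamma> \<turnstile> Tm m (ins 0 [a] P)"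
  shows "T \<rhd> \<Gamma> \<turnstile> Tm (Pr Zero (Pr Star (Rfl a))) (eps a (Zfun (UIC_index s i) (UIC_family s i c) (Zset a m q2)))"
proof -
  let ?a = "UIC_index s i" and ?b = "UIC_family s i c"
  let ?r = "recN a m q2 Zero" and ?f = "Lam (Pr (sh 1 a) (sh 1 m))"
  have ax: "axset (ml T) \<Gamma> s i c v" and P: "T \<rhd> Dec s # \<Gamma> \<turnstile> Ty P" using g by (auto simp: coalg_def)
  have A: "T \<rhd> \<Gamma> \<turnstile> Ty (Dec s)" using P by (rule ml_hd)
  note u = UIC_ufam(1)[OF ax]
  note B = recN_base[OF g a m]
  note r = recN(1)[OF g a m]
  have "T \<rhd> \<Gamma> \<turnstile> TmEq (Fst ?r) uN1 (SubU ?a ?b)"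
    using TmEq_Fst[OF r[unfolded recT_def Let_def]] B(2) by (rule ml.tm_trans)
  then have E: "T \<rhd> \<Gamma> \<turnstile> TyEq (SubDec ?a ?b (Fst ?r)) (SubDec ?a ?b uN1)" by (rule TyEq_SubDec[OF u])
  have star: "T \<rhd> \<Gamma> \<turnstile> Tm Star (SubDec ?a ?b uN1)"
    by (rule ml.conv[OF ml.N1_I[OF ml_Ok[OF a]] ml.ty_sym[OF ml.uN1_D[OF u]]])
  have star': "T \<rhd> \<Gamma> \<turnstile> Tm Star (SubDec ?a ?b (Fst ?r))" by (rule ml.conv[OF star ml.ty_sym[OF E]])
  have "T \<rhd> \<Gamma> \<turnstile> TmEq (Snd ?r) (Snd (Pr uN1 ?f)) (arr (SubDec ?a ?b (Fst ?r)) (Sig (Dec s) P))"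
    using TmEq_Snd[OF r[unfolded recT_def Let_def]] by (simp add: nfr)
  from ml.conv_eq[OF this TyEq_arr[OF E ml.ty_refl[OF Sig_Ty[OF P]]]] B(3)
  have "T \<rhd> \<Gamma> \<turnstile> TmEq (Snd ?r) ?f (arr (SubDec ?a ?b uN1) (Sig (Dec s) P))" by (rule ml.tm_trans)
  from TmEq_App[OF this ml.tm_refl[OF star]] have "T \<rhd> \<Gamma> \<turnstile> TmEq (App (Snd ?r) Star) (App ?f Star) (Sig (Dec s) P)"
    by (simp add: nf)
  from TmEq_Fst[OF ml.tm_trans[OF this B(4)[OF star]]]
  have "T \<rhd> \<Gamma> \<turnstile> TmEq (Fst (App (Snd ?r) Star)) (Fst (Pr a m)) (Dec s)" .
  note ml.tm_sym[OF ml.tm_trans[OF this Fst_C[OF P a m]]]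
  then have "T \<rhd> \<Gamma> \<turnstile> TyEq (Eq (Dec s) a a) (Eq (Dec s) a (Fst (App (Snd ?r) Star)))"
    by (rule ml.Eq_cong[OF ml.ty_refl[OF A] ml.tm_refl[OF a]])
  from Zset_intro[OF g a m a ml.Nat_I0[OF ml_Ok[OF a]] star' ml.conv[OF ml.Eq_I[OF a] this]]
  show ?thesis .
qed

lemma znext_I:
  assumes g: "coalg \<Gamma> s i c v P q2" and a: "T \<rhd> \<Gamma> \<turnstile> Tm a (Dec s)" and m: "T \<rhd> \<Gamma> \<turnstile> Tm m (ins 0 [a] P)"
    and x: "T \<rhd> \<Gamma> \<turnstile> Tm x (Dec s)"
    and z: "T \<rhd> \<Gamma> \<turnstile> Tm z (eps x (Zfun (UIC_index s i) (UIC_family s i c) (Zset a m q2)))"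
    and j: "T \<rhd> \<Gamma> \<turnstile> Tm j (Dec (ins 0 [Fst (zst a m q2 z)] i))"
  shows "T \<rhd> \<Gamma> \<turnstile> Tm (znext a m q2 z j) (Sig (Dec s) (prod (eps (Var 0) (sh 1 (ins 0 [j, Fst (zst a m q2 z)] c)))
     (eps (Var 0) (sh 1 (Zfun (UIC_index s i) (UIC_family s i c) (Zset a m q2))))))"
proof -
  let ?Z = "Zfun (UIC_index s i) (UIC_family s i c) (Zset a m q2)"
  have ax: "axset (ml T) \<Gamma> s i c v" and P: "T \<rhd> Dec s # \<Gamma> \<turnstile> Ty P" using g by (auto simp: coalg_def)
  have A: "T \<rhd> \<Gamma> \<turnstile> Ty (Dec s)" using P by (rule ml_hd)
  note zz = Zset_elim[OF g a m x z]
  define st where "st = zst a m q2 z"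
  define W where "W = stepW q2 st j"
  let ?r = "recN a m q2 (Fst z)" and ?t = "Fst (Snd z)"
  have W: "T \<rhd> \<Gamma> \<turnstile> Tm W (Sig (Dec s) (prod (eps (Var 0) (sh 1 (ins 0 [j, Fst st] c))) P))"
    unfolding W_def st_def by (rule stepW_I[OF g zz(4) j])
  note y = Fst_I[OF W]
  have W2: "T \<rhd> \<Gamma> \<turnstile> Tm (Snd W) (prod (eps (Fst W) (ins 0 [j, Fst st] c)) (ins 0 [Fst W] P))"
    using Snd_I[OF W] by (simp add: nf)
  note N = recS_next[OF g recN(2)[OF g a m zz(1)] recN(3)[OF g a m zz(1)] zz(2) j[unfolded zst_def]]
  have "T \<rhd> \<Gamma> \<turnstile> TmEq (Fst (step q2 st j)) (Fst W) (Dec s)"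
    unfolding step_def W_def[symmetric] by (rule Fst_C[OF P y Snd_prod[OF W2]])
  with TmEq_Fst[OF N(2)] have "T \<rhd> \<Gamma> \<turnstile> TmEq (Fst (App (Snd (recN a m q2 (Succ (Fst z)))) (Pr ?t j))) (Fst W) (Dec s)"
    unfolding st_def zst_def by (rule ml.tm_trans)
  from ml.tm_sym[OF this] have "T \<rhd> \<Gamma> \<turnstile> TyEq (Eq (Dec s) (Fst W) (Fst W)) (Eq (Dec s) (Fst W) (Fst (App (Snd (recN a m q2 (Succ (Fst z)))) (Pr ?t j))))"
    by (rule ml.Eq_cong[OF ml.ty_refl[OF A] ml.tm_refl[OF y]])
  from Zset_intro[OF g a m y ml.Nat_IS[OF zz(1)] N(1) ml.conv[OF ml.Eq_I[OF y] this]]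
  have "T \<rhd> \<Gamma> \<turnstile> Tm (Pr (Succ (Fst z)) (Pr (Pr ?t j) (Rfl (Fst W)))) (eps (Fst W) ?Z)" .
  from Pr_prod[OF Fst_prod[OF W2] this]
  have e: "T \<rhd> \<Gamma> \<turnstile> Tm (Pr (Fst (Snd W)) (Pr (Succ (Fst z)) (Pr (Pr ?t j) (Rfl (Fst W)))))
     (prod (eps (Fst W) (ins 0 [j, Fst st] c)) (eps (Fst W) ?Z))" .
  have v0: "T \<rhd> Dec s # \<Gamma> \<turnstile> Tm (Var 0) (Dec (sh 1 s))" using ml_var0[OF A] by (simp add: nf)
  have "T \<rhd> Dec s # \<Gamma> \<turnstile> Ty (eps (Var 0) (sh 1 ?Z))"
    using App_arr[OF _ v0, of "sh 1 ?Z" Univ] wk1_Tm[OF Zset(2)[OF g a m] A]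
    by (intro ml.Dec_F) (simp add: nf)
  moreover have "T \<rhd> Dec s # \<Gamma> \<turnstile> Ty (eps (Var 0) (sh 1 (ins 0 [j, Fst st] c)))"
    using presup_Tm[OF W] Ty_SigD by blast
  ultimately have "T \<rhd> Dec s # \<Gamma> \<turnstile> Ty (prod (eps (Var 0) (sh 1 (ins 0 [j, Fst st] c))) (eps (Var 0) (sh 1 ?Z)))"
    by (intro Ty_prod)
  from ml.Sig_I[OF this y] e show ?thesis
    unfolding znext_def Let_def st_def[symmetric] W_def[symmetric] by (simp add: nfr)
qed

lemma zincl_I:
  assumes g: "coalg \<Gamma> s i c v P q2" and a: "T \<rhd> \<Gamma> \<turnstile> Tm a (Dec s)" and m: "T \<rhd> \<Gamma> \<turnstile> Tm m (ins 0 [a] P)"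
    and q1: "T \<rhd> P # Dec s # \<Gamma> \<turnstile> Tm q1 (eps (Var 1) (sh 2 v))"
    and x: "T \<rhd> \<Gamma> \<turnstile> Tm x (Dec s)"
    and z: "T \<rhd> \<Gamma> \<turnstile> Tm z (eps x (Zfun (UIC_index s i) (UIC_family s i c) (Zset a m q2)))"
  shows "T \<rhd> \<Gamma> \<turnstile> Tm (zincl a m q1 q2 z) (eps x v)"
proof -
  have ax: "axset (ml T) \<Gamma> s i c v" and P: "T \<rhd> Dec s # \<Gamma> \<turnstile> Ty P" using g by (auto simp: coalg_def)
  have A: "T \<rhd> \<Gamma> \<turnstile> Ty (Dec s)" using P by (rule ml_hd)
  note zz = Zset_elim[OF g a m x z]
  have Q: "T \<rhd> Dec s # \<Gamma> \<turnstile> Ty (eps (Var 0) (sh 1 v))"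
    using App_arr[of "Dec s # \<Gamma>" "sh 1 v" "Dec (sh 1 s)" Univ "Var 0"] ml_var0[OF A] wk1_Tm[of T \<Gamma> v "arr (Dec s) Univ" "Dec s"] ax A
    by (intro ml.Dec_F) (simp add: nf)
  have "T \<rhd> \<Gamma> \<turnstile> Tm (ins 0 [Snd (zst a m q2 z), Fst (zst a m q2 z)] q1) (ins 0 [Fst (zst a m q2 z)] (eps (Var 0) (sh 1 v)))"
    using ins2_Tm[OF q1 Fst_I[OF zz(4)], of "Snd (zst a m q2 z)"] Snd_I[OF zz(4)] by (simp add: nf)
  from transport[OF zz(3) Q this] show ?thesis unfolding zincl_def by (simp add: nf)
qed

lemma ztau_I:
  assumes g: "coalg \<Gamma> s i c v P q2" and a: "T \<rhd> \<Gamma> \<turnstile> Tm a (Dec s)" and m: "T \<rhd> \<Gamma> \<turnstile> Tm m (ins 0 [a] P)"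
    and x: "T \<rhd> \<Gamma> \<turnstile> Tm x (Dec s)"
    and z: "T \<rhd> \<Gamma> \<turnstile> Tm z (eps x (Zfun (UIC_index s i) (UIC_family s i c) (Zset a m q2)))"
  shows "T \<rhd> \<Gamma> \<turnstile> Tm (ztau a m q2 z) (tauT s i c (Zfun (UIC_index s i) (UIC_family s i c) (Zset a m q2)) x)"
proof -
  let ?Z = "Zfun (UIC_index s i) (UIC_family s i c) (Zset a m q2)"
  have ax: "axset (ml T) \<Gamma> s i c v" and P: "T \<rhd> Dec s # \<Gamma> \<turnstile> Ty P" using g by (auto simp: coalg_def)
  have A: "T \<rhd> \<Gamma> \<turnstile> Ty (Dec s)" using P by (rule ml_hd)
  note zz = Zset_elim[OF g a m x z]
  let ?st = "zst a m q2 z"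
  \<comment> \<open>The motive of the transport is the second half of \<open>tauT\<close>, as a type
    over the point.\<close>
  let ?Q = "Pi (Dec i) (Sig (Dec (sh 2 s)) (prod (eps (Var 0) (sh 1 c)) (eps (Var 0) (sh 3 ?Z))))"
  have I': "T \<rhd> Dec s # \<Gamma> \<turnstile> Ty (Dec i)" using ax by (auto intro: ml.Dec_F)
  have Q: "T \<rhd> Dec s # \<Gamma> \<turnstile> Ty ?Q"
    by (rule ml.Pi_F[OF I' presup_TyEq(2)[OF codeD(2)[OF code_tau_aux[OF ax Zset(2)[OF g a m]]]]])
  let ?I = "Dec (ins 0 [Fst ?st] i)"
  have I: "T \<rhd> \<Gamma> \<turnstile> Ty ?I"
    using ins1_Ty[of T "Dec s" \<Gamma> "Dec i" "Fst ?st"] ax Fst_I[OF zz(4)] by (simp add: nf ml.Dec_F)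
  note t = tsub_up1[OF I]
  have "T \<rhd> ?I # \<Gamma> \<turnstile> Tm (znext (sh 1 a) (sh 1 m) (lift 1 3 q2) (sh 1 z) (Var 0))
    (sub (under 1 (Fst ?st ;; Var)) (Sig (Dec (sh 2 s)) (prod (eps (Var 0) (sh 1 c)) (eps (Var 0) (sh 3 ?Z)))))"
    using znext_I[OF coalg_sub[OF t g], of "sh 1 a" "sh 1 m" "sh 1 x" "sh 1 z" "Var 0"]
      tsub_Tm[OF t a] tsub_Tm[OF t m] tsub_Tm[OF t x] tsub_Tm[OF t z] ml_var0[OF I]
    by (simp add: nfr sub_zst)
  then have "T \<rhd> \<Gamma> \<turnstile> Tm (Lam (znext (sh 1 a) (sh 1 m) (lift 1 3 q2) (sh 1 z) (Var 0))) (ins 0 [Fst ?st] ?Q)"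
    using ml.Pi_I[of T ?I \<Gamma>] by (simp add: nfr)
  from transport[OF zz(3) Q this] show ?thesis
    unfolding ztau_def tauT_def by (intro Pr_prod z) (simp add: nfr)
qed

lemma pos3_I:
  assumes g: "coalg \<Gamma> s i c v P q2" and a: "T \<rhd> \<Gamma> \<turnstile> Tm a (Dec s)" and m: "T \<rhd> \<Gamma> \<turnstile> Tm m (ins 0 [a] P)"
    and q1: "T \<rhd> P # Dec s # \<Gamma> \<turnstile> Tm q1 (eps (Var 1) (sh 2 v))"
  shows "T \<rhd> \<Gamma> \<turnstile> Tm (pos3 a m q1 q2) (eps a (Wmax s i c v))"
proof -
  let ?Z = "Zfun (UIC_index s i) (UIC_family s i c) (Zset a m q2)"
  have ax: "axset (ml T) \<Gamma> s i c v" and P: "T \<rhd> Dec s # \<Gamma> \<turnstile> Ty P" using g by (auto simp: coalg_def)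
  have A: "T \<rhd> \<Gamma> \<turnstile> Ty (Dec s)" using P by (rule ml_hd)
  have v0: "T \<rhd> Dec s # \<Gamma> \<turnstile> Tm (Var 0) (Dec (sh 1 s))" using ml_var0[OF A] by (simp add: nf)
  let ?E = "eps (Var 0) (sh 1 ?Z)"
  have E: "T \<rhd> Dec s # \<Gamma> \<turnstile> Ty ?E"
    using App_arr[OF _ v0, of "sh 1 ?Z" Univ] wk1_Tm[OF Zset(2)[OF g a m] A]
    by (intro ml.Dec_F) (simp add: nf)
  let ?G = "?E # Dec s # \<Gamma>"
  have t: "tsub T ?G (up 2) \<Gamma>" using tsub_upS[OF E tsub_up1[OF A]] by (simp add: nf)
  note ok = ml.ok_ext[OF E]
  have x: "T \<rhd> ?G \<turnstile> Tm (Var 1) (Dec (sub (up 2) s))" and z: "T \<rhd> ?G \<turnstile> Tm (Var 0) (eps (Var 1) (sh 2 ?Z))"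
    using ml.var[OF ok, of 1] ml.var[OF ok, of 0] by (simp_all add: nf)
  note g2 = coalg_sub[OF t g]
  have a2: "T \<rhd> ?G \<turnstile> Tm (sh 2 a) (Dec (sub (up 2) s))" and m2: "T \<rhd> ?G \<turnstile> Tm (sh 2 m) (ins 0 [sh 2 a] (sub (under 1 (up 2)) P))"
    using tsub_Tm[OF t a] tsub_Tm[OF t m] by (simp_all add: nf)
  note t4 = tsub_under[OF tsub_under[OF t A] P]
  have "T \<rhd> ?G \<turnstile> Tm (zincl (sh 2 a) (sh 2 m) (lift 2 2 q1) (lift 2 3 q2) (Var 0)) (eps (Var 1) (sh 2 v))"
    using zincl_I[OF g2 a2 m2 _ x, of "lift 2 2 q1" "Var 0"] tsub_Tm[OF t4 q1] z by (simp add: nfr)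
  then have 1: "T \<rhd> \<Gamma> \<turnstile> Tm (Lam (Lam (zincl (sh 2 a) (sh 2 m) (lift 2 2 q1) (lift 2 3 q2) (Var 0)))) (inclT s ?Z v)"
    unfolding inclT_def by (intro ml.Pi_I) (simp add: nf)
  have "T \<rhd> ?G \<turnstile> Tm (ztau (sh 2 a) (sh 2 m) (lift 2 3 q2) (Var 0))
      (sh 1 (tauT (sh 1 s) (lift 1 1 i) (lift 1 2 c) (sh 1 ?Z) (Var 0)))"
    using ztau_I[OF g2 a2 m2 x, of "Var 0"] z by (simp add: nfr)
  then have 2: "T \<rhd> \<Gamma> \<turnstile> Tm (Lam (Lam (ztau (sh 2 a) (sh 2 m) (lift 2 3 q2) (Var 0))))
      (Pi (Dec s) (arr ?E (tauT (sh 1 s) (lift 1 1 i) (lift 1 2 c) (sh 1 ?Z) (Var 0))))"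
    by (intro ml.Pi_I)
  show ?thesis unfolding pos3_def
    using Wmax_intro[OF ax a Zset(1)[OF g a m]] Pr_prod[OF Zset_start[OF g a m] Pr_prod[OF 2 1]]
    unfolding posT_def by blast
qed

end

section \<open>The interpretation of \<open>MLtt_cind\<close>\<close>

lemma under_ren: "(\<And>i. \<exists>j. \<sigma> i = Var j) \<Longrightarrow> \<exists>j. under k \<sigma> i = Var j"
  by (simp add: under_def) (metis lift_Var)

locale stable_terms =
  fixes x1 :: "tm \<Rightarrow> tm \<Rightarrow> tm" and x2 :: "tm \<Rightarrow> tm \<Rightarrow> tm \<Rightarrow> tm" and x3 :: "tm \<Rightarrow> tm \<Rightarrow> tm \<Rightarrow> tm \<Rightarrow> tm"
  assumes stable: "stable x1 x2 x3"
begin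

lemma sub_x:
  "sub \<sigma> (x1 a q) = x1 (sub \<sigma> a) (sub \<sigma> q)"
  "sub \<sigma> (x2 a j q) = x2 (sub \<sigma> a) (sub \<sigma> j) (sub \<sigma> q)"
  "sub \<sigma> (x3 a m q1 q2) = x3 (sub \<sigma> a) (sub \<sigma> m) (sub (under 2 \<sigma>) q1) (sub (under 3 \<sigma>) q2)"
  using stable unfolding stable_def by blast+

abbreviation "ct \<equiv> cind_tm x1 x2 x3"

text \<open>Renamings come first, because \<open>under\<close> lifts the entries of a substitution
  and the law for \<open>lift\<close> is an instance of this one.\<close>

lemma ct_ren: "(\<And>i. \<exists>j. \<sigma> i = Var j) \<Longrightarrow> ct (sub \<sigma> t) = sub \<sigma> (ct t)"
proof (induction t arbitrary: \<sigma>)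
  case (Var i)
  then show ?case by (metis cind_tm.simps(1) sub_simps(1))
qed (simp_all add: under_ren sub_x sub_Wmax)

lemma ct_lift: "ct (lift n k t) = lift n k (ct t)"
  unfolding lift_sub by (rule ct_ren) simp

lemma ct_under: "ct (under k \<sigma> i) = under k (\<lambda>i. ct (\<sigma> i)) i"
  by (simp add: under_def ct_lift)

text \<open>An identity of expressions, unlike \<open>ity_sub\<close>: as \<open>Dec\<close> keeps
  codes and types apart, a single homomorphic translation serves terms and types.\<close>

lemma ct_sub: "ct (sub \<sigma> t) = sub (\<lambda>i. ct (\<sigma> i)) (ct t)"
  by (induction t arbitrary: \<sigma>) (simp_all add: ct_under sub_x sub_Wmax)

lemma ct_ins: "ct (ins n ts t) = ins n (map ct ts) (ct t)"
  unfolding ins_def ct_sub by (rule arg_cong2[where f=sub]) (auto simp: fun_eq_iff)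

lemma cind_jsub: "cind_jdg x1 x2 x3 (jsub \<sigma> J) = jsub (\<lambda>i. ct (\<sigma> i)) (cind_jdg x1 x2 x3 J)"
  by (cases J) (simp_all add: ct_sub)

lemmas ml_head_rules = ml.ok_nil ml.ok_ext ml.N0_F ml.N0_E ml.N1_F ml.N1_I ml.N1_E ml.N1_C ml.Nat_F
  ml.Nat_I0 ml.Nat_IS ml.Nat_E ml.Nat_C0 ml.Nat_CS ml.Lst_F ml.Lst_cong ml.Lst_I0 ml.Lst_I1 ml.Lst_E
  ml.Lst_C0 ml.Lst_C1 ml.Sum_F ml.Sum_cong ml.Sum_I1 ml.Sum_I2 ml.Sum_E ml.Sum_C1 ml.Sum_C2
  ml.Sig_F ml.Sig_cong ml.Sig_I ml.Sig_E ml.Sig_C ml.Pi_F ml.Pi_cong ml.Pi_I ml.Pi_E ml.Pi_C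
  ml.Eq_F ml.Eq_cong ml.Eq_I ml.Eq_E ml.Eq_C ml.Univ_F ml.Dec_F ml.cN0_I ml.cN0_D ml.cN1_I ml.cN1_D
  ml.cNN_I ml.cNN_D ml.cLst_I ml.cLst_D ml.cSum_I ml.cSum_D ml.cSig_I ml.cSig_D ml.cPi_I ml.cPi_D
  ml.cEq_I ml.cEq_D ml.Cov_F ml.Cov_rf ml.Cov_tr ml.Cov_E ml.Cov_C1 ml.Cov_C2

end

lemma sh_Wmax: "sh n (Wmax s i c v) = Wmax (sh n s) (lift n 1 i) (lift n 2 c) (sh n v)"
  by (simp add: lift_nf sub_Wmax)

lemma stable_pos: "stable pos1 pos2 pos3"
  by (simp add: stable_def sub_pos3 pos1_def pos2_def Let_def nf)

lemma interpret_MLtt: "interprets_MLtt_cind pos1 pos2 pos3"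
proof -
  interpret stable_terms pos1 pos2 pos3
    by unfold_locales (rule stable_pos)
  interpret mls MLS_ind
    by unfold_locales simp
  have "MLtt_cind \<rhd> \<Gamma> \<turnstile> J \<Longrightarrow> MLS_ind \<rhd> map ct \<Gamma> \<turnstile> cind_jdg pos1 pos2 pos3 J" for \<Gamma> J
  proof (induction rule: ml.induct)
    case (var \<Gamma> i)
    then show ?case using ml.var[of MLS_ind "map ct \<Gamma>" i] by (simp add: ct_lift)
  next
    case (subst \<Delta> J \<Gamma> \<sigma>)
    then show ?case unfolding cind_jsub
      by (intro ml.subst[of _ "map ct \<Delta>"]) (auto simp: ct_sub ct_lift)
  next
    case (repl_ty \<Delta> C \<Gamma> \<sigma> \<tau>)
    then show ?case unfolding cind_jdg.simps ct_sub
      by (intro ml.repl_ty[of _ "map ct \<Delta>"]) (auto simp: ct_sub ct_lift)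
  next
    case (repl_tm \<Delta> C \<Gamma> \<sigma> \<tau>)
    then show ?case unfolding cind_jdg.simps ct_sub
      by (intro ml.repl_tm[of _ "map ct \<Delta>"]) (auto simp: ct_sub ct_lift)
  next
    case (Cov_F \<Gamma> s i c v a)
    then show ?case by (simp add: ml.Cov_F ct_lift del: One_nat_def)
  next
    case (Cov_rf \<Gamma> s i c v a r)
    then show ?case by (simp add: ml.Cov_rf ct_lift del: One_nat_def)
  next
    case (Cov_tr \<Gamma> s i c v a j r)
    then show ?case by (simp add: ml.Cov_tr ct_lift ct_ins del: One_nat_def)
  next
    case (Cov_E \<Gamma> s i c v a P m q1 q2)
    then show ?case
      using ml.Cov_E[of MLS_ind "map ct \<Gamma>" "ct s" "ct i" "ct c" "ct v" "ct a" "ct P" "ct m" "ct q1" "ct q2"]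
      by (simp add: ct_lift ct_ins del: One_nat_def)
  next
    case (Cov_C1 \<Gamma> s i c v a P r q1 q2)
    then show ?case
      using ml.Cov_C1[of MLS_ind "map ct \<Gamma>" "ct s" "ct i" "ct c" "ct v" "ct a" "ct P" "ct r" "ct q1" "ct q2"]
      by (simp add: ct_lift ct_ins del: One_nat_def)
  next
    case (Cov_C2 \<Gamma> s i c v a P j r q1 q2)
    then show ?case
      using ml.Cov_C2[of MLS_ind "map ct \<Gamma>" "ct s" "ct i" "ct c" "ct v" "ct a" "ct P" "ct j" "ct r" "ct q1" "ct q2"]
      by (simp add: ct_lift ct_ins del: One_nat_def)
  next
    \<comment> \<open>The interpretation of \<open>Dec (Pos s i c v a)\<close> is literally of the
      form \<open>eps a (Wmax s i c v)\<close>, so the rules match \<open>pos1_I\<close>,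
      \<open>pos2_I\<close> and \<open>pos3_I\<close>.\<close>
    case (Pos_F \<Gamma> s i c v a)
    then show ?case
      using App_arr[OF Wmax(1)[of "map ct \<Gamma>" "ct s" "ct i" "ct c" "ct v"], of "ct a"]
      by (simp add: ct_lift del: One_nat_def)
  next
    case (Pos_ax1 \<Gamma> s i c v a q)
    then show ?case
      using pos1_I[of "map ct \<Gamma>" "ct s" "ct i" "ct c" "ct v" "ct a" "ct q"]
      by (simp add: ct_lift del: One_nat_def)
  next
    case (Pos_ax2 \<Gamma> s i c v a j q)
    then show ?case
      using pos2_I[of "map ct \<Gamma>" "ct s" "ct i" "ct c" "ct v" "ct a" "ct j" "ct q"]
      by (simp add: ct_lift ct_ins sh_Wmax del: One_nat_def)
  next
    case (Pos_ax3 \<Gamma> s i c v a P m q1 q2)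
    then show ?case
      using pos3_I[of "map ct \<Gamma>" "ct s" "ct i" "ct c" "ct v" "ct P" "ct q2" "ct a" "ct m" "ct q1"]
      by (simp add: coalg_def ct_lift ct_ins del: One_nat_def)
  next
    case (ty_trans \<Gamma> A B C)
    then show ?case by (auto intro: ml.ty_trans)
  next
    case (tm_trans \<Gamma> a b A c)
    then show ?case by (auto intro: ml.tm_trans)
  next
    case (conv \<Gamma> a A B)
    then show ?case by (auto intro: ml.conv)
  next
    case (conv_eq \<Gamma> a b A B)
    then show ?case by (auto intro: ml.conv_eq)
  qed (simp_all add: ct_lift ct_ins del: One_nat_def,
      (rule ml_head_rules ml.ty_refl ml.tm_refl ml.ty_sym ml.tm_sym; assumption)+)
  then show ?thesis by (simp add: interprets_MLtt_cind_def stable_pos)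
qed

section \<open>The interpretation of \<open>mTT_cind\<close>\<close>

text \<open>In \<open>mTT_cind\<close> the conjuncts in the premise on \<open>q2\<close> stand in
  the opposite order; they are swapped before \<open>pos3\<close> is applied.\<close>

definition pos3' :: "tm \<Rightarrow> tm \<Rightarrow> tm \<Rightarrow> tm \<Rightarrow> tm" where
  "pos3' a m q1 q2 = pos3 a m q1 (Pr (Fst q2) (Pr (Snd (Snd q2)) (Fst (Snd q2))))"

lemma stable_pos': "stable pos1 pos2 pos3'"
  using stable_pos by (simp add: stable_def pos3'_def nf)

definition choice_tm :: tm where
  "choice_tm = Lam (Pr (Lam (Fst (App (Var 1) (Var 0)))) (Lam (Snd (App (Var 1) (Var 0)))))"

text \<open>
  The interpretation of Defs is extended to the axioms: \<open>itm T\<close> and \<open>ity T\<close> agree with \<open>mtt_tm\<close> and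
  \<open>mtt_ty\<close> for \<open>T = mTT_cind\<close>, whereas for \<open>T = mTT_cind_AC_CT\<close> the postulated element of an
  instance of \<open>AC\<close>, which is an implication, becomes \<open>choice_tm\<close>, and that of \<open>CT\<close> becomes \<open>Post CT\<close>.
\<close>

fun post :: "mtt_theory \<Rightarrow> tm \<Rightarrow> tm \<Rightarrow> tm" where
  "post mTT_cind a a' = Post a'"
| "post mTT_cind_AC_CT (C2 f a b) a' = choice_tm"
| "post mTT_cind_AC_CT a a' = Post CT"

primrec itm :: "mtt_theory \<Rightarrow> tm \<Rightarrow> tm" where
  "itm T (Var i) = Var i"
| "itm T (C0 f) = (if f \<in> {oN0, oBot} then cN0 else if f = oN1 then cN1 else if f = oNN then cNN else C0 f)"
| "itm T (C1 f a) = (if f = oPost then post T a (itm T a) else if f = oLst then cLst (itm T a) else C1 f (itm T a))"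
| "itm T (C2 f a b) =
    (if f \<in> {oCoprod, oOr} then cCoprod (itm T a) (itm T b) else if f = oAnd then cAnd (itm T a) (itm T b)
     else if f = oImp then cImp (itm T a) (itm T b) else if f = oAx1 then pos1 (itm T a) (itm T b)
     else C2 f (itm T a) (itm T b))"
| "itm T (C3 f a b c) =
    (if f = oEq then cEq (itm T a) (itm T b) (itm T c) else if f = oAx2 then pos2 (itm T a) (itm T b) (itm T c)
     else C3 f (itm T a) (itm T b) (itm T c))"
| "itm T (CB f a b) =
    (if f \<in> {oSig, oExis} then cSig (itm T a) (itm T b) else if f \<in> {oPi, oForall} then cPi (itm T a) (itm T b)
     else CB f (itm T a) (itm T b))"
| "itm T (Lam a) = Lam (itm T a)"
| "itm T (Split a b) = Split (itm T a) (itm T b)"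
| "itm T (When a b c) = When (itm T a) (itm T b) (itm T c)"
| "itm T (RNat a b c) = RNat (itm T a) (itm T b) (itm T c)"
| "itm T (RLst a b c) = RLst (itm T a) (itm T b) (itm T c)"
| "itm T (SubDec a b c) = SubDec (itm T a) (itm T b) (itm T c)"
| "itm T (SubLift a b c) = SubLift (itm T a) (itm T b) (itm T c)"
| "itm T (Cov a b c d e) = Cov (itm T a) (itm T b) (itm T c) (itm T d) (itm T e)"
| "itm T (Pos a b c d e) = App (Wmax (itm T a) (itm T b) (itm T c) (itm T d)) (itm T e)"
| "itm T (Ind a b c) = Ind (itm T a) (itm T b) (itm T c)"
| "itm T (Ax3 a b c d) = pos3' (itm T a) (itm T b) (itm T c) (itm T d)"

fun ity :: "mtt_theory \<Rightarrow> tm \<Rightarrow> tm" where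
  "ity T (C0 f) = (if f \<in> {oN0, oN1, oNN} then C0 f else if f = oBot then N0 else if f = oProps then Univ
     else Dec (itm T (C0 f)))"
| "ity T (C1 f a) = (if f = oLst then Lst (ity T a) else Dec (itm T (C1 f a)))"
| "ity T (C2 f a b) =
    (if f \<in> {oCoprod, oOr} then Coprod (ity T a) (ity T b) else if f = oAnd then prod (ity T a) (ity T b)
     else if f = oImp then arr (ity T a) (ity T b) else Dec (itm T (C2 f a b)))"
| "ity T (C3 f a b c) = (if f = oEq then Eq (ity T a) (itm T b) (itm T c) else Dec (itm T (C3 f a b c)))"
| "ity T (CB f a b) =
    (if f \<in> {oSig, oExis} then Sig (ity T a) (ity T b) else if f \<in> {oPi, oForall} then Pi (ity T a) (ity T b)
     else Dec (itm T (CB f a b)))"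
| "ity T t = Dec (itm T t)"

lemma itm_mTT_cind: "itm mTT_cind t = mtt_tm pos1 pos2 pos3' t"
  by (induction t) (auto split: op0.split op1.split op2.split op3.split opB.split)

lemma ity_mTT_cind: "ity mTT_cind t = mtt_ty pos1 pos2 pos3' t"
  by (induction t) (auto simp: itm_mTT_cind split: op0.split op1.split op2.split op3.split opB.split)

section \<open>Scoping, and substitution in interpreted terms\<close>

text \<open>
  \<open>wft t n\<close>: the free variables of \<open>t\<close> are below \<open>n\<close>, and \<open>Post\<close> is not applied to a variable,
  so that \<open>post\<close> commutes with substitution.
\<close>

primrec wft :: "tm \<Rightarrow> nat \<Rightarrow> bool" where
  "wft (Var i) n \<longleftrightarrow> i < n"
| "wft (C0 f) n \<longleftrightarrow> True"
| "wft (C1 f a) n \<longleftrightarrow> wft a n \<and> (f = oPost \<longrightarrow> (\<forall>i. a \<noteq> Var i))"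
| "wft (C2 f a b) n \<longleftrightarrow> wft a n \<and> wft b n"
| "wft (C3 f a b c) n \<longleftrightarrow> wft a n \<and> wft b n \<and> wft c n"
| "wft (CB f a b) n \<longleftrightarrow> wft a n \<and> wft b (n + 1)"
| "wft (Lam a) n \<longleftrightarrow> wft a (n + 1)"
| "wft (Split a b) n \<longleftrightarrow> wft a n \<and> wft b (n + 2)"
| "wft (When a b c) n \<longleftrightarrow> wft a n \<and> wft b (n + 1) \<and> wft c (n + 1)"
| "wft (RNat a b c) n \<longleftrightarrow> wft a n \<and> wft b n \<and> wft c (n + 2)"
| "wft (RLst a b c) n \<longleftrightarrow> wft a n \<and> wft b n \<and> wft c (n + 3)"
| "wft (SubDec a b c) n \<longleftrightarrow> wft a n \<and> wft b (n + 1) \<and> wft c n"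
| "wft (SubLift a b c) n \<longleftrightarrow> wft a n \<and> wft b (n + 1) \<and> wft c n"
| "wft (Cov a b c d e) n \<longleftrightarrow> wft a n \<and> wft b (n + 1) \<and> wft c (n + 2) \<and> wft d n \<and> wft e n"
| "wft (Pos a b c d e) n \<longleftrightarrow> wft a n \<and> wft b (n + 1) \<and> wft c (n + 2) \<and> wft d n \<and> wft e n"
| "wft (Ind a b c) n \<longleftrightarrow> wft a n \<and> wft b (n + 2) \<and> wft c (n + 4)"
| "wft (Ax3 a b c d) n \<longleftrightarrow> wft a n \<and> wft b n \<and> wft c (n + 2) \<and> wft d (n + 3)"

lemma sub_not_Var: "(\<forall>i. a \<noteq> Var i) \<Longrightarrow> sub \<sigma> a \<noteq> Var j"
  by (cases a) auto

definition ren :: "(nat \<Rightarrow> tm) \<Rightarrow> nat \<Rightarrow> nat \<Rightarrow> bool" where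
  "ren \<sigma> n m \<longleftrightarrow> (\<forall>i. \<exists>j. \<sigma> i = Var j \<and> (i < n \<longrightarrow> j < m))"

lemma ren_under: "ren \<sigma> n m \<Longrightarrow> ren (under k \<sigma>) (n + k) (m + k)"
  unfolding ren_def under_def
proof (intro allI)
  fix i assume *: "\<forall>i. \<exists>j. \<sigma> i = Var j \<and> (i < n \<longrightarrow> j < m)"
  show "\<exists>j. (if i < k then Var i else sh k (\<sigma> (i - k))) = Var j \<and> (i < n + k \<longrightarrow> j < m + k)"
  proof (cases "i < k")
    case False
    from * obtain j where "\<sigma> (i - k) = Var j" "i - k < n \<longrightarrow> j < m" by blast
    with False show ?thesis by (auto simp: lift_Var)
  qed auto
qed

lemma wft_ren: "wft t n \<Longrightarrow> ren \<sigma> n m \<Longrightarrow> wft (sub \<sigma> t) m"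
proof (induction t arbitrary: n m \<sigma>)
  case (Var i)
  then show ?case by (auto simp: ren_def dest!: spec[of _ i])
qed (auto simp: sub_not_Var dest: ren_under[of _ _ _ 1] ren_under[of _ _ _ 2] ren_under[of _ _ _ 3] ren_under[of _ _ _ 4])

lemma wft_lift: "wft t m \<Longrightarrow> wft (lift n k t) (m + n)"
  unfolding lift_sub by (rule wft_ren) (auto simp: ren_def)

lemma wft_lift': "wft t (m - n) \<Longrightarrow> n \<le> m \<Longrightarrow> wft (lift n k t) m"
  using wft_lift[of t "m - n" n k] by simp

lemma wft_mono: "wft t n \<Longrightarrow> n \<le> m \<Longrightarrow> wft t m"
  using wft_ren[of t n Var m] by (auto simp: ren_def)

definition wfs :: "(nat \<Rightarrow> tm) \<Rightarrow> nat \<Rightarrow> nat \<Rightarrow> bool" where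
  "wfs \<sigma> n m \<longleftrightarrow> (\<forall>i<n. wft (\<sigma> i) m)"

lemma wfs_under: "wfs \<sigma> n m \<Longrightarrow> wfs (under k \<sigma>) (n + k) (m + k)"
  by (auto simp: wfs_def under_def intro: wft_lift)

lemma wft_sub: "wft t n \<Longrightarrow> wfs \<sigma> n m \<Longrightarrow> wft (sub \<sigma> t) m"
proof (induction t arbitrary: n m \<sigma>)
  case (Var i)
  then show ?case by (auto simp: wfs_def)
qed (auto simp: sub_not_Var dest: wfs_under[of _ _ _ 1] wfs_under[of _ _ _ 2] wfs_under[of _ _ _ 3] wfs_under[of _ _ _ 4])

lemma wft_ins: "wft t (l + length ts) \<Longrightarrow> \<forall>u\<in>set ts. wft u (l + n) \<Longrightarrow> wft (ins n ts t) (l + n)"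
  unfolding ins_def by (rule wft_sub) (auto simp: wfs_def)

definition idn :: "(nat \<Rightarrow> tm) \<Rightarrow> nat \<Rightarrow> bool" where
  "idn \<sigma> n \<longleftrightarrow> (\<forall>i<n. \<sigma> i = Var i)"

lemma idn_under: "idn \<sigma> n \<Longrightarrow> idn (under k \<sigma>) (n + k)"
  by (auto simp: idn_def under_def lift_Var)

lemma sub_closed: "wft t n \<Longrightarrow> idn \<sigma> n \<Longrightarrow> sub \<sigma> t = t"
proof (induction t arbitrary: n \<sigma>)
  case (Var i)
  then show ?case by (simp add: idn_def)
qed (auto dest: idn_under[of _ _ 1] idn_under[of _ _ 2] idn_under[of _ _ 3] idn_under[of _ _ 4])

lemma wft_pr_tm: "pr_ok f (length ts) \<Longrightarrow> \<forall>t\<in>set ts. wft t n \<Longrightarrow> wft (pr_tm f ts) n"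
proof (induction f arbitrary: ts n)
  case (PComp f gs)
  have "\<forall>u\<in>set (map (\<lambda>h. h ts) (map pr_tm gs)). wft u n"
    using PComp.prems by (auto simp: list_all_iff intro!: PComp.IH(2))
  then show ?case using PComp.prems PComp.IH(1)[of "map (\<lambda>h. h ts) (map pr_tm gs)"] by simp
next
  case (PRec f g)
  then obtain t us where ts: "ts = t # us" by (cases ts) auto
  have "wft (pr_tm g (Var 1 # Var 0 # map (sh 2) us)) (n + 2)"
    using PRec.prems ts by (intro PRec.IH(2)) (auto intro: wft_lift')
  then show ?case using PRec ts by simp
next
  case PSucc
  then show ?case by (cases ts) auto
qed auto

lemma wft_CT: "wft CT 0" and wft_mCT: "wft mCT 0"
  using pr_ok_prT pr_ok_prU
  by (auto simp: CT_def mCT_def numeral_3_eq_3 intro!: wft_lift' wft_pr_tm)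

text \<open>\<open>post\<close> inspects the head of its argument. A substitution changes the head
  only of a variable, and a renaming turns a variable into a variable; the values
  \<open>choice_tm\<close> and \<open>Post CT\<close> are closed.\<close>

lemma post_sub:
  assumes "(\<forall>i. a \<noteq> Var i) \<or> (\<forall>i. \<exists>j. \<sigma> i = Var j)"
  shows "post T (sub \<sigma> a) (sub \<tau> a') = sub \<tau> (post T a a')"
proof -
  have "sub \<tau> CT = CT" by (rule sub_closed[OF wft_CT]) (simp add: idn_def)
  moreover have "sub \<tau> choice_tm = choice_tm" by (simp add: choice_tm_def nf)
  moreover have "\<exists>j. \<sigma> i = Var j" if "a = Var i" for i using assms that by auto
  ultimately show ?thesis by (cases T; cases a) force+
qed

lemma itm_ren: "(\<And>i. \<exists>j. \<sigma> i = Var j) \<Longrightarrow> itm T (sub \<sigma> t) = sub \<sigma> (itm T t)"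
proof (induction t arbitrary: \<sigma>)
  case (Var i)
  then show ?case by (metis itm.simps(1) sub_simps(1))
qed (use stable_pos' in \<open>simp_all add: under_ren stable_def sub_Wmax sub_sh[of "Suc 0", simplified] post_sub\<close>)

lemma itm_lift: "itm T (lift n k t) = lift n k (itm T t)"
  unfolding lift_sub by (rule itm_ren) simp

lemma itm_under: "itm T (under k \<sigma> i) = under k (\<lambda>i. itm T (\<sigma> i)) i"
  by (simp add: under_def itm_lift)

lemma itm_sub: "wft t n \<Longrightarrow> itm T (sub \<sigma> t) = sub (\<lambda>i. itm T (\<sigma> i)) (itm T t)"
proof (induction t arbitrary: \<sigma> n)
  case (C1 f a)
  then show ?case by (auto simp: post_sub)
qed (use stable_pos' in \<open>auto simp: itm_under stable_def sub_Wmax sub_sh[of "Suc 0", simplified]\<close>)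

lemma insf_map: "(\<lambda>i. itm T (insf n ts i)) = insf n (map (itm T) ts)"
  by (auto simp: insf_def fun_eq_iff)

lemma itm_ins: "wft t l \<Longrightarrow> itm T (ins n ts t) = ins n (map (itm T) ts) (itm T t)"
  by (simp add: ins_nf itm_sub insf_map)

primrec wfc :: "tm list \<Rightarrow> bool" where
  "wfc [] \<longleftrightarrow> True"
| "wfc (A # \<Gamma>) \<longleftrightarrow> wft A (length \<Gamma>) \<and> wfc \<Gamma>"

primrec wfj :: "nat \<Rightarrow> mjdg \<Rightarrow> bool" where
  "wfj n mOk \<longleftrightarrow> True"
| "wfj n (mTy k A) \<longleftrightarrow> wft A n"
| "wfj n (mTyEq k A B) \<longleftrightarrow> wft A n \<and> wft B n"
| "wfj n (mTm a A) \<longleftrightarrow> wft a n \<and> wft A n"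
| "wfj n (mTmEq a b A) \<longleftrightarrow> wft a n \<and> wft b n \<and> wft A n"

lemma wfc_nth: "wfc \<Gamma> \<Longrightarrow> i < length \<Gamma> \<Longrightarrow> wft (\<Gamma> ! i) (length \<Gamma> - Suc i)"
  by (induction \<Gamma> arbitrary: i) (auto simp: nth_Cons split: nat.split)

lemma wft_ins': "wft t (m - n + length ts) \<Longrightarrow> n \<le> m \<Longrightarrow> \<forall>u\<in>set ts. wft u m \<Longrightarrow> wft (ins n ts t) m"
  using wft_ins[of t "m - n" ts n] by simp

lemma wfj_sub: "wfj n J \<Longrightarrow> wfs \<sigma> n m \<Longrightarrow> wfj m (mjsub \<sigma> J)"
  by (cases J) (auto intro: wft_sub)

text \<open>Provides the hypothesis \<open>wft\<close> of the substitution laws. Only the two axiom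
  rules introduce \<open>Post\<close>, with an implication or a quantification as argument, and
  substitution turns neither into a variable.\<close>

lemma mtt_wf: "T \<rhd> \<Gamma> \<Turnstile> J \<Longrightarrow> wfc \<Gamma> \<and> wfj (length \<Gamma>) J"
proof (induction rule: mtt.induct)
  case (var \<Gamma> i)
  then show ?case by (auto intro!: wft_lift' wfc_nth)
next
  case (subst \<Delta> J \<Gamma> \<sigma>)
  then show ?case by (auto intro!: wfj_sub simp: wfs_def)
next
  case (repl_ty \<Delta> k C \<Gamma> \<sigma> \<tau>)
  then have "wfs \<sigma> (length \<Delta>) (length \<Gamma>)" "wfs \<tau> (length \<Delta>) (length \<Gamma>)" by (auto simp: wfs_def)
  then show ?case using repl_ty by (auto intro: wft_sub)
next
  case (repl_tm \<Delta> c C \<Gamma> \<sigma> \<tau>)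
  then have "wfs \<sigma> (length \<Delta>) (length \<Gamma>)" "wfs \<tau> (length \<Delta>) (length \<Gamma>)" by (auto simp: wfs_def)
  then show ?case using repl_tm by (auto intro: wft_sub)
next
  case (CT_ax \<Gamma>)
  then show ?case using wft_mono[OF wft_mCT] by (auto simp: mCT_def)
next
  case (AC_ax \<Gamma> A B R)
  then show ?case by (auto simp: mAC_def numeral_eq_Suc intro!: wft_lift' wft_ins')
qed (auto simp: numeral_eq_Suc intro!: wft_lift' wft_ins')

section \<open>Interpreted types and substitution\<close>

lemma size_ren: "(\<And>i. \<exists>j. \<sigma> i = Var j) \<Longrightarrow> size (sub \<sigma> t) = size t"
proof (induction t arbitrary: \<sigma>)
  case (Var i)
  then obtain j where "\<sigma> i = Var j" by blast
  then show ?case by simp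
qed (simp_all add: under_ren)

lemma size_lift: "size (lift n k t) = size t"
  unfolding lift_sub by (rule size_ren) simp

lemma ity_ren: "(\<And>i. \<exists>j. \<sigma> i = Var j) \<Longrightarrow> ity T (sub \<sigma> A) = sub \<sigma> (ity T A)"
proof (induction A arbitrary: \<sigma>)
  case (Var i)
  then obtain j where "\<sigma> i = Var j" by blast
  then show ?case by simp
qed (use stable_pos' in \<open>simp_all add: itm_ren under_ren stable_def sub_Wmax sub_sh[of "Suc 0", simplified] post_sub\<close>)

lemma ity_lift: "ity T (lift n k t) = lift n k (ity T t)"
  unfolding lift_sub by (rule ity_ren) simp

text \<open>\<open>ity\<close> decodes variables, so it commutes with \<open>\<sigma>\<close>
  literally if it also decodes the entries of \<open>\<sigma>\<close>. Variables and constructor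
  terms such as \<open>Zero\<close>, \<open>Succ t\<close> or \<open>Pr a b\<close> are of this
  kind, which covers the motives in the branches of the eliminators.\<close>

lemma ity_strict:
  "wft A n \<Longrightarrow> (\<And>i. ity T (\<sigma> i) = Dec (itm T (\<sigma> i))) \<Longrightarrow> ity T (sub \<sigma> A) = sub (\<lambda>i. itm T (\<sigma> i)) (ity T A)"
proof (induction A arbitrary: \<sigma> n)
  case (C1 f a)
  then show ?case by (auto simp: itm_sub post_sub)
next
  case (CB f a b)
  have "ity T (under (Suc 0) \<sigma> i) = Dec (itm T (under (Suc 0) \<sigma> i))" for i
    using CB.prems(2) by (simp add: under_def ity_lift itm_lift) (simp add: lift_nf)
  then show ?case using CB by (auto simp: itm_sub itm_under)
qed (use stable_pos' in \<open>auto simp: itm_sub itm_under stable_def sub_Wmax sub_sh[of "Suc 0", simplified]\<close>)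

lemma ity_ins_strict:
  assumes "wft A l" "\<forall>t\<in>set ts. ity T t = Dec (itm T t)"
  shows "ity T (ins n ts A) = ins n (map (itm T) ts) (ity T A)"
proof -
  have "ity T (sub (insf n ts) A) = sub (\<lambda>i. itm T (insf n ts i)) (ity T A)"
    using assms by (intro ity_strict) (auto simp: insf_def)
  then show ?thesis by (simp add: ins_nf insf_map)
qed

context mls
begin

text \<open>By \<open>ml_inv_Tm\<close> a derivable code that interprets a type former has derivable
  codes as components; decoding rules followed by type congruence give the equation.
  \<open>Props\<close> is excluded, as it is no derivable code, and for other heads both sides
  coincide. The induction is on size because the second part of a conjunction or an implication
  occurs weakened.\<close>

lemma good: "T \<rhd> \<Gamma> \<turnstile> Tm (itm S a) Univ \<Longrightarrow> T \<rhd> \<Gamma> \<turnstile> TyEq (Dec (itm S a)) (ity S a)"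
proof (induction "size a" arbitrary: a \<Gamma> rule: less_induct)
  case less
  note ok = ml_Ok[OF less.prems]
  note inv = ml_inv_Tm[OF less.prems]
  have self: "T \<rhd> \<Gamma> \<turnstile> TyEq (Dec (itm S a)) (Dec (itm S a))" by (rule ml.ty_refl[OF ml.Dec_F[OF less.prems]])
  have IH: "T \<rhd> \<Delta> \<turnstile> TyEq (Dec (itm S b)) (ity S b)" if "size b < size a" "T \<rhd> \<Delta> \<turnstile> Tm (itm S b) Univ" for b \<Delta>
    using less.hyps that .
  show ?case
  proof (cases a)
    case (C0 f)
    then show ?thesis using self inv ok by (auto simp: tm_inv_def intro: ml.cN0_D ml.cN1_D ml.cNN_D)
  next
    case (C1 f b)
    then show ?thesis using self inv IH[of b \<Gamma>]
      by (auto simp: tm_inv_def intro: ml.ty_trans[OF ml.cLst_D ml.Lst_cong])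
  next
    case (C2 f b c)
    then show ?thesis using self inv IH[of b \<Gamma>] IH[of c \<Gamma>] IH[of "sh 1 c" "Dec (itm S b) # \<Gamma>"]
      by (auto simp: tm_inv_def size_lift itm_lift ity_lift intro: ml.ty_trans[OF ml.cSum_D ml.Sum_cong]
         ml.ty_trans[OF ml.cSig_D ml.Sig_cong] ml.ty_trans[OF ml.cPi_D ml.Pi_cong])
  next
    case (C3 f b c d)
    then show ?thesis using self inv IH[of b \<Gamma>]
      by (auto simp: tm_inv_def intro: ml.ty_trans[OF ml.cEq_D ml.Eq_cong[OF _ ml.tm_refl ml.tm_refl]])
  next
    case (CB f b c)
    then show ?thesis using self inv IH[of b \<Gamma>] IH[of c "Dec (itm S b) # \<Gamma>"]
      by (auto simp: tm_inv_def intro: ml.ty_trans[OF ml.cSig_D ml.Sig_cong] ml.ty_trans[OF ml.cPi_D ml.Pi_cong])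
  qed (use self in auto)
qed

text \<open>Literal equality fails only at a variable in type position, where
  \<open>\<sigma> i\<close> may be a small proposition with a type former at its head; there
  \<open>good\<close> applies. Congruence of types, also under binders, propagates the
  equation.\<close>

lemma ity_sub:
  "wft A n \<Longrightarrow> T \<rhd> \<Delta> \<turnstile> Ty (ity S A) \<Longrightarrow> tsub T \<Gamma> (\<lambda>i. itm S (\<sigma> i)) \<Delta> \<Longrightarrow>
    T \<rhd> \<Gamma> \<turnstile> TyEq (sub (\<lambda>i. itm S (\<sigma> i)) (ity S A)) (ity S (sub \<sigma> A))"
proof (induction "size A" arbitrary: A n \<Delta> \<Gamma> \<sigma> rule: less_induct)
  case less
  let ?\<sigma> = "\<lambda>i. itm S (\<sigma> i)"
  note t = less.prems(3)
  note ok = ml_Ok[OF tsub_Ty[OF t less.prems(2)]]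
  note inv = ml_inv_Ty[OF less.prems(2)]
  have self: "T \<rhd> \<Gamma> \<turnstile> TyEq (sub ?\<sigma> (ity S A)) (sub ?\<sigma> (ity S A))" by (rule ml.ty_refl[OF tsub_Ty[OF t less.prems(2)]])
  have IH: "T \<rhd> \<Gamma> \<turnstile> TyEq (sub ?\<sigma> (ity S B)) (ity S (sub \<sigma> B))"
    if "size B < size A" "wft B m" "T \<rhd> \<Delta> \<turnstile> Ty (ity S B)" for B m
    using less.hyps[OF that t] .
  have IH1: "T \<rhd> sub ?\<sigma> X # \<Gamma> \<turnstile> TyEq (sub (under 1 ?\<sigma>) (ity S B)) (ity S (sub (under 1 \<sigma>) B))"
    if "size B < size A" "wft B m" "T \<rhd> X # \<Delta> \<turnstile> Ty (ity S B)" for X B m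
  proof -
    have "tsub T (sub ?\<sigma> X # \<Gamma>) (\<lambda>i. itm S (under 1 \<sigma> i)) (X # \<Delta>)"
      using tsub_under[OF t ml_hd[OF that(3)]] unfolding itm_under by (simp add: nf)
    from less.hyps[OF that this] show ?thesis by (simp add: itm_under)
  qed
  have IH2: "T \<rhd> sub ?\<sigma> X # \<Gamma> \<turnstile> TyEq (sub (under 1 ?\<sigma>) (sh 1 (ity S B))) (sh 1 (ity S (sub \<sigma> B)))"
    if "size B < size A" "wft B m" "T \<rhd> X # \<Delta> \<turnstile> Ty (sh 1 (ity S B))" for X B m
    using IH1[of "sh 1 B" "m + 1" X] that by (simp add: size_lift wft_lift' ity_lift sub_sh)
  show ?case
  proof (cases A)
    case (Var i)
    then have "T \<rhd> \<Delta> \<turnstile> Tm (Var i) Univ" using inv by simp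
    from tsub_Tm[OF t this] Var show ?thesis by (simp add: good)
  next
    case (C0 f)
    then show ?thesis using self by auto
  next
    case (C1 f b)
    then show ?thesis using self inv IH[of b n] less.prems(1)
      by (auto simp: itm_sub post_sub intro: ml.Lst_cong)
  next
    case (C2 f b c)
    then show ?thesis using self inv IH[of b n] IH[of c n] IH2[of c n "ity S b"] less.prems(1) stable_pos'
      by (auto simp: itm_sub stable_def sub_sh[of "Suc 0", simplified] intro: ml.Sum_cong ml.Sig_cong ml.Pi_cong)
  next
    case (C3 f b c d)
    then show ?thesis using self inv IH[of b n] less.prems(1) tsub_Tm[OF t] stable_pos'
      by (auto simp: itm_sub stable_def intro!: ml.Eq_cong ml.tm_refl)
  next
    case (CB f b c)
    then show ?thesis using self inv IH[of b n] IH1[of c "n + 1" "ity S b"] less.prems(1)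
      by (auto simp: itm_sub itm_under intro: ml.Sig_cong ml.Pi_cong)
  qed (use self less.prems(1) stable_pos' in \<open>auto simp: itm_sub itm_under stable_def sub_Wmax\<close>)
qed

text \<open>The type of each entry is converted by \<open>ity_sub\<close>, which requires a
  well-typed substitution for the rest of the context; hence the induction on
  \<open>\<Delta>\<close>.\<close>

lemma tsub_itm:
  assumes "T \<rhd> map (ity S) \<Delta> \<turnstile> Ok" "T \<rhd> \<Gamma> \<turnstile> Ok" "wfc \<Delta>"
    and "\<forall>i<length \<Delta>. T \<rhd> \<Gamma> \<turnstile> Tm (itm S (\<sigma> i)) (ity S (sub \<sigma> (sh (Suc i) (\<Delta> ! i))))"
  shows "tsub T \<Gamma> (\<lambda>i. itm S (\<sigma> i)) (map (ity S) \<Delta>)"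
  using assms
proof (induction \<Delta> arbitrary: \<sigma>)
  case Nil
  then show ?case by (simp add: tsub_def)
next
  case (Cons A \<Delta>)
  have ok: "T \<rhd> map (ity S) \<Delta> \<turnstile> Ok" and A: "T \<rhd> map (ity S) \<Delta> \<turnstile> Ty (ity S A)"
    using ml_tl[OF Cons.prems(1)[simplified]] ml_hd[OF Cons.prems(1)[simplified]] by auto
  have "\<forall>i<length \<Delta>. T \<rhd> \<Gamma> \<turnstile> Tm (itm S (\<sigma> (Suc i))) (ity S (sub (\<lambda>i. \<sigma> (Suc i)) (sh (Suc i) (\<Delta> ! i))))"
  proof (intro allI impI)
    fix i assume "i < length \<Delta>"
    then have "T \<rhd> \<Gamma> \<turnstile> Tm (itm S (\<sigma> (Suc i))) (ity S (sub \<sigma> (sh (Suc (Suc i)) (\<Delta> ! i))))"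
      using Cons.prems(4)[rule_format, of "Suc i"] by simp
    moreover have "sub \<sigma> (sh (Suc (Suc i)) (\<Delta> ! i)) = sub (\<lambda>i. \<sigma> (Suc i)) (sh (Suc i) (\<Delta> ! i))"
      by (simp add: lift_sub sub_sub)
    ultimately show "T \<rhd> \<Gamma> \<turnstile> Tm (itm S (\<sigma> (Suc i))) (ity S (sub (\<lambda>i. \<sigma> (Suc i)) (sh (Suc i) (\<Delta> ! i))))" by simp
  qed
  then have t: "tsub T \<Gamma> (\<lambda>i. itm S (\<sigma> (Suc i))) (map (ity S) \<Delta>)"
    using Cons.prems ok by (intro Cons.IH) auto
  have "T \<rhd> \<Gamma> \<turnstile> Tm (itm S (\<sigma> 0)) (ity S (sub (\<lambda>i. \<sigma> (Suc i)) A))"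
    using Cons.prems(4)[rule_format, of 0] by (simp add: lift_sub sub_sub)
  then have "T \<rhd> \<Gamma> \<turnstile> Tm (itm S (\<sigma> 0)) (sub (\<lambda>i. itm S (\<sigma> (Suc i))) (ity S A))"
    using ity_sub[OF _ A t] Cons.prems(3) by (auto intro: ml.conv ml.ty_sym)
  from tsub_Cons[OF t this] have "tsub T \<Gamma> (itm S (\<sigma> 0) ;; (\<lambda>i. itm S (\<sigma> (Suc i)))) (map (ity S) (A # \<Delta>))" by simp
  moreover have "itm S (\<sigma> 0) ;; (\<lambda>i. itm S (\<sigma> (Suc i))) = (\<lambda>i. itm S (\<sigma> i))"
    by (auto simp: scons_def fun_eq_iff split: nat.split)
  ultimately show ?case by simp
qed

end

section \<open>The soundness statement and its behaviour under substitution\<close>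

primrec tgt :: "mtt_theory \<Rightarrow> ml_theory" where
  "tgt mTT_cind = MLS_ind"
| "tgt mTT_cind_AC_CT = MLS_ind_CT"

text \<open>For a set or a small proposition a code is demanded; that it decodes to the interpreted
  type follows by \<open>good\<close>.\<close>

fun holds :: "mtt_theory \<Rightarrow> tm list \<Rightarrow> mjdg \<Rightarrow> bool" where
  "holds S \<Gamma> mOk \<longleftrightarrow> tgt S \<rhd> map (ity S) \<Gamma> \<turnstile> Ok"
| "holds S \<Gamma> (mTy k A) \<longleftrightarrow> tgt S \<rhd> map (ity S) \<Gamma> \<turnstile> Ty (ity S A) \<and>
     (k \<in> {SetK, PropS} \<longrightarrow> tgt S \<rhd> map (ity S) \<Gamma> \<turnstile> Tm (itm S A) Univ)"
| "holds S \<Gamma> (mTyEq k A B) \<longleftrightarrow> tgt S \<rhd> map (ity S) \<Gamma> \<turnstile> TyEq (ity S A) (ity S B)"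
| "holds S \<Gamma> (mTm a A) \<longleftrightarrow> tgt S \<rhd> map (ity S) \<Gamma> \<turnstile> Tm (itm S a) (ity S A)"
| "holds S \<Gamma> (mTmEq a b A) \<longleftrightarrow> tgt S \<rhd> map (ity S) \<Gamma> \<turnstile> TmEq (itm S a) (itm S b) (ity S A)"

context mls
begin

lemma small_Ty: "T \<rhd> \<Gamma> \<turnstile> Tm (itm S A) Univ \<Longrightarrow> T \<rhd> \<Gamma> \<turnstile> Ty (ity S A)"
  by (rule presup_TyEq(2)[OF good])

lemma tsub_small: "T \<rhd> \<Gamma> \<turnstile> Tm (itm S A) Univ \<Longrightarrow> tsub T (Dec (itm S A) # \<Gamma>) Var (ity S A # \<Gamma>)"
  by (rule tsub_conv_Var[OF tsub_Var good]) (auto intro: ml_Ok ml.Dec_F)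

lemma ctx_small: "T \<rhd> \<Gamma> \<turnstile> Tm (itm S A) Univ \<Longrightarrow> T \<rhd> ity S A # \<Gamma> \<turnstile> J \<Longrightarrow> T \<rhd> Dec (itm S A) # \<Gamma> \<turnstile> J"
  by (rule ml_ctx_conv[OF tsub_small])

lemma conv_ins:
  assumes "tsub T \<Gamma> (insf 0 (map (itm S) ts)) \<Delta>" "T \<rhd> \<Delta> \<turnstile> Ty (ity S C)" "wft C l"
  shows "T \<rhd> \<Gamma> \<turnstile> TyEq (ins 0 (map (itm S) ts) (ity S C)) (ity S (ins 0 ts C))"
  using ity_sub[OF assms(3,2), of \<Gamma> "insf 0 ts"] assms(1) by (simp add: ins_nf insf_map)

lemma conv_ins1:
  assumes "T \<rhd> X # \<Gamma> \<turnstile> Ty (ity S C)" "T \<rhd> \<Gamma> \<turnstile> Tm (itm S t) X" "wft C l"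
  shows "T \<rhd> \<Gamma> \<turnstile> TyEq (ins 0 [itm S t] (ity S C)) (ity S (ins 0 [t] C))"
  using conv_ins[of \<Gamma> S "[t]" "X # \<Gamma>" C l] tsub_Cons[OF tsub_Var, of T \<Gamma> "itm S t" X] assms
  by (auto simp: insf_simps up_0 dest: ml_Ok)

lemma conv_ins2:
  assumes "T \<rhd> Y # X # \<Gamma> \<turnstile> Ty (ity S C)" "T \<rhd> \<Gamma> \<turnstile> Tm (itm S a) X" "T \<rhd> \<Gamma> \<turnstile> Tm (itm S b) (sub (itm S a ;; Var) Y)" "wft C l"
  shows "T \<rhd> \<Gamma> \<turnstile> TyEq (ins 0 [itm S b, itm S a] (ity S C)) (ity S (ins 0 [b, a] C))"
  using conv_ins[of \<Gamma> S "[b, a]" "Y # X # \<Gamma>" C l] tsub_Cons[OF tsub_Cons[OF tsub_Var], of T \<Gamma> "itm S a" X "itm S b" Y] assms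
  by (auto simp: insf_simps up_0 dest: ml_Ok)

lemma Tm_ins1:
  assumes "T \<rhd> X # \<Gamma> \<turnstile> Ty (ity S C)" "T \<rhd> \<Gamma> \<turnstile> Tm (itm S t) X" "wft C l"
  shows "T \<rhd> \<Gamma> \<turnstile> Tm u (ity S (ins 0 [t] C)) \<longleftrightarrow> T \<rhd> \<Gamma> \<turnstile> Tm u (ins 0 [itm S t] (ity S C))"
    and "T \<rhd> \<Gamma> \<turnstile> TmEq u u' (ity S (ins 0 [t] C)) \<longleftrightarrow> T \<rhd> \<Gamma> \<turnstile> TmEq u u' (ins 0 [itm S t] (ity S C))"
  using conv_ins1[OF assms] by (auto intro: ml.conv ml.conv_eq ml.ty_sym)

text \<open>Eliminations towards propositions that do not depend on proof-terms are dependent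
  eliminations with a constant motive. So are the rules that follow; in \<open>IdRec_nd\<close> the
  motive is constant in the identity proof only.\<close>

lemma R0_nd: "T \<rhd> \<Gamma> \<turnstile> Ty C \<Longrightarrow> T \<rhd> \<Gamma> \<turnstile> Tm t N0 \<Longrightarrow> T \<rhd> \<Gamma> \<turnstile> Tm (R0 t) C"
  using ml.N0_E[of T \<Gamma> "sh 1 C" t] wk1_Ty[of T \<Gamma> C N0] ml.N0_F[of T \<Gamma>] by (auto simp: nf dest: ml_Ok)

lemma Split_nd':
  assumes C: "T \<rhd> \<Gamma> \<turnstile> Ty C" and t: "T \<rhd> \<Gamma> \<turnstile> Tm t (Sig A B)" and c: "T \<rhd> B # A # \<Gamma> \<turnstile> Tm c (sh 2 C)"
  shows "T \<rhd> \<Gamma> \<turnstile> Tm (Split t c) C"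
  using ml.Sig_E[OF wk1_Ty[OF C presup_Tm[OF t]] t, of c] c by (simp add: nf)

lemma Split_nd_C:
  assumes C: "T \<rhd> \<Gamma> \<turnstile> Ty C" and B: "T \<rhd> A # \<Gamma> \<turnstile> Ty B" and a: "T \<rhd> \<Gamma> \<turnstile> Tm a A" and b: "T \<rhd> \<Gamma> \<turnstile> Tm b (ins 0 [a] B)"
    and c: "T \<rhd> B # A # \<Gamma> \<turnstile> Tm c (sh 2 C)"
  shows "T \<rhd> \<Gamma> \<turnstile> TmEq (Split (Pr a b) c) (ins 0 [b, a] c) C"
  using ml.Sig_C[OF wk1_Ty[OF C Sig_Ty[OF B]] a b, of c] c by (simp add: nf)

lemma When_nd':
  assumes C: "T \<rhd> \<Gamma> \<turnstile> Ty C" and t: "T \<rhd> \<Gamma> \<turnstile> Tm t (Coprod A B)"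
    and c: "T \<rhd> A # \<Gamma> \<turnstile> Tm c (sh 1 C)" and d: "T \<rhd> B # \<Gamma> \<turnstile> Tm d (sh 1 C)"
  shows "T \<rhd> \<Gamma> \<turnstile> Tm (When t c d) C"
  using ml.Sum_E[OF wk1_Ty[OF C presup_Tm[OF t]] t, of c d] c d by (simp add: nf)

lemma When_nd_C:
  assumes C: "T \<rhd> \<Gamma> \<turnstile> Ty C" and c: "T \<rhd> A # \<Gamma> \<turnstile> Tm c (sh 1 C)" and d: "T \<rhd> B # \<Gamma> \<turnstile> Tm d (sh 1 C)"
  shows "T \<rhd> \<Gamma> \<turnstile> Tm a A \<Longrightarrow> T \<rhd> \<Gamma> \<turnstile> TmEq (When (InL a) c d) (ins 0 [a] c) C"
    and "T \<rhd> \<Gamma> \<turnstile> Tm b B \<Longrightarrow> T \<rhd> \<Gamma> \<turnstile> TmEq (When (InR b) c d) (ins 0 [b] d) C"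
  using ml.Sum_C1[OF wk1_Ty[OF C ml.Sum_F[OF ml_hd[OF c] ml_hd[OF d]]], of a c d]
    ml.Sum_C2[OF wk1_Ty[OF C ml.Sum_F[OF ml_hd[OF c] ml_hd[OF d]]], of b c d] c d
  by (simp_all add: nf)

lemma IdRec_nd:
  assumes C: "T \<rhd> sh 1 A # A # \<Gamma> \<turnstile> Ty C" and c: "T \<rhd> A # \<Gamma> \<turnstile> Tm c (ins 1 [Var 0, Var 0] C)"
  shows "T \<rhd> \<Gamma> \<turnstile> Tm p (Eq A a b) \<Longrightarrow> T \<rhd> \<Gamma> \<turnstile> Tm (IdRec p c) (ins 0 [b, a] C)"
    and "T \<rhd> \<Gamma> \<turnstile> Tm a A \<Longrightarrow> T \<rhd> \<Gamma> \<turnstile> TmEq (IdRec (Rfl a) c) (ins 0 [a] c) (ins 0 [a, a] C)"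
proof -
  have A: "T \<rhd> \<Gamma> \<turnstile> Ty A" using ml_hd[OF c] .
  let ?G = "sh 1 A # A # \<Gamma>"
  note ok = ml_Ok[OF C]
  have A2: "T \<rhd> ?G \<turnstile> Ty (sh 2 A)"
    using tsub_Ty[OF tsub_upS[OF ml_hd[OF C] tsub_up1[OF A]] A] by (simp add: nf)
  have "T \<rhd> ?G \<turnstile> Ty (Eq (sh 2 A) (Var 1) (Var 0))"
    using ml.var[OF ok, of 1] ml.var[OF ok, of 0] A2 by (intro ml.Eq_F) (simp_all add: nf)
  note C' = wk1_Ty[OF C this]
  show "T \<rhd> \<Gamma> \<turnstile> Tm (IdRec p c) (ins 0 [b, a] C)" if "T \<rhd> \<Gamma> \<turnstile> Tm p (Eq A a b)"
    using ml.Eq_E[OF C' _ _ that, of c] ml_inv_Ty[OF presup_Tm[OF that]] c by (simp add: nf)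
  show "T \<rhd> \<Gamma> \<turnstile> TmEq (IdRec (Rfl a) c) (ins 0 [a] c) (ins 0 [a, a] C)" if "T \<rhd> \<Gamma> \<turnstile> Tm a A"
    using ml.Eq_C[OF C' that, of c] c by (simp add: nf)
qed

lemma holds_sub:
  assumes t: "tsub (tgt S) (map (ity S) \<Gamma>) (\<lambda>i. itm S (\<sigma> i)) (map (ity S) \<Delta>)" and S: "T = tgt S"
    and J: "holds S \<Delta> J" "wfj (length \<Delta>) J"
  shows "holds S \<Gamma> (mjsub \<sigma> J)"
proof -
  note t' = t[folded S]
  have e: "T \<rhd> map (ity S) \<Gamma> \<turnstile> TyEq (sub (\<lambda>i. itm S (\<sigma> i)) (ity S A)) (ity S (sub \<sigma> A))"
    if "T \<rhd> map (ity S) \<Delta> \<turnstile> Ty (ity S A)" "wft A (length \<Delta>)" for A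
    by (rule ity_sub[OF that(2,1) t'])
  show ?thesis
  proof (cases J)
    case mOk
    then show ?thesis using t by (simp add: tsub_def)
  next
    case (mTy k A)
    then show ?thesis using J e[of A] tsub_Tm[OF t', of "itm S A" Univ]
      by (auto simp: S[symmetric] itm_sub dest: presup_TyEq)
  next
    case (mTyEq k A B)
    then have *: "T \<rhd> map (ity S) \<Delta> \<turnstile> TyEq (ity S A) (ity S B)" using J by (simp add: S)
    then show ?thesis using mTyEq J e[OF presup_TyEq(1)[OF *]] e[OF presup_TyEq(2)[OF *]] tsub_TyEq[OF t' *]
      by (auto simp: S[symmetric] intro: ml.ty_trans ml.ty_sym)
  next
    case (mTm a A)
    then have *: "T \<rhd> map (ity S) \<Delta> \<turnstile> Tm (itm S a) (ity S A)" using J by (simp add: S)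
    then show ?thesis using mTm J e[OF presup_Tm[OF *]] tsub_Tm[OF t' *]
      by (auto simp: S[symmetric] itm_sub intro: ml.conv)
  next
    case (mTmEq a b A)
    then have *: "T \<rhd> map (ity S) \<Delta> \<turnstile> TmEq (itm S a) (itm S b) (ity S A)" using J by (simp add: S)
    then show ?thesis using mTmEq J e[OF presup_Tm[OF presup_TmEq(1)[OF *]]] tsub_TmEq[OF t' *]
      by (auto simp: S[symmetric] itm_sub intro: ml.conv_eq)
  qed
qed

text \<open>The equations are given at types \<open>ity S (sub \<sigma> A)\<close>.
  \<open>ity_sub\<close> along the left-hand substitution moves them to the types that replacement
  expects, and \<open>tsub_teq\<close> then types the right-hand one.\<close>

lemma teq_itm:
  assumes ok: "T \<rhd> map (ity S) \<Delta> \<turnstile> Ok" "T \<rhd> \<Gamma> \<turnstile> Ok" and wf: "wfc \<Delta>"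
    and eq: "\<forall>i<length \<Delta>. T \<rhd> \<Gamma> \<turnstile> TmEq (itm S (\<sigma> i)) (itm S (\<tau> i)) (ity S (sub \<sigma> (sh (Suc i) (\<Delta> ! i))))"
  shows "tsub T \<Gamma> (\<lambda>i. itm S (\<sigma> i)) (map (ity S) \<Delta>)" (is ?s)
    and "tsub T \<Gamma> (\<lambda>i. itm S (\<tau> i)) (map (ity S) \<Delta>)" (is ?t)
    and "teq T \<Gamma> (\<lambda>i. itm S (\<sigma> i)) (\<lambda>i. itm S (\<tau> i)) (map (ity S) \<Delta>)" (is ?e)
proof -
  let ?\<sigma> = "\<lambda>i. itm S (\<sigma> i)" and ?\<tau> = "\<lambda>i. itm S (\<tau> i)"
  show s: ?s using eq presup_TmEq(1) by (intro tsub_itm[OF ok wf]) blast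
  have e: "T \<rhd> \<Gamma> \<turnstile> TmEq (?\<sigma> i) (?\<tau> i) (sub (?\<sigma> \<odot> up (Suc i)) (map (ity S) \<Delta> ! i))" if i: "i < length \<Delta>" for i
  proof -
    have "drop i \<Delta> = \<Delta> ! i # drop (Suc i) \<Delta>" using i by (simp add: Cons_nth_drop_Suc)
    then have "drop i (map (ity S) \<Delta>) = ity S (\<Delta> ! i) # drop (Suc i) (map (ity S) \<Delta>)" by (simp add: drop_map)
    then have A: "T \<rhd> drop (Suc i) (map (ity S) \<Delta>) \<turnstile> Ty (ity S (\<Delta> ! i))" using ml_ctx[OF ok(1)] by blast
    have "tsub T (map (ity S) \<Delta>) (up (Suc i)) (drop (Suc i) (map (ity S) \<Delta>))"
      using ml.var[OF ok(1)] ok(1) by (auto simp: tsub_def nf ac_simps)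
    from tsub_Ty[OF this A] have "T \<rhd> map (ity S) \<Delta> \<turnstile> Ty (ity S (sh (Suc i) (\<Delta> ! i)))"
      unfolding ity_lift by (simp add: lift_nf)
    from ity_sub[OF wft_lift[OF wfc_nth[OF wf i]] this s] eq[rule_format, OF i]
    show ?thesis using i by (auto simp: ity_lift sub_sh_nf intro: ml.conv_eq ml.ty_sym)
  qed
  then show ?e using ok(2) by (simp add: teq_def)
  have "\<forall>i<length (map (ity S) \<Delta>).
      T \<rhd> \<Gamma> \<turnstile> TmEq (?\<sigma> i) (?\<tau> i) (sub (?\<sigma> \<odot> up (Suc i)) (map (ity S) \<Delta> ! i)) \<and>
      T \<rhd> \<Gamma> \<turnstile> Tm (?\<sigma> i) (sub (?\<sigma> \<odot> up (Suc i)) (map (ity S) \<Delta> ! i)) \<and>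
      T \<rhd> \<Gamma> \<turnstile> Tm (?\<tau> i) (sub (?\<sigma> \<odot> up (Suc i)) (map (ity S) \<Delta> ! i))"
    using e presup_TmEq[OF e] by simp
  from tsub_teq[OF this ok(2,1)] show ?t by blast
qed

text \<open>The contexts in the hypotheses consist of interpreted types, those in
  \<open>axset\<close> of decodings of codes; by \<open>good\<close> they are judgmentally
  equal.\<close>

lemma maxset_axset:
  assumes "T \<rhd> \<Gamma> \<turnstile> Tm (itm S A) Univ" "T \<rhd> ity S A # \<Gamma> \<turnstile> Tm (itm S I) Univ"
    "T \<rhd> ity S I # ity S A # \<Gamma> \<turnstile> Tm (itm S C) (ity S (Pws (sh 2 A)))" "T \<rhd> \<Gamma> \<turnstile> Tm (itm S V) (ity S (Pws A))"
  shows "axset (ml T) \<Gamma> (itm S A) (itm S I) (itm S C) (itm S V)"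
proof -
  note A = good[OF assms(1)] and I = good[OF assms(2)]
  have I': "T \<rhd> Dec (itm S A) # \<Gamma> \<turnstile> Tm (itm S I) Univ" by (rule ctx_small[OF assms(1,2)])
  have t: "tsub T (Dec (itm S I) # Dec (itm S A) # \<Gamma>) Var (ity S I # ity S A # \<Gamma>)"
    by (rule tsub_conv_Var[OF tsub_small[OF assms(1)] good[OF I'] ml.Dec_F[OF I']])
  have U: "T \<rhd> ity S A # \<Gamma> \<turnstile> TyEq Univ Univ" "T \<rhd> Dec (itm S A) # \<Gamma> \<turnstile> TyEq Univ Univ"
    using assms(2) I' by (auto intro!: ml.ty_refl ml.Univ_F dest: ml_Ok)
  have V: "T \<rhd> \<Gamma> \<turnstile> TyEq (Pi (ity S A) Univ) (Pi (Dec (itm S A)) Univ)"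
    by (rule ml.Pi_cong[OF ml.ty_sym[OF A] U(1)])
  have t2: "tsub T (Dec (itm S I) # Dec (itm S A) # \<Gamma>) (up 2) \<Gamma>"
    using tsub_upS[OF ml.Dec_F[OF I'] tsub_up1[OF ml.Dec_F[OF assms(1)]]] by (simp add: nf)
  have "T \<rhd> Dec (itm S I) # Dec (itm S A) # \<Gamma> \<turnstile> Tm (itm S C) (Pi (sh 2 (ity S A)) Univ)"
    using tsub_Tm[OF t assms(3)] by (simp add: ity_lift)
  moreover have "T \<rhd> Dec (itm S I) # Dec (itm S A) # \<Gamma> \<turnstile> TyEq (Pi (sh 2 (ity S A)) Univ) (arr (Dec (sh 2 (itm S A))) Univ)"
    using tsub_TyEq[OF t2 V] by (simp add: nf)
  moreover have "T \<rhd> \<Gamma> \<turnstile> Tm (itm S V) (arr (Dec (itm S A)) Univ)"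
    using ml.conv[OF assms(4), of "Pi (Dec (itm S A)) Univ"] V by (simp add: nf)
  ultimately show ?thesis using assms(1) I' by (blast intro: ml.conv)
qed

end

section \<open>Church's thesis and the axiom of choice\<close>

lemma itm_pr_tm: "pr_ok f (length ts) \<Longrightarrow> itm T (pr_tm f ts) = pr_tm f (map (itm T) ts)"
proof (induction f arbitrary: ts)
  case (PComp f gs)
  have "map (itm T) (map (\<lambda>h. h ts) (map pr_tm gs)) = map (\<lambda>h. h (map (itm T) ts)) (map pr_tm gs)"
    using PComp.prems PComp.IH(2) by (auto simp: list_all_iff)
  then show ?case using PComp.prems PComp.IH(1)[of "map (\<lambda>h. h ts) (map pr_tm gs)"]
    by (simp del: map_map)
next
  case (PRec f g)
  then obtain t us where ts: "ts = t # us" by (cases ts) auto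
  have "map (itm T) (map (sh 2) us) = map (sh 2) (map (itm T) us)" by (simp add: itm_lift)
  then have "itm T (pr_tm g (Var 1 # Var 0 # map (sh 2) us)) = pr_tm g (Var 1 # Var 0 # map (sh 2) (map (itm T) us))"
    using PRec.prems ts PRec.IH(2)[of "Var 1 # Var 0 # map (sh 2) us"] by (simp del: map_map)
  then show ?case using PRec ts by simp
next
  case PSucc
  then show ?case by (cases ts) auto
qed auto

lemma ity_mCT: "ity T mCT = CT"
  using pr_ok_prT pr_ok_prU by (simp add: mCT_def CT_def itm_pr_tm lift_def numeral_3_eq_3)

context mls
begin

text \<open>The second projection proves \<open>R\<close> at \<open>fst (f x)\<close>, whereas the
  goal has the function \<open>\<lambda>x. fst (f x)\<close> applied to \<open>x\<close>; beta and
  replacement convert one into the other.\<close>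

lemma choice_aux:
  assumes R: "T \<rhd> B # A # \<Gamma> \<turnstile> Ty R" and f: "T \<rhd> \<Gamma> \<turnstile> Tm f (Pi A (Sig B R))"
  defines "e \<equiv> App (sh 1 f) (Var 0)"
  shows "T \<rhd> \<Gamma> \<turnstile> Tm (Pr (Lam (Fst e)) (Lam (Snd e))) (Sig (Pi A B) (Pi (sh 1 A) (ins 2 [App (Var 1) (Var 0), Var 0] R)))"
proof -
  have B: "T \<rhd> A # \<Gamma> \<turnstile> Ty B" and A: "T \<rhd> \<Gamma> \<turnstile> Ty A" using R ml_hd by blast+
  have P: "T \<rhd> \<Gamma> \<turnstile> Ty (Pi A B)" by (rule ml.Pi_F[OF A B])
  have e: "T \<rhd> A # \<Gamma> \<turnstile> Tm e (Sig B R)"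
    using ml.Pi_E[OF tsub_Tm[OF tsub_up1[OF A] f, unfolded sub_simps] ml_var0[OF A]] by (simp add: nf e_def)
  have g: "T \<rhd> \<Gamma> \<turnstile> Tm (Lam (Fst e)) (Pi A B)" by (rule ml.Pi_I[OF Fst_I[OF e]])
  let ?G = "sh 1 A # Pi A B # \<Gamma>"
  note up = tsub_up1[OF P]
  have A1: "T \<rhd> Pi A B # \<Gamma> \<turnstile> Ty (sh 1 A)" using tsub_Ty[OF up A] by (simp add: nf)
  have t2: "tsub T ?G (up 2) \<Gamma>" using tsub_upS[OF A1 up] by (simp add: nf)
  have x: "T \<rhd> ?G \<turnstile> Tm (Var 0) (sub (up 2) A)" and h: "T \<rhd> ?G \<turnstile> Tm (Var 1) (sub (up 2) (Pi A B))"
    using ml.var[OF ml.ok_ext[OF A1], of 0] ml.var[OF ml.ok_ext[OF A1], of 1] by (simp_all add: nf)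
  have "T \<rhd> ?G \<turnstile> Tm (App (Var 1) (Var 0)) (sub (Var 0 ;; up 2) B)"
    using ml.Pi_E[OF h[unfolded sub_simps] x] by (simp add: nf)
  from tsub_Ty[OF tsub_Cons[OF tsub_Cons[OF t2 x] this] R]
  have "T \<rhd> Pi A B # \<Gamma> \<turnstile> Ty (Pi (sh 1 A) (ins 2 [App (Var 1) (Var 0), Var 0] R))"
    by (intro ml.Pi_F[OF A1]) (simp add: nf)
  note I = ml.Sig_I[OF this g]
  have "T \<rhd> A # \<Gamma> \<turnstile> Tm (sh 1 (Lam (Fst e))) (sh 1 (Pi A B))"
    using wk1_Tm[OF g A] by (simp add: nf)
  have "T \<rhd> A # \<Gamma> \<turnstile> TmEq (App (sh 1 (Lam (Fst e))) (Var 0)) (Fst e) B"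
    using ml.Pi_C[OF tsub_Tm[OF tsub_under[OF tsub_up1[OF A] A] Fst_I[OF e]] ml_var0[OF A]]
    by (simp add: nf)
  from TyEq_repl1[OF R ml.tm_sym[OF this]] Snd_I[OF e]
  have "T \<rhd> A # \<Gamma> \<turnstile> Tm (Snd e) (sub (App (sh 1 (Lam (Fst e))) (Var 0) ;; Var) R)"
    by (auto simp: nf intro: ml.conv)
  from I[of "Lam (Snd e)"] ml.Pi_I[OF this] show ?thesis by (simp add: nf)
qed

lemma choice_I:
  assumes R: "T \<rhd> B # A # \<Gamma> \<turnstile> Ty R"
  shows "T \<rhd> \<Gamma> \<turnstile> Tm choice_tm (arr (Pi A (Sig B R)) (Sig (Pi A B) (Pi (sh 1 A) (ins 2 [App (Var 1) (Var 0), Var 0] R))))"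
proof -
  have B: "T \<rhd> A # \<Gamma> \<turnstile> Ty B" and A: "T \<rhd> \<Gamma> \<turnstile> Ty A" using R ml_hd by blast+
  have F: "T \<rhd> \<Gamma> \<turnstile> Ty (Pi A (Sig B R))" by (rule ml.Pi_F[OF A Sig_Ty[OF R]])
  note up = tsub_up1[OF F]
  note R1 = tsub_Ty[OF tsub_under[OF tsub_under[OF up A] B] R]
  show ?thesis
    unfolding choice_tm_def
    using choice_aux[OF R1, of "Var 0"] ml_var0[OF F] by (intro ml.Pi_I) (simp add: nf)
qed

section \<open>Covers and positivity of \<open>mTT_cind\<close>\<close>

lemma cover_elim:
  fixes S A I C V
  defines "s \<equiv> itm S A" and "i \<equiv> itm S I" and "c \<equiv> itm S C" and "v \<equiv> itm S V"
  assumes A: "T \<rhd> \<Gamma> \<turnstile> Tm s Univ" and ax: "axset (ml T) \<Gamma> s i c v"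
    and P: "T \<rhd> ity S A # \<Gamma> \<turnstile> Ty P"
    and q1: "T \<rhd> eps (Var 0) (sh 1 v) # ity S A # \<Gamma> \<turnstile> Tm q1 (sh 1 P)"
    and q2: "T \<rhd> Pi (sh 3 (ity S A)) (arr (eps (Var 0) (sh 2 c)) (ins 4 [Var 0] P))
         # Pi (sh 2 (ity S A)) (arr (eps (Var 0) (sh 1 c)) (CovT 3 s i c v (Var 0))) # ity S I # ity S A # \<Gamma>
       \<turnstile> Tm q2 (sh 3 P)"
    and I: "T \<rhd> ity S A # \<Gamma> \<turnstile> Tm i Univ"
  shows "T \<rhd> CovT 1 s i c v (Var 0) # Dec s # \<Gamma> \<turnstile> Ty (sh 1 P)"
    and "T \<rhd> eps (Var 0) (sh 1 v) # Dec s # \<Gamma> \<turnstile> Tm q1 (ins 2 [Rf (Var 1) (Var 0), Var 1] (sh 1 P))"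
    and "T \<rhd> Pi (Dec (sh 3 s)) (Pi (eps (Var 0) (sh 2 c)) (ins 5 [App (App (Var 2) (Var 1)) (Var 0), Var 1] (sh 1 P)))
         # CovAll 2 s i c v c # Dec i # Dec s # \<Gamma> \<turnstile> Tm q2 (ins 4 [Tr (Var 3) (Var 2) (Var 1), Var 3] (sh 1 P))"
proof -
  \<comment> \<open>The motive does not depend on the proof of the cover, hence the weakened
    \<open>sh 1 P\<close>. What remains is to exchange the context entries from the outermost on:
    interpreted sets become decodings of codes, also as domains in the entries for \<open>k\<close>
    and \<open>f\<close>.\<close>
  note A' = A[unfolded s_def] and I' = I[unfolded i_def]
  have t1: "tsub T (Dec s # \<Gamma>) Var (ity S A # \<Gamma>)" unfolding s_def by (rule tsub_small[OF A'])
  have DA: "T \<rhd> \<Gamma> \<turnstile> Ty (Dec s)" using A by (rule ml.Dec_F)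
  have eA: "T \<rhd> \<Gamma> \<turnstile> TyEq (Dec s) (ity S A)" unfolding s_def by (rule good[OF A'])
  have P1: "T \<rhd> Dec s # \<Gamma> \<turnstile> Ty P" by (rule ml_ctx_conv[OF t1 P])
  have I1: "T \<rhd> Dec s # \<Gamma> \<turnstile> Tm i Univ" by (rule ml_ctx_conv[OF t1 I])
  have DI: "T \<rhd> Dec s # \<Gamma> \<turnstile> Ty (Dec i)" using I1 by (rule ml.Dec_F)
  have v0: "T \<rhd> Dec s # \<Gamma> \<turnstile> Tm (Var 0) (Dec (sh 1 s))" using ml_var0[OF DA] by (simp add: nf)
  have "T \<rhd> Dec s # \<Gamma> \<turnstile> Tm (Cov (sh 1 s) (lift 1 1 i) (lift 1 2 c) (sh 1 v) (Var 0)) Univ"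
    using ml.Cov_F[OF axset_sub[OF tsub_up1[OF DA] ax], of "Var 0"] v0 by (simp add: nf)
  then have cov: "T \<rhd> Dec s # \<Gamma> \<turnstile> Ty (CovT 1 s i c v (Var 0))" by (rule ml.Dec_F)
  show "T \<rhd> CovT 1 s i c v (Var 0) # Dec s # \<Gamma> \<turnstile> Ty (sh 1 P)"
    using wk1_Ty[OF P1 cov] by (simp add: nf)
  have eps: "T \<rhd> Dec s # \<Gamma> \<turnstile> Ty (eps (Var 0) (sh 1 v))"
    by (rule ml_ctx_conv[OF t1 ml_hd[OF q1]])
  have "tsub T (eps (Var 0) (sh 1 v) # Dec s # \<Gamma>) Var (eps (Var 0) (sh 1 v) # ity S A # \<Gamma>)"
    by (rule tsub_conv_Var[OF t1 ml.ty_refl[OF eps] eps])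
  from ml_ctx_conv[OF this q1]
  show "T \<rhd> eps (Var 0) (sh 1 v) # Dec s # \<Gamma> \<turnstile> Tm q1 (ins 2 [Rf (Var 1) (Var 0), Var 1] (sh 1 P))"
    by (simp add: nf scons_eta(1)[of "Suc 0", simplified])
  have t2: "tsub T (Dec i # Dec s # \<Gamma>) Var (ity S I # ity S A # \<Gamma>)"
    using tsub_conv_Var[OF t1 good[OF I1[unfolded i_def s_def], folded i_def s_def] DI] .
  let ?K = "Pi (sh 2 (ity S A)) (arr (eps (Var 0) (sh 1 c)) (CovT 3 s i c v (Var 0)))"
  let ?K' = "CovAll 2 s i c v c"
  have u2: "tsub T (Dec i # Dec s # \<Gamma>) (up 2) \<Gamma>" using tsub_upS[OF DI tsub_up1[OF DA]] by (simp add: nf)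
  have K: "T \<rhd> Dec i # Dec s # \<Gamma> \<turnstile> Ty ?K" by (rule ml_ctx_conv[OF t2 ml_hd[OF ml_Ok[OF ml_hd[OF q2]]]])
  have eA2: "T \<rhd> Dec i # Dec s # \<Gamma> \<turnstile> TyEq (sh 2 (ity S A)) (Dec (sh 2 s))"
    using ml.ty_sym[OF tsub_TyEq[OF u2 eA]] by (simp add: nf)
  have eK: "T \<rhd> Dec i # Dec s # \<Gamma> \<turnstile> TyEq ?K ?K'"
    using ml.Pi_cong[OF eA2 ml.ty_refl[OF conjunct2[OF Ty_PiD[OF K]]]] by (simp add: nf)
  have t3: "tsub T (?K' # Dec i # Dec s # \<Gamma>) Var (?K # ity S I # ity S A # \<Gamma>)"
    by (rule tsub_conv_Var[OF t2 ml.ty_sym[OF eK] presup_TyEq(2)[OF eK]])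
  let ?L = "Pi (sh 3 (ity S A)) (arr (eps (Var 0) (sh 2 c)) (ins 4 [Var 0] P))"
  let ?L' = "Pi (Dec (sh 3 s)) (Pi (eps (Var 0) (sh 2 c)) (ins 5 [App (App (Var 2) (Var 1)) (Var 0), Var 1] (sh 1 P)))"
  have L: "T \<rhd> ?K' # Dec i # Dec s # \<Gamma> \<turnstile> Ty ?L" by (rule ml_ctx_conv[OF t3 ml_hd[OF q2]])
  have eA3: "T \<rhd> ?K' # Dec i # Dec s # \<Gamma> \<turnstile> TyEq (sh 3 (ity S A)) (Dec (sh 3 s))"
    using wk1_TyEq[OF eA2 presup_TyEq(2)[OF eK]] by (simp add: nf)
  have eL: "T \<rhd> ?K' # Dec i # Dec s # \<Gamma> \<turnstile> TyEq ?L ?L'"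
    using ml.Pi_cong[OF eA3 ml.ty_refl[OF conjunct2[OF Ty_PiD[OF L]]]] by (simp add: nf)
  have "tsub T (?L' # ?K' # Dec i # Dec s # \<Gamma>) Var (?L # ?K # ity S I # ity S A # \<Gamma>)"
    by (rule tsub_conv_Var[OF t3 ml.ty_sym[OF eL] presup_TyEq(2)[OF eL]])
  from ml_ctx_conv[OF this q2]
  show "T \<rhd> ?L' # ?K' # Dec i # Dec s # \<Gamma> \<turnstile> Tm q2 (ins 4 [Tr (Var 3) (Var 2) (Var 1), Var 3] (sh 1 P))"
    by (simp add: nf)
qed

lemma pos3'_I:
  assumes ax: "axset (ml T) \<Gamma> s i c v" and P: "T \<rhd> Dec s # \<Gamma> \<turnstile> Ty P"
    and a: "T \<rhd> \<Gamma> \<turnstile> Tm a (Dec s)" and m: "T \<rhd> \<Gamma> \<turnstile> Tm m (ins 0 [a] P)"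
    and q1: "T \<rhd> P # Dec s # \<Gamma> \<turnstile> Tm q1 (eps (Var 1) (sh 2 v))"
    and q2: "T \<rhd> sh 1 P # Dec i # Dec s # \<Gamma>
       \<turnstile> Tm q2 (Sig (Dec (sh 3 s)) (prod (ins 4 [Var 0] P) (eps (Var 0) (sh 2 c))))"
  shows "T \<rhd> \<Gamma> \<turnstile> Tm (pos3' a m q1 q2) (eps a (Wmax s i c v))"
proof -
  let ?G = "sh 1 P # Dec i # Dec s # \<Gamma>"
  have B: "T \<rhd> Dec (sh 3 s) # ?G \<turnstile> Ty (prod (ins 4 [Var 0] P) (eps (Var 0) (sh 2 c)))"
    using Ty_SigD[OF presup_Tm[OF q2]] by simp
  have B1: "T \<rhd> Dec (sh 3 s) # ?G \<turnstile> Ty (ins 4 [Var 0] P)" using Ty_SigD[OF B] by simp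
  have DA: "T \<rhd> \<Gamma> \<turnstile> Ty (Dec s)" using a by (rule presup_Tm)
  have I: "T \<rhd> Dec s # \<Gamma> \<turnstile> Ty (Dec i)" and P2: "T \<rhd> Dec i # Dec s # \<Gamma> \<turnstile> Ty (sh 1 P)"
    using q2 by (auto dest: ml_hd ml_Ok)
  have A3: "T \<rhd> ?G \<turnstile> Ty (Dec (sh 3 s))" by (rule ml_hd[OF B])
  have t1: "tsub T (Dec (sh 3 s) # ?G) (up 2) (Dec i # Dec s # \<Gamma>)"
    using tsub_upS[OF A3 tsub_up1[OF P2]] by (simp add: nf)
  have "T \<rhd> Dec (sh 3 s) # ?G \<turnstile> Tm (sh 2 c) (arr (Dec (sh 4 s)) Univ)"
    using tsub_Tm[OF t1, of c "arr (Dec (sh 2 s)) Univ"] ax by (simp add: nf)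
  from App_arr[OF this, of "Var 0"] ml_var0[OF A3]
  have B2: "T \<rhd> Dec (sh 3 s) # ?G \<turnstile> Ty (eps (Var 0) (sh 2 c))" by (intro ml.Dec_F) (simp add: nf)
  have w: "T \<rhd> ?G \<turnstile> Tm (Snd q2) (prod (sub (Fst q2 ;; up 3) P) (eps (Fst q2) (sh 1 c)))"
    using Snd_I[OF q2] by (simp add: nf)
  have "T \<rhd> ?G \<turnstile> Tm (Pr (Snd (Snd q2)) (Fst (Snd q2))) (ins 0 [Fst q2] (prod (eps (Var 0) (sh 2 c)) (ins 4 [Var 0] P)))"
    using Pr_prod[OF Snd_prod[OF w] Fst_prod[OF w]] by (simp add: nf)
  from ml.Sig_I[OF Ty_prod[OF B2 B1] Fst_I[OF q2] this]
  have "coalg \<Gamma> s i c v P (Pr (Fst q2) (Pr (Snd (Snd q2)) (Fst (Snd q2))))"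
    using ax P by (simp add: coalg_def)
  from pos3_I[OF this a m q1] show ?thesis unfolding pos3'_def .
qed

lemma Pi_good: "T \<rhd> \<Gamma> \<turnstile> Tm f (Pi (ity S A) X) \<Longrightarrow> T \<rhd> \<Gamma> \<turnstile> Tm (itm S A) Univ \<Longrightarrow> T \<rhd> \<Gamma> \<turnstile> Tm f (Pi (Dec (itm S A)) X)"
  by (rule ml.conv[OF _ ml.Pi_cong[OF ml.ty_sym[OF good] ml.ty_refl]]) (auto dest: presup_Tm Ty_PiD)

lemma Sig_good: "T \<rhd> \<Gamma> \<turnstile> Tm f (Sig (Dec (itm S A)) X) \<Longrightarrow> T \<rhd> \<Gamma> \<turnstile> Tm (itm S A) Univ \<Longrightarrow> T \<rhd> \<Gamma> \<turnstile> Tm f (Sig (ity S A) X)"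
  by (rule ml.conv[OF _ ml.Sig_cong[OF good ml.ty_refl]]) (auto dest: presup_Tm Ty_SigD)

lemma index_conv:
  assumes ax: "axset (ml T) \<Gamma> s (itm S I) c v" and a: "T \<rhd> \<Gamma> \<turnstile> Tm (itm S a) (Dec s)" and w: "wft I l"
    and j: "T \<rhd> \<Gamma> \<turnstile> Tm j (ity S (ins 0 [a] I))"
  shows "T \<rhd> \<Gamma> \<turnstile> Tm j (Dec (ins 0 [itm S a] (itm S I)))"
proof -
  have "T \<rhd> \<Gamma> \<turnstile> Tm (ins 0 [itm S a] (itm S I)) Univ"
    using ml_ins1'(2)[OF _ a, of "itm S I" Univ] ax by (simp add: nf)
  then have "T \<rhd> \<Gamma> \<turnstile> Tm (itm S (ins 0 [a] I)) Univ" by (simp add: itm_ins[OF w])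
  from good[OF this] j show ?thesis by (auto simp: itm_ins[OF w] intro: ml.conv ml.ty_sym)
qed

lemma pos_coind:
  fixes S A I
  defines "s \<equiv> itm S A" and "i \<equiv> itm S I"
  assumes A: "T \<rhd> \<Gamma> \<turnstile> Tm s Univ" and I: "T \<rhd> ity S A # \<Gamma> \<turnstile> Tm i Univ" and ax: "axset (ml T) \<Gamma> s i c v"
    and P: "T \<rhd> ity S A # \<Gamma> \<turnstile> Ty P"
    and a: "T \<rhd> \<Gamma> \<turnstile> Tm a (Dec s)" and m: "T \<rhd> \<Gamma> \<turnstile> Tm m (ins 0 [a] P)"
    and q1: "T \<rhd> P # ity S A # \<Gamma> \<turnstile> Tm q1 (eps (Var 1) (sh 2 v))"
    and q2: "T \<rhd> sh 1 P # ity S I # ity S A # \<Gamma>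
       \<turnstile> Tm q2 (Sig (sh 3 (ity S A)) (prod (ins 4 [Var 0] P) (eps (Var 0) (sh 2 c))))"
  shows "T \<rhd> \<Gamma> \<turnstile> Tm (pos3' a m q1 q2) (eps a (Wmax s i c v))"
proof (rule pos3'_I[OF ax _ a m])
  have t1: "tsub T (Dec s # \<Gamma>) Var (ity S A # \<Gamma>)" unfolding s_def by (rule tsub_small[OF A[unfolded s_def]])
  have DA: "T \<rhd> \<Gamma> \<turnstile> Ty (Dec s)" using A by (rule ml.Dec_F)
  have eA: "T \<rhd> \<Gamma> \<turnstile> TyEq (ity S A) (Dec s)" using ml.ty_sym[OF good[OF A[unfolded s_def]]] unfolding s_def .
  show P1: "T \<rhd> Dec s # \<Gamma> \<turnstile> Ty P" by (rule ml_ctx_conv[OF t1 P])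
  have I1: "T \<rhd> Dec s # \<Gamma> \<turnstile> Tm i Univ" by (rule ml_ctx_conv[OF t1 I])
  have DI: "T \<rhd> Dec s # \<Gamma> \<turnstile> Ty (Dec i)" using I1 by (rule ml.Dec_F)
  show "T \<rhd> P # Dec s # \<Gamma> \<turnstile> Tm q1 (eps (Var 1) (sh 2 v))"
    by (rule ml_ctx_conv[OF tsub_conv_Var[OF t1 ml.ty_refl[OF P1] P1] q1])
  have t2: "tsub T (Dec i # Dec s # \<Gamma>) Var (ity S I # ity S A # \<Gamma>)"
    using tsub_conv_Var[OF t1 good[OF I1[unfolded i_def s_def], folded i_def s_def] DI] .
  have P2: "T \<rhd> Dec i # Dec s # \<Gamma> \<turnstile> Ty (sh 1 P)" by (rule ml_ctx_conv[OF t2 ml_hd[OF q2]])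
  let ?G = "sh 1 P # Dec i # Dec s # \<Gamma>"
  have q2': "T \<rhd> ?G \<turnstile> Tm q2 (Sig (sh 3 (ity S A)) (prod (ins 4 [Var 0] P) (eps (Var 0) (sh 2 c))))"
    by (rule ml_ctx_conv[OF tsub_conv_Var[OF t2 ml.ty_refl[OF P2] P2] q2])
  have "tsub T ?G (up 3) \<Gamma>" using tsub_upS[OF P2 tsub_upS[OF DI tsub_up1[OF DA]]] by (simp add: nf)
  from tsub_TyEq[OF this eA] have "T \<rhd> ?G \<turnstile> TyEq (sh 3 (ity S A)) (Dec (sh 3 s))" by (simp add: nf)
  from ml.Sig_cong[OF this ml.ty_refl[OF conjunct2[OF Ty_SigD[OF presup_Tm[OF q2']]]]]
  show "T \<rhd> ?G \<turnstile> Tm q2 (Sig (Dec (sh 3 s)) (prod (ins 4 [Var 0] P) (eps (Var 0) (sh 2 c))))"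
    by (rule ml.conv[OF q2'])
qed

text \<open>The hypothesis on \<open>maxset\<close> has the shape in which rule induction delivers
  this premise: derivability, which gives scoping, together with the interpretation, which gives
  typing.\<close>

lemma maxset_holds:
  assumes S: "T = tgt S" and m: "maxset (\<lambda>\<Gamma> J. S \<rhd> \<Gamma> \<Turnstile> J \<and> holds S \<Gamma> J) \<Gamma> A I C V"
  shows "axset (ml T) (map (ity S) \<Gamma>) (itm S A) (itm S I) (itm S C) (itm S V)"
    and "T \<rhd> map (ity S) \<Gamma> \<turnstile> Tm (itm S A) Univ"
    and "T \<rhd> ity S A # map (ity S) \<Gamma> \<turnstile> Tm (itm S I) Univ"
    and "wft I (Suc (length \<Gamma>))"
    and "wft C (Suc (Suc (length \<Gamma>)))"
    and "holds S \<Gamma> (mTm a A) \<Longrightarrow> T \<rhd> map (ity S) \<Gamma> \<turnstile> Tm (itm S a) (Dec (itm S A))"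
    and "holds S \<Gamma> (mTm a A) \<Longrightarrow> holds S \<Gamma> (mTm j (ins 0 [a] I)) \<Longrightarrow>
      T \<rhd> map (ity S) \<Gamma> \<turnstile> Tm (itm S j) (Dec (ins 0 [itm S a] (itm S I)))"
    and "holds S \<Gamma> (mTm r (mCovAll 0 A I C V (ins 0 [j, a] C))) \<Longrightarrow>
      T \<rhd> map (ity S) \<Gamma> \<turnstile> Tm (itm S r) (CovAll 0 (itm S A) (itm S I) (itm S C) (itm S V) (ins 0 [itm S j, itm S a] (itm S C)))"
proof -
  show ax: "axset (ml T) (map (ity S) \<Gamma>) (itm S A) (itm S I) (itm S C) (itm S V)"
    using m S by (intro maxset_axset) auto
  show A: "T \<rhd> map (ity S) \<Gamma> \<turnstile> Tm (itm S A) Univ" and "T \<rhd> ity S A # map (ity S) \<Gamma> \<turnstile> Tm (itm S I) Univ"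
    using m S by auto
  show wI: "wft I (Suc (length \<Gamma>))" using m mtt_wf[of S "A # \<Gamma>" "mTy SetK I"] by simp
  show wC: "wft C (Suc (Suc (length \<Gamma>)))" using m mtt_wf[of S "I # A # \<Gamma>" "mTm C (Pws (sh 2 A))"] by simp
  show a: "T \<rhd> map (ity S) \<Gamma> \<turnstile> Tm (itm S a) (Dec (itm S A))" if "holds S \<Gamma> (mTm a A)" for a
    using that S ml.conv[OF _ ml.ty_sym[OF good[OF A]]] by simp
  show "T \<rhd> map (ity S) \<Gamma> \<turnstile> Tm (itm S j) (Dec (ins 0 [itm S a] (itm S I)))"
    if "holds S \<Gamma> (mTm a A)" "holds S \<Gamma> (mTm j (ins 0 [a] I))"
    using that S by (intro index_conv[OF ax a wI]) auto
  show "T \<rhd> map (ity S) \<Gamma> \<turnstile> Tm (itm S r) (CovAll 0 (itm S A) (itm S I) (itm S C) (itm S V) (ins 0 [itm S j, itm S a] (itm S C)))"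
    if "holds S \<Gamma> (mTm r (mCovAll 0 A I C V (ins 0 [j, a] C)))"
    using Pi_good[OF _ A, of "itm S r"] that S by (simp add: itm_lift itm_ins[OF wC])
qed

lemma elim_holds:
  fixes S A I C V
  defines "s \<equiv> itm S A" and "i \<equiv> itm S I" and "c \<equiv> itm S C" and "v \<equiv> itm S V"
  assumes S: "T = tgt S" and m: "maxset (\<lambda>\<Gamma> J. S \<rhd> \<Gamma> \<Turnstile> J \<and> holds S \<Gamma> J) \<Gamma> A I C V"
    and P: "holds S (A # \<Gamma>) (mTy Prop P)" and wP: "wft P (Suc (length \<Gamma>))"
    and q1: "holds S (elt (Var 0) (sh 1 V) # A # \<Gamma>) (mTm q1 (sh 1 P))"
    and q2: "holds S (Forall (sh 3 A) (Imp (elt (Var 0) (sh 2 C)) (ins 4 [Var 0] P)) # mCovAll 2 A I C V C # I # A # \<Gamma>) (mTm q2 (sh 3 P))"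
  shows "T \<rhd> CovT 1 s i c v (Var 0) # Dec s # map (ity S) \<Gamma> \<turnstile> Ty (sh 1 (ity S P))"
    and "T \<rhd> eps (Var 0) (sh 1 v) # Dec s # map (ity S) \<Gamma> \<turnstile> Tm (itm S q1) (ins 2 [Rf (Var 1) (Var 0), Var 1] (sh 1 (ity S P)))"
    and "T \<rhd> Pi (Dec (sh 3 s)) (Pi (eps (Var 0) (sh 2 c)) (ins 5 [App (App (Var 2) (Var 1)) (Var 0), Var 1] (sh 1 (ity S P))))
         # CovAll 2 s i c v c # Dec i # Dec s # map (ity S) \<Gamma> \<turnstile> Tm (itm S q2) (ins 4 [Tr (Var 3) (Var 2) (Var 1), Var 3] (sh 1 (ity S P)))"
proof -
  have I: "T \<rhd> ity S A # map (ity S) \<Gamma> \<turnstile> Tm (itm S I) Univ" by (rule maxset_holds(3)[OF S m])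
  note E = cover_elim[of "map (ity S) \<Gamma>" S A I C V "ity S P" "itm S q1" "itm S q2", OF maxset_holds(2,1)[OF S m],
      folded s_def i_def c_def v_def]
  have 1: "T \<rhd> ity S A # map (ity S) \<Gamma> \<turnstile> Ty (ity S P)" using P S by simp
  have 2: "T \<rhd> eps (Var 0) (sh 1 v) # ity S A # map (ity S) \<Gamma> \<turnstile> Tm (itm S q1) (sh 1 (ity S P))"
    using q1 S by (simp add: itm_lift ity_lift v_def del: One_nat_def)
  have 3: "T \<rhd> Pi (sh 3 (ity S A)) (arr (eps (Var 0) (sh 2 c)) (ins 4 [Var 0] (ity S P)))
         # Pi (sh 2 (ity S A)) (arr (eps (Var 0) (sh 1 c)) (CovT 3 s i c v (Var 0))) # ity S I # ity S A # map (ity S) \<Gamma>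
       \<turnstile> Tm (itm S q2) (sh 3 (ity S P))"
    using q2 S by (simp add: itm_lift ity_lift ity_ins_strict[OF wP] s_def i_def c_def v_def del: One_nat_def)
  note E = E[OF 1 2 3 I[folded i_def]]
  show "T \<rhd> CovT 1 s i c v (Var 0) # Dec s # map (ity S) \<Gamma> \<turnstile> Ty (sh 1 (ity S P))" by (rule E(1))
  show "T \<rhd> eps (Var 0) (sh 1 v) # Dec s # map (ity S) \<Gamma> \<turnstile> Tm (itm S q1) (ins 2 [Rf (Var 1) (Var 0), Var 1] (sh 1 (ity S P)))"
    by (rule E(2))
  show "T \<rhd> Pi (Dec (sh 3 s)) (Pi (eps (Var 0) (sh 2 c)) (ins 5 [App (App (Var 2) (Var 1)) (Var 0), Var 1] (sh 1 (ity S P))))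
         # CovAll 2 s i c v c # Dec i # Dec s # map (ity S) \<Gamma> \<turnstile> Tm (itm S q2) (ins 4 [Tr (Var 3) (Var 2) (Var 1), Var 3] (sh 1 (ity S P)))"
    by (rule E(3))
qed

end

section \<open>Soundness of all rules, and relative consistency\<close>

lemma mtt_holds: "S \<rhd> \<Gamma> \<Turnstile> J \<Longrightarrow> holds S \<Gamma> J"
proof -
  interpret mls "tgt S" by unfold_locales (cases S; simp)
  \<comment> \<open>Keeps \<open>sh 1\<close> and \<open>lift 1 k\<close> in the form in which the
    lemmas about them are stated.\<close>
  note [simp del] = One_nat_def
  show "S \<rhd> \<Gamma> \<Turnstile> J \<Longrightarrow> holds S \<Gamma> J"
  proof (induction rule: mtt.induct)
    case (var \<Gamma> i)
    then show ?case using ml.var[of "tgt S" "map (ity S) \<Gamma>" i] by (simp add: ity_lift)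
  next
    case (ty_sub \<Gamma> k A l)
    then show ?case by (auto elim!: subkind.cases)
  next
    case (tyeq_sub \<Gamma> k A B l)
    then show ?case by simp
  next
    case (ty_sym \<Gamma> k A B)
    then show ?case by (simp add: ml.ty_sym)
  next
    case (ty_trans \<Gamma> k A B C)
    then show ?case by (auto intro: ml.ty_trans)
  next
    case (tm_sym \<Gamma> a b A)
    then show ?case by (simp add: ml.tm_sym)
  next
    case (tm_trans \<Gamma> a b A c)
    then show ?case by (auto intro: ml.tm_trans)
  next
    case (conv \<Gamma> a A B)
    then show ?case by (auto intro: ml.conv)
  next
    case (conv_eq \<Gamma> a b A B)
    then show ?case by (auto intro: ml.conv_eq)
  next
    case (subst \<Delta> J \<Gamma> \<sigma>)
    have wf: "wfc \<Delta>" "wfj (length \<Delta>) J" using mtt_wf[OF subst.hyps(1)] by auto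
    have ok: "tgt S \<rhd> map (ity S) \<Delta> \<turnstile> Ok"
      using subst.IH(1) by (cases J) (auto dest: ml_Ok)
    show ?case
      using subst.IH(2,3) by (intro holds_sub[OF tsub_itm[OF ok _ wf(1)] refl subst.IH(1) wf(2)]) auto
  next
    case (repl_ty \<Delta> k C \<Gamma> \<sigma> \<tau>)
    have wf: "wfc \<Delta>" "wft C (length \<Delta>)" using mtt_wf[OF repl_ty.hyps(1)] by auto
    have C: "tgt S \<rhd> map (ity S) \<Delta> \<turnstile> Ty (ity S C)" using repl_ty.IH(1) by simp
    note t = teq_itm[OF ml_Ok[OF C] _ wf(1), of "map (ity S) \<Gamma>" \<sigma> \<tau>]
    \<comment> \<open>Replacement in the target relates the two instances of the interpreted
      \<open>C\<close>; \<open>ity_sub\<close> relates each of them to the interpretation of an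
      instance of \<open>C\<close>.\<close>
    have "tgt S \<rhd> map (ity S) \<Gamma> \<turnstile> TyEq (sub (\<lambda>i. itm S (\<sigma> i)) (ity S C)) (sub (\<lambda>i. itm S (\<tau> i)) (ity S C))"
      using repl_ty.IH by (intro teq_Ty[OF t(3) C]) auto
    moreover have "tgt S \<rhd> map (ity S) \<Gamma> \<turnstile> TyEq (sub (\<lambda>i. itm S (\<sigma> i)) (ity S C)) (ity S (sub \<sigma> C))"
      using repl_ty.IH by (intro ity_sub[OF wf(2) C t(1)]) auto
    moreover have "tgt S \<rhd> map (ity S) \<Gamma> \<turnstile> TyEq (sub (\<lambda>i. itm S (\<tau> i)) (ity S C)) (ity S (sub \<tau> C))"
      using repl_ty.IH by (intro ity_sub[OF wf(2) C t(2)]) auto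
    ultimately show ?case by (auto intro: ml.ty_trans ml.ty_sym)
  next
    case (repl_tm \<Delta> c C \<Gamma> \<sigma> \<tau>)
    have wf: "wfc \<Delta>" "wft C (length \<Delta>)" "wft c (length \<Delta>)" using mtt_wf[OF repl_tm.hyps(1)] by auto
    have c: "tgt S \<rhd> map (ity S) \<Delta> \<turnstile> Tm (itm S c) (ity S C)" using repl_tm.IH(1) by simp
    note t = teq_itm[OF ml_Ok[OF c] _ wf(1), of "map (ity S) \<Gamma>" \<sigma> \<tau>]
    have "tgt S \<rhd> map (ity S) \<Gamma> \<turnstile> TmEq (itm S (sub \<sigma> c)) (itm S (sub \<tau> c)) (sub (\<lambda>i. itm S (\<sigma> i)) (ity S C))"
      unfolding itm_sub[OF wf(3)] using repl_tm.IH by (intro teq_Tm[OF t(3) c]) auto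
    moreover have "tgt S \<rhd> map (ity S) \<Gamma> \<turnstile> TyEq (sub (\<lambda>i. itm S (\<sigma> i)) (ity S C)) (ity S (sub \<sigma> C))"
      using repl_tm.IH by (intro ity_sub[OF wf(2) presup_Tm[OF c] t(1)]) auto
    ultimately show ?case by (auto intro: ml.conv_eq)
  next
    case C: (N0_E \<Gamma> C t)
    have w: "wft C (Suc (length \<Gamma>))" using mtt_wf[OF C.hyps(1)] by (simp add: One_nat_def numeral_eq_Suc)
    show ?case using ml.N0_E Tm_ins1(1)[OF _ _ w] C.IH by simp
  next
    case C: (N1_E \<Gamma> C t c)
    have w: "wft C (Suc (length \<Gamma>))" using mtt_wf[OF C.hyps(1)] by (simp add: One_nat_def numeral_eq_Suc)
    show ?case using ml.N1_E Tm_ins1(1)[OF _ _ w] C.IH by (simp add: ity_ins_strict[OF w])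
  next
    case C: (N1_C \<Gamma> C c)
    have w: "wft C (Suc (length \<Gamma>))" using mtt_wf[OF C.hyps(1)] by (simp add: One_nat_def numeral_eq_Suc)
    show ?case using ml.N1_C C.IH by (simp add: ity_ins_strict[OF w])
  next
    case C: (Nat_E \<Gamma> C t c d)
    have w: "wft C (Suc (length \<Gamma>))" using mtt_wf[OF C.hyps(1)] by (simp add: One_nat_def numeral_eq_Suc)
    show ?case using ml.Nat_E Tm_ins1(1)[OF _ _ w] C.IH by (simp add: ity_ins_strict[OF w])
  next
    case C: (Nat_C0 \<Gamma> C c d)
    have w: "wft C (Suc (length \<Gamma>))" using mtt_wf[OF C.hyps(1)] by (simp add: One_nat_def numeral_eq_Suc)
    show ?case using ml.Nat_C0 C.IH by (simp add: ity_ins_strict[OF w])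
  next
    case C: (Nat_CS \<Gamma> C t c d)
    have w: "wft C (Suc (length \<Gamma>))" "wft d (Suc (Suc (length \<Gamma>)))" using mtt_wf[OF C.hyps(1)] mtt_wf[OF C.hyps(4)] by simp_all
    show ?case using ml.Nat_CS C.IH by (simp add: ity_ins_strict[OF w(1)] itm_ins[OF w(2)])
  next
    case C: (Lst_E A \<Gamma> C t c d)
    have w: "wft C (Suc (length \<Gamma>))" using mtt_wf[OF C.hyps(1)] by (simp add: One_nat_def numeral_eq_Suc)
    show ?case using ml.Lst_E Tm_ins1(1)[OF _ _ w] C.IH by (simp add: ity_ins_strict[OF w] ity_lift)
  next
    case C: (Lst_C0 A \<Gamma> C c d)
    have w: "wft C (Suc (length \<Gamma>))" using mtt_wf[OF C.hyps(1)] by (simp add: One_nat_def numeral_eq_Suc)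
    show ?case using ml.Lst_C0 C.IH by (simp add: ity_ins_strict[OF w] ity_lift)
  next
    case C: (Lst_C1 A \<Gamma> C a l c d)
    have w: "wft C (Suc (length \<Gamma>))" "wft d (Suc (Suc (Suc (length \<Gamma>))))" using mtt_wf[OF C.hyps(1)] mtt_wf[OF C.hyps(5)] by simp_all
    show ?case using ml.Lst_C1 C.IH by (simp add: ity_ins_strict[OF w(1)] itm_ins[OF w(2)] ity_lift)
  next
    case C: (Sum_E A B \<Gamma> C t c d)
    have w: "wft C (Suc (length \<Gamma>))" using mtt_wf[OF C.hyps(1)] by (simp add: One_nat_def numeral_eq_Suc)
    show ?case using ml.Sum_E Tm_ins1(1)[OF _ _ w] C.IH by (simp add: ity_ins_strict[OF w])
  next
    case C: (Sum_C1 A B \<Gamma> C a c d)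
    have w: "wft C (Suc (length \<Gamma>))" "wft c (Suc (length \<Gamma>))" using mtt_wf[OF C.hyps(1)] mtt_wf[OF C.hyps(3)] by simp_all
    show ?case using ml.Sum_C1 C.IH by (simp add: ity_ins_strict[OF w(1)] itm_ins[OF w(2)])
  next
    case C: (Sum_C2 A B \<Gamma> C b c d)
    have w: "wft C (Suc (length \<Gamma>))" "wft d (Suc (length \<Gamma>))" using mtt_wf[OF C.hyps(1)] mtt_wf[OF C.hyps(4)] by simp_all
    show ?case using ml.Sum_C2 C.IH by (simp add: ity_ins_strict[OF w(1)] itm_ins[OF w(2)])
  next
    case (CT_ax \<Gamma>)
    then have "itm S (Post mCT) = Post CT" by (simp add: mCT_def)
    with CT_ax show ?case by (simp add: ity_mCT ml.CT_ax)
  next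
    case C: (Sig_F k \<Gamma> A B)
    then show ?case by (auto intro!: ml.Sig_F ml.cSig_I intro: ctx_small)
  next
    case C: (Sig_I A \<Gamma> B a b)
    have wB: "wft B (Suc (length \<Gamma>))" using mtt_wf[OF C.hyps(1)] by (simp add: One_nat_def numeral_eq_Suc)
    show ?case using ml.Sig_I Tm_ins1(1)[OF _ _ wB] C.IH by simp
  next
    case C: (Sig_E A B \<Gamma> C t c)
    have wC: "wft C (Suc (length \<Gamma>))" using mtt_wf[OF C.hyps(1)] by (simp add: One_nat_def numeral_eq_Suc)
    show ?case using ml.Sig_E Tm_ins1(1)[OF _ _ wC] C.IH by (simp add: ity_ins_strict[OF wC])
  next
    case C: (Sig_C A B \<Gamma> C a b c)
    have wC: "wft C (Suc (length \<Gamma>))" using mtt_wf[OF C.hyps(1)] by (simp add: One_nat_def numeral_eq_Suc)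
    have wB: "wft B (Suc (length \<Gamma>))" using mtt_wf[OF C.hyps(1)] by (simp add: One_nat_def numeral_eq_Suc)
    have wc: "wft c (Suc (Suc (length \<Gamma>)))" using mtt_wf[OF C.hyps(4)] by (simp add: One_nat_def numeral_eq_Suc)
    have B: "tgt S \<rhd> ity S A # map (ity S) \<Gamma> \<turnstile> Ty (ity S B)"
      using C.IH(1) ml_hd Ty_SigD by fastforce
    show ?case using ml.Sig_C Tm_ins1(1)[OF B _ wB] C.IH by (simp add: ity_ins_strict[OF wC] itm_ins[OF wc])
  next
    case C: (Pi_F \<Gamma> A B)
    then show ?case by (auto intro!: ml.Pi_F ml.cPi_I intro: ctx_small)
  next
    case (Props_I \<Gamma> A)
    then show ?case by simp
  next
    case C: (Props_Eq \<Gamma> A B)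
    \<comment> \<open>Equal codes have equal decodings, and \<open>good\<close> on both sides leads
      from the decodings to the interpreted types.\<close>
    then have e: "tgt S \<rhd> map (ity S) \<Gamma> \<turnstile> TmEq (itm S A) (itm S B) Univ" by simp
    show ?case
      using ml.ty_trans[OF ml.ty_sym[OF good[OF presup_TmEq(1)[OF e]]] ml.ty_trans[OF TyEq_Dec[OF e] good[OF presup_TmEq(2)[OF e]]]]
      by simp
  next
    case C: (Pow_F \<Gamma> A)
    then show ?case by (auto intro!: ml.Pi_F ml.Univ_F ml.ok_ext)
  next
    case C: (Pow_cong \<Gamma> A A')
    then show ?case by (auto intro!: ml.Pi_cong ml.ty_refl ml.Univ_F ml.ok_ext dest: presup_TyEq)
  next
    case C: (Pi_E \<Gamma> f A B a)
    have wB: "wft B (Suc (length \<Gamma>))" using mtt_wf[OF C.hyps(1)] by (simp add: One_nat_def numeral_eq_Suc)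
    have B: "tgt S \<rhd> ity S A # map (ity S) \<Gamma> \<turnstile> Ty (ity S B)"
      using C.IH(1) presup_Tm Ty_PiD by fastforce
    show ?case using ml.Pi_E Tm_ins1(1)[OF B _ wB] C.IH by simp
  next
    case C: (Pi_C \<Gamma> A B b a)
    have wB: "wft B (Suc (length \<Gamma>))" using mtt_wf[OF C.hyps(1)] by (simp add: One_nat_def numeral_eq_Suc)
    have wb: "wft b (Suc (length \<Gamma>))" using mtt_wf[OF C.hyps(2)] by (simp add: One_nat_def numeral_eq_Suc)
    have B: "tgt S \<rhd> ity S A # map (ity S) \<Gamma> \<turnstile> Ty (ity S B)"
      using C.IH(1) Ty_PiD by fastforce
    show ?case using ml.Pi_C Tm_ins1(2)[OF B _ wB] C.IH by (simp add: itm_ins[OF wb])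
  next
    case C: (And_F k \<Gamma> A B)
    then show ?case by (auto intro!: Ty_prod codeD(1)[OF code_And] code_self)
  next
    case C: (And_E \<Gamma> C t A B c)
    then show ?case using Split_nd'[of "map (ity S) \<Gamma>" "ity S C" "itm S t" "ity S A" "sh 1 (ity S B)" "itm S c"]
      by (simp add: ity_lift)
  next
    case C: (And_C \<Gamma> C A B a b c)
    have wc: "wft c (Suc (Suc (length \<Gamma>)))" using mtt_wf[OF C.hyps(5)] by (simp add: One_nat_def numeral_eq_Suc)
    have B: "tgt S \<rhd> ity S A # map (ity S) \<Gamma> \<turnstile> Ty (sh 1 (ity S B))"
      using C.IH(2) Ty_SigD by fastforce
    have b: "ins 0 [itm S a] (sh 1 (ity S B)) = ity S B" by (simp add: nf One_nat_def)
    show ?case using Split_nd_C[of "map (ity S) \<Gamma>" "ity S C" "ity S A" "sh 1 (ity S B)" "itm S a" "itm S b" "itm S c"] B C.IH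
      by (simp add: ity_lift itm_ins[OF wc] b)
  next
    case C: (Or_F k \<Gamma> A B)
    then show ?case by (auto intro!: ml.Sum_F ml.cSum_I)
  next
    case C: (Or_I1 \<Gamma> A B a)
    then have "tgt S \<rhd> map (ity S) \<Gamma> \<turnstile> Ty (ity S B)" by (auto dest: ml_inv_Ty)
    with C show ?case by (simp add: ml.Sum_I1)
  next
    case C: (Or_I2 \<Gamma> A B b)
    then have "tgt S \<rhd> map (ity S) \<Gamma> \<turnstile> Ty (ity S A)" by (auto dest: ml_inv_Ty)
    with C show ?case by (simp add: ml.Sum_I2)
  next
    case C: (Or_E \<Gamma> C t A B c d)
    then show ?case using When_nd'[of "map (ity S) \<Gamma>" "ity S C" "itm S t" "ity S A" "ity S B" "itm S c" "itm S d"]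
      by (simp add: ity_lift)
  next
    case C: (Or_C1 \<Gamma> C A B a c d)
    have wc: "wft c (Suc (length \<Gamma>))" using mtt_wf[OF C.hyps(4)] by (simp add: One_nat_def numeral_eq_Suc)
    show ?case using When_nd_C(1)[of "map (ity S) \<Gamma>" "ity S C" "ity S A" "itm S c" "ity S B" "itm S d" "itm S a"] C.IH
      by (simp add: ity_lift itm_ins[OF wc])
  next
    case C: (Or_C2 \<Gamma> C A B b c d)
    have wd: "wft d (Suc (length \<Gamma>))" using mtt_wf[OF C.hyps(5)] by (simp add: One_nat_def numeral_eq_Suc)
    show ?case using When_nd_C(2)[of "map (ity S) \<Gamma>" "ity S C" "ity S A" "itm S c" "ity S B" "itm S d" "itm S b"] C.IH
      by (simp add: ity_lift itm_ins[OF wd])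
  next
    case C: (Imp_F k \<Gamma> A B)
    then show ?case by (auto intro!: Ty_arr codeD(1)[OF code_Imp] code_self)
  next
    case C: (Imp_E \<Gamma> f A B a)
    then show ?case using App_arr by simp
  next
    case C: (Imp_C \<Gamma> A B b a)
    have wb: "wft b (Suc (length \<Gamma>))" using mtt_wf[OF C.hyps(2)] by (simp add: One_nat_def numeral_eq_Suc)
    show ?case using TmEq_beta[of "ity S A" "map (ity S) \<Gamma>" "itm S b" "ity S B" "itm S a"] C.IH
      by (simp add: ity_lift itm_ins[OF wb])
  next
    case C: (All_FS \<Gamma> A B)
    then show ?case by (auto intro!: ml.Pi_F ml.cPi_I intro: ctx_small)
  next
    case C: (All_cong k l \<Gamma> A A' B B')
    then show ?case by (auto intro: ml.Pi_cong)
  next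
    case C: (All_E \<Gamma> f A B a)
    have wB: "wft B (Suc (length \<Gamma>))" using mtt_wf[OF C.hyps(1)] by (simp add: One_nat_def numeral_eq_Suc)
    have B: "tgt S \<rhd> ity S A # map (ity S) \<Gamma> \<turnstile> Ty (ity S B)"
      using C.IH(1) presup_Tm Ty_PiD by fastforce
    show ?case using ml.Pi_E Tm_ins1(1)[OF B _ wB] C.IH by simp
  next
    case C: (All_C A \<Gamma> B b a)
    have wB: "wft B (Suc (length \<Gamma>))" using mtt_wf[OF C.hyps(1)] by (simp add: One_nat_def numeral_eq_Suc)
    have wb: "wft b (Suc (length \<Gamma>))" using mtt_wf[OF C.hyps(2)] by (simp add: One_nat_def numeral_eq_Suc)
    show ?case using ml.Pi_C Tm_ins1(2)[OF _ _ wB] C.IH by (simp add: itm_ins[OF wb])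
  next
    case C: (Ex_FS \<Gamma> A B)
    then show ?case by (auto intro!: ml.Sig_F ml.cSig_I intro: ctx_small)
  next
    case C: (Ex_cong k l \<Gamma> A A' B B')
    then show ?case by (auto intro: ml.Sig_cong)
  next
    case C: (Ex_I A \<Gamma> B a b)
    have wB: "wft B (Suc (length \<Gamma>))" using mtt_wf[OF C.hyps(1)] by (simp add: One_nat_def numeral_eq_Suc)
    show ?case using ml.Sig_I Tm_ins1(1)[OF _ _ wB] C.IH by simp
  next
    case C: (Ex_E \<Gamma> C t A B c)
    then show ?case using Split_nd'[of "map (ity S) \<Gamma>" "ity S C" "itm S t" "ity S A" "ity S B" "itm S c"]
      by (simp add: ity_lift)
  next
    case C: (Ex_C \<Gamma> C A B a b c)
    have wB: "wft B (Suc (length \<Gamma>))" using mtt_wf[OF C.hyps(2)] by (simp add: One_nat_def numeral_eq_Suc)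
    have wc: "wft c (Suc (Suc (length \<Gamma>)))" using mtt_wf[OF C.hyps(5)] by (simp add: One_nat_def numeral_eq_Suc)
    show ?case using Split_nd_C[of "map (ity S) \<Gamma>" "ity S C" "ity S A" "ity S B" "itm S a" "itm S b" "itm S c"] C.IH
        Tm_ins1(1)[OF _ _ wB, of "ity S A" "map (ity S) \<Gamma>" S a "itm S b"]
      by (simp add: ity_lift itm_ins[OF wc])
  next
    case C: (Eq_F k l \<Gamma> A a b)
    then show ?case by (auto intro!: ml.Eq_F ml.cEq_I intro: ml.conv ml.ty_sym good)
  next
    case C: (Eq_cong k l \<Gamma> A A' a a' b b')
    then show ?case by (auto intro: ml.Eq_cong)
  next
    case C: (Eq_E A \<Gamma> C a b p c)
    have wC: "wft C (Suc (Suc (length \<Gamma>)))" using mtt_wf[OF C.hyps(1)] by (simp add: One_nat_def numeral_eq_Suc)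
    have "tgt S \<rhd> map (ity S) \<Gamma> \<turnstile> Tm (IdRec (itm S p) (itm S c)) (ins 0 [itm S b, itm S a] (ity S C))"
      using IdRec_nd(1)[of "ity S A" "map (ity S) \<Gamma>" "ity S C" "itm S c"] C.IH
      by (simp add: ity_lift ity_ins_strict[OF wC])
    moreover have "tgt S \<rhd> map (ity S) \<Gamma> \<turnstile> TyEq (ins 0 [itm S b, itm S a] (ity S C)) (ity S (ins 0 [b, a] C))"
      using conv_ins2[of "sh 1 (ity S A)" "ity S A" "map (ity S) \<Gamma>" S C a b, OF _ _ _ wC] C.IH
      by (simp add: ity_lift) (simp add: nf One_nat_def)
    ultimately show ?case by (auto intro: ml.conv)
  next
    case C: (Eq_C A \<Gamma> C a c)
    have wC: "wft C (Suc (Suc (length \<Gamma>)))" using mtt_wf[OF C.hyps(1)] by (simp add: One_nat_def numeral_eq_Suc)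
    have wc: "wft c (Suc (length \<Gamma>))" using mtt_wf[OF C.hyps(3)] by (simp add: One_nat_def numeral_eq_Suc)
    have "tgt S \<rhd> map (ity S) \<Gamma> \<turnstile> TmEq (IdRec (Rfl (itm S a)) (itm S c)) (ins 0 [itm S a] (itm S c)) (ins 0 [itm S a, itm S a] (ity S C))"
      using IdRec_nd(2)[of "ity S A" "map (ity S) \<Gamma>" "ity S C" "itm S c"] C.IH
      by (simp add: ity_lift ity_ins_strict[OF wC])
    moreover have "tgt S \<rhd> map (ity S) \<Gamma> \<turnstile> TyEq (ins 0 [itm S a, itm S a] (ity S C)) (ity S (ins 0 [a, a] C))"
      using conv_ins2[of "sh 1 (ity S A)" "ity S A" "map (ity S) \<Gamma>" S C a a, OF _ _ _ wC] C.IH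
      by (simp add: ity_lift) (simp add: nf One_nat_def)
    ultimately show ?case by (auto simp: itm_ins[OF wc] intro: ml.conv_eq)
  next
    case C: (AC_ax \<Gamma> A B R)
    have wR: "wft R (Suc (Suc (length \<Gamma>)))" using mtt_wf[OF C.hyps(5)] by (simp add: One_nat_def numeral_eq_Suc)
    then have "itm S (Post (mAC A B R)) = choice_tm" using C.hyps(1) by (simp add: mAC_def)
    with C choice_I[of "ity S B" "ity S A" "map (ity S) \<Gamma>" "ity S R"] show ?case
      by (simp add: mAC_def ity_lift ity_ins_strict[OF wR])
  next
    case C: (Cov_F \<Gamma> A I C V a)
    note M = maxset_holds[OF refl C.IH(1)]
    note a = M(6)[OF C.IH(2)]
    show ?case using ml.Cov_F[OF M(1) a] by (simp add: ml.Dec_F)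
  next
    case C: (Cov_rf \<Gamma> A I C V a r)
    note M = maxset_holds[OF refl C.IH(1)]
    note a = M(6)[OF C.IH(2)]
    show ?case using ml.Cov_rf[OF M(1) a] C.IH by simp
  next
    case C: (Cov_tr \<Gamma> A I C V a j r)
    note M = maxset_holds[OF refl C.IH(1)]
    note a = M(6)[OF C.IH(2)]
    note j = M(7)[OF C.IH(2) C.IH(3)]
    note r = M(8)[OF C.IH(4)]
    show ?case using ml.Cov_tr[OF M(1) a j r] by simp
  next
    case C: (Cov_E \<Gamma> A I C V a P m q1 q2)
    note M = maxset_holds[OF refl C.IH(1)]
    note a = M(6)[OF C.IH(2)]
    have wP: "wft P (Suc (length \<Gamma>))" using mtt_wf[OF C.hyps(2)] by simp
    note E = elim_holds[OF refl C.IH(1) C.IH(3) wP C.IH(5) C.IH(6)]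
    have P: "ins 0 [u, itm S a] (sh 1 (ity S P)) = ins 0 [itm S a] (ity S P)" for u by (simp add: nf One_nat_def)
    have Pa: "tgt S \<rhd> map (ity S) \<Gamma> \<turnstile> TyEq (ins 0 [itm S a] (ity S P)) (ity S (ins 0 [a] P))"
      using conv_ins1[OF _ _ wP] C.IH by simp
    show ?case using ml.Cov_E[OF M(1) a E(1) _ E(2,3), of "itm S m"] C.IH ml.conv[OF _ Pa] by (simp add: P)
  next
    case C: (Cov_C1 \<Gamma> A I C V a P r q1 q2)
    note M = maxset_holds[OF refl C.IH(1)]
    note a = M(6)[OF C.IH(2)]
    have wP: "wft P (Suc (length \<Gamma>))" using mtt_wf[OF C.hyps(2)] by simp
    note E = elim_holds[OF refl C.IH(1) C.IH(3) wP C.IH(5) C.IH(6)]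
    have P: "ins 0 [u, itm S a] (sh 1 (ity S P)) = ins 0 [itm S a] (ity S P)" for u by (simp add: nf One_nat_def)
    have Pa: "tgt S \<rhd> map (ity S) \<Gamma> \<turnstile> TyEq (ins 0 [itm S a] (ity S P)) (ity S (ins 0 [a] P))"
      using conv_ins1[OF _ _ wP] C.IH by simp
    have w: "wft q1 (Suc (Suc (length \<Gamma>)))" using mtt_wf[OF C.hyps(4)] by simp
    show ?case using ml.Cov_C1[OF M(1) a E(1) _ E(2,3), of "itm S r"] C.IH ml.conv_eq[OF _ Pa] by (simp add: P itm_ins[OF w])
  next
    case C: (Cov_C2 \<Gamma> A I C V a P j r q1 q2)
    note M = maxset_holds[OF refl C.IH(1)]
    note a = M(6)[OF C.IH(2)]
    have wP: "wft P (Suc (length \<Gamma>))" using mtt_wf[OF C.hyps(2)] by simp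
    note E = elim_holds[OF refl C.IH(1) C.IH(3) wP C.IH(6) C.IH(7)]
    have P: "ins 0 [u, itm S a] (sh 1 (ity S P)) = ins 0 [itm S a] (ity S P)" for u by (simp add: nf One_nat_def)
    have Pa: "tgt S \<rhd> map (ity S) \<Gamma> \<turnstile> TyEq (ins 0 [itm S a] (ity S P)) (ity S (ins 0 [a] P))"
      using conv_ins1[OF _ _ wP] C.IH by simp
    note j = M(7)[OF C.IH(2) C.IH(4)]
    note r = M(8)[OF C.IH(5)]
    have w: "wft q2 (Suc (Suc (Suc (Suc (length \<Gamma>)))))" using mtt_wf[OF C.hyps(6)] by simp
    show ?case using ml.conv_eq[OF ml.Cov_C2[OF M(1) a E(1) j r E(2,3), unfolded P] Pa] by (simp add: itm_ins[OF w] itm_lift)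
  next
    case C: (Pos_F \<Gamma> A I C V a)
    note M = maxset_holds[OF refl C.IH(1)]
    note a = M(6)[OF C.IH(2)]
    have "tgt S \<rhd> map (ity S) \<Gamma> \<turnstile> Tm (App (Wmax (itm S A) (itm S I) (itm S C) (itm S V)) (itm S a)) Univ"
      by (rule App_arr[OF Wmax(1)[OF M(1)] a])
    then show ?case by (simp add: ml.Dec_F)
  next
    case C: (Pos_ax1 \<Gamma> A I C V a q)
    note M = maxset_holds[OF refl C.IH(1)]
    note a = M(6)[OF C.IH(2)]
    show ?case using pos1_I[OF M(1) a] C.IH by simp
  next
    case C: (Pos_ax2 \<Gamma> A I C V a j q)
    note M = maxset_holds[OF refl C.IH(1)]
    note a = M(6)[OF C.IH(2)]
    note j = M(7)[OF C.IH(2) C.IH(3)]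
    show ?case using Sig_good[OF pos2_I[OF M(1) a j, of "itm S q"] M(2)] C.IH by (simp add: itm_ins[OF M(5)] itm_lift sh_Wmax)
  next
    case C: (Pos_ax3 \<Gamma> A I C V a P m q1 q2)
    note M = maxset_holds[OF refl C.IH(1)]
    have a: "tgt S \<rhd> map (ity S) \<Gamma> \<turnstile> Tm (itm S a) (Dec (itm S A))" using M(6) C.IH(2) by simp
    have wP: "wft P (Suc (length \<Gamma>))" using mtt_wf[OF C.hyps(2)] by simp
    have m: "tgt S \<rhd> map (ity S) \<Gamma> \<turnstile> Tm (itm S m) (ins 0 [itm S a] (ity S P))"
      using Tm_ins1(1)[OF _ _ wP, of "ity S A" "map (ity S) \<Gamma>" S a] C.IH by simp
    show ?case
      using pos_coind[OF M(2,3,1) _ a m, of "itm S q1" "itm S q2"] C.IH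
      by (simp add: itm_lift ity_lift ity_ins_strict[OF wP])
  qed (simp_all add: ml.ok_nil ml.ok_ext ml.ty_refl ml.tm_refl ml.N0_F ml.cN0_I ml.N1_F ml.cN1_I ml.N1_I ml.Nat_F
      ml.cNN_I ml.Nat_I0 ml.Nat_IS ml.Lst_F ml.cLst_I ml.Lst_cong ml.Lst_I0 ml.Lst_I1 ml.Sum_F
      ml.cSum_I ml.Sum_cong ml.Sum_I1 ml.Sum_I2 ml.Sig_cong ml.Pi_cong ml.Univ_F small_Ty ml.Pi_I
      R0_nd TyEq_prod Pr_prod TyEq_arr ity_lift ml.Pi_F ml.Sig_F ml.Eq_I)
qed

lemma interpret_mTT: "interprets_mTT_cind pos1 pos2 pos3'"
proof -
  interpret mls MLS_ind by unfold_locales simp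
  have "MLS_ind \<rhd> map (ity mTT_cind) \<Gamma> \<turnstile> K"
    if "mTT_cind \<rhd> \<Gamma> \<Turnstile> J" "K \<in> mtt_jdg pos1 pos2 pos3' J" for \<Gamma> J K
    using mtt_holds[OF that(1)] that(2) good
    by (cases J) (auto simp: itm_mTT_cind[symmetric] ity_mTT_cind[symmetric] split: if_splits)
  moreover have "ity mTT_cind = mtt_ty pos1 pos2 pos3'"
    by (simp add: fun_eq_iff ity_mTT_cind)
  ultimately show ?thesis by (simp add: interprets_mTT_cind_def stable_pos')
qed

lemma consistent_mTT:
  assumes "ml_consistent MLS_ind_CT"
  shows "mtt_consistent mTT_cind_AC_CT"
  using assms by (auto simp: mtt_consistent_def ml_consistent_def dest!: mtt_holds)

theorem corollary3p4:
  shows "(\<exists>x1 x2 x3. interprets_mTT_cind x1 x2 x3)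
       \<and> (\<exists>x1 x2 x3. interprets_MLtt_cind x1 x2 x3)
       \<and> (ml_consistent MLS_ind_CT \<longrightarrow> mtt_consistent mTT_cind_AC_CT)"
  using interpret_mTT interpret_MLtt consistent_mTT by blast

end
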